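(* Let $E$ be a Banach space, $\mathscr{T}\subseteq\mathcal{L}(E)$ a JdLG-admissible semigroup of operators, $\mathscr{S}$ its closure in the weak operator topology, and $E=E_r\oplus E_{\mathrm{aws}}$ the JdLG-decomposition. (i) The restriction of $\mathscr{T}$ to $E_r$ (i.e. the representation $T\mapsto T|_{E_r}$ of $\mathscr{T}$ on $E_r$) is weakly equivalent to a unitary representation $U$ of $\mathscr{T}$ on a Hilbert space $\mathcal{H}$. Furthermore, the representation $U$ decomposes into a direct sum of finite-dimensional representations. (ii) Let $M$ be a bi-invariant mean on $C(\mathscr{S})$. Then $$E_{\mathrm{aws}}=\left\{\xi\in E:\ \forall f'\in E',\ M\left(T\mapsto|f'(T\xi)|\right)=0\right\}.$$
   Context: Banach and Hilbert spaces are complex; $E'$ is the dual of $E$. $\mathcal{L}(E)$ is the space of bounded linear operators on $E$, and for sets of operators "weakly" refers to the weak operator topology, with which $\mathscr{T}$ and $\mathscr{S}$ are endowed (they are then semitopological semigroups: Hausdorff with separately continuous multiplication). A semigroup $\mathscr{T}\subseteq\mathcal{L}(E)$ is JdLG-admissible if it is relatively weakly compact and its weak closure $\mathscr{S}$ contains a unique minimal idempotent (an idempotent is minimal if it lies in the smallest two-sided ideal $K(\mathscr{S})$). Equivalently, $\mathscr{S}$ is weakly compact and $$E_r=\{\xi\in E:\forall u\in\mathscr{S}\ \exists v\in\mathscr{S},\ vu\xi=\xi\},\qquad E_{\mathrm{aws}}=\{\xi\in E:u\xi=0\text{ for some }u\in\mathscr{S}\}$$ are closed $\mathscr{S}$-invariant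 linear subspaces with $E=E_r\oplus E_{\mathrm{aws}}$ (the JdLG-decomposition). A representation of a semitopological semigroup $S$ on a Banach space $F$ is a semigroup homomorphism $\pi:S\to\mathcal{L}(F)$ that is continuous for the weak operator topology (with $\pi_e=\mathrm{Id}$ if $S$ has an identity $e$); it is unitary if $F$ is a Hilbert space and each $\pi_s$ is unitary. For representations $\pi_1,\pi_2$ of $S$ on $E_1,E_2$, $\pi_1$ is weakly contained in $\pi_2$ if for all $\xi\in E_1$, $f'\in E_1'$, $\epsilon>0$ there exist $\eta_1,\dots,\eta_k\in E_2$ and $h_1',\dots,h_k'\in E_2'$ with $\sup_{s\in S}\left|f'(\pi_{1,s}\xi)-\sum_{j=1}^k h_j'(\pi_{2,s}\eta_j)\right|<\epsilon$. They are weakly equivalent if each is weakly contained in the other. A bi-invariant mean on $C(\mathscr{S})$ (continuous complex functions on $\mathscr{S}$) is a positive linear functional $M$ of norm $1$ with $M(t\mapsto f(st))=M(f)=M(t\mapsto f(ts))$ for all $s\in\mathscr{S}$, $f\in C(\mathscr{S})$. *)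

theory Defs
  imports "HOL-Analysis.Analysis"
begin

section \<open>Complex Banach and Hilbert spaces\<close>

class cbanach = banach +
  fixes scaleC :: "complex \<Rightarrow> 'a \<Rightarrow> 'a"  (infixr \<open>*\<^sub>C\<close> 75)
  assumes scaleC_add_right: "a *\<^sub>C (x + y) = a *\<^sub>C x + a *\<^sub>C y"
    and scaleC_add_left: "(a + b) *\<^sub>C x = a *\<^sub>C x + b *\<^sub>C x"
    and scaleC_scaleC: "a *\<^sub>C (b *\<^sub>C x) = (a * b) *\<^sub>C x"
    and scaleR_scaleC: "r *\<^sub>R x = complex_of_real r *\<^sub>C x"
    and norm_scaleC: "norm (a *\<^sub>C x) = cmod a * norm x"

lemma scaleC_one: "1 *\<^sub>C x = (x :: 'a::cbanach)"
  using scaleR_scaleC[of 1 x] by simp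

text \<open>The complex linear subspaces are the sets satisfying \<open>cspace.subspace\<close>, and
  \<open>cspace.span\<close> is the complex linear span.\<close>

global_interpretation cspace: vector_space "scaleC :: complex \<Rightarrow> 'a \<Rightarrow> 'a::cbanach"
  by unfold_locales
    (simp_all add: scaleC_add_right scaleC_add_left scaleC_scaleC scaleC_one)

text \<open>The inner product is linear in the first argument. Positive definiteness follows from the
  last axiom, because \<open>sqrt\<close> is negative on the negative reals.\<close>

class chilbert_space = cbanach +
  fixes cinner :: "'a \<Rightarrow> 'a \<Rightarrow> complex"
  assumes cinner_commute: "cinner x y = cnj (cinner y x)"
    and cinner_add_left: "cinner (x + y) z = cinner x z + cinner y z"
    and cinner_scaleC_left: "cinner (a *\<^sub>C x) y = a * cinner x y"
    and norm_eq_sqrt_cinner: "norm x = sqrt (Re (cinner x x))"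

instantiation complex :: chilbert_space
begin

definition scaleC_complex :: "complex \<Rightarrow> complex \<Rightarrow> complex" where
  "scaleC_complex a x = a * x"

definition cinner_complex :: "complex \<Rightarrow> complex \<Rightarrow> complex" where
  "cinner_complex x y = x * cnj y"

instance
proof
  fix x :: complex
  show "norm x = sqrt (Re (cinner x x))"
    by (simp add: cinner_complex_def cmod_def power2_eq_square)
qed (simp_all add: scaleC_complex_def cinner_complex_def algebra_simps norm_mult
    scaleR_conv_of_real)

end


section \<open>The Hilbert space of square-summable families\<close>

text \<open>HOL cannot quantify existentially over types, so ``there is a Hilbert space'' is rendered
  below by ``there is a closed subspace of \<open>\<ell>\<^sup>2(I)\<close>'' for a concrete index type \<open>I\<close>.
  The index type \<open>'a set \<times> nat\<close> has room for coordinates in every finite-dimensional subspace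
  of a Banach space on \<open>'a\<close>.\<close>

lemma l2_summable_iff:
  fixes f :: "'i \<Rightarrow> complex"
  shows "(\<lambda>i. (cmod (f i))\<^sup>2) summable_on UNIV
    \<longleftrightarrow> (\<exists>C. \<forall>F. finite F \<longrightarrow> L2_set (\<lambda>i. cmod (f i)) F \<le> C)"
proof
  assume s: "(\<lambda>i. (cmod (f i))\<^sup>2) summable_on UNIV"
  have "L2_set (\<lambda>i. cmod (f i)) F \<le> sqrt (\<Sum>\<^sub>\<infinity>i. (cmod (f i))\<^sup>2)" if "finite F" for F
    unfolding L2_set_def using finite_sum_le_infsum[OF s that] by simp
  then show "\<exists>C. \<forall>F. finite F \<longrightarrow> L2_set (\<lambda>i. cmod (f i)) F \<le> C" by blast
next
  assume "\<exists>C. \<forall>F. finite F \<longrightarrow> L2_set (\<lambda>i. cmod (f i)) F \<le> C"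
  then obtain C where C: "\<And>F. finite F \<Longrightarrow> L2_set (\<lambda>i. cmod (f i)) F \<le> C" by blast
  have "(\<Sum>i\<in>F. (cmod (f i))\<^sup>2) \<le> C\<^sup>2" if "finite F" for F
    using C[OF that] unfolding L2_set_def by (rule sqrt_le_D)
  then show "(\<lambda>i. (cmod (f i))\<^sup>2) summable_on UNIV"
    by (intro nonneg_bdd_above_summable_on bdd_aboveI2[where M = "C\<^sup>2"]) auto
qed

typedef 'i ell2 = "{f :: 'i \<Rightarrow> complex. (\<lambda>i. (cmod (f i))\<^sup>2) summable_on UNIV}"
  by (rule exI[of _ "\<lambda>_. 0"]) simp

setup_lifting type_definition_ell2

lemma L2_set_cmod_add:
  "L2_set (\<lambda>i. cmod (f i + g i)) F \<le> L2_set (\<lambda>i. cmod (f i)) F + L2_set (\<lambda>i. cmod (g i)) F"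
  by (rule order_trans[OF L2_set_mono L2_set_triangle_ineq]) (auto simp: norm_triangle_ineq)

lemma L2_set_cmod_mult:
  "L2_set (\<lambda>i. cmod (a * f i)) F = cmod a * L2_set (\<lambda>i. cmod (f i)) F"
  by (simp add: norm_mult L2_set_right_distrib)

lemma ell2_add_closed:
  assumes "(\<lambda>i. (cmod (f i))\<^sup>2) summable_on UNIV" "(\<lambda>i. (cmod (g i))\<^sup>2) summable_on UNIV"
  shows "(\<lambda>i. (cmod (f i + g i))\<^sup>2) summable_on UNIV"
proof -
  obtain C D where "\<And>F. finite F \<Longrightarrow> L2_set (\<lambda>i. cmod (f i)) F \<le> C"
      "\<And>F. finite F \<Longrightarrow> L2_set (\<lambda>i. cmod (g i)) F \<le> D"
    using assms unfolding l2_summable_iff by blast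
  then have "L2_set (\<lambda>i. cmod (f i + g i)) F \<le> C + D" if "finite F" for F
    by (rule order_trans[OF L2_set_cmod_add add_mono]) (use that in auto)
  then show ?thesis unfolding l2_summable_iff by blast
qed

lemma ell2_scale_closed:
  assumes "(\<lambda>i. (cmod (f i))\<^sup>2) summable_on UNIV"
  shows "(\<lambda>i. (cmod (a * f i))\<^sup>2) summable_on UNIV"
  using summable_on_cmult_right[OF assms, of "(cmod a)\<^sup>2"]
  by (simp add: norm_mult power_mult_distrib)

lemma ell2_prod_summable:
  fixes f g :: "'i \<Rightarrow> complex"
  assumes "(\<lambda>i. (cmod (f i))\<^sup>2) summable_on UNIV" "(\<lambda>i. (cmod (g i))\<^sup>2) summable_on UNIV"
  shows "(\<lambda>i. f i * cnj (g i)) summable_on UNIV"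
proof (rule abs_summable_summable)
  have sum: "(\<lambda>i. (cmod (f i))\<^sup>2 + (cmod (g i))\<^sup>2) summable_on UNIV"
    by (rule summable_on_add[OF assms])
  have le: "norm (f i * cnj (g i)) \<le> (cmod (f i))\<^sup>2 + (cmod (g i))\<^sup>2" for i
  proof -
    have "0 \<le> (cmod (f i) - cmod (g i))\<^sup>2" "0 \<le> cmod (f i) * cmod (g i)" by simp_all
    then show ?thesis unfolding norm_mult complex_mod_cnj power2_diff by linarith
  qed
  show "(\<lambda>i. norm (f i * cnj (g i))) summable_on UNIV"
    by (rule Infinite_Sum.abs_summable_on_comparison_test'[OF sum le])
qed

instantiation ell2 :: (type) "{plus, minus, uminus, zero, scaleR}"
begin

lift_definition zero_ell2 :: "'i ell2" is "\<lambda>_. 0" by simp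

lift_definition plus_ell2 :: "'i ell2 \<Rightarrow> 'i ell2 \<Rightarrow> 'i ell2" is "\<lambda>f g i. f i + g i"
  by (rule ell2_add_closed)

lift_definition uminus_ell2 :: "'i ell2 \<Rightarrow> 'i ell2" is "\<lambda>f i. - f i" by simp

lift_definition minus_ell2 :: "'i ell2 \<Rightarrow> 'i ell2 \<Rightarrow> 'i ell2" is "\<lambda>f g i. f i - g i"
  subgoal for f g using ell2_add_closed[of f "\<lambda>i. - g i"] by simp
  done

lift_definition scaleR_ell2 :: "real \<Rightarrow> 'i ell2 \<Rightarrow> 'i ell2" is "\<lambda>r f i. complex_of_real r * f i"
  by (rule ell2_scale_closed)

instance ..

end

lift_definition ell2_norm :: "'i ell2 \<Rightarrow> real" is "\<lambda>f. sqrt (\<Sum>\<^sub>\<infinity>i. (cmod (f i))\<^sup>2)" .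

lemma ell2_eq_iff: "x = y \<longleftrightarrow> (\<forall>i. Rep_ell2 x i = Rep_ell2 y i)"
  by (simp add: Rep_ell2_inject[symmetric] fun_eq_iff)

lemma ell2_L2_set_le_norm: "finite F \<Longrightarrow> L2_set (\<lambda>i. cmod (Rep_ell2 x i)) F \<le> ell2_norm x"
  unfolding L2_set_def ell2_norm.rep_eq
  by (rule real_sqrt_le_mono, rule finite_sum_le_infsum) (use Rep_ell2[of x] in auto)

lemma ell2_cmod_le_norm: "cmod (Rep_ell2 x i) \<le> ell2_norm x"
  using ell2_L2_set_le_norm[of "{i}" x] by simp

lemma ell2_norm_leI:
  assumes "\<And>F. finite F \<Longrightarrow> L2_set (\<lambda>i. cmod (Rep_ell2 x i)) F \<le> C"
  shows "ell2_norm x \<le> C"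
proof -
  have C: "0 \<le> C" using assms[of "{}"] by simp
  have "(\<Sum>\<^sub>\<infinity>i. (cmod (Rep_ell2 x i))\<^sup>2) \<le> C\<^sup>2"
  proof (rule infsum_le_finite_sums)
    show "(\<lambda>i. (cmod (Rep_ell2 x i))\<^sup>2) summable_on UNIV" using Rep_ell2[of x] by simp
    fix F :: "'a set" assume "finite F"
    from assms[OF this] show "(\<Sum>i\<in>F. (cmod (Rep_ell2 x i))\<^sup>2) \<le> C\<^sup>2"
      unfolding L2_set_def by (rule sqrt_le_D)
  qed
  then show ?thesis unfolding ell2_norm.rep_eq using C real_le_lsqrt by blast
qed

instantiation ell2 :: (type) real_normed_vector
begin

definition norm_ell2 :: "'a ell2 \<Rightarrow> real" where "norm_ell2 = ell2_norm"

definition sgn_ell2 :: "'a ell2 \<Rightarrow> 'a ell2" where "sgn_ell2 x = x /\<^sub>R norm x"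

definition dist_ell2 :: "'a ell2 \<Rightarrow> 'a ell2 \<Rightarrow> real" where "dist_ell2 x y = norm (x - y)"

definition uniformity_ell2 :: "('a ell2 \<times> 'a ell2) filter" where
  "uniformity_ell2 = (INF e\<in>{0<..}. principal {(x, y). dist x y < e})"

definition open_ell2 :: "'a ell2 set \<Rightarrow> bool" where
  "open_ell2 U \<longleftrightarrow> (\<forall>x\<in>U. \<forall>\<^sub>F (x', y) in uniformity. x' = x \<longrightarrow> y \<in> U)"

instance
proof
  fix x y z :: "'a ell2" and r s :: real
  show "norm x = 0 \<longleftrightarrow> x = 0"
  proof
    assume "norm x = 0"
    then show "x = 0" using ell2_cmod_le_norm[of x]
      by (simp add: norm_ell2_def ell2_eq_iff zero_ell2.rep_eq)
  qed (simp add: norm_ell2_def ell2_norm.rep_eq zero_ell2.rep_eq)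
  show "norm (x + y) \<le> norm x + norm y"
    unfolding norm_ell2_def
    by (rule ell2_norm_leI, unfold plus_ell2.rep_eq,
        rule order_trans[OF L2_set_cmod_add add_mono]) (auto intro: ell2_L2_set_le_norm)
  show "norm (r *\<^sub>R x) = \<bar>r\<bar> * norm x"
    by (simp add: norm_ell2_def ell2_norm.rep_eq scaleR_ell2.rep_eq norm_mult power_mult_distrib
        infsum_cmult_right' real_sqrt_mult)
qed (auto simp: ell2_eq_iff plus_ell2.rep_eq minus_ell2.rep_eq uminus_ell2.rep_eq
      zero_ell2.rep_eq scaleR_ell2.rep_eq algebra_simps
      sgn_ell2_def dist_ell2_def uniformity_ell2_def open_ell2_def)

end

instance ell2 :: (type) banach
proof
  fix X :: "nat \<Rightarrow> 'a ell2" assume X: "Cauchy X"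
  define f where "f = (\<lambda>i. lim (\<lambda>n. Rep_ell2 (X n) i))"
  have "Cauchy (\<lambda>n. Rep_ell2 (X n) i)" for i
  proof (rule metric_CauchyI)
    fix e :: real assume "e > 0"
    then obtain N where N: "\<And>m n. m \<ge> N \<Longrightarrow> n \<ge> N \<Longrightarrow> dist (X m) (X n) < e"
      using metric_CauchyD[OF X \<open>e > 0\<close>] by blast
    have "dist (Rep_ell2 (X m) i) (Rep_ell2 (X n) i) \<le> dist (X m) (X n)" for m n
      using ell2_cmod_le_norm[of "X m - X n" i, folded norm_ell2_def] by (simp add: dist_norm minus_ell2.rep_eq)
    then show "\<exists>N. \<forall>m\<ge>N. \<forall>n\<ge>N. dist (Rep_ell2 (X m) i) (Rep_ell2 (X n) i) < e"
      using N by (meson order_le_less_trans)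
  qed
  then have lim: "(\<lambda>n. Rep_ell2 (X n) i) \<longlonglongrightarrow> f i" for i
    unfolding f_def by (simp add: Cauchy_convergent_iff convergent_LIMSEQ_iff)
  have tail: "\<exists>N. \<forall>n\<ge>N. \<forall>F. finite F \<longrightarrow> L2_set (\<lambda>i. cmod (Rep_ell2 (X n) i - f i)) F \<le> e"
    if "e > 0" for e
  proof -
    obtain N where N: "\<And>m n. m \<ge> N \<Longrightarrow> n \<ge> N \<Longrightarrow> dist (X m) (X n) < e"
      using metric_CauchyD[OF X \<open>e > 0\<close>] by blast
    have "L2_set (\<lambda>i. cmod (Rep_ell2 (X n) i - f i)) F \<le> e" if "n \<ge> N" "finite F" for n F
    proof (rule LIMSEQ_le_const2)
      show "(\<lambda>m. L2_set (\<lambda>i. cmod (Rep_ell2 (X n) i - Rep_ell2 (X m) i)) F)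
          \<longlonglongrightarrow> L2_set (\<lambda>i. cmod (Rep_ell2 (X n) i - f i)) F"
        unfolding L2_set_def by (intro tendsto_intros lim)
      have "L2_set (\<lambda>i. cmod (Rep_ell2 (X n) i - Rep_ell2 (X m) i)) F \<le> e" if "m \<ge> N" for m
        using ell2_L2_set_le_norm[OF \<open>finite F\<close>, of "X n - X m", folded norm_ell2_def] N[OF \<open>n \<ge> N\<close> that]
        by (simp add: dist_norm minus_ell2.rep_eq)
      then show "\<exists>M. \<forall>m\<ge>M. L2_set (\<lambda>i. cmod (Rep_ell2 (X n) i - Rep_ell2 (X m) i)) F \<le> e"
        by blast
    qed
    then show ?thesis by blast
  qed
  obtain N where N: "\<And>F. finite F \<Longrightarrow> L2_set (\<lambda>i. cmod (Rep_ell2 (X N) i - f i)) F \<le> 1"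
    using tail[of 1] by auto
  have "(\<lambda>i. (cmod (Rep_ell2 (X N) i - f i))\<^sup>2) summable_on UNIV"
    unfolding l2_summable_iff using N by blast
  from ell2_scale_closed[OF this, of "-1"]
  have d: "(\<lambda>i. (cmod (f i - Rep_ell2 (X N) i))\<^sup>2) summable_on UNIV" by simp
  have "(\<lambda>i. (cmod (f i))\<^sup>2) summable_on UNIV"
    using ell2_add_closed[OF d, of "Rep_ell2 (X N)"] Rep_ell2[of "X N"] by simp
  then have f: "Rep_ell2 (Abs_ell2 f) = f" by (simp add: Abs_ell2_inverse)
  have "X \<longlonglongrightarrow> Abs_ell2 f"
  proof (rule LIMSEQ_I)
    fix r :: real assume "r > 0"
    then obtain N where N: "\<And>n F. n \<ge> N \<Longrightarrow> finite F
        \<Longrightarrow> L2_set (\<lambda>i. cmod (Rep_ell2 (X n) i - f i)) F \<le> r / 2"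
      using tail[of "r / 2"] by auto
    have "norm (X n - Abs_ell2 f) \<le> r / 2" if "n \<ge> N" for n
      unfolding norm_ell2_def by (rule ell2_norm_leI) (use N[OF that] in \<open>simp add: minus_ell2.rep_eq f\<close>)
    then show "\<exists>no. \<forall>n\<ge>no. norm (X n - Abs_ell2 f) < r"
      using \<open>r > 0\<close> by (intro exI[of _ N]) fastforce
  qed
  then show "convergent X" by (rule convergentI)
qed

instantiation ell2 :: (type) chilbert_space
begin

lift_definition scaleC_ell2 :: "complex \<Rightarrow> 'a ell2 \<Rightarrow> 'a ell2" is "\<lambda>a f i. a * f i"
  by (rule ell2_scale_closed)

lift_definition cinner_ell2 :: "'a ell2 \<Rightarrow> 'a ell2 \<Rightarrow> complex"
  is "\<lambda>f g. \<Sum>\<^sub>\<infinity>i. f i * cnj (g i)" .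

instance
proof
  fix x y z :: "'a ell2" and a b :: complex and r :: real
  have sx: "(\<lambda>i. Rep_ell2 x i * cnj (Rep_ell2 y i)) summable_on UNIV" for x y :: "'a ell2"
    by (rule ell2_prod_summable) (use Rep_ell2[of x] Rep_ell2[of y] in auto)
  show "norm (a *\<^sub>C x) = cmod a * norm x"
    by (simp add: norm_ell2_def ell2_norm.rep_eq scaleC_ell2.rep_eq norm_mult power_mult_distrib
        infsum_cmult_right' real_sqrt_mult)
  show "cinner x y = cnj (cinner y x)"
    by (simp add: cinner_ell2.rep_eq infsum_cnj[symmetric] mult.commute del: infsum_cnj)
  show "cinner (x + y) z = cinner x z + cinner y z"
    using infsum_add[OF sx[of x z] sx[of y z]]
    by (simp add: cinner_ell2.rep_eq plus_ell2.rep_eq ring_distribs)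
  show "cinner (a *\<^sub>C x) y = a * cinner x y"
    by (simp add: cinner_ell2.rep_eq scaleC_ell2.rep_eq mult.assoc infsum_cmult_right')
  show "norm x = sqrt (Re (cinner x x))"
    using infsum_Re[OF sx[of x x]]
    by (simp add: cinner_ell2.rep_eq norm_ell2_def ell2_norm.rep_eq complex_norm_square[symmetric]
        flip: of_real_power)
qed (auto simp: ell2_eq_iff plus_ell2.rep_eq scaleR_ell2.rep_eq scaleC_ell2.rep_eq algebra_simps)

end


section \<open>Bounded operators on closed subspaces and the weak operator topology\<close>

text \<open>A Banach space is represented by a closed subspace \<open>F\<close> of a type of class \<open>cbanach\<close>.
  Operators and functionals on \<open>F\<close> are functions on the whole type of which only the
  values on \<open>F\<close> matter; for \<open>F = UNIV\<close> this is the usual notion.\<close>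

definition bounded_clinear_on :: "'a::cbanach set \<Rightarrow> ('a \<Rightarrow> 'b::cbanach) \<Rightarrow> bool" where
  "bounded_clinear_on F f \<longleftrightarrow>
     (\<forall>x\<in>F. \<forall>y\<in>F. f (x + y) = f x + f y) \<and>
     (\<forall>c. \<forall>x\<in>F. f (c *\<^sub>C x) = c *\<^sub>C f x) \<and>
     (\<exists>K. \<forall>x\<in>F. norm (f x) \<le> K * norm x)"

definition dual :: "'a::cbanach set \<Rightarrow> ('a \<Rightarrow> complex) set" where
  "dual F = {f. bounded_clinear_on F f}"

definition bounded_ops :: "'a::cbanach set \<Rightarrow> ('a \<Rightarrow> 'a) set" where
  "bounded_ops F = {T. T ` F \<subseteq> F \<and> bounded_clinear_on F T}"

definition wot :: "'a::cbanach set \<Rightarrow> ('a \<Rightarrow> 'a) topology" where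
  "wot F = topology_generated_by
     {{T \<in> bounded_ops F. f (T x) \<in> W} | f x W. f \<in> dual F \<and> x \<in> F \<and> open W}"

lemma topspace_wot:
  assumes "x \<in> F"
  shows "topspace (wot F) = bounded_ops F"
proof -
  have "(\<lambda>_. 0) \<in> dual F"
    by (auto simp: dual_def bounded_clinear_on_def scaleC_complex_def intro: exI[of _ 0])
  then have "bounded_ops F \<in>
      {{T \<in> bounded_ops F. f (T x) \<in> W} | f x W. f \<in> dual F \<and> x \<in> F \<and> open W}"
    using assms by (auto intro!: exI[of _ "\<lambda>_. 0"] exI[of _ x] exI[of _ UNIV])
  then show ?thesis unfolding wot_def topology_generated_by_topspace by blast
qed


section \<open>Representations\<close>

text \<open>\<open>X\<close> is the topology of a semitopological semigroup with carrier \<open>topspace X\<close> and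
  multiplication \<open>mul\<close>.\<close>

definition representation ::
  "'s topology \<Rightarrow> ('s \<Rightarrow> 's \<Rightarrow> 's) \<Rightarrow> 'a::cbanach set \<Rightarrow> ('s \<Rightarrow> 'a \<Rightarrow> 'a) \<Rightarrow> bool" where
  "representation X mul F \<pi> \<longleftrightarrow>
     cspace.subspace F \<and> closed F \<and>
     continuous_map X (wot F) \<pi> \<and>
     (\<forall>s\<in>topspace X. \<forall>t\<in>topspace X. \<forall>x\<in>F. \<pi> (mul s t) x = \<pi> s (\<pi> t x)) \<and>
     (\<forall>e\<in>topspace X. (\<forall>s\<in>topspace X. mul e s = s \<and> mul s e = s) \<longrightarrow> (\<forall>x\<in>F. \<pi> e x = x))"

definition unitary_representation ::
  "'s topology \<Rightarrow> ('s \<Rightarrow> 's \<Rightarrow> 's) \<Rightarrow> 'h::chilbert_space set \<Rightarrow> ('s \<Rightarrow> 'h \<Rightarrow> 'h) \<Rightarrow> bool" where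
  "unitary_representation X mul H U \<longleftrightarrow>
     representation X mul H U \<and>
     (\<forall>s\<in>topspace X. U s ` H = H \<and> (\<forall>x\<in>H. \<forall>y\<in>H. cinner (U s x) (U s y) = cinner x y))"

text \<open>The supremum is taken in the extended reals, where it exists for every set.\<close>

definition weakly_contained ::
  "'s topology \<Rightarrow> 'a::cbanach set \<Rightarrow> ('s \<Rightarrow> 'a \<Rightarrow> 'a)
    \<Rightarrow> 'b::cbanach set \<Rightarrow> ('s \<Rightarrow> 'b \<Rightarrow> 'b) \<Rightarrow> bool" where
  "weakly_contained X F1 \<pi>1 F2 \<pi>2 \<longleftrightarrow>
     (\<forall>\<xi>\<in>F1. \<forall>f\<in>dual F1. \<forall>\<epsilon>>0. \<exists>(k::nat) \<eta> h.
        (\<forall>j<k. \<eta> j \<in> F2 \<and> h j \<in> dual F2) \<and>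
        (SUP s\<in>topspace X. ereal (cmod (f (\<pi>1 s \<xi>) - (\<Sum>j<k. h j (\<pi>2 s (\<eta> j)))))) < ereal \<epsilon>)"

definition weakly_equivalent ::
  "'s topology \<Rightarrow> 'a::cbanach set \<Rightarrow> ('s \<Rightarrow> 'a \<Rightarrow> 'a)
    \<Rightarrow> 'b::cbanach set \<Rightarrow> ('s \<Rightarrow> 'b \<Rightarrow> 'b) \<Rightarrow> bool" where
  "weakly_equivalent X F1 \<pi>1 F2 \<pi>2 \<longleftrightarrow>
     weakly_contained X F1 \<pi>1 F2 \<pi>2 \<and> weakly_contained X F2 \<pi>2 F1 \<pi>1"

text \<open>A Hilbert space direct sum of finite-dimensional subrepresentations: a family of pairwise
  orthogonal invariant subspaces whose span is dense in \<open>H\<close>.\<close>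

definition sum_of_finite_dim ::
  "'s topology \<Rightarrow> ('s \<Rightarrow> 's \<Rightarrow> 's) \<Rightarrow> 'h::chilbert_space set \<Rightarrow> ('s \<Rightarrow> 'h \<Rightarrow> 'h) \<Rightarrow> bool" where
  "sum_of_finite_dim X mul H U \<longleftrightarrow>
     (\<exists>\<V>. (\<forall>V\<in>\<V>. V \<subseteq> H \<and> (\<exists>B. finite B \<and> V = cspace.span B) \<and> representation X mul V U) \<and>
          (\<forall>V\<in>\<V>. \<forall>W\<in>\<V>. V \<noteq> W \<longrightarrow> (\<forall>x\<in>V. \<forall>y\<in>W. cinner x y = 0)) \<and>
          H = closure (cspace.span (\<Union>\<V>)))"


section \<open>Semigroups of operators\<close>

definition operator_semigroup :: "('a::cbanach \<Rightarrow> 'a) set \<Rightarrow> bool" where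
  "operator_semigroup \<T> \<longleftrightarrow> \<T> \<subseteq> bounded_ops UNIV \<and> (\<forall>S\<in>\<T>. \<forall>T\<in>\<T>. S \<circ> T \<in> \<T>)"

definition weak_closure :: "('a::cbanach \<Rightarrow> 'a) set \<Rightarrow> ('a \<Rightarrow> 'a) set" where
  "weak_closure \<T> = wot UNIV closure_of \<T>"

definition two_sided_ideal :: "('a \<Rightarrow> 'a) set \<Rightarrow> ('a \<Rightarrow> 'a) set \<Rightarrow> bool" where
  "two_sided_ideal \<S> I \<longleftrightarrow>
     I \<noteq> {} \<and> I \<subseteq> \<S> \<and> (\<forall>s\<in>\<S>. \<forall>u\<in>I. s \<circ> u \<in> I \<and> u \<circ> s \<in> I)"

definition smallest_ideal :: "('a \<Rightarrow> 'a) set \<Rightarrow> ('a \<Rightarrow> 'a) set \<Rightarrow> bool" where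
  "smallest_ideal \<S> K \<longleftrightarrow> two_sided_ideal \<S> K \<and> (\<forall>I. two_sided_ideal \<S> I \<longrightarrow> K \<subseteq> I)"

definition minimal_idempotent :: "('a \<Rightarrow> 'a) set \<Rightarrow> ('a \<Rightarrow> 'a) \<Rightarrow> bool" where
  "minimal_idempotent \<S> e \<longleftrightarrow> e \<circ> e = e \<and> (\<exists>K. smallest_ideal \<S> K \<and> e \<in> K)"

definition JdLG_admissible :: "('a::cbanach \<Rightarrow> 'a) set \<Rightarrow> bool" where
  "JdLG_admissible \<T> \<longleftrightarrow>
     operator_semigroup \<T> \<and>
     compactin (wot UNIV) (weak_closure \<T>) \<and>
     (\<exists>!e. minimal_idempotent (weak_closure \<T>) e)"

definition reversible_part :: "('a::cbanach \<Rightarrow> 'a) set \<Rightarrow> 'a set" where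
  "reversible_part \<S> = {\<xi>. \<forall>u\<in>\<S>. \<exists>v\<in>\<S>. v (u \<xi>) = \<xi>}"

definition aws_part :: "('a::cbanach \<Rightarrow> 'a) set \<Rightarrow> 'a set" where
  "aws_part \<S> = {\<xi>. \<exists>u\<in>\<S>. u \<xi> = 0}"


section \<open>Bi-invariant means\<close>

text \<open>\<open>C(\<S>)\<close> consists of functions on the whole type of operators; the values off \<open>\<S>\<close> are
  irrelevant, because a functional of norm 1 (for the supremum norm over \<open>\<S>\<close>) vanishes on functions
  that vanish on \<open>\<S>\<close>.\<close>

definition cont_fun :: "('a::cbanach \<Rightarrow> 'a) set \<Rightarrow> (('a \<Rightarrow> 'a) \<Rightarrow> complex) set" where
  "cont_fun \<S> = {f. continuous_map (subtopology (wot UNIV) \<S>) euclidean f}"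

definition bi_invariant_mean ::
  "('a::cbanach \<Rightarrow> 'a) set \<Rightarrow> ((('a \<Rightarrow> 'a) \<Rightarrow> complex) \<Rightarrow> complex) \<Rightarrow> bool" where
  "bi_invariant_mean \<S> M \<longleftrightarrow>
     (\<forall>f\<in>cont_fun \<S>. \<forall>g\<in>cont_fun \<S>. M (\<lambda>t. f t + g t) = M f + M g) \<and>
     (\<forall>c. \<forall>f\<in>cont_fun \<S>. M (\<lambda>t. c * f t) = c * M f) \<and>
     (\<forall>f\<in>cont_fun \<S>. (\<forall>t\<in>\<S>. f t \<in> \<real>\<^sub>\<ge>\<^sub>0) \<longrightarrow> M f \<in> \<real>\<^sub>\<ge>\<^sub>0) \<and>
     (SUP f\<in>{f \<in> cont_fun \<S>. \<forall>t\<in>\<S>. cmod (f t) \<le> 1}. ereal (cmod (M f))) = 1 \<and>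
     (\<forall>s\<in>\<S>. \<forall>f\<in>cont_fun \<S>. M (\<lambda>t. f (s \<circ> t)) = M f \<and> M (\<lambda>t. f (t \<circ> s)) = M f)"

end

theory Submission
  imports Defs "HOL-Complex_Analysis.Great_Picard"
begin

text \<open>The unique minimal idempotent \<open>e\<close> commutes with \<open>\<S>\<close>, and the minimal ideal is a group with
  identity \<open>e\<close>, so that \<open>E\<^sub>r\<close> is the range and \<open>E\<^sub>a\<^sub>w\<^sub>s\<close> the kernel of \<open>e\<close>.

  For (ii) no Haar measure is needed: if \<open>e \<xi> \<noteq> 0\<close>, pick \<open>f\<close> not vanishing at \<open>e \<xi>\<close>; finitely many
  translates of \<open>T \<mapsto> \<bar>f (T e \<xi>)\<bar>\<close> have a sum bounded below by a positive constant, so an invariant mean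
  cannot vanish on this function.

  For (i), weak compactness makes the orbits of the group norm precompact, because a weakly compact set
  has weakly open pieces of small norm diameter. The sup distance along an orbit is a bi-invariant
  precompact pseudometric on the group, and averaging over nets of minimal cardinality converges to a
  bi-invariant mean, since Hall's theorem matches any two such nets within twice their mesh. The
  convolution operator with a kernel supported near the identity is compact and self-adjoint and
  commutes with translations, so its eigenfunctions span finite-dimensional invariant spaces, which
  transfer to \<open>E\<^sub>r\<close> by averaging the orbit of a vector. Thus the finite-dimensional invariant subspaces
  are dense in \<open>E\<^sub>r\<close>; each carries an invariant inner product, and \<open>U\<close> is the orthogonal sum of all of
  them.\<close>

section \<open>The Hahn--Banach theorem\<close>

text \<open>The obstacle is continuity: multiplication on the compact group is only separately
  continuous for the weak operator topology, so it is not at once a topological group. Every later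
  argument, however, concerns one vector or one finite-dimensional subspace, hence a finite set
  \<open>B\<close>. The group therefore carries a separate pseudometric and a separate mean for each
  \<open>B\<close>, and only functions that are uniformly continuous for this pseudometric are
  averaged. These functions form an incomplete inner product space. Spectral theory is replaced by
  two elementary devices: orthonormal families of eigenfunctions with eigenvalues at least \<delta>
  have bounded size, and convolution turns mean-square bounds into equicontinuity, so that limits
  are uniform limits of functions. The space of \<open>U\<close> is not a copy of
  \<open>E_r\<close>: its blocks are indexed by all finite-dimensional invariant subspaces, which
  overlap heavily. The repetition is harmless because weak equivalence sees only coefficient
  functions, and no decomposition of \<open>E_r\<close> has to be chosen.\<close>

lemma hahn_banach_extension_step:
  fixes p :: "'a::real_vector \<Rightarrow> real" and V :: "('a \<times> real) set"
  assumes p_add: "\<And>x y. p (x + y) \<le> p x + p y"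
    and p_scale: "\<And>r x. p (r *\<^sub>R x) = \<bar>r\<bar> * p x"
    and V: "subspace V" and le: "\<And>x a. (x, a) \<in> V \<Longrightarrow> a \<le> p x"
  shows "\<exists>W c. subspace W \<and> V \<subseteq> W \<and> (z, c) \<in> W \<and> (\<forall>x a. (x, a) \<in> W \<longrightarrow> a \<le> p x)"
proof -
  have zero: "(0, 0) \<in> V" using subspace_0[OF V] by (simp add: zero_prod_def)
  define L where "L = (\<lambda>q :: 'a \<times> real. snd q - p (fst q - z)) ` V"
  \<comment> \<open>Subadditivity at \<open>(x - z) + (y + z)\<close> puts every lower bound for the
    value at \<open>z\<close> below every upper bound, so the supremum \<open>c\<close> of the lower
    bounds is admissible. Homogeneity of \<open>p\<close> carries this from \<open>z\<close> and
    \<open>- z\<close> to all multiples of \<open>z\<close>.\<close>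
  have key: "a - p (x - z) \<le> p (y + z) - b" if "(x, a) \<in> V" "(y, b) \<in> V" for x a y b
  proof -
    have "a + b \<le> p (x + y)" using le subspace_add[OF V that] by simp
    also have "\<dots> \<le> p (x - z) + p (y + z)" using p_add[of "x - z" "y + z"] by simp
    finally show ?thesis by simp
  qed
  define c where "c = Sup L"
  have bdd: "bdd_above L" unfolding L_def bdd_above_def using key[OF _ zero] by fastforce
  have c1: "a - p (x - z) \<le> c" if "(x, a) \<in> V" for x a
    unfolding c_def using that by (intro cSup_upper[OF _ bdd]) (force simp: L_def)
  have c2: "c \<le> p (y + z) - b" if "(y, b) \<in> V" for y b
    unfolding c_def using zero key that by (intro cSup_least) (force simp: L_def)+
  define W where "W = {u + v | u v. u \<in> V \<and> v \<in> span {(z, c)}}"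
  have W: "subspace W" unfolding W_def by (rule subspace_sums[OF V subspace_span])
  have "V \<subseteq> W"
  proof
    fix u assume "u \<in> V"
    then show "u \<in> W"
      unfolding W_def using span_zero[of "{(z, c)}"]
      by (metis (mono_tags, lifting) add.right_neutral mem_Collect_eq)
  qed
  moreover have "(z, c) \<in> W" unfolding W_def using zero span_base[of "(z,c)" "{(z,c)}"]
    by (intro CollectI exI[of _ "(0,0)"] exI[of _ "(z,c)"]) auto
  moreover have "a \<le> p x" if "(x, a) \<in> W" for x a
  proof -
    obtain u t where u: "u \<in> V" and xa: "(x, a) = u + t *\<^sub>R (z, c)"
      using \<open>(x, a) \<in> W\<close> unfolding W_def span_singleton by blast
    obtain y b where "u = (y, b)" by (cases u)
    then have yb: "(y, b) \<in> V" and x: "x = y + t *\<^sub>R z" and a: "a = b + t * c"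
      using u xa by simp_all
    have s: "(s *\<^sub>R y, s * b) \<in> V" for s using subspace_scale[OF V yb, of s] by simp
    show ?thesis
    proof (cases t "0::real" rule: linorder_cases)
      case less
      have "(1/(-t)) * b - p ((1/(-t)) *\<^sub>R y - z) \<le> c" by (rule c1[OF s])
      then have "(-t) * ((1/(-t)) * b - p ((1/(-t)) *\<^sub>R y - z)) \<le> (-t) * c"
        using less by (intro mult_left_mono) auto
      moreover have "(-t) * p ((1/(-t)) *\<^sub>R y - z) = p ((-t) *\<^sub>R ((1/(-t)) *\<^sub>R y - z))"
        using less p_scale[of "-t" "(1/(-t)) *\<^sub>R y - z"] by simp
      moreover have "(-t) *\<^sub>R ((1/(-t)) *\<^sub>R y - z) = x"
        using less by (simp add: x algebra_simps)
      moreover have "(-t) * ((1/(-t)) * b) = b" using less by simp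
      ultimately show ?thesis unfolding a by (simp only: right_diff_distrib)
    next
      case equal
      then show ?thesis using le[OF yb] x a by simp
    next
      case greater
      have "c \<le> p ((1/t) *\<^sub>R y + z) - (1/t) * b" by (rule c2[OF s])
      then have "t * c \<le> t * (p ((1/t) *\<^sub>R y + z) - (1/t) * b)"
        using greater by (intro mult_left_mono) auto
      moreover have "t * p ((1/t) *\<^sub>R y + z) = p (t *\<^sub>R ((1/t) *\<^sub>R y + z))"
        using greater p_scale[of t "(1/t) *\<^sub>R y + z"] by simp
      moreover have "t *\<^sub>R ((1/t) *\<^sub>R y + z) = x"
        using greater by (simp add: x algebra_simps)
      moreover have "t * ((1/t) * b) = b" using greater by simp
      ultimately show ?thesis unfolding a by (simp only: right_diff_distrib)
    qed
  qed
  ultimately show ?thesis using W by blast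
qed

theorem hahn_banach_seminorm:
  fixes p :: "'a::real_vector \<Rightarrow> real"
  assumes p_add: "\<And>x y. p (x + y) \<le> p x + p y"
    and p_scale: "\<And>r x. p (r *\<^sub>R x) = \<bar>r\<bar> * p x"
  obtains f where "linear f" "\<And>x. \<bar>f x\<bar> \<le> p x" "f z = p z"
proof -
  \<comment> \<open>Linear functionals below \<open>p\<close> are encoded by their graphs; since \<open>p 0 = 0\<close>, a subspace on which
    \<open>a \<le> p x\<close> holds is automatically single-valued.\<close>
  define A where "A = {V :: ('a \<times> real) set. subspace V \<and> (z, p z) \<in> V \<and> (\<forall>x a. (x, a) \<in> V \<longrightarrow> a \<le> p x)}"
  have p0: "p 0 = 0" using p_scale[of 0 0] by simp
  have pneg: "p (- x) = p x" for x using p_scale[of "-1" x] by simp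
  have p_ge: "0 \<le> p x" for x using p_add[of x "- x"] by (simp add: p0 pneg)
  have init: "span {(z, p z)} \<in> A"
  proof -
    have "t * p z \<le> p (t *\<^sub>R z)" for t
      unfolding p_scale by (intro mult_right_mono p_ge) simp
    then have "\<forall>x a. (x, a) \<in> span {(z, p z)} \<longrightarrow> a \<le> p x" by (auto simp: span_singleton)
    then show ?thesis
      unfolding A_def using subspace_span[of "{(z, p z)}"] span_base[of "(z, p z)" "{(z, p z)}"] by simp
  qed
  have "\<exists>M\<in>A. \<forall>X\<in>A. M \<subseteq> X \<longrightarrow> X = M"
  proof (rule subset_Zorn_nonempty)
    show "A \<noteq> {}" using init by blast
    fix C assume C: "C \<noteq> {}" "subset.chain A C"
    then have CA: "C \<subseteq> A" by (simp add: subset.chain_def)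
    have "subspace (\<Union>C)"
    proof (rule subspaceI)
      show "0 \<in> \<Union>C" using C CA A_def subspace_0 by blast
      fix x y assume "x \<in> \<Union>C" "y \<in> \<Union>C"
      then obtain U where "U \<in> C" "x \<in> U" "y \<in> U"
        using C(2) unfolding subset.chain_def by blast
      then show "x + y \<in> \<Union>C" using CA A_def subspace_add by blast
    next
      fix x c assume "x \<in> \<Union>C"
      then show "c *\<^sub>R x \<in> \<Union>C" using CA A_def subspace_scale by blast
    qed
    then show "\<Union>C \<in> A" using C(1) CA unfolding A_def by blast
  qed
  then obtain V where VA: "V \<in> A" and max: "\<And>W. W \<in> A \<Longrightarrow> V \<subseteq> W \<Longrightarrow> W = V" by blast
  have V: "subspace V" and zV: "(z, p z) \<in> V" and le: "\<And>x a. (x, a) \<in> V \<Longrightarrow> a \<le> p x"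
    using VA by (auto simp: A_def)
  have total: "\<exists>a. (x, a) \<in> V" for x
  proof -
    obtain W c where "subspace W" "V \<subseteq> W" "(x, c) \<in> W" "\<forall>x a. (x, a) \<in> W \<longrightarrow> a \<le> p x"
      using hahn_banach_extension_step[OF p_add p_scale V le] by blast
    moreover from this have "W = V" using zV by (intro max) (auto simp: A_def)
    ultimately show ?thesis by blast
  qed
  have unique: "a = b" if "(x, a) \<in> V" "(x, b) \<in> V" for x a b
    using le[of "0" "a - b"] le[of "0" "b - a"] subspace_diff[OF V that] subspace_diff[OF V that(2,1)]
    by (simp add: p0)
  define f where "f = (\<lambda>x. SOME a. (x, a) \<in> V)"
  have f: "(x, f x) \<in> V" for x unfolding f_def using total by (rule someI_ex)
  have "linear f"
  proof (rule linearI)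
    show "f (x + y) = f x + f y" for x y
      using subspace_add[OF V f f, of x y] by (intro unique[OF f]) simp
    show "f (r *\<^sub>R x) = r *\<^sub>R f x" for r x
      using subspace_scale[OF V f, of r x] by (intro unique[OF f]) simp
  qed
  moreover have "\<bar>f x\<bar> \<le> p x" for x
    using le[OF f, of x] le[OF f, of "- x"] linear_neg[OF \<open>linear f\<close>, of x] pneg[of x] by simp
  moreover have "f z = p z" by (rule unique[OF f zV])
  ultimately show ?thesis using that by blast
qed

section \<open>Functionals and operators on a subspace\<close>

lemma bounded_clinear_onI:
  assumes "\<And>x y. x \<in> F \<Longrightarrow> y \<in> F \<Longrightarrow> f (x + y) = f x + f y"
    "\<And>c x. x \<in> F \<Longrightarrow> f (c *\<^sub>C x) = c *\<^sub>C f x"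
    "\<And>x. x \<in> F \<Longrightarrow> norm (f x) \<le> K * norm x"
  shows "bounded_clinear_on F f"
  using assms unfolding bounded_clinear_on_def by blast

lemma dual_add: "f \<in> dual F \<Longrightarrow> x \<in> F \<Longrightarrow> y \<in> F \<Longrightarrow> f (x + y) = f x + f y"
  and dual_scaleC: "f \<in> dual F \<Longrightarrow> x \<in> F \<Longrightarrow> f (c *\<^sub>C x) = c * f x"
  by (auto simp: dual_def bounded_clinear_on_def scaleC_complex_def)

lemma dual_diff:
  assumes "f \<in> dual F" "x \<in> F" "y \<in> F" "cspace.subspace F"
  shows "f (x - y) = f x - f y"
  using dual_add[OF assms(1) assms(2), of "(-1) *\<^sub>C y"] dual_scaleC[OF assms(1,3), of "-1"]
    cspace.subspace_scale[OF assms(4,3), of "-1"]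
  by (simp add: cspace.scale_minus_left)

lemma dual_zero: "f \<in> dual F \<Longrightarrow> 0 \<in> F \<Longrightarrow> f 0 = 0"
  using dual_scaleC[of f F 0 0] by simp

lemma dual_bounded:
  assumes "f \<in> dual F"
  obtains K where "K > 0" "\<And>x. x \<in> F \<Longrightarrow> cmod (f x) \<le> K * norm x"
proof -
  obtain K where K: "\<forall>x\<in>F. norm (f x) \<le> K * norm x"
    using assms unfolding dual_def bounded_clinear_on_def by blast
  have "cmod (f x) \<le> (\<bar>K\<bar> + 1) * norm x" if "x \<in> F" for x
  proof -
    have "norm (f x) \<le> K * norm x" using K that by blast
    also have "\<dots> \<le> (\<bar>K\<bar> + 1) * norm x" by (intro mult_right_mono) auto
    finally show ?thesis .
  qed
  then show ?thesis by (intro that[of "\<bar>K\<bar> + 1"]) auto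
qed

lemma bounded_clinear_on_bounded_linear:
  assumes "bounded_clinear_on UNIV f"
  shows "bounded_linear f"
proof -
  obtain K where K: "\<And>x. norm (f x) \<le> K * norm x"
    using assms unfolding bounded_clinear_on_def by blast
  show ?thesis
  proof (rule bounded_linear_intro[where K = K])
    show "f (x + y) = f x + f y" for x y
      using assms unfolding bounded_clinear_on_def by blast
    show "f (r *\<^sub>R x) = r *\<^sub>R f x" for r x
      using assms unfolding bounded_clinear_on_def scaleR_scaleC by blast
    show "norm (f x) \<le> norm x * K" for x using K by (simp add: mult.commute)
  qed
qed

lemma dual_bounded_linear: "f \<in> dual UNIV \<Longrightarrow> bounded_linear f"
  by (simp add: dual_def bounded_clinear_on_bounded_linear)

lemma ops_bounded_linear: "T \<in> bounded_ops UNIV \<Longrightarrow> bounded_linear T"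
  by (simp add: bounded_ops_def bounded_clinear_on_bounded_linear)

lemma ops_scaleC: "T \<in> bounded_ops UNIV \<Longrightarrow> T (c *\<^sub>C x) = c *\<^sub>C T x"
  by (simp add: bounded_ops_def bounded_clinear_on_def)

lemma bounded_clinear_on_compose:
  assumes "bounded_clinear_on F f" "bounded_clinear_on UNIV T" "range T \<subseteq> F"
  shows "bounded_clinear_on UNIV (\<lambda>x. f (T x))"
proof -
  obtain K L where K: "\<And>x. x \<in> F \<Longrightarrow> norm (f x) \<le> K * norm x" and L: "\<And>x. norm (T x) \<le> L * norm x"
    using assms unfolding bounded_clinear_on_def by blast
  have "norm (f (T x)) \<le> (\<bar>K\<bar> * L) * norm x" for x
  proof -
    have "norm (f (T x)) \<le> K * norm (T x)" using K assms(3) by blast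
    also have "\<dots> \<le> \<bar>K\<bar> * norm (T x)" by (intro mult_right_mono) auto
    also have "\<dots> \<le> \<bar>K\<bar> * (L * norm x)" by (intro mult_left_mono L) auto
    finally show ?thesis by (simp add: mult.assoc)
  qed
  then show ?thesis
    using assms(1,2,3) unfolding bounded_clinear_on_def by (simp add: image_subset_iff) blast
qed

lemma dual_compose_op:
  "f \<in> dual UNIV \<Longrightarrow> T \<in> bounded_ops UNIV \<Longrightarrow> (\<lambda>x. f (T x)) \<in> dual UNIV"
  by (simp add: dual_def bounded_ops_def bounded_clinear_on_compose)

lemma ops_compose:
  "S \<in> bounded_ops UNIV \<Longrightarrow> T \<in> bounded_ops UNIV \<Longrightarrow> S \<circ> T \<in> bounded_ops UNIV"
  by (simp add: bounded_ops_def bounded_clinear_on_compose comp_def)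

section \<open>Distance to a subspace and complex functionals\<close>

lemma infdist_add_subspace:
  fixes F :: "'a::cbanach set"
  assumes F: "cspace.subspace F"
  shows "infdist (x + y) F \<le> infdist x F + infdist y F"
proof (rule field_le_epsilon)
  fix e :: real assume e: "e > 0"
  have ne: "F \<noteq> {}" using cspace.subspace_0[OF F] by blast
  have "\<exists>a\<in>F. dist x a < infdist x F + e / 2" for x
    using cINF_less_iff[of F "dist x" "infdist x F + e / 2"] ne e
    by (simp add: infdist_notempty)
  then obtain a b where a: "a \<in> F" "dist x a < infdist x F + e / 2"
    and b: "b \<in> F" "dist y b < infdist y F + e / 2" by meson
  have "infdist (x + y) F \<le> dist (x + y) (a + b)"
    using a b cspace.subspace_add[OF F] by (intro infdist_le) auto
  also have "\<dots> \<le> dist x a + dist y b" by (rule dist_triangle_add)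
  finally show "infdist (x + y) F \<le> infdist x F + infdist y F + e" using a b by linarith
qed

lemma infdist_scaleR_subspace:
  fixes F :: "'a::cbanach set"
  assumes F: "cspace.subspace F"
  shows "infdist (r *\<^sub>R x) F = \<bar>r\<bar> * infdist x F"
proof -
  have sc: "r *\<^sub>R y \<in> F" if "y \<in> F" for y r
    using that cspace.subspace_scale[OF F] by (simp add: scaleR_scaleC)
  have ne: "F \<noteq> {}" using cspace.subspace_0[OF F] by blast
  have le: "infdist (r *\<^sub>R x) F \<le> \<bar>r\<bar> * infdist x F" for r x
  proof (cases "r = 0")
    case True
    then show ?thesis using cspace.subspace_0[OF F] by simp
  next
    case False
    have "infdist (r *\<^sub>R x) F / \<bar>r\<bar> \<le> infdist x F"
      unfolding infdist_notempty[OF ne, of x]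
    proof (rule cINF_greatest[OF ne])
      fix a assume "a \<in> F"
      then have "infdist (r *\<^sub>R x) F \<le> dist (r *\<^sub>R x) (r *\<^sub>R a)" by (intro infdist_le sc)
      then show "infdist (r *\<^sub>R x) F / \<bar>r\<bar> \<le> dist x a"
        using False by (simp add: pos_divide_le_eq dist_norm mult.commute flip: scaleR_diff_right)
    qed
    then show ?thesis using False by (simp add: pos_divide_le_eq mult.commute)
  qed
  show ?thesis
  proof (cases "r = 0")
    case True
    then show ?thesis using cspace.subspace_0[OF F] by simp
  next
    case False
    have "infdist x F \<le> \<bar>1 / r\<bar> * infdist (r *\<^sub>R x) F"
      using le[of "1 / r" "r *\<^sub>R x"] False by simp
    then have "\<bar>r\<bar> * infdist x F \<le> infdist (r *\<^sub>R x) F"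
      using False by (simp add: pos_le_divide_eq mult.commute)
    then show ?thesis using le[of r x] by simp
  qed
qed

text \<open>A complex-linear \<open>f\<close> satisfies \<open>Im (f x) = - Re (f (\<i> x))\<close>,
  so its real part \<open>u\<close> determines it; this is that formula read backwards.\<close>

lemma complexification_in_dual:
  fixes u :: "'a::cbanach \<Rightarrow> real"
  assumes u: "bounded_linear u"
  shows "(\<lambda>x. Complex (u x) (- u (\<i> *\<^sub>C x))) \<in> dual UNIV"
proof -
  have lin: "linear u" by (rule bounded_linear.linear[OF u])
  obtain K where K: "\<And>x. \<bar>u x\<bar> \<le> norm x * K"
    using bounded_linear.bounded[OF u] by auto
  have u_C: "u (c *\<^sub>C x) = Re c * u x + Im c * u (\<i> *\<^sub>C x)" for c x
  proof -
    have "c *\<^sub>C x = (complex_of_real (Re c) + complex_of_real (Im c) * \<i>) *\<^sub>C x"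
      by (metis complex_eq mult.commute)
    also have "\<dots> = Re c *\<^sub>R x + Im c *\<^sub>R (\<i> *\<^sub>C x)"
      by (simp only: scaleR_scaleC scaleC_scaleC scaleC_add_left)
    finally show ?thesis by (simp add: linear_add[OF lin] linear_scale[OF lin])
  qed
  show ?thesis
    unfolding dual_def mem_Collect_eq
  proof (rule bounded_clinear_onI)
    show "Complex (u (x + y)) (- u (\<i> *\<^sub>C (x + y)))
        = Complex (u x) (- u (\<i> *\<^sub>C x)) + Complex (u y) (- u (\<i> *\<^sub>C y))" for x y
      by (simp add: complex_eq_iff linear_add[OF lin] scaleC_add_right)
    show "Complex (u (c *\<^sub>C x)) (- u (\<i> *\<^sub>C c *\<^sub>C x)) = c *\<^sub>C Complex (u x) (- u (\<i> *\<^sub>C x))" for c x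
    proof -
      have "u (c *\<^sub>C x) = Re c * u x + Im c * u (\<i> *\<^sub>C x)" by (rule u_C)
      moreover have "u (\<i> *\<^sub>C c *\<^sub>C x) = - Im c * u x + Re c * u (\<i> *\<^sub>C x)"
        using u_C[of "\<i> * c" x] unfolding scaleC_scaleC by simp
      ultimately show ?thesis by (simp add: complex_eq_iff scaleC_complex_def algebra_simps)
    qed
    show "norm (Complex (u x) (- u (\<i> *\<^sub>C x))) \<le> (2 * K) * norm x" for x
      using cmod_le[of "Complex (u x) (- u (\<i> *\<^sub>C x))"] K[of x] K[of "\<i> *\<^sub>C x"]
      by (simp add: norm_scaleC algebra_simps)
  qed
qed

text \<open>The seminorm \<open>infdist _ F\<close> puts several demands into one domination: a
  functional below it vanishes on \<open>F\<close>, is bounded by the norm, and can be made to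
  attain the distance at \<open>z\<close>. Since \<open>F\<close> is complex, \<open>\<i> y\<close>
  also lies in \<open>F\<close>, which kills the imaginary part there.\<close>

theorem hahn_banach_subspace:
  fixes F :: "'a::cbanach set"
  assumes F: "cspace.subspace F"
  obtains f where "f \<in> dual UNIV" "\<And>y. y \<in> F \<Longrightarrow> f y = 0" "Re (f z) = infdist z F"
    "\<And>y. \<bar>Re (f y)\<bar> \<le> norm y"
proof -
  obtain u where lin: "linear u" and le: "\<And>x. \<bar>u x\<bar> \<le> infdist x F" and uz: "u z = infdist z F"
    by (rule hahn_banach_seminorm[where p = "\<lambda>x. infdist x F" and z = z])
      (simp_all add: infdist_add_subspace infdist_scaleR_subspace F)
  have inf_le: "infdist x F \<le> norm x" for x
    using infdist_le[of 0 F x] cspace.subspace_0[OF F] by simp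
  define f where "f = (\<lambda>x. Complex (u x) (- u (\<i> *\<^sub>C x)))"
  have "bounded_linear u"
    using le inf_le by (intro bounded_linear_intro[where K = 1])
      (auto simp: linear_add[OF lin] linear_scale[OF lin] intro: order_trans)
  then have "f \<in> dual UNIV" unfolding f_def by (rule complexification_in_dual)
  moreover have "f y = 0" if "y \<in> F" for y
    using le[of y] le[of "\<i> *\<^sub>C y"] that cspace.subspace_scale[OF F that, of \<i>]
    by (simp add: f_def complex_eq_iff)
  moreover have "\<bar>Re (f y)\<bar> \<le> norm y" for y using le[of y] inf_le[of y] by (simp add: f_def)
  moreover have "Re (f z) = infdist z F" by (simp add: f_def uz)
  ultimately show ?thesis using that by blast
qed

corollary norming_functional:
  fixes z :: "'a::cbanach"
  obtains f where "f \<in> dual UNIV" "Re (f z) = norm z" "\<And>y. \<bar>Re (f y)\<bar> \<le> norm y"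
  using hahn_banach_subspace[OF cspace.subspace_single_0, of z] by auto

corollary dual_separates:
  fixes x y :: "'a::cbanach"
  assumes "\<And>f. f \<in> dual UNIV \<Longrightarrow> f x = f y"
  shows "x = y"
proof -
  obtain f where f: "f \<in> dual UNIV" "Re (f (x - y)) = norm (x - y)"
    using norming_functional by blast
  then show ?thesis
    using assms[OF f(1)] linear_diff[OF bounded_linear.linear[OF dual_bounded_linear[OF f(1)]], of x y]
    by simp
qed

corollary separate_closed_subspace:
  fixes F :: "'a::cbanach set"
  assumes F: "cspace.subspace F" "closed F" and z: "z \<notin> F"
  obtains f where "f \<in> dual UNIV" "\<And>y. y \<in> F \<Longrightarrow> f y = 0" "f z = 1"
proof -
  obtain f where f: "f \<in> dual UNIV" "\<And>y. y \<in> F \<Longrightarrow> f y = 0" "Re (f z) = infdist z F"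
    using hahn_banach_subspace[OF F(1)] by metis
  have "infdist z F > 0"
    using in_closed_iff_infdist_zero[OF F(2)] z cspace.subspace_0[OF F(1)] infdist_nonneg[of z F]
    by (metis empty_iff less_eq_real_def)
  then have nz: "f z \<noteq> 0" using f(3) by auto
  obtain K where K: "\<And>x. cmod (f x) \<le> K * norm x" using dual_bounded[OF f(1)] by auto
  have "(\<lambda>x. f x / f z) \<in> dual UNIV"
    unfolding dual_def mem_Collect_eq
  proof (rule bounded_clinear_onI[where K = "K / cmod (f z)"])
    show "f (x + y) / f z = f x / f z + f y / f z" for x y
      using dual_add[OF f(1), of x y] by (simp add: add_divide_distrib)
    show "f (c *\<^sub>C x) / f z = c *\<^sub>C (f x / f z)" for c x
      using dual_scaleC[OF f(1), of x c] by (simp add: scaleC_complex_def)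
    show "norm (f x / f z) \<le> K / cmod (f z) * norm x" for x
      using K[of x] nz by (simp add: norm_divide field_simps)
  qed
  then show ?thesis using that[of "\<lambda>x. f x / f z"] f(2) nz by simp
qed

text \<open>If \<open>f\<close> vanishes on the closed span of \<open>B\<close> and
  \<open>f b = 1\<close>, then the span of \<open>insert b B\<close> is the preimage of the span of
  \<open>B\<close> under the continuous map \<open>z - f z b\<close>.\<close>

lemma closed_span_finite:
  assumes "finite B"
  shows "closed (cspace.span B :: 'a::cbanach set)"
  using assms
proof induction
  case empty
  then show ?case by simp
next
  case (insert b B)
  show ?case
  proof (cases "b \<in> cspace.span B")
    case True
    then show ?thesis using insert.IH by (simp add: cspace.span_redundant)
  next
    case False
    obtain f where f: "f \<in> dual UNIV" "\<And>y. y \<in> cspace.span B \<Longrightarrow> f y = 0" "f b = 1"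
      using separate_closed_subspace[OF cspace.subspace_span insert.IH False] by blast
    have bl: "bounded_linear f" by (rule dual_bounded_linear[OF f(1)])
    obtain g :: "'a \<Rightarrow> 'a" where g: "g = (\<lambda>z. z - f z *\<^sub>C b)" by simp
    have "bounded_linear g"
    proof -
      have "bounded_linear (\<lambda>c :: complex. c *\<^sub>C b)"
        by (rule bounded_linear_intro[where K = "norm b"])
          (simp_all only: scaleC_add_left norm_scaleC scaleR_conv_of_real scaleR_scaleC scaleC_scaleC
            order_refl)
      then show ?thesis unfolding g
        by (intro bounded_linear_sub bounded_linear_ident bounded_linear_compose[OF _ bl])
    qed
    then have cont: "continuous_on UNIV g" by (simp add: linear_continuous_on)
    have "cspace.span (insert b B) = g -` cspace.span B"
    proof (intro set_eqI iffI)
      fix x assume "x \<in> cspace.span (insert b B)"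
      then obtain k where k: "x - k *\<^sub>C b \<in> cspace.span B" by (auto simp: cspace.span_insert)
      have "f x = k"
        using f(2)[OF k] dual_add[OF f(1), of "x - k *\<^sub>C b" "k *\<^sub>C b"] dual_scaleC[OF f(1), of b k] f(3)
        by simp
      then show "x \<in> g -` cspace.span B" using k by (simp add: g)
    next
      fix x assume "x \<in> g -` cspace.span B"
      then show "x \<in> cspace.span (insert b B)" by (auto simp: cspace.span_insert g)
    qed
    then show ?thesis using continuous_closed_vimage[OF insert.IH, of g] cont
      by (simp add: continuous_on_eq_continuous_within)
  qed
qed

text \<open>Each coordinate functional separates a basis vector from the closed span of the others.
  It is obtained on the whole space, so that composing it with operators gives continuous functions
  for the weak operator topology.\<close>

lemma dual_basis:
  fixes B :: "'a::cbanach set"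
  assumes "finite B" "\<not> cspace.dependent B"
  obtains c where "\<And>b. b \<in> B \<Longrightarrow> c b \<in> dual UNIV"
    "\<And>x. x \<in> cspace.span B \<Longrightarrow> x = (\<Sum>b\<in>B. c b x *\<^sub>C b)"
    "\<And>b b'. b \<in> B \<Longrightarrow> b' \<in> B \<Longrightarrow> c b b' = (if b = b' then 1 else 0)"
proof -
  have "\<exists>f\<in>dual UNIV. (\<forall>y\<in>cspace.span (B - {b}). f y = 0) \<and> f b = 1" if "b \<in> B" for b
  proof -
    have "b \<notin> cspace.span (B - {b})" using that assms(2) cspace.dependent_def by blast
    then show ?thesis
      using separate_closed_subspace[OF cspace.subspace_span closed_span_finite] assms(1)
      by (metis finite_Diff)
  qed
  then obtain c where c: "\<And>b. b \<in> B \<Longrightarrow> c b \<in> dual UNIV"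
      "\<And>b y. b \<in> B \<Longrightarrow> y \<in> cspace.span (B - {b}) \<Longrightarrow> c b y = 0" "\<And>b. b \<in> B \<Longrightarrow> c b b = 1"
    by metis
  have delta: "c b b' = (if b = b' then 1 else 0)" if "b \<in> B" "b' \<in> B" for b b'
    using c(2)[OF that(1), of b'] c(3)[OF that(1)] that by (auto intro: cspace.span_base)
  have "x = (\<Sum>b\<in>B. c b x *\<^sub>C b)" if x: "x \<in> cspace.span B" for x
  proof -
    obtain u where u: "x = (\<Sum>b\<in>B. u b *\<^sub>C b)" using x cspace.span_finite[OF assms(1)] by auto
    have "c b x = u b" if "b \<in> B" for b
    proof -
      have "c b x = (\<Sum>b'\<in>B. c b (u b' *\<^sub>C b'))"
        unfolding u by (rule linear_sum[OF bounded_linear.linear[OF dual_bounded_linear[OF c(1)[OF that]]]])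
      also have "\<dots> = (\<Sum>b'\<in>B. if b = b' then u b' else 0)"
        using delta[OF that] dual_scaleC[OF c(1)[OF that]] by (intro sum.cong) auto
      finally show ?thesis using assms(1) that by simp
    qed
    then show ?thesis using u by simp
  qed
  then show ?thesis using that[of c] c(1) delta by blast
qed

section \<open>The weak operator topology\<close>

lemma topspace_wot_UNIV: "topspace (wot UNIV) = bounded_ops UNIV"
  by (rule topspace_wot) simp

lemma continuous_map_wot_eval:
  assumes "f \<in> dual F" "x \<in> F"
  shows "continuous_map (wot F) euclidean (\<lambda>T. f (T x))"
  unfolding continuous_map_def
proof (intro conjI allI impI)
  fix W :: "complex set" assume "openin euclidean W"
  then have "openin (wot F) {T \<in> bounded_ops F. f (T x) \<in> W}"
    unfolding wot_def using assms by (intro topology_generated_by_Basis) auto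
  then show "openin (wot F) {T \<in> topspace (wot F). f (T x) \<in> W}"
    by (simp add: topspace_wot[OF assms(2)])
qed simp

text \<open>The universal property of an initial topology. A point of \<open>F\<close> is required
  so that there is a generating set at all; otherwise the carrier of the generated topology would be
  empty.\<close>

lemma continuous_map_into_wot:
  assumes "\<And>s. s \<in> topspace X \<Longrightarrow> \<pi> s \<in> bounded_ops F"
    and "\<And>f x. f \<in> dual F \<Longrightarrow> x \<in> F \<Longrightarrow> continuous_map X euclidean (\<lambda>s. f (\<pi> s x))"
    and "F \<noteq> {}"
  shows "continuous_map X (wot F) \<pi>"
  unfolding wot_def
proof (rule continuous_on_generated_topo)
  fix U assume "U \<in> {{T \<in> bounded_ops F. f (T x) \<in> W} |f x W. f \<in> dual F \<and> x \<in> F \<and> open W}"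
  then obtain f x W where U: "U = {T \<in> bounded_ops F. f (T x) \<in> W}" and fxW: "f \<in> dual F" "x \<in> F" "open W"
    by blast
  have "\<pi> -` U \<inter> topspace X = {s \<in> topspace X. f (\<pi> s x) \<in> W}"
    using assms(1) by (auto simp: U)
  then show "openin X (\<pi> -` U \<inter> topspace X)"
    using openin_continuous_map_preimage[OF assms(2)[OF fxW(1,2)], of W] fxW(3) by simp
next
  obtain x where "x \<in> F" using assms(3) by blast
  have "bounded_ops F \<subseteq> \<Union>{{T \<in> bounded_ops F. f (T x) \<in> W} |f x W. f \<in> dual F \<and> x \<in> F \<and> open W}"
    using topspace_wot[OF \<open>x \<in> F\<close>] unfolding wot_def topology_generated_by_topspace by simp
  then show "\<pi> ` topspace X \<subseteq> \<Union>{{T \<in> bounded_ops F. f (T x) \<in> W} |f x W. f \<in> dual F \<and> x \<in> F \<and> open W}"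
    using assms(1) by blast
qed

lemma continuous_map_wot_right:
  assumes "T \<in> bounded_ops UNIV"
  shows "continuous_map (wot UNIV) (wot UNIV) (\<lambda>S. S \<circ> T)"
  using assms continuous_map_wot_eval
  by (intro continuous_map_into_wot) (auto simp: topspace_wot_UNIV ops_compose)

text \<open>A fixed left factor \<open>T\<close> is absorbed by the functional, \<open>f\<close>
  becoming \<open>f \<circ> T\<close>; a fixed right factor moves the point from \<open>x\<close> to
  \<open>T x\<close>. No such device handles both factors at once.\<close>

lemma continuous_map_wot_left:
  assumes "T \<in> bounded_ops UNIV"
  shows "continuous_map (wot UNIV) (wot UNIV) (\<lambda>S. T \<circ> S)"
proof (rule continuous_map_into_wot)
  show "continuous_map (wot UNIV) euclidean (\<lambda>S. f ((T \<circ> S) x))" if "f \<in> dual UNIV" for f x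
    using continuous_map_wot_eval[OF dual_compose_op[OF that assms], of x] by simp
qed (use assms in \<open>auto simp: topspace_wot_UNIV ops_compose\<close>)

lemma Hausdorff_space_wot: "Hausdorff_space (wot UNIV :: ('a::cbanach \<Rightarrow> 'a) topology)"
  unfolding Hausdorff_space_def topspace_wot_UNIV
proof (intro allI impI)
  fix S T :: "'a \<Rightarrow> 'a" assume ST: "S \<in> bounded_ops UNIV \<and> T \<in> bounded_ops UNIV \<and> S \<noteq> T"
  then obtain x where "S x \<noteq> T x" by blast
  then obtain f where f: "f \<in> dual UNIV" "f (S x) \<noteq> f (T x)"
    using dual_separates by blast
  then obtain U V where UV: "open U" "open V" "f (S x) \<in> U" "f (T x) \<in> V" "U \<inter> V = {}"
    using hausdorff by meson
  have op: "openin (wot UNIV) {T \<in> topspace (wot UNIV). f (T x) \<in> W}" if "open W" for W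
    using that by (intro openin_continuous_map_preimage[OF continuous_map_wot_eval[OF f(1)]]) auto
  show "\<exists>U V. openin (wot UNIV) U \<and> openin (wot UNIV) V \<and> S \<in> U \<and> T \<in> V \<and> disjnt U V"
    using op[OF UV(1)] op[OF UV(2)] UV ST
    by (intro exI[of _ "{T \<in> topspace (wot UNIV). f (T x) \<in> U}"]
        exI[of _ "{T \<in> topspace (wot UNIV). f (T x) \<in> V}"])
      (auto simp: topspace_wot_UNIV disjnt_def)
qed

section \<open>Uniform boundedness\<close>

theorem banach_steinhaus:
  fixes \<Phi> :: "('a::banach \<Rightarrow> 'b::real_normed_vector) set"
  assumes lin: "\<And>T. T \<in> \<Phi> \<Longrightarrow> bounded_linear T"
    and bdd: "\<And>x. \<exists>c. \<forall>T\<in>\<Phi>. norm (T x) \<le> c"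
  obtains C where "C > 0" "\<And>T x. T \<in> \<Phi> \<Longrightarrow> norm (T x) \<le> C * norm x"
proof -
  define G where "G = (\<lambda>n. {x. \<forall>T\<in>\<Phi>. norm (T x) \<le> real n})"
  have "closed (G n)" for n
  proof -
    have "G n = (\<Inter>T\<in>\<Phi>. {x. norm (T x) \<le> real n})" by (auto simp: G_def)
    moreover have "closed {x. norm (T x) \<le> real n}" if "T \<in> \<Phi>" for T
      using linear_continuous_on[OF lin[OF that], of UNIV] by (intro closed_Collect_le continuous_intros)
    ultimately show ?thesis by auto
  qed
  moreover have "\<Union>(range G) = UNIV"
  proof -
    have "\<exists>n. x \<in> G n" for x
    proof -
      obtain c where "\<forall>T\<in>\<Phi>. norm (T x) \<le> c" using bdd by blast
      moreover obtain n where "c \<le> real n" using real_arch_simple by blast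
      ultimately have "x \<in> G n" unfolding G_def by fastforce
      then show ?thesis ..
    qed
    then show ?thesis by auto
  qed
  ultimately obtain n where "interior (G n) \<noteq> {}"
    using Baire_category_alt[of "euclidean :: 'a topology" "range G"]
    by (auto simp: completely_metrizable_space_euclidean)
  then obtain x0 r where r: "r > 0" "ball x0 r \<subseteq> G n"
    using mem_interior by blast
  \<comment> \<open>Scaling \<open>x\<close> by \<open>t = r / (2 norm x)\<close> keeps
    \<open>x0 + t x\<close> in the ball, where \<open>T\<close> is at most \<open>n\<close>; the
    difference with \<open>T x0\<close> gives \<open>t * norm (T x) \<le> 2 n\<close>. Using
    \<open>n + 1\<close> keeps the constant positive when \<open>n = 0\<close>.\<close>
  have "norm (T x) \<le> (4 * (real n + 1) / r) * norm x" if T: "T \<in> \<Phi>" for T x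
  proof (cases "x = 0")
    case True
    then show ?thesis using linear_0[OF bounded_linear.linear[OF lin[OF T]]] by simp
  next
    case False
    define t where "t = r / (2 * norm x)"
    have t: "t > 0" using r False by (simp add: t_def)
    have "norm (t *\<^sub>R x) < r" using r False by (simp add: t_def)
    then have "x0 + t *\<^sub>R x \<in> G n" "x0 \<in> G n" using r by (auto simp: dist_norm subset_iff)
    then have *: "norm (T (x0 + t *\<^sub>R x)) \<le> n" "norm (T x0) \<le> n" using T by (auto simp: G_def)
    have "t * norm (T x) = norm (T (x0 + t *\<^sub>R x) - T x0)"
      using t by (simp add: linear_add[OF bounded_linear.linear[OF lin[OF T]]]
          linear_scale[OF bounded_linear.linear[OF lin[OF T]]])
    also have "\<dots> \<le> norm (T (x0 + t *\<^sub>R x)) + norm (T x0)" by (rule norm_triangle_ineq4)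
    also have "\<dots> \<le> real n + real n" by (rule add_mono[OF *])
    also have "\<dots> \<le> 2 * (real n + 1)" by simp
    finally have "norm (T x) \<le> 2 * (real n + 1) / t" using t by (simp add: pos_le_divide_eq mult.commute)
    also have "2 * (real n + 1) / t = (4 * (real n + 1) / r) * norm x" using r False by (simp add: t_def)
    finally show ?thesis .
  qed
  then show ?thesis using r by (intro that[of "4 * (real n + 1) / r"]) auto
qed

text \<open>Uniform boundedness is used twice: compactness bounds the scalars
  \<open>f (T x)\<close>, the first use turns this into a norm bound on each orbit, and the second
  into a bound on the operators.\<close>

lemma compactin_wot_bounded:
  fixes S :: "('a::cbanach \<Rightarrow> 'a) set"
  assumes S: "compactin (wot UNIV) S"
  obtains C where "C > 0" "\<And>T x. T \<in> S \<Longrightarrow> norm (T x) \<le> C * norm x"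
proof -
  have ops: "S \<subseteq> bounded_ops UNIV" using compactin_subset_topspace[OF S] by (simp add: topspace_wot_UNIV)
  have weak: "\<exists>c. \<forall>T\<in>S. cmod (f (T x)) \<le> c" if f: "f \<in> dual UNIV" for f x
  proof -
    have "compactin euclidean ((\<lambda>T. f (T x)) ` S)"
      by (rule image_compactin[OF S continuous_map_wot_eval[OF f UNIV_I]])
    then have "bounded ((\<lambda>T. f (T x)) ` S)" by (simp add: compact_imp_bounded)
    then show ?thesis unfolding bounded_iff by auto
  qed
  \<comment> \<open>A point \<open>y\<close> is regarded as a functional on the Banach space of real functionals.\<close>
  have "\<exists>c. \<forall>T\<in>S. norm (T x) \<le> c" for x
  proof -
    define \<Phi> where "\<Phi> = (\<lambda>T. (\<lambda>u :: 'a \<Rightarrow>\<^sub>L real. u (T x))) ` S"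
    have "\<exists>c. \<forall>F\<in>\<Phi>. norm (F u) \<le> c" for u
    proof -
      obtain c where c: "\<forall>T\<in>S. cmod (Complex (u (T x)) (- u (\<i> *\<^sub>C T x))) \<le> c"
        using weak[OF complexification_in_dual[OF blinfun.bounded_linear_right[of u]], of x] by blast
      have "\<bar>u (T x)\<bar> \<le> c" if "T \<in> S" for T
        using abs_Re_le_cmod[of "Complex (u (T x)) (- u (\<i> *\<^sub>C T x))"] c that by fastforce
      then show ?thesis unfolding \<Phi>_def by (intro exI[of _ c]) simp
    qed
    moreover have "bounded_linear F" if "F \<in> \<Phi>" for F
      using that by (auto simp: \<Phi>_def intro: blinfun.bounded_linear_left)
    ultimately obtain C where C: "C > 0" "\<And>F u. F \<in> \<Phi> \<Longrightarrow> norm (F u) \<le> C * norm u"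
      using banach_steinhaus by metis
    have "norm (T x) \<le> C" if T: "T \<in> S" for T
    proof -
      obtain f where f: "f \<in> dual UNIV" "Re (f (T x)) = norm (T x)" "\<And>y. \<bar>Re (f y)\<bar> \<le> norm y"
        using norming_functional by blast
      have bl: "bounded_linear (\<lambda>y. Re (f y))"
        by (rule bounded_linear_compose[OF bounded_linear_Re dual_bounded_linear[OF f(1)]])
      have "norm (Blinfun (\<lambda>y. Re (f y))) \<le> 1"
        using f(3) by (intro norm_blinfun_bound) (auto simp: bounded_linear_Blinfun_apply[OF bl])
      moreover have "norm (T x) \<le> C * norm (Blinfun (\<lambda>y. Re (f y)))"
        using C(2)[of "\<lambda>u. u (T x)" "Blinfun (\<lambda>y. Re (f y))"] T f(2)
        by (simp add: \<Phi>_def bounded_linear_Blinfun_apply[OF bl])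
      ultimately show ?thesis
        using mult_left_mono[of "norm (Blinfun (\<lambda>y. Re (f y)))" 1 C] C(1) by linarith
    qed
    then show ?thesis by blast
  qed
  then show ?thesis
    using banach_steinhaus[of S] ops ops_bounded_linear that by blast
qed

section \<open>Compact semitopological semigroups\<close>

text \<open>Let \<open>B\<close> be a minimal closed subsemigroup and \<open>p \<in> B\<close>. Then
  \<open>B p = B\<close>, so the elements \<open>a\<close> with \<open>a p = p\<close> form a closed
  nonempty subsemigroup; by minimality it is \<open>B\<close>, and it contains \<open>p\<close>. The
  multiplication is a parameter so that the opposite one, continuous in the other factor, can be
  inserted.\<close>

theorem ellis_numakura_idempotent:
  fixes X :: "'s topology" and mul :: "'s \<Rightarrow> 's \<Rightarrow> 's"
  assumes X: "Hausdorff_space X" and A: "compactin X A" "A \<noteq> {}"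
    and closed: "\<And>a b. a \<in> A \<Longrightarrow> b \<in> A \<Longrightarrow> mul a b \<in> A"
    and assoc: "\<And>a b c. a \<in> A \<Longrightarrow> b \<in> A \<Longrightarrow> c \<in> A \<Longrightarrow> mul (mul a b) c = mul a (mul b c)"
    and cont: "\<And>b. b \<in> A \<Longrightarrow> continuous_map X X (\<lambda>a. mul a b)"
  obtains p where "p \<in> A" "mul p p = p"
proof -
  define \<A> where "\<A> = {B. B \<subseteq> A \<and> B \<noteq> {} \<and> closedin X B \<and> (\<forall>a\<in>B. \<forall>b\<in>B. mul a b \<in> B)}"
  \<comment> \<open>Zorn's lemma is available for maximal elements under unions, so it is applied to
    complements in \<open>A\<close>; the union of a chain of complements corresponds to the
    intersection of the sets, which compactness keeps nonempty.\<close>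
  have "\<exists>M\<in>(\<lambda>B. A - B) ` \<A>. \<forall>Z\<in>(\<lambda>B. A - B) ` \<A>. M \<subseteq> Z \<longrightarrow> Z = M"
  proof (rule subset_Zorn_nonempty)
    have "A \<in> \<A>" using A closed by (auto simp: \<A>_def compactin_imp_closedin[OF X])
    then show "(\<lambda>B. A - B) ` \<A> \<noteq> {}" by blast
    fix \<C> assume ne: "\<C> \<noteq> {}" and ch: "subset.chain ((\<lambda>B. A - B) ` \<A>) \<C>"
    define \<U> where "\<U> = {B \<in> \<A>. A - B \<in> \<C>}"
    have sub: "\<And>B. B \<in> \<A> \<Longrightarrow> B \<subseteq> A" by (auto simp: \<A>_def)
    have \<C>: "\<C> = (\<lambda>B. A - B) ` \<U>" using ch by (auto simp: \<U>_def subset_chain_def)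
    then have \<U>_ne: "\<U> \<noteq> {}" using ne by blast
    have lin: "B \<subseteq> B' \<or> B' \<subseteq> B" if "B \<in> \<U>" "B' \<in> \<U>" for B B'
    proof -
      have "A - B \<in> \<C>" "A - B' \<in> \<C>" "B \<subseteq> A" "B' \<subseteq> A" using that sub by (simp_all add: \<U>_def)
      moreover have "\<forall>Y\<in>\<C>. \<forall>Z\<in>\<C>. Y \<subseteq> Z \<or> Z \<subseteq> Y" using ch by (simp add: subset_chain_def)
      ultimately show ?thesis by (metis Diff_Diff_Int Diff_mono inf.absorb_iff2 order_refl)
    qed
    have fin: "\<exists>B\<in>\<U>. B \<subseteq> \<Inter>\<F>" if "finite \<F>" "\<F> \<subseteq> \<U>" for \<F>
      using that
    proof induction
      case empty
      then show ?case using \<U>_ne by auto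
    next
      case (insert B \<F>)
      then obtain B' where B': "B' \<in> \<U>" "B' \<subseteq> \<Inter>\<F>" by auto
      have "B \<in> \<U>" using insert.prems by simp
      from lin[OF this B'(1)] show ?case using B' \<open>B \<in> \<U>\<close> by (metis Inter_insert le_inf_iff order_refl order_trans)
    qed
    have "A \<inter> \<Inter>\<U> \<noteq> {}"
    proof -
      have "A \<inter> \<Inter>\<F> \<noteq> {}" if \<F>: "finite \<F>" "\<F> \<subseteq> \<U>" for \<F>
      proof -
        obtain B where B: "B \<in> \<U>" "B \<subseteq> \<Inter>\<F>" using fin[OF \<F>] by blast
        then have "B \<noteq> {}" "B \<subseteq> A" by (auto simp: \<U>_def \<A>_def)
        then show ?thesis using B by blast
      qed
      moreover have "\<forall>C\<in>\<U>. closedin X C" by (auto simp: \<U>_def \<A>_def)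
      ultimately show ?thesis using A(1) unfolding compactin_fip by blast
    qed
    moreover have "\<Inter>\<U> \<subseteq> A" using \<U>_ne sub by (auto simp: \<U>_def)
    moreover have "closedin X (\<Inter>\<U>)" using \<U>_ne by (intro closedin_Inter) (auto simp: \<U>_def \<A>_def)
    moreover have "mul a b \<in> \<Inter>\<U>" if "a \<in> \<Inter>\<U>" "b \<in> \<Inter>\<U>" for a b
      using that by (auto simp: \<U>_def \<A>_def)
    ultimately have "\<Inter>\<U> \<in> \<A>" by (auto simp: \<A>_def)
    moreover have "\<Union>\<C> = A - \<Inter>\<U>" unfolding \<C> using \<U>_ne by blast
    ultimately show "\<Union>\<C> \<in> (\<lambda>B. A - B) ` \<A>" by blast
  qed
  then obtain B where BA: "B \<in> \<A>" and max: "\<And>C. C \<in> \<A> \<Longrightarrow> A - B \<subseteq> A - C \<Longrightarrow> A - C = A - B" by blast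
  have min: "C = B" if "C \<in> \<A>" "C \<subseteq> B" for C
    using max[OF that(1)] that BA by (auto simp: \<A>_def)
  have B: "B \<subseteq> A" "B \<noteq> {}" "closedin X B" "\<And>a b. a \<in> B \<Longrightarrow> b \<in> B \<Longrightarrow> mul a b \<in> B"
    using BA by (auto simp: \<A>_def)
  have compB: "compactin X B" using closed_compactin[OF A(1) B(1,3)] .
  obtain p where p: "p \<in> B" using B(2) by blast
  then have pA: "p \<in> A" using B by blast
  have "(\<lambda>a. mul a p) ` B \<in> \<A>"
  proof -
    have "closedin X ((\<lambda>a. mul a p) ` B)"
      by (intro compactin_imp_closedin[OF X] image_compactin[OF compB cont[OF pA]])
    moreover have "mul (mul a p) (mul b p) \<in> (\<lambda>a. mul a p) ` B" if "a \<in> B" "b \<in> B" for a b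
    proof -
      have "mul (mul a p) (mul b p) = mul (mul (mul a p) b) p"
        using assoc[of "mul a p" b p] B that p by (metis subsetD)
      then show ?thesis using B(4) that p by blast
    qed
    moreover have "(\<lambda>a. mul a p) ` B \<subseteq> A" using B p by blast
    ultimately show ?thesis using p by (auto simp: \<A>_def)
  qed
  then have "(\<lambda>a. mul a p) ` B = B" by (rule min) (use B p in auto)
  then have ex: "\<exists>a\<in>B. mul a p = p" using p by (metis imageE)
  have "{a \<in> B. mul a p = p} \<in> \<A>"
  proof -
    have "closedin X {p}" using p B(3) closedin_subset X
      by (meson Hausdorff_imp_t1_space closedin_t1_singleton subsetD)
    then have "closedin X {a \<in> topspace X. mul a p \<in> {p}}"
      by (rule closedin_continuous_map_preimage[OF cont[OF pA]])
    then have "closedin X (B \<inter> {a \<in> topspace X. mul a p \<in> {p}})" using B(3) by blast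
    moreover have "B \<inter> {a \<in> topspace X. mul a p \<in> {p}} = {a \<in> B. mul a p = p}"
      using closedin_subset[OF B(3)] by auto
    moreover have "mul (mul a b) p = p" if "a \<in> B" "b \<in> B" "mul a p = p" "mul b p = p" for a b
      using assoc[of a b p] that B p by auto
    ultimately show ?thesis using B ex by (auto simp: \<A>_def)
  qed
  then have "{a \<in> B. mul a p = p} = B" by (rule min) auto
  then have "mul p p = p" using p by blast
  then show ?thesis using that pA by blast
qed

section \<open>Compact groups of operators\<close>

text \<open>The neutral element \<open>e\<close> is in general a proper projection and not the
  identity operator: elements of \<open>G\<close> are invertible only on the range of
  \<open>e\<close>.\<close>

locale compact_operator_group =
  fixes G :: "('a::cbanach \<Rightarrow> 'a) set" and e :: "'a \<Rightarrow> 'a"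
  assumes G_ops: "G \<subseteq> bounded_ops UNIV"
    and G_compact: "compactin (wot UNIV) G"
    and G_mult: "g \<in> G \<Longrightarrow> h \<in> G \<Longrightarrow> g \<circ> h \<in> G"
    and e_G: "e \<in> G"
    and e_left: "g \<in> G \<Longrightarrow> e \<circ> g = g"
    and e_right: "g \<in> G \<Longrightarrow> g \<circ> e = g"
    and G_left_inverse: "g \<in> G \<Longrightarrow> \<exists>h\<in>G. h \<circ> g = e"

locale semigroup_with_minimal_idempotent =
  fixes S :: "('a::cbanach \<Rightarrow> 'a) set" and K :: "('a \<Rightarrow> 'a) set" and e :: "'a \<Rightarrow> 'a"
  assumes S_ops: "S \<subseteq> bounded_ops UNIV"
    and S_compact: "compactin (wot UNIV) S"
    and S_mult: "s \<in> S \<Longrightarrow> t \<in> S \<Longrightarrow> s \<circ> t \<in> S"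
    and K: "smallest_ideal S K"
    and e_K: "e \<in> K" and e_idem: "e \<circ> e = e"
    and e_unique: "p \<in> K \<Longrightarrow> p \<circ> p = p \<Longrightarrow> p = e"
begin

lemma K_S: "K \<subseteq> S" and K_left: "s \<in> S \<Longrightarrow> u \<in> K \<Longrightarrow> s \<circ> u \<in> K"
  and K_right: "s \<in> S \<Longrightarrow> u \<in> K \<Longrightarrow> u \<circ> s \<in> K"
  using K unfolding smallest_ideal_def two_sided_ideal_def by auto

lemma e_S: "e \<in> S" using e_K K_S by blast

text \<open>The compact semigroup \<open>S \<circ> x\<close> lies inside the ideal \<open>K\<close>,
  so the idempotent that it must contain can only be \<open>e\<close>.\<close>

lemma left_quotient:
  assumes "x \<in> K"
  obtains v where "v \<in> S" "v \<circ> x = e"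
proof -
  have x: "x \<in> S" using assms K_S by blast
  have "compactin (wot UNIV) ((\<lambda>s. s \<circ> x) ` S)"
    using x S_ops by (intro image_compactin[OF S_compact] continuous_map_wot_right) auto
  then obtain p where p: "p \<in> (\<lambda>s. s \<circ> x) ` S" "p \<circ> p = p"
  proof (rule ellis_numakura_idempotent[OF Hausdorff_space_wot, where mul = "(\<circ>)"])
    show "(\<lambda>s. s \<circ> x) ` S \<noteq> {}" using x by blast
    show "a \<circ> b \<in> (\<lambda>s. s \<circ> x) ` S" if "a \<in> (\<lambda>s. s \<circ> x) ` S" "b \<in> (\<lambda>s. s \<circ> x) ` S" for a b
      using that x S_mult by (fastforce simp: o_assoc)
    show "continuous_map (wot UNIV) (wot UNIV) (\<lambda>a. a \<circ> b)" if "b \<in> (\<lambda>s. s \<circ> x) ` S" for b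
      using that x S_mult S_ops by (intro continuous_map_wot_right) blast
  qed (auto simp: o_assoc)
  then obtain v where v: "v \<in> S" "p = v \<circ> x" by blast
  then show ?thesis using e_unique[OF K_left[OF v(1) assms]] p that by simp
qed

text \<open>The mirror image for \<open>x \<circ> S\<close>: here the left factor is the fixed one,
  so the idempotent theorem is used for the opposite multiplication.\<close>

lemma right_quotient:
  assumes "x \<in> K"
  obtains v where "v \<in> S" "x \<circ> v = e"
proof -
  have x: "x \<in> S" using assms K_S by blast
  have "compactin (wot UNIV) ((\<lambda>s. x \<circ> s) ` S)"
    using x S_ops by (intro image_compactin[OF S_compact] continuous_map_wot_left) auto
  then obtain p where p: "p \<in> (\<lambda>s. x \<circ> s) ` S" "p \<circ> p = p"
  proof (rule ellis_numakura_idempotent[OF Hausdorff_space_wot, where mul = "\<lambda>a b. b \<circ> a"])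
    show "(\<lambda>s. x \<circ> s) ` S \<noteq> {}" using x by blast
    show "b \<circ> a \<in> (\<lambda>s. x \<circ> s) ` S" if "a \<in> (\<lambda>s. x \<circ> s) ` S" "b \<in> (\<lambda>s. x \<circ> s) ` S" for a b
      using that x S_mult by (fastforce simp: o_assoc[symmetric])
    show "continuous_map (wot UNIV) (wot UNIV) (\<lambda>a. b \<circ> a)" if "b \<in> (\<lambda>s. x \<circ> s) ` S" for b
      using that x S_mult S_ops by (intro continuous_map_wot_left) blast
  qed (auto simp: o_assoc)
  then obtain v where v: "v \<in> S" "p = x \<circ> v" by blast
  then show ?thesis using e_unique[OF K_right[OF v(1) assms]] p that by simp
qed

text \<open>For \<open>a = s \<circ> e\<close> a right inverse \<open>v\<close> in \<open>K\<close>
  makes \<open>v \<circ> a\<close> an idempotent of \<open>K\<close>, hence equal to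
  \<open>e\<close>. So the inverse is two-sided and
  \<open>e a = (a v) a = a (v a) = a\<close>.\<close>

lemma e_absorb_left:
  assumes s: "s \<in> S"
  shows "e \<circ> (s \<circ> e) = s \<circ> e"
proof -
  define a where "a = s \<circ> e"
  have aK: "a \<in> K" unfolding a_def by (rule K_left[OF s e_K])
  have ae: "a \<circ> e = a" by (simp add: a_def o_assoc[symmetric] e_idem)
  obtain w where w: "w \<in> S" "a \<circ> w = e" using right_quotient[OF aK] .
  \<comment> \<open>Enclosing \<open>w\<close> between two copies of \<open>e\<close> brings the
    inverse into \<open>K\<close> and makes \<open>e\<close> neutral for it, without changing the
    product with \<open>a\<close>.\<close>
  define v where "v = e \<circ> w \<circ> e"
  have vK: "v \<in> K" unfolding v_def using w e_S e_K by (intro K_left S_mult)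
  have av: "a \<circ> v = e" by (simp add: v_def o_assoc ae w e_idem)
  have ve: "v \<circ> e = v" by (simp add: v_def o_assoc[symmetric] e_idem)
  have "(v \<circ> a) \<circ> (v \<circ> a) = (v \<circ> (a \<circ> v)) \<circ> a" by (simp add: o_assoc)
  then have "(v \<circ> a) \<circ> (v \<circ> a) = v \<circ> a" by (simp add: av ve)
  then have va: "v \<circ> a = e" using vK aK K_S by (intro e_unique K_left) auto
  have "e \<circ> a = a \<circ> v \<circ> a" by (simp add: av)
  also have "\<dots> = a" by (simp add: o_assoc[symmetric] va ae)
  finally show ?thesis by (simp add: a_def)
qed

lemma e_absorb_right:
  assumes s: "s \<in> S"
  shows "(e \<circ> s) \<circ> e = e \<circ> s"
proof -
  define a where "a = e \<circ> s"
  have aK: "a \<in> K" unfolding a_def by (rule K_right[OF s e_K])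
  have ea: "e \<circ> a = a" by (simp add: a_def o_assoc e_idem)
  obtain w where w: "w \<in> S" "w \<circ> a = e" using left_quotient[OF aK] .
  define v where "v = e \<circ> w \<circ> e"
  have vK: "v \<in> K" unfolding v_def using w e_S e_K by (intro K_left S_mult)
  have va: "v \<circ> a = e" by (simp add: v_def o_assoc[symmetric] ea w e_idem)
  have ev: "e \<circ> v = v" by (simp add: v_def o_assoc e_idem)
  have "(a \<circ> v) \<circ> (a \<circ> v) = a \<circ> ((v \<circ> a) \<circ> v)" by (simp add: o_assoc)
  then have "(a \<circ> v) \<circ> (a \<circ> v) = a \<circ> v" by (simp add: va ev)
  then have av: "a \<circ> v = e" using vK aK K_S by (intro e_unique K_left) auto
  have "a \<circ> e = (a \<circ> v) \<circ> a" by (simp add: va o_assoc[symmetric])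
  also have "\<dots> = a" by (simp add: av ea)
  finally show ?thesis by (simp add: a_def)
qed

lemma e_commutes: "s \<in> S \<Longrightarrow> e \<circ> s = s \<circ> e"
  using e_absorb_left e_absorb_right by (metis o_assoc)

text \<open>Because \<open>e\<close> commutes with \<open>S\<close>, the left ideal
  \<open>S \<circ> e\<close> is two-sided. The formula shows \<open>K\<close> as a continuous image
  of \<open>S\<close>, which is how \<open>K\<close> becomes compact.\<close>

lemma K_eq: "K = (\<lambda>s. s \<circ> e) ` S"
proof
  have "two_sided_ideal S ((\<lambda>s. s \<circ> e) ` S)"
    unfolding two_sided_ideal_def
  proof (intro conjI ballI)
    show "(\<lambda>s. s \<circ> e) ` S \<noteq> {}" "(\<lambda>s. s \<circ> e) ` S \<subseteq> S" using e_S S_mult by auto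
    fix s u assume s: "s \<in> S" and "u \<in> (\<lambda>s. s \<circ> e) ` S"
    then obtain t where t: "t \<in> S" "u = t \<circ> e" by blast
    show "s \<circ> u \<in> (\<lambda>s. s \<circ> e) ` S" using S_mult[OF s t(1)] t(2) by (auto simp: o_assoc)
    have "u \<circ> s = (t \<circ> s) \<circ> e" using e_commutes[OF s] t(2) by (metis o_assoc)
    then show "u \<circ> s \<in> (\<lambda>s. s \<circ> e) ` S" using S_mult[OF t(1) s] by blast
  qed
  then show "K \<subseteq> (\<lambda>s. s \<circ> e) ` S" using K by (simp add: smallest_ideal_def)
  show "(\<lambda>s. s \<circ> e) ` S \<subseteq> K" using K_left e_K by blast
qed

sublocale compact_operator_group K e
proof
  show "K \<subseteq> bounded_ops UNIV" using K_S S_ops by blast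
  show "compactin (wot UNIV) K"
    unfolding K_eq using e_S S_ops by (intro image_compactin[OF S_compact] continuous_map_wot_right) auto
  show "g \<circ> h \<in> K" if "g \<in> K" "h \<in> K" for g h using that K_left K_S by blast
  show "e \<in> K" by (rule e_K)
  show "g \<circ> e = g" if "g \<in> K" for g using that by (auto simp: K_eq o_assoc[symmetric] e_idem)
  then show "e \<circ> g = g" if "g \<in> K" for g using that e_commutes K_S by auto
  then show "\<exists>h\<in>K. h \<circ> g = e" if g: "g \<in> K" for g
  proof -
    obtain v where "v \<in> S" "v \<circ> g = e" using left_quotient[OF g] .
    then show ?thesis using K_right[OF _ e_K, of v] e_idem by (metis o_assoc)
  qed
qed

text \<open>Reversibility tested on \<open>u = e\<close> puts \<open>x\<close> into the range of
  \<open>v \<circ> e = e \<circ> v \<circ> e\<close>. Conversely \<open>u \<circ> e\<close> lies in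
  \<open>K\<close> and has a left quotient, which returns \<open>u x\<close> to
  \<open>e x = x\<close>.\<close>

lemma reversible_part_eq: "reversible_part S = {x. e x = x}"
proof
  show "reversible_part S \<subseteq> {x. e x = x}"
  proof
    fix x assume "x \<in> reversible_part S"
    then obtain v where v: "v \<in> S" "v (e x) = x" using e_S by (auto simp: reversible_part_def)
    have "e x = (e \<circ> (v \<circ> e)) x" using v by simp
    also have "\<dots> = x" unfolding e_absorb_left[OF v(1)] using v(2) by simp
    finally show "x \<in> {x. e x = x}" by simp
  qed
  show "{x. e x = x} \<subseteq> reversible_part S"
  proof
    fix x assume "x \<in> {x. e x = x}"
    then have x: "e x = x" by simp
    have "\<exists>v\<in>S. v (u x) = x" if u: "u \<in> S" for u
    proof -
      obtain v where v: "v \<in> S" "v \<circ> (u \<circ> e) = e" using left_quotient[OF K_left[OF u e_K]] .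
      have "v (u x) = (v \<circ> (u \<circ> e)) x" by (simp add: x)
      then show ?thesis using v x by auto
    qed
    then show "x \<in> reversible_part S" by (simp add: reversible_part_def)
  qed
qed

lemma op_zero: "u \<in> S \<Longrightarrow> u 0 = 0"
  using S_ops ops_bounded_linear linear_0 bounded_linear.linear by blast

text \<open>If \<open>u\<close> annihilates \<open>x\<close>, so does
  \<open>v \<circ> e \<circ> u\<close>, and for a suitable \<open>v\<close> this operator is
  \<open>e\<close>.\<close>

lemma aws_part_eq: "aws_part S = {x. e x = 0}"
proof
  show "aws_part S \<subseteq> {x. e x = 0}"
  proof
    fix x assume "x \<in> aws_part S"
    then obtain u where u: "u \<in> S" "u x = 0" by (auto simp: aws_part_def)
    obtain v where v: "v \<in> S" "v \<circ> (e \<circ> u) = e" using left_quotient[OF K_right[OF u(1) e_K]] .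
    have "e x = v (e (u x))" using v(2) by (metis comp_apply)
    then show "x \<in> {x. e x = 0}" using u v e_S by (simp add: op_zero)
  qed
  show "{x. e x = 0} \<subseteq> aws_part S" using e_S by (auto simp: aws_part_def)
qed

section \<open>Bi-invariant means\<close>

lemma coefficient_cont_fun:
  assumes "f \<in> dual UNIV"
  shows "(\<lambda>T. complex_of_real (cmod (f (T x)))) \<in> cont_fun S"
proof -
  have f: "continuous_map (subtopology (wot UNIV) S) euclidean (\<lambda>T. f (T x))"
    by (rule continuous_map_from_subtopology[OF continuous_map_wot_eval[OF assms UNIV_I]])
  have "continuous_map euclidean euclidean (\<lambda>z. complex_of_real (cmod z))"
    by (auto intro!: continuous_intros)
  from continuous_map_compose[OF f this] show ?thesis unfolding cont_fun_def comp_def by simp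
qed

lemma bi_invariant_mean_aws:
  assumes M: "bi_invariant_mean S M"
  shows "aws_part S = {x. \<forall>f\<in>dual UNIV. M (\<lambda>T. complex_of_real (cmod (f (T x)))) = 0}"
proof -
  have M_add: "M (\<lambda>t. f t + g t) = M f + M g" if "f \<in> cont_fun S" "g \<in> cont_fun S" for f g
    using M that unfolding bi_invariant_mean_def by blast
  have M_scale: "M (\<lambda>t. c * f t) = c * M f" if "f \<in> cont_fun S" for c f
    using M that unfolding bi_invariant_mean_def by blast
  have M_pos: "M f \<in> \<real>\<^sub>\<ge>\<^sub>0" if "f \<in> cont_fun S" "\<And>t. t \<in> S \<Longrightarrow> f t \<in> \<real>\<^sub>\<ge>\<^sub>0" for f
    using M that unfolding bi_invariant_mean_def by blast
  have M_left: "M (\<lambda>t. f (s \<circ> t)) = M f" if "f \<in> cont_fun S" "s \<in> S" for f s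
    using M that unfolding bi_invariant_mean_def by blast
  have M_right: "M (\<lambda>t. f (t \<circ> s)) = M f" if "f \<in> cont_fun S" "s \<in> S" for f s
    using M that unfolding bi_invariant_mean_def by blast
  have M_norm: "(SUP f\<in>{f \<in> cont_fun S. \<forall>t\<in>S. cmod (f t) \<le> 1}. ereal (cmod (M f))) = 1"
    using M unfolding bi_invariant_mean_def by blast
  have const: "(\<lambda>_. c) \<in> cont_fun S" for c by (simp add: cont_fun_def)
  have M_0: "M (\<lambda>_. 0) = 0" using M_scale[OF const[of 0], of 0] by simp
  have add_cont: "(\<lambda>t. f t + g t) \<in> cont_fun S" if "f \<in> cont_fun S" "g \<in> cont_fun S" for f g
    using that by (simp add: cont_fun_def continuous_map_add)
  have vanish: "M g = 0" if g: "g \<in> cont_fun S" "\<And>t. t \<in> S \<Longrightarrow> g t = 0" for g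
  proof -
    have "M g \<in> \<real>\<^sub>\<ge>\<^sub>0" using g by (intro M_pos) auto
    moreover have "(\<lambda>t. (-1) * g t) \<in> cont_fun S"
      using g(1) by (auto simp: cont_fun_def intro: continuous_map_minus)
    then have "M (\<lambda>t. (-1) * g t) \<in> \<real>\<^sub>\<ge>\<^sub>0" using g(2) by (intro M_pos) auto
    then have "- M g \<in> \<real>\<^sub>\<ge>\<^sub>0" using M_scale[OF g(1), of "-1"] by simp
    ultimately show ?thesis by (auto simp: complex_nonneg_Reals_iff complex_eq_iff)
  qed
  have M_cong: "M f = M g" if f: "f \<in> cont_fun S" and g: "g \<in> cont_fun S" and eq: "\<And>t. t \<in> S \<Longrightarrow> f t = g t" for f g
  proof -
    have g': "(\<lambda>t. (-1) * g t) \<in> cont_fun S"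
      using g by (auto simp: cont_fun_def intro: continuous_map_minus)
    have "M (\<lambda>t. f t + (-1) * g t) = 0" using add_cont[OF f g'] eq by (intro vanish) auto
    then show ?thesis using M_add[OF f g'] M_scale[OF g, of "-1"] by simp
  qed
  have M_sum: "(\<lambda>t. \<Sum>i\<in>D. F i t) \<in> cont_fun S \<and> M (\<lambda>t. \<Sum>i\<in>D. F i t) = (\<Sum>i\<in>D. M (F i))"
    if "finite D" "\<And>i. i \<in> D \<Longrightarrow> F i \<in> cont_fun S" for D :: "('a \<Rightarrow> 'a) set" and F
    using that by (induction D) (simp_all add: const M_0 add_cont M_add)
  \<comment> \<open>The norm of \<open>M\<close> is given only as a supremum. If \<open>M\<close>
    vanished at the constant 1, positivity applied to \<open>1 + f\<close> and \<open>1 - f\<close>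
    would force \<open>M f = 0\<close> for all real \<open>f\<close> of modulus at most 1, then for
    the whole unit ball, and the supremum would be 0.\<close>
  have M_1: "M (\<lambda>_. 1) \<noteq> 0"
  proof
    assume M1: "M (\<lambda>_. 1) = 0"
    have real0: "M (\<lambda>t. complex_of_real (f t)) = 0"
      if f: "continuous_map (subtopology (wot UNIV) S) euclidean f" and le: "\<And>t. t \<in> S \<Longrightarrow> \<bar>f t\<bar> \<le> 1" for f
    proof -
      have cf: "(\<lambda>t. complex_of_real (r * f t)) \<in> cont_fun S" for r
      proof -
        have "continuous_map euclidean euclidean (\<lambda>z. complex_of_real (r * z))"
          by (auto intro!: continuous_intros)
        from continuous_map_compose[OF f this] show ?thesis unfolding cont_fun_def comp_def by simp
      qed
      have "M (\<lambda>t. complex_of_real (r * f t)) \<in> \<real>\<^sub>\<ge>\<^sub>0" if r: "\<bar>r\<bar> = 1" for r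
      proof -
        have "M (\<lambda>t. complex_of_real (r * f t) + 1) \<in> \<real>\<^sub>\<ge>\<^sub>0"
        proof (rule M_pos)
          fix t assume "t \<in> S"
          then have "\<bar>r * f t\<bar> \<le> 1" using le r by (simp add: abs_mult)
          then have "complex_of_real (r * f t + 1) \<in> \<real>\<^sub>\<ge>\<^sub>0" by (simp only: nonneg_Reals_of_real_iff)
          then show "complex_of_real (r * f t) + 1 \<in> \<real>\<^sub>\<ge>\<^sub>0" by simp
        qed (rule add_cont[OF cf const])
        then show ?thesis using M_add[OF cf const, of r 1] M1 by simp
      qed
      from this[of 1] this[of "-1"] show ?thesis
        using M_scale[OF cf[of 1], of "-1"] by (auto simp: complex_nonneg_Reals_iff complex_eq_iff)
    qed
    have "M f = 0" if f: "f \<in> cont_fun S" and le: "\<And>t. t \<in> S \<Longrightarrow> cmod (f t) \<le> 1" for f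
    proof -
      have cf: "continuous_map (subtopology (wot UNIV) S) euclidean f" using f by (simp add: cont_fun_def)
      have re: "continuous_map (subtopology (wot UNIV) S) euclidean (\<lambda>t. Re (f t))"
        using continuous_map_compose[OF cf, of euclidean Re] by (simp add: comp_def continuous_on_Re)
      have im: "continuous_map (subtopology (wot UNIV) S) euclidean (\<lambda>t. Im (f t))"
        using continuous_map_compose[OF cf, of euclidean Im] by (simp add: comp_def continuous_on_Im)
      have "(\<lambda>t. complex_of_real (g t)) \<in> cont_fun S"
        if "continuous_map (subtopology (wot UNIV) S) euclidean g" for g
        using continuous_map_compose[OF that, of euclidean complex_of_real]
        by (simp add: comp_def cont_fun_def continuous_on_of_real)
      note cont_re = this[OF re] and cont_im = this[OF im]
      have sc: "(\<lambda>t. \<i> * complex_of_real (Im (f t))) \<in> cont_fun S"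
        using continuous_map_compose[OF im, of euclidean "\<lambda>x. \<i> * complex_of_real x"]
        by (simp add: comp_def cont_fun_def continuous_intros)
      have "M f = M (\<lambda>t. complex_of_real (Re (f t)) + \<i> * complex_of_real (Im (f t)))"
        by (simp flip: complex_eq)
      also have "\<dots> = M (\<lambda>t. complex_of_real (Re (f t))) + \<i> * M (\<lambda>t. complex_of_real (Im (f t)))"
        using M_add[OF cont_re sc] M_scale[OF cont_im] by simp
      also have "\<dots> = 0"
        using real0[OF re order_trans[OF abs_Re_le_cmod le]] real0[OF im order_trans[OF abs_Im_le_cmod le]]
        by simp
      finally show ?thesis .
    qed
    then have "(SUP f\<in>{f \<in> cont_fun S. \<forall>t\<in>S. cmod (f t) \<le> 1}. ereal (cmod (M f))) \<le> 0"
      by (intro SUP_least) auto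
    then show False using M_norm by simp
  qed
  show ?thesis
  proof
    show "aws_part S \<subseteq> {x. \<forall>f\<in>dual UNIV. M (\<lambda>T. complex_of_real (cmod (f (T x)))) = 0}"
    proof (intro subsetI CollectI ballI)
      fix x and f :: "'a \<Rightarrow> complex" assume "x \<in> aws_part S" and f: "f \<in> dual UNIV"
      then obtain u where u: "u \<in> S" "u x = 0" by (auto simp: aws_part_def)
      have f0: "f 0 = 0" using dual_zero[OF f] by simp
      \<comment> \<open>Right translation by the \<open>u\<close> that annihilates \<open>x\<close>
        turns the coefficient into the zero function.\<close>
      have "M (\<lambda>T. complex_of_real (cmod (f (T x)))) = M (\<lambda>T. complex_of_real (cmod (f (T (u x)))))"
        using M_right[OF coefficient_cont_fun[OF f] u(1), of x] by simp
      also have "\<dots> = 0"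
        using coefficient_cont_fun[OF f] by (rule vanish) (simp add: u(2) op_zero f0)
      finally show "M (\<lambda>T. complex_of_real (cmod (f (T x)))) = 0" .
    qed
  next
    show "{x. \<forall>f\<in>dual UNIV. M (\<lambda>T. complex_of_real (cmod (f (T x)))) = 0} \<subseteq> aws_part S"
    proof
      fix x assume "x \<in> {x. \<forall>f\<in>dual UNIV. M (\<lambda>T. complex_of_real (cmod (f (T x)))) = 0}"
      then have x: "\<And>f. f \<in> dual UNIV \<Longrightarrow> M (\<lambda>T. complex_of_real (cmod (f (T x)))) = 0" by blast
      show "x \<in> aws_part S"
      proof (rule ccontr)
        assume "x \<notin> aws_part S"
        then have "e x \<noteq> 0" by (simp add: aws_part_eq)
        then obtain f where f: "f \<in> dual UNIV" "Re (f (e x)) = norm (e x)"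
          using norming_functional by blast
        then have fe: "f (e x) \<noteq> 0" using \<open>e x \<noteq> 0\<close> by auto
        \<comment> \<open>The translates of \<open>t \<mapsto> cmod (f (t (e x)))\<close> have mean zero, but by compactness finitely many
          of them have a sum that is bounded away from zero.\<close>
        define F where "F = (\<lambda>(s :: 'a \<Rightarrow> 'a) (t :: 'a \<Rightarrow> 'a). complex_of_real (cmod (f (s (t (e x))))))"
        have F_cont: "F s \<in> cont_fun S" if "s \<in> S" for s
          unfolding F_def using coefficient_cont_fun[OF dual_compose_op[OF f(1)]] that S_ops by blast
        have F_M: "M (F s) = 0" if s: "s \<in> S" for s
        proof -
          have fs: "(\<lambda>y. f (s y)) \<in> dual UNIV" using dual_compose_op[OF f(1)] s S_ops by blast
          show ?thesis
            unfolding F_def using M_right[OF coefficient_cont_fun[OF fs] e_S, of x] x[OF fs] by simp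
        qed
        define W where "W = (\<lambda>s :: 'a \<Rightarrow> 'a. {t \<in> topspace (wot UNIV). f (s (t (e x))) \<in> - {0}})"
        have "openin (wot UNIV) (W s)" if "s \<in> S" for s
        proof -
          have fs: "(\<lambda>y. f (s y)) \<in> dual UNIV" using dual_compose_op[OF f(1)] that S_ops by blast
          show ?thesis
            unfolding W_def by (rule openin_continuous_map_preimage[OF continuous_map_wot_eval[OF fs UNIV_I]])
                (simp add: open_Compl)
        qed
        moreover have "S \<subseteq> (\<Union>s\<in>S. W s)"
        proof
          fix t assume t: "t \<in> S"
          \<comment> \<open>The left quotient brings \<open>t (e x)\<close> back to
            \<open>e x\<close>, where \<open>f\<close> does not vanish; hence the sets
            \<open>W v\<close> cover \<open>S\<close>.\<close>
          obtain v where v: "v \<in> S" "v \<circ> (t \<circ> e) = e" using left_quotient[OF K_left[OF t e_K]] .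
          have "v (t (e x)) = e x" using v(2) by (metis comp_apply)
          then have "t \<in> W v" using t fe S_ops by (auto simp: W_def topspace_wot_UNIV)
          then show "t \<in> (\<Union>s\<in>S. W s)" using v(1) by blast
        qed
        ultimately obtain \<F> where "finite \<F>" "\<F> \<subseteq> W ` S" "S \<subseteq> \<Union>\<F>"
          using compactinD[OF S_compact, of "W ` S"] by blast
        then obtain D where D: "finite D" "D \<subseteq> S" "S \<subseteq> (\<Union>s\<in>D. W s)"
          by (metis finite_subset_image)
        define g where "g = (\<lambda>t :: 'a \<Rightarrow> 'a. \<Sum>s\<in>D. cmod (f (s (t (e x)))))"
        have g: "(\<lambda>t. complex_of_real (g t)) = (\<lambda>t. \<Sum>s\<in>D. F s t)" by (simp add: g_def F_def)
        have g_cont: "(\<lambda>t. complex_of_real (g t)) \<in> cont_fun S" and Mg: "M (\<lambda>t. complex_of_real (g t)) = 0"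
        proof -
          have "F i \<in> cont_fun S" "M (F i) = 0" if "i \<in> D" for i using that D(2) F_cont F_M by auto
          then show "(\<lambda>t. complex_of_real (g t)) \<in> cont_fun S" "M (\<lambda>t. complex_of_real (g t)) = 0"
            unfolding g using M_sum[OF D(1), of F] by simp_all
        qed
        have g_pos: "g t > 0" if t: "t \<in> S" for t
        proof -
          obtain s where s: "s \<in> D" "t \<in> W s" using D(3) t by blast
          then show ?thesis unfolding g_def by (intro sum_pos2[OF D(1) s(1)]) (auto simp: W_def)
        qed
        have g_map: "continuous_map (subtopology (wot UNIV) S) euclidean g"
          using continuous_map_compose[OF g_cont[unfolded cont_fun_def mem_Collect_eq], of euclidean Re]
          by (simp add: comp_def continuous_on_Re)
        have "compactin (subtopology (wot UNIV) S) S" using S_compact by (simp add: compactin_subtopology)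
        from image_compactin[OF this g_map] have "compact (g ` S)" by simp
        \<comment> \<open>The minimum \<delta> of the positive continuous \<open>g\<close> on
          compact \<open>S\<close> is positive. As \<open>g - \<delta>\<close> is nonnegative and
          \<open>M g = 0\<close>, positivity would make \<open>- \<delta> * M 1\<close>
          nonnegative.\<close>
        then obtain \<delta> where \<delta>: "\<delta> \<in> g ` S" "\<And>y. y \<in> g ` S \<Longrightarrow> \<delta> \<le> y"
          using compact_attains_inf[of "g ` S"] e_S by blast
        then have \<delta>0: "\<delta> > 0" using g_pos by blast
        have "M (\<lambda>t. complex_of_real (g t) + complex_of_real (- \<delta>) * 1) \<in> \<real>\<^sub>\<ge>\<^sub>0"
        proof (rule M_pos)
          show "(\<lambda>t. complex_of_real (g t) + complex_of_real (- \<delta>) * 1) \<in> cont_fun S"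
            by (rule add_cont[OF g_cont const])
          fix t assume "t \<in> S"
          then have "complex_of_real (g t + - \<delta>) \<in> \<real>\<^sub>\<ge>\<^sub>0"
            using \<delta>(2)[of "g t"] by (simp only: nonneg_Reals_of_real_iff) simp
          then show "complex_of_real (g t) + complex_of_real (- \<delta>) * 1 \<in> \<real>\<^sub>\<ge>\<^sub>0" by simp
        qed
        then have "- complex_of_real \<delta> * M (\<lambda>_. 1) \<in> \<real>\<^sub>\<ge>\<^sub>0"
          using M_add[OF g_cont const[of "- complex_of_real \<delta>"]] M_scale[OF const[of 1], of "- complex_of_real \<delta>"] Mg
          by simp
        moreover have "M (\<lambda>_. 1) \<in> \<real>\<^sub>\<ge>\<^sub>0" using const by (rule M_pos) simp
        ultimately show False using M_1 \<delta>0
          by (auto simp: complex_nonneg_Reals_iff complex_eq_iff zero_le_mult_iff mult_le_0_iff)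
      qed
    qed
  qed
qed

end

section \<open>Norm compactness of orbits\<close>

lemma cspace_subspace_closure:
  fixes V :: "'a::cbanach set"
  assumes V: "cspace.subspace V"
  shows "cspace.subspace (closure V)"
proof (rule cspace.subspaceI)
  show "0 \<in> closure V" using cspace.subspace_0[OF V] closure_subset by blast
  fix x y assume "x \<in> closure V" "y \<in> closure V"
  then obtain X Y where "\<And>n. X n \<in> V" "X \<longlonglongrightarrow> x" "\<And>n. Y n \<in> V" "Y \<longlonglongrightarrow> y"
    by (auto simp: closure_sequential)
  then show "x + y \<in> closure V"
    unfolding closure_sequential
    by (intro exI[of _ "\<lambda>n. X n + Y n"]) (simp add: tendsto_add cspace.subspace_add[OF V])
next
  fix c x assume "x \<in> closure V"
  then obtain X where X: "\<And>n. X n \<in> V" "X \<longlonglongrightarrow> x" by (auto simp: closure_sequential)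
  have "bounded_linear (\<lambda>x :: 'a. c *\<^sub>C x)"
    by (rule bounded_linear_intro[where K = "cmod c"])
      (simp_all add: scaleC_add_right scaleR_scaleC scaleC_scaleC norm_scaleC mult.commute)
  then have "(\<lambda>n. c *\<^sub>C X n) \<longlonglongrightarrow> c *\<^sub>C x" using X(2) bounded_linear.tendsto by blast
  moreover have "c *\<^sub>C X n \<in> V" for n using X(1) cspace.subspace_scale[OF V] by blast
  ultimately show "c *\<^sub>C x \<in> closure V" unfolding closure_sequential by (intro exI[of _ "\<lambda>n. c *\<^sub>C X n"]) simp
qed

text \<open>A list of pairs from \<open>Q \<times> B\<close> encodes a finite linear combination
  with coefficients in a countable dense set \<open>Q\<close> of complex numbers, and there are only
  countably many lists.\<close>

lemma countable_dense_span:
  fixes B :: "'a::cbanach set"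
  assumes B: "countable B"
  obtains D where "countable D" "cspace.span B \<subseteq> closure D"
proof -
  obtain Q :: "complex set" where Q: "countable Q" "\<And>X. open X \<Longrightarrow> X \<noteq> {} \<Longrightarrow> \<exists>q\<in>Q. q \<in> X"
    using countable_dense_exists by metis
  define F where "F = (\<lambda>l. foldr (\<lambda>(q, b) x. q *\<^sub>C b + x) l (0 :: 'a))"
  define D where "D = F ` lists (Q \<times> B)"
  have "countable D" unfolding D_def using Q(1) B by (intro countable_image countable_lists countable_SIGMA)
  moreover have "\<exists>d\<in>D. norm (x - d) < \<epsilon>" if "x \<in> cspace.span B" "\<epsilon> > 0" for x \<epsilon>
    using that
  proof (induction arbitrary: \<epsilon> rule: cspace.span_induct_alt)
    case base
    have "F [] \<in> D" unfolding D_def by blast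
    then show ?case using base by (intro bexI[of _ "F []"]) (simp_all add: F_def)
  next
    case (step c b y)
    obtain d where d: "d \<in> D" "norm (y - d) < \<epsilon> / 2"
      using step.IH[of "\<epsilon> / 2"] step.prems by auto
    obtain l where l: "l \<in> lists (Q \<times> B)" "d = F l" using d(1) by (auto simp: D_def)
    \<comment> \<open>The coefficient error, multiplied by \<open>norm b\<close>, may use half of
      the tolerance; the added 1 avoids division by zero for \<open>b = 0\<close>.\<close>
    have "0 < \<epsilon> / (2 * (norm b + 1))"
      using step.prems by (intro divide_pos_pos mult_pos_pos add_nonneg_pos) simp_all
    then have "ball c (\<epsilon> / (2 * (norm b + 1))) \<noteq> {}" by (simp only: ball_eq_empty not_le)
    then obtain q where q: "q \<in> Q" "q \<in> ball c (\<epsilon> / (2 * (norm b + 1)))" using Q(2) open_ball by blast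
    have "F ((q, b) # l) \<in> D" unfolding D_def using l q step.hyps by auto
    moreover have "norm (c *\<^sub>C b + y - F ((q, b) # l)) < \<epsilon>"
    proof -
      have "c *\<^sub>C b + y - F ((q, b) # l) = (c - q) *\<^sub>C b + (y - d)"
        using l(2) by (simp add: F_def cspace.scale_left_diff_distrib)
      also have "norm \<dots> \<le> cmod (c - q) * norm b + norm (y - d)"
        by (rule norm_triangle_le) (simp add: norm_scaleC)
      also have "cmod (c - q) * norm b \<le> \<epsilon> / 2"
      proof -
        have "cmod (c - q) * (norm b + 1) \<le> \<epsilon> / 2"
        proof -
          have "cmod (c - q) < \<epsilon> / (2 * (norm b + 1))" using q(2) by (simp only: mem_ball dist_norm)
          moreover have "0 < 2 * (norm b + 1)" by (intro mult_pos_pos add_nonneg_pos) simp_all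
          ultimately have "cmod (c - q) * (2 * (norm b + 1)) < \<epsilon>" by (simp only: pos_less_divide_eq)
          then show ?thesis by (simp add: algebra_simps)
        qed
        moreover have "cmod (c - q) * norm b \<le> cmod (c - q) * (norm b + 1)" by (intro mult_left_mono) auto
        ultimately show ?thesis by linarith
      qed
      finally show ?thesis using d(2) by linarith
    qed
    ultimately show ?case by blast
  qed
  then have "cspace.span B \<subseteq> closure D"
    by (auto simp: closure_approachable dist_norm norm_minus_commute)
  ultimately show ?thesis using that by blast
qed

lemma uncountable_nat_bool: "uncountable (UNIV :: (nat \<Rightarrow> bool) set)"
proof
  assume "countable (UNIV :: (nat \<Rightarrow> bool) set)"
  then obtain f :: "nat \<Rightarrow> nat \<Rightarrow> bool" where "range f = UNIV"
    using uncountable_def by blast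
  then obtain n where "f n = (\<lambda>n. \<not> f n n)" by (metis UNIV_I imageE)
  then show False by (metis (full_types))
qed

text \<open>If every weakly open piece of the orbit had norm diameter above \<open>\<epsilon>\<close>, a Cantor scheme of open
  sets would produce uncountably many \<open>\<epsilon>\<close>-separated points in a separable subspace.\<close>

lemma compactin_wot_small_piece:
  fixes G :: "('a::cbanach \<Rightarrow> 'a) set"
  assumes comp: "compactin (wot UNIV) G" and ne: "G \<noteq> {}" and \<epsilon>: "\<epsilon> > 0"
  obtains W where "openin (wot UNIV) W" "W \<inter> G \<noteq> {}"
    "\<And>g h. g \<in> W \<inter> G \<Longrightarrow> h \<in> W \<inter> G \<Longrightarrow> norm (g \<xi> - h \<xi>) \<le> \<epsilon>"
proof (rule ccontr)
  assume "\<not> thesis"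
  then have big: "\<exists>g h. g \<in> W \<inter> G \<and> h \<in> W \<inter> G \<and> norm (g \<xi> - h \<xi>) > \<epsilon>"
    if "openin (wot UNIV) W" "W \<inter> G \<noteq> {}" for W
    using that \<open>\<And>W. \<lbrakk>openin (wot UNIV) W; W \<inter> G \<noteq> {}; \<And>g h. g \<in> W \<inter> G \<Longrightarrow> h \<in> W \<inter> G \<Longrightarrow> norm (g \<xi> - h \<xi>) \<le> \<epsilon>\<rbrakk> \<Longrightarrow> thesis\<close>
    by (meson not_le)
  define good where "good = (\<lambda>W :: ('a \<Rightarrow> 'a) set. openin (wot UNIV) W \<and> W \<inter> G \<noteq> {})"
  \<comment> \<open>The two halves of a node are separated by a gap \<epsilon> in the real part of a
    functional dominated by the norm. The gap is recorded by non-strict inequalities, because only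
    these survive in weak limits.\<close>
  define split where "split = (\<lambda>W (U :: bool \<Rightarrow> ('a \<Rightarrow> 'a) set) (f :: 'a \<Rightarrow> complex) a.
    (\<forall>b. good (U b) \<and> U b \<subseteq> W) \<and> f \<in> dual UNIV \<and> (\<forall>y. \<bar>Re (f y)\<bar> \<le> norm y) \<and>
    (\<forall>g\<in>U True. Re (f (g \<xi>)) \<ge> a + \<epsilon>) \<and> (\<forall>g\<in>U False. Re (f (g \<xi>)) \<le> a))"
  have "\<exists>U f a. split W U f a" if W: "good W" for W
  proof -
    obtain g h where gh: "g \<in> W \<inter> G" "h \<in> W \<inter> G" "norm (g \<xi> - h \<xi>) > \<epsilon>"
      using big[of W] W unfolding good_def by blast
    obtain f where f: "f \<in> dual UNIV" "Re (f (g \<xi> - h \<xi>)) = norm (g \<xi> - h \<xi>)" "\<And>y. \<bar>Re (f y)\<bar> \<le> norm y"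
      using norming_functional by blast
    \<comment> \<open>The distance of the two points is \<open>\<epsilon> + 2 \<eta>\<close>, so
      after the gap a margin \<eta> remains on either side and both points satisfy strict, hence
      open, conditions.\<close>
    define \<eta> where "\<eta> = (norm (g \<xi> - h \<xi>) - \<epsilon>) / 2"
    define a where "a = Re (f (h \<xi>)) + \<eta>"
    have \<eta>: "\<eta> > 0" using gh(3) by (simp add: \<eta>_def)
    have fg: "Re (f (g \<xi>)) = a + \<epsilon> + \<eta>"
      using f(2) dual_diff[OF f(1), of "g \<xi>" "h \<xi>"] by (simp add: a_def \<eta>_def field_simps)
    define U where "U = (\<lambda>b. W \<inter> {T \<in> topspace (wot UNIV). f (T \<xi>) \<in> (if b then {z. Re z > a + \<epsilon>} else {z. Re z < a})})"
    have Wo: "openin (wot UNIV) W" using W by (simp add: good_def)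
    then have top: "g \<in> topspace (wot UNIV)" "h \<in> topspace (wot UNIV)"
      using gh openin_subset by blast+
    have "openin (wot UNIV) (U b)" for b
      unfolding U_def
      by (intro openin_Int Wo openin_continuous_map_preimage[OF continuous_map_wot_eval[OF f(1) UNIV_I]])
        (auto simp: open_halfspace_Re_gt open_halfspace_Re_lt)
    moreover have "g \<in> U True" "h \<in> U False" using gh top fg \<eta> by (auto simp: U_def a_def)
    then have "U b \<inter> G \<noteq> {}" for b using gh by (cases b) auto
    moreover have "U b \<subseteq> W" for b by (auto simp: U_def)
    moreover have "\<forall>g\<in>U True. Re (f (g \<xi>)) \<ge> a + \<epsilon>" "\<forall>g\<in>U False. Re (f (g \<xi>)) \<le> a"
      by (auto simp: U_def)
    ultimately have "split W U f a" using f by (simp add: split_def good_def)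
    then show ?thesis by blast
  qed
  then obtain U f a where spl: "\<And>W. good W \<Longrightarrow> split W (U W) (f W) (a W)" by metis
  define node where "node = (\<lambda>s. foldr (\<lambda>b W. U W b) s (topspace (wot UNIV)))"
  have node_Cons: "node (b # s) = U (node s) b" for b s by (simp add: node_def)
  have G_top: "G \<subseteq> topspace (wot UNIV)" by (rule compactin_subset_topspace[OF comp])
  have good: "good (node s)" for s
  proof (induction s)
    case Nil
    then show ?case using ne G_top by (auto simp: node_def good_def)
  next
    case (Cons b s)
    then show ?case using spl[OF Cons] by (simp add: node_Cons split_def)
  qed
  have node_sub: "node (b # s) \<subseteq> node s" for b s
    using spl[OF good] by (simp add: node_Cons split_def)
  have "\<forall>s. \<exists>g. g \<in> node s \<inter> G" using good unfolding good_def by blast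
  then obtain p where p: "\<And>s. p s \<in> node s \<inter> G" by metis
  define B where "B = range (\<lambda>s. p s \<xi>)"
  have "countable B" unfolding B_def by simp
  then obtain D where D: "countable D" "cspace.span B \<subseteq> closure D" using countable_dense_span by blast
  \<comment> \<open>The most recent bit stands at the head of the list, matching
    \<open>node\<close>, so prolonging the branch by one bit is a \<open>Cons\<close>.\<close>
  define path where "path = (\<lambda>(\<sigma> :: nat \<Rightarrow> bool) n. map \<sigma> (rev [0..<n]))"
  have path_Suc: "path \<sigma> (Suc n) = \<sigma> n # path \<sigma> n" for \<sigma> n by (simp add: path_def)
  have node_path: "node (path \<sigma> m) \<subseteq> node (path \<sigma> n)" if "n \<le> m" for \<sigma> n m
    using that by (induction rule: dec_induct) (use node_sub path_Suc in \<open>force+\<close>)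
  \<comment> \<open>A cluster point of the chosen points along the branch \<sigma>. The nodes are
    open, so it may lie outside all of them; what it keeps are closed conditions valid from some
    stage on.\<close>
  have "\<exists>g\<in>G. \<forall>n. g \<in> wot UNIV closure_of (p ` path \<sigma> ` {n..})" for \<sigma>
  proof -
    define \<U> where "\<U> = range (\<lambda>n. wot UNIV closure_of (p ` path \<sigma> ` {n..}))"
    have "G \<inter> \<Inter>\<F> \<noteq> {}" if \<F>: "finite \<F>" "\<F> \<subseteq> \<U>" for \<F>
    proof -
      from finite_subset_image[OF \<F>(1) \<F>(2)[unfolded \<U>_def]]
      obtain N where N: "finite N" "\<F> = (\<lambda>n. wot UNIV closure_of (p ` path \<sigma> ` {n..})) ` N"
        by auto
      from N(1) obtain m where m: "\<And>n. n \<in> N \<Longrightarrow> n \<le> m" by (auto simp: finite_nat_set_iff_bounded_le)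
      have "p (path \<sigma> m) \<in> wot UNIV closure_of (p ` path \<sigma> ` {n..})" if "n \<in> N" for n
      proof -
        have "p ` path \<sigma> ` {n..} \<subseteq> topspace (wot UNIV)" using p G_top by blast
        then show ?thesis using closure_of_subset m[OF that] by fastforce
      qed
      then have "p (path \<sigma> m) \<in> G \<inter> \<Inter>\<F>" using p N by auto
      then show ?thesis by blast
    qed
    moreover have "\<forall>C\<in>\<U>. closedin (wot UNIV) C" by (auto simp: \<U>_def)
    ultimately have "G \<inter> \<Inter>\<U> \<noteq> {}" using comp unfolding compactin_fip by blast
    then show ?thesis by (auto simp: \<U>_def)
  qed
  then obtain c where cG: "\<And>\<sigma>. c \<sigma> \<in> G" and c: "\<And>\<sigma> n. c \<sigma> \<in> wot UNIV closure_of (p ` path \<sigma> ` {n..})"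
    by metis
  have limit: "h (c \<sigma> \<xi>) \<in> C"
    if h: "h \<in> dual UNIV" and C: "closed C" and m: "\<And>m. m \<ge> n \<Longrightarrow> h (p (path \<sigma> m) \<xi>) \<in> C" for h C \<sigma> n
  proof -
    have "closedin (wot UNIV) {T \<in> topspace (wot UNIV). h (T \<xi>) \<in> C}"
      using C by (intro closedin_continuous_map_preimage[OF continuous_map_wot_eval[OF h]]) auto
    moreover have "p ` path \<sigma> ` {n..} \<subseteq> {T \<in> topspace (wot UNIV). h (T \<xi>) \<in> C}"
      using m p G_top by auto
    ultimately show ?thesis using closure_of_minimal c[of \<sigma> n] by blast
  qed
  \<comment> \<open>A weak limit of points of a closed subspace stays in it: otherwise a functional
    vanishing on the subspace would take the value 1 at the limit. All the limits thus lie in one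
    norm-separable space.\<close>
  have c_span: "c \<sigma> \<xi> \<in> closure (cspace.span B)" for \<sigma>
  proof (rule ccontr)
    assume "c \<sigma> \<xi> \<notin> closure (cspace.span B)"
    then obtain h where h: "h \<in> dual UNIV" "\<And>y. y \<in> closure (cspace.span B) \<Longrightarrow> h y = 0" "h (c \<sigma> \<xi>) = 1"
      using separate_closed_subspace[OF cspace_subspace_closure[OF cspace.subspace_span] closed_closure]
      by metis
    have "p s \<xi> \<in> closure (cspace.span B)" for s
    proof -
      have "p s \<xi> \<in> cspace.span B" by (rule cspace.span_base) (simp add: B_def)
      then show ?thesis using closure_subset by blast
    qed
    then have "h (c \<sigma> \<xi>) \<in> {0}" using h(2) by (intro limit[OF h(1), of _ 0]) auto
    then show False using h(3) by simp
  qed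
  have sep: "norm (c \<sigma> \<xi> - c \<tau> \<xi>) \<ge> \<epsilon>" if \<sigma>\<tau>: "\<sigma> \<noteq> \<tau>" for \<sigma> \<tau>
  proof -
    \<comment> \<open>At the first bit where the branches differ they pass through the two halves of
      one node, whose functional still sees the gap \<epsilon> in the limits.\<close>
    define n where "n = (LEAST n. \<sigma> n \<noteq> \<tau> n)"
    have "\<exists>n. \<sigma> n \<noteq> \<tau> n" using \<sigma>\<tau> by (simp add: fun_eq_iff)
    then have n: "\<sigma> n \<noteq> \<tau> n" unfolding n_def by (rule LeastI_ex)
    have "\<sigma> m = \<tau> m" if "m < n" for m using not_less_Least[OF that[unfolded n_def]] by simp
    then have eq: "path \<sigma> n = path \<tau> n" by (simp add: path_def)
    define W where "W = node (path \<sigma> n)"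
    have s: "split W (U W) (f W) (a W)" unfolding W_def by (rule spl[OF good])
    have fd: "f W \<in> dual UNIV" and fn: "\<And>y. \<bar>Re (f W y)\<bar> \<le> norm y"
      and s_hi: "\<And>g. g \<in> U W True \<Longrightarrow> a W + \<epsilon> \<le> Re (f W (g \<xi>))"
      and s_lo: "\<And>g. g \<in> U W False \<Longrightarrow> Re (f W (g \<xi>)) \<le> a W"
      using s by (simp_all add: split_def)
    have in_U: "p (path \<rho> m) \<in> U W (\<rho> n)" if m: "m \<ge> Suc n" and \<rho>: "path \<rho> n = path \<sigma> n" for \<rho> m
    proof -
      have "p (path \<rho> m) \<in> node (path \<rho> (Suc n))" using p[of "path \<rho> m"] node_path[OF m, of \<rho>] by blast
      then show ?thesis by (simp add: path_Suc node_Cons W_def \<rho>)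
    qed
    have hi: "Re (f W (c \<rho> \<xi>)) \<ge> a W + \<epsilon>" if \<rho>: "\<rho> n" "path \<rho> n = path \<sigma> n" for \<rho>
    proof -
      have "f W (c \<rho> \<xi>) \<in> {z. Re z \<ge> a W + \<epsilon>}"
      proof (rule limit[OF fd closed_halfspace_Re_ge])
        show "f W (p (path \<rho> m) \<xi>) \<in> {z. Re z \<ge> a W + \<epsilon>}" if "m \<ge> Suc n" for m
          using s_hi in_U[OF that \<rho>(2)] \<rho>(1) by simp
      qed
      then show ?thesis by simp
    qed
    have lo: "Re (f W (c \<rho> \<xi>)) \<le> a W" if \<rho>: "\<not> \<rho> n" "path \<rho> n = path \<sigma> n" for \<rho>
    proof -
      have "f W (c \<rho> \<xi>) \<in> {z. Re z \<le> a W}"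
      proof (rule limit[OF fd closed_halfspace_Re_le])
        show "f W (p (path \<rho> m) \<xi>) \<in> {z. Re z \<le> a W}" if "m \<ge> Suc n" for m
          using s_lo in_U[OF that \<rho>(2)] \<rho>(1) by simp
      qed
      then show ?thesis by simp
    qed
    have diff: "f W (c \<sigma> \<xi> - c \<tau> \<xi>) = f W (c \<sigma> \<xi>) - f W (c \<tau> \<xi>)"
      by (rule dual_diff[OF fd]) auto
    show ?thesis
    proof (cases "\<sigma> n")
      case True
      then have "\<epsilon> \<le> Re (f W (c \<sigma> \<xi> - c \<tau> \<xi>))" using hi[of \<sigma>] lo[of \<tau>] n eq diff by simp
      then show ?thesis using fn[of "c \<sigma> \<xi> - c \<tau> \<xi>"] by linarith
    next
      case False
      then have "\<epsilon> \<le> - Re (f W (c \<sigma> \<xi> - c \<tau> \<xi>))" using hi[of \<tau>] lo[of \<sigma>] n eq diff by simp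
      then show ?thesis using fn[of "c \<sigma> \<xi> - c \<tau> \<xi>"] by linarith
    qed
  qed
  have "closure (cspace.span B) \<subseteq> closure D" using D(2) closure_minimal by blast
  then have "\<exists>d\<in>D. dist d (c \<sigma> \<xi>) < \<epsilon> / 2" for \<sigma>
    using c_span[of \<sigma>] \<epsilon> by (meson closure_approachable half_gt_zero subsetD)
  \<comment> \<open>Points of a countable set within \<open>\<epsilon> / 2\<close> of limits that
    are \<epsilon> apart are distinct, so the uncountably many branches would inject into that
    set.\<close>
  then obtain d where d: "\<And>\<sigma>. d \<sigma> \<in> D" "\<And>\<sigma>. dist (d \<sigma>) (c \<sigma> \<xi>) < \<epsilon> / 2" by metis
  have "inj d"
  proof (rule injI, rule ccontr)
    fix \<sigma> \<tau> assume eq: "d \<sigma> = d \<tau>" and "\<sigma> \<noteq> \<tau>"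
    have "dist (c \<sigma> \<xi>) (c \<tau> \<xi>) < \<epsilon>"
      using dist_triangle_half_r[OF d(2)[of \<sigma>]] d(2)[of \<tau>] eq by simp
    then show False using sep[OF \<open>\<sigma> \<noteq> \<tau>\<close>] by (simp add: dist_norm)
  qed
  moreover have "countable (range d)" using D(1) d(1) by (meson countable_subset image_subsetI)
  ultimately show False using uncountable_nat_bool countable_image_inj_on by blast
qed

context compact_operator_group
begin

lemma G_linear: "g \<in> G \<Longrightarrow> bounded_linear g"
  using G_ops ops_bounded_linear by blast

lemma G_bounded:
  obtains C where "C > 0" "\<And>g x. g \<in> G \<Longrightarrow> norm (g x) \<le> C * norm x"
  using compactin_wot_bounded[OF G_compact] by blast

text \<open>Left translation spreads one small piece \<open>W\<close> over the group, and
  compactness makes the cover finite. Undoing a translation costs a factor \<open>C\<close>, so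
  \<open>W\<close> is taken of diameter \<open>\<epsilon> / C\<close>.\<close>

lemma G_finite_cover:
  assumes \<epsilon>: "\<epsilon> > 0"
  shows "\<exists>\<P>. finite \<P> \<and> G \<subseteq> \<Union>\<P> \<and> (\<forall>P\<in>\<P>. \<forall>g\<in>P \<inter> G. \<forall>h\<in>P \<inter> G. norm (g \<xi> - h \<xi>) \<le> \<epsilon>)"
proof -
  obtain C where C: "C > 0" "\<And>g x. g \<in> G \<Longrightarrow> norm (g x) \<le> C * norm x" using G_bounded by blast
  have "\<epsilon> / C > 0" using \<epsilon> C by simp
  then obtain W where W: "openin (wot UNIV) W" "W \<inter> G \<noteq> {}"
      "\<And>g h. g \<in> W \<inter> G \<Longrightarrow> h \<in> W \<inter> G \<Longrightarrow> norm (g \<xi> - h \<xi>) \<le> \<epsilon> / C"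
    using compactin_wot_small_piece[OF G_compact] e_G by (metis empty_iff)
  obtain w where w: "w \<in> W" "w \<in> G" using W(2) by blast
  define V where "V = (\<lambda>a. {T \<in> topspace (wot UNIV). a \<circ> T \<in> W})"
  have "openin (wot UNIV) (V a)" if "a \<in> G" for a
    unfolding V_def using that G_ops
    by (intro openin_continuous_map_preimage[OF continuous_map_wot_left W(1)]) blast
  moreover have "G \<subseteq> (\<Union>a\<in>G. V a)"
  proof
    fix x assume x: "x \<in> G"
    obtain x' where x': "x' \<in> G" "x' \<circ> x = e" using G_left_inverse[OF x] by blast
    have "(w \<circ> x') \<circ> x = w" using x'(2) e_right[OF w(2)] by (simp add: o_assoc[symmetric])
    then have "x \<in> V (w \<circ> x')" using w x G_ops by (auto simp: V_def topspace_wot_UNIV)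
    then show "x \<in> (\<Union>a\<in>G. V a)" using G_mult[OF w(2) x'(1)] by blast
  qed
  ultimately obtain \<P> where \<P>: "finite \<P>" "\<P> \<subseteq> V ` G" "G \<subseteq> \<Union>\<P>"
    using compactinD[OF G_compact, of "V ` G"] by blast
  have "norm (g \<xi> - h \<xi>) \<le> \<epsilon>" if P: "P \<in> \<P>" and g: "g \<in> P \<inter> G" and h: "h \<in> P \<inter> G" for P g h
  proof -
    obtain a where a: "a \<in> G" "P = V a" using P \<P>(2) by blast
    obtain b where b: "b \<in> G" "b \<circ> a = e" using G_left_inverse[OF a(1)] by blast
    have ab: "b (a (k \<xi>)) = k \<xi>" if "k \<in> G" for k
      using b(2) e_left[OF that] by (metis comp_apply)
    have "norm (g \<xi> - h \<xi>) = norm (b (a (g \<xi>) - a (h \<xi>)))"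
      using g h ab linear_diff[OF bounded_linear.linear[OF G_linear[OF b(1)]]] by simp
    also have "\<dots> \<le> C * norm ((a \<circ> g) \<xi> - (a \<circ> h) \<xi>)" using C(2)[OF b(1)] by simp
    also have "\<dots> \<le> C * (\<epsilon> / C)"
      using g h a G_mult C(1) by (intro mult_left_mono W(3)) (auto simp: V_def simp del: o_apply)
    finally show ?thesis using C(1) by simp
  qed
  then show ?thesis using \<P>(1,3) by (intro exI[of _ \<P>]) simp
qed

end

section \<open>Invariant means on precompact groups\<close>

text \<open>Induction in two cases. A proper tight subset is matched within its neighbours and the
  rest within the remaining points, where Hall's condition still holds by subtraction. Without a
  tight subset the condition has slack 1, so any admissible pair can be removed.\<close>

theorem hall_marriage:
  fixes N :: "'a \<Rightarrow> 'b set"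
  assumes "finite A" "\<And>a. a \<in> A \<Longrightarrow> finite (N a)"
    and "\<And>X. X \<subseteq> A \<Longrightarrow> card X \<le> card (\<Union>(N ` X))"
  shows "\<exists>\<pi>. inj_on \<pi> A \<and> (\<forall>a\<in>A. \<pi> a \<in> N a)"
  using assms
proof (induction A arbitrary: N rule: finite_psubset_induct)
  case (psubset A)
  note fin = psubset.prems(1) and hall = psubset.prems(2)
  have finU: "finite (\<Union>(N ` X))" if "X \<subseteq> A" for X
    using that psubset.hyps(1) fin by (meson finite_UN_I finite_subset subsetD)
  show ?case
  proof (cases "A = {}")
    case True
    then show ?thesis by simp
  next
    case False
    show ?thesis
    proof (cases "\<exists>X. X \<noteq> {} \<and> X \<subset> A \<and> card X = card (\<Union>(N ` X))")
      case True
      then obtain X where X: "X \<noteq> {}" "X \<subset> A" "card X = card (\<Union>(N ` X))" by blast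
      have finX: "finite X" using X(2) psubset.hyps(1) finite_subset by blast
      have "\<exists>\<pi>. inj_on \<pi> X \<and> (\<forall>a\<in>X. \<pi> a \<in> N a)"
      proof (rule psubset.IH[OF X(2)])
        show "finite (N a)" if "a \<in> X" for a using that X(2) fin by blast
        show "card Y \<le> card (\<Union>(N ` Y))" if "Y \<subseteq> X" for Y using that X(2) hall by blast
      qed
      then obtain \<pi> where \<pi>: "inj_on \<pi> X" "\<forall>a\<in>X. \<pi> a \<in> N a" by blast
      define N' where "N' = (\<lambda>a. N a - \<Union>(N ` X))"
      have "\<exists>\<rho>. inj_on \<rho> (A - X) \<and> (\<forall>a\<in>A - X. \<rho> a \<in> N' a)"
      proof (rule psubset.IH)
        show "A - X \<subset> A" using X by blast
        show "finite (N' a)" if "a \<in> A - X" for a using that fin by (simp add: N'_def)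
        show "card Y \<le> card (\<Union>(N' ` Y))" if Y: "Y \<subseteq> A - X" for Y
        proof -
          have sub: "Y \<union> X \<subseteq> A" using X Y by blast
          have "finite Y" using Y psubset.hyps(1) by (meson finite_Diff finite_subset)
          then have "card Y + card X = card (Y \<union> X)" using Y finX by (intro card_Un_disjoint[symmetric]) auto
          also have "\<dots> \<le> card (\<Union>(N ` (Y \<union> X)))" by (rule hall[OF sub])
          also have "\<Union>(N ` (Y \<union> X)) = \<Union>(N' ` Y) \<union> \<Union>(N ` X)" by (auto simp: N'_def)
          also have "card \<dots> \<le> card (\<Union>(N' ` Y)) + card (\<Union>(N ` X))" by (rule card_Un_le)
          finally show ?thesis using X(3) by simp
        qed
      qed
      then obtain \<rho> where \<rho>: "inj_on \<rho> (A - X)" "\<forall>a\<in>A - X. \<rho> a \<in> N' a" by blast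
      define \<tau> where "\<tau> = (\<lambda>a. if a \<in> X then \<pi> a else \<rho> a)"
      have "inj_on \<tau> A"
      proof (rule inj_onI)
        fix x y assume xy: "x \<in> A" "y \<in> A" "\<tau> x = \<tau> y"
        have "\<rho> a \<noteq> \<pi> b" if "a \<in> A - X" "b \<in> X" for a b
        proof -
          have "\<rho> a \<notin> \<Union>(N ` X)" using bspec[OF \<rho>(2) that(1)] by (simp add: N'_def)
          moreover have "\<pi> b \<in> \<Union>(N ` X)" using bspec[OF \<pi>(2) that(2)] that(2) by (rule UN_I[rotated])
          ultimately show ?thesis by metis
        qed
        then show "x = y" using xy inj_onD[OF \<pi>(1)] inj_onD[OF \<rho>(1)]
          by (cases "x \<in> X"; cases "y \<in> X") (auto simp: \<tau>_def, metis)
      qed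
      moreover have "\<forall>a\<in>A. \<tau> a \<in> N a" using \<pi>(2) \<rho>(2) by (auto simp: \<tau>_def N'_def)
      ultimately show ?thesis by blast
    next
      case strict: False
      obtain a where a: "a \<in> A" using False by blast
      have "card {a} \<le> card (\<Union>(N ` {a}))" using a by (intro hall) auto
      then have "N a \<noteq> {}" by auto
      then obtain b where b: "b \<in> N a" by blast
      define N' where "N' = (\<lambda>x. N x - {b})"
      have "\<exists>\<rho>. inj_on \<rho> (A - {a}) \<and> (\<forall>x\<in>A - {a}. \<rho> x \<in> N' x)"
      proof (rule psubset.IH)
        show "A - {a} \<subset> A" using a by blast
        show "finite (N' x)" if "x \<in> A - {a}" for x using that fin by (simp add: N'_def)
        show "card Y \<le> card (\<Union>(N' ` Y))" if Y: "Y \<subseteq> A - {a}" for Y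
        proof (cases "Y = {}")
          case True
          then show ?thesis by simp
        next
          case False
          have "Y \<subset> A" using Y a by blast
          then have "card Y \<noteq> card (\<Union>(N ` Y))" "card Y \<le> card (\<Union>(N ` Y))"
            using strict False hall by auto
          moreover have "\<Union>(N' ` Y) = \<Union>(N ` Y) - {b}" by (auto simp: N'_def)
          moreover have "finite (\<Union>(N ` Y))" using \<open>Y \<subset> A\<close> by (intro finU) blast
          then have "card (\<Union>(N ` Y)) - 1 \<le> card (\<Union>(N ` Y) - {b})" by (simp add: card_Diff_singleton_if)
          ultimately show ?thesis by simp
        qed
      qed
      then obtain \<rho> where \<rho>: "inj_on \<rho> (A - {a})" "\<forall>x\<in>A - {a}. \<rho> x \<in> N' x" by blast
      have "inj_on (\<rho>(a := b)) A"
      proof (rule inj_onI)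
        fix x y assume xy: "x \<in> A" "y \<in> A" "(\<rho>(a := b)) x = (\<rho>(a := b)) y"
        have "\<rho> z \<noteq> b" if "z \<in> A - {a}" for z using that \<rho>(2) by (force simp: N'_def)
        then show "x = y" using xy \<rho>(1) by (auto simp: inj_on_def split: if_splits)
      qed
      moreover have "\<forall>x\<in>A. (\<rho>(a := b)) x \<in> N x" using \<rho>(2) b by (auto simp: N'_def)
      ultimately show ?thesis by blast
    qed
  qed
qed

definition average :: "('g \<Rightarrow> 'b::real_vector) \<Rightarrow> 'g set \<Rightarrow> 'b" where
  "average f A = (1 / real (card A)) *\<^sub>R sum f A"

lemma average_diff_le:
  fixes f g :: "'g \<Rightarrow> 'b::real_normed_vector"
  assumes A: "finite A" "A \<noteq> {}" and le: "\<And>a. a \<in> A \<Longrightarrow> norm (f a - g a) \<le> c"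
  shows "norm (average f A - average g A) \<le> c"
proof -
  have "norm (average f A - average g A) = norm (\<Sum>a\<in>A. f a - g a) / real (card A)"
    by (simp add: average_def sum_subtractf scaleR_diff_right[symmetric])
  also have "\<dots> \<le> (real (card A) * c) / real (card A)"
    using A sum_norm_bound[of A "\<lambda>a. f a - g a" c, OF le] by (intro divide_right_mono) auto
  finally show ?thesis using A by simp
qed

lemma average_const: "finite A \<Longrightarrow> A \<noteq> {} \<Longrightarrow> average (\<lambda>_. c) A = c"
  by (simp add: average_def sum_constant_scaleR)

lemma average_add: "average (\<lambda>x. f x + g x) A = average f A + average g A"
  by (simp add: average_def sum.distrib scaleR_add_right)

lemma average_linear: "linear T \<Longrightarrow> average (\<lambda>x. T (f x)) A = T (average f A)"
  by (simp add: average_def linear_scale linear_sum)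

lemma average_mono:
  fixes f g :: "'g \<Rightarrow> real"
  shows "(\<And>a. a \<in> A \<Longrightarrow> f a \<le> g a) \<Longrightarrow> average f A \<le> average g A"
  by (simp add: average_def divide_right_mono sum_mono)

lemma average_norm: "norm (average f A) \<le> average (\<lambda>x. norm (f x)) A"
  by (simp add: average_def norm_sum divide_right_mono)

lemma average_swap: "average (\<lambda>x. average (\<lambda>y. F x y) B) A = average (\<lambda>y. average (\<lambda>x. F x y) A) B"
  unfolding average_def scaleR_sum_right
  by (subst sum.swap) (simp add: mult.commute scaleR_sum_right)

lemma average_cong: "(\<And>x. x \<in> A \<Longrightarrow> f x = g x) \<Longrightarrow> average f A = average g A"
  by (simp add: average_def cong: sum.cong)

text \<open>\<open>d\<close> is a pseudometric: elements that act alike on the vectors under study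
  may have distance zero. Keeping the group itself avoids quotients, and all analysis goes through
  functions uniformly continuous for \<open>d\<close>.\<close>

locale precompact_group =
  fixes G :: "'g set" and mul :: "'g \<Rightarrow> 'g \<Rightarrow> 'g" (infixl \<open>\<cdot>\<close> 70) and one :: 'g
    and d :: "'g \<Rightarrow> 'g \<Rightarrow> real"
  assumes mul_closed: "x \<in> G \<Longrightarrow> y \<in> G \<Longrightarrow> x \<cdot> y \<in> G"
    and mul_assoc: "x \<in> G \<Longrightarrow> y \<in> G \<Longrightarrow> z \<in> G \<Longrightarrow> (x \<cdot> y) \<cdot> z = x \<cdot> (y \<cdot> z)"
    and one_closed: "one \<in> G"
    and one_left: "x \<in> G \<Longrightarrow> one \<cdot> x = x"
    and one_right: "x \<in> G \<Longrightarrow> x \<cdot> one = x"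
    and left_inverse: "x \<in> G \<Longrightarrow> \<exists>y\<in>G. y \<cdot> x = one"
    and d_refl: "x \<in> G \<Longrightarrow> d x x = 0"
    and d_sym: "x \<in> G \<Longrightarrow> y \<in> G \<Longrightarrow> d x y = d y x"
    and d_triangle: "x \<in> G \<Longrightarrow> y \<in> G \<Longrightarrow> z \<in> G \<Longrightarrow> d x z \<le> d x y + d y z"
    and d_left: "s \<in> G \<Longrightarrow> x \<in> G \<Longrightarrow> y \<in> G \<Longrightarrow> d (s \<cdot> x) (s \<cdot> y) = d x y"
    and d_right: "s \<in> G \<Longrightarrow> x \<in> G \<Longrightarrow> y \<in> G \<Longrightarrow> d (x \<cdot> s) (y \<cdot> s) = d x y"
    and d_precompact: "\<epsilon> > 0 \<Longrightarrow> \<exists>A. finite A \<and> A \<subseteq> G \<and> (\<forall>g\<in>G. \<exists>a\<in>A. d g a < \<epsilon>)"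
begin

lemma inverse:
  assumes "x \<in> G"
  obtains y where "y \<in> G" "y \<cdot> x = one" "x \<cdot> y = one"
proof -
  obtain y where y: "y \<in> G" "y \<cdot> x = one" using left_inverse[OF assms] by blast
  obtain z where z: "z \<in> G" "z \<cdot> y = one" using left_inverse[OF y(1)] by blast
  have "x \<cdot> y = (z \<cdot> y) \<cdot> (x \<cdot> y)" using z y assms by (simp add: one_left mul_closed)
  also have "\<dots> = z \<cdot> ((y \<cdot> x) \<cdot> y)" using z(1) y(1) assms by (simp add: mul_assoc mul_closed)
  also have "\<dots> = one" using z y by (simp add: one_left)
  finally show ?thesis using that y by blast
qed

lemma left_surj:
  assumes "s \<in> G" "g \<in> G"
  obtains h where "h \<in> G" "g = s \<cdot> h"
proof -
  obtain y where y: "y \<in> G" "y \<cdot> s = one" "s \<cdot> y = one" using inverse[OF assms(1)] .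
  have "g = s \<cdot> (y \<cdot> g)" using y assms by (metis mul_assoc one_left)
  then show ?thesis using that y assms mul_closed by blast
qed

lemma right_surj:
  assumes "s \<in> G" "g \<in> G"
  obtains h where "h \<in> G" "g = h \<cdot> s"
proof -
  obtain y where y: "y \<in> G" "y \<cdot> s = one" "s \<cdot> y = one" using inverse[OF assms(1)] .
  have "g = (g \<cdot> y) \<cdot> s" using y assms by (metis mul_assoc one_right)
  then show ?thesis using that y assms mul_closed by blast
qed

lemma left_inj:
  assumes s: "s \<in> G"
  shows "inj_on (\<lambda>x. s \<cdot> x) G"
proof (rule inj_onI)
  fix x y assume xy: "x \<in> G" "y \<in> G" "s \<cdot> x = s \<cdot> y"
  obtain t where t: "t \<in> G" "t \<cdot> s = one" using inverse[OF s] by metis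
  have "t \<cdot> (s \<cdot> z) = z" if "z \<in> G" for z using mul_assoc[OF t(1) s that] t(2) one_left[OF that] by simp
  then show "x = y" using xy by metis
qed

lemma right_inj:
  assumes s: "s \<in> G"
  shows "inj_on (\<lambda>x. x \<cdot> s) G"
proof (rule inj_onI)
  fix x y assume xy: "x \<in> G" "y \<in> G" "x \<cdot> s = y \<cdot> s"
  obtain t where t: "t \<in> G" "s \<cdot> t = one" using inverse[OF s] by metis
  have "(z \<cdot> s) \<cdot> t = z" if "z \<in> G" for z using mul_assoc[OF that s t(1)] t(2) one_right[OF that] by simp
  then show "x = y" using xy by metis
qed

lemma d_nonneg: "x \<in> G \<Longrightarrow> y \<in> G \<Longrightarrow> 0 \<le> d x y"
  using d_triangle[of x y x] d_sym[of x y] d_refl[of x] by simp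

section \<open>Minimal nets and their matchings\<close>

definition net :: "real \<Rightarrow> 'g set \<Rightarrow> bool" where
  "net \<epsilon> A \<longleftrightarrow> finite A \<and> A \<subseteq> G \<and> (\<forall>g\<in>G. \<exists>a\<in>A. d g a < \<epsilon>)"

definition min_net :: "real \<Rightarrow> 'g set \<Rightarrow> bool" where
  "min_net \<epsilon> A \<longleftrightarrow> net \<epsilon> A \<and> (\<forall>B. net \<epsilon> B \<longrightarrow> card A \<le> card B)"

lemma min_net_D:
  assumes "min_net \<epsilon> A"
  shows "finite A" "A \<subseteq> G" "A \<noteq> {}"
  using assms one_closed by (auto simp: min_net_def net_def)

lemma min_net_exists:
  assumes "\<epsilon> > 0"
  shows "\<exists>A. min_net \<epsilon> A"
proof -
  have "\<exists>A. net \<epsilon> A" using d_precompact[OF assms] by (simp add: net_def)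
  then show ?thesis
    using ex_has_least_nat[of "net \<epsilon>" _ card] by (auto simp: min_net_def)
qed

text \<open>Translations are bijective isometries, so they respect covering and cardinality.
  Invariance of the mean then amounts to comparing a minimal net with its translate.\<close>

lemma min_net_left:
  assumes s: "s \<in> G" and A: "min_net \<epsilon> A"
  shows "min_net \<epsilon> ((\<lambda>x. s \<cdot> x) ` A)"
proof -
  have "net \<epsilon> ((\<lambda>x. s \<cdot> x) ` A)"
    unfolding net_def
  proof (intro conjI ballI)
    show "finite ((\<lambda>x. s \<cdot> x) ` A)" "(\<lambda>x. s \<cdot> x) ` A \<subseteq> G"
      using min_net_D[OF A] s mul_closed by auto
    fix g assume "g \<in> G"
    then obtain h where h: "h \<in> G" "g = s \<cdot> h" using left_surj[OF s] by blast
    obtain a where a: "a \<in> A" "d h a < \<epsilon>" using A h(1) by (auto simp: min_net_def net_def)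
    then have "d g (s \<cdot> a) < \<epsilon>" using d_left[OF s h(1), of a] min_net_D(2)[OF A] h(2) by auto
    then show "\<exists>b\<in>(\<lambda>x. s \<cdot> x) ` A. d g b < \<epsilon>" using a(1) by blast
  qed
  moreover have "card ((\<lambda>x. s \<cdot> x) ` A) = card A"
    using left_inj[OF s] min_net_D(2)[OF A] by (intro card_image) (rule inj_on_subset)
  ultimately show ?thesis using A by (simp add: min_net_def)
qed

lemma min_net_right:
  assumes s: "s \<in> G" and A: "min_net \<epsilon> A"
  shows "min_net \<epsilon> ((\<lambda>x. x \<cdot> s) ` A)"
proof -
  have "net \<epsilon> ((\<lambda>x. x \<cdot> s) ` A)"
    unfolding net_def
  proof (intro conjI ballI)
    show "finite ((\<lambda>x. x \<cdot> s) ` A)" "(\<lambda>x. x \<cdot> s) ` A \<subseteq> G"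
      using min_net_D[OF A] s mul_closed by auto
    fix g assume "g \<in> G"
    then obtain h where h: "h \<in> G" "g = h \<cdot> s" using right_surj[OF s] by blast
    obtain a where a: "a \<in> A" "d h a < \<epsilon>" using A h(1) by (auto simp: min_net_def net_def)
    then have "d g (a \<cdot> s) < \<epsilon>" using d_right[OF s h(1), of a] min_net_D(2)[OF A] h(2) by auto
    then show "\<exists>b\<in>(\<lambda>x. x \<cdot> s) ` A. d g b < \<epsilon>" using a(1) by blast
  qed
  moreover have "card ((\<lambda>x. x \<cdot> s) ` A) = card A"
    using right_inj[OF s] min_net_D(2)[OF A] by (intro card_image) (rule inj_on_subset)
  ultimately show ?thesis using A by (simp add: min_net_def)
qed

text \<open>Two minimal nets satisfy Hall's condition: the points of \<open>A\<close> outside \<open>X\<close> together with the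
  neighbours of \<open>X\<close> in \<open>B\<close> form another net.\<close>

lemma min_net_matching:
  assumes A: "min_net \<epsilon> A" and B: "min_net \<epsilon> B"
  obtains \<pi> where "bij_betw \<pi> A B" "\<And>a. a \<in> A \<Longrightarrow> d a (\<pi> a) < 2 * \<epsilon>"
proof -
  have finA: "finite A" "A \<subseteq> G" and finB: "finite B" "B \<subseteq> G"
    using min_net_D[OF A] min_net_D[OF B] by auto
  define N where "N = (\<lambda>a. {b \<in> B. d a b < 2 * \<epsilon>})"
  have "\<exists>\<pi>. inj_on \<pi> A \<and> (\<forall>a\<in>A. \<pi> a \<in> N a)"
  proof (rule hall_marriage[OF finA(1)])
    show "finite (N a)" for a using finB by (simp add: N_def)
    fix X assume X: "X \<subseteq> A"
    have "net \<epsilon> ((A - X) \<union> \<Union>(N ` X))"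
      unfolding net_def
    proof (intro conjI ballI)
      have "\<Union>(N ` X) \<subseteq> B" by (auto simp: N_def)
      then show "finite ((A - X) \<union> \<Union>(N ` X))" "(A - X) \<union> \<Union>(N ` X) \<subseteq> G"
        using finA finB by (auto intro: finite_subset)
      fix g assume g: "g \<in> G"
      obtain a where a: "a \<in> A" "d g a < \<epsilon>" using A g by (auto simp: min_net_def net_def)
      obtain b where b: "b \<in> B" "d g b < \<epsilon>" using B g by (auto simp: min_net_def net_def)
      show "\<exists>a\<in>(A - X) \<union> \<Union>(N ` X). d g a < \<epsilon>"
      proof (cases "a \<in> X")
        case True
        have "d a b \<le> d a g + d g b" using a b g finA finB by (intro d_triangle) auto
        then have "d a b < 2 * \<epsilon>" using a b d_sym[of a g] g finA by auto
        then show ?thesis using True b by (auto simp: N_def)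
      next
        case False
        then show ?thesis using a by blast
      qed
    qed
    then have "card A \<le> card ((A - X) \<union> \<Union>(N ` X))" using A by (simp add: min_net_def)
    also have "\<dots> \<le> card (A - X) + card (\<Union>(N ` X))" by (rule card_Un_le)
    also have "card (A - X) = card A - card X" using X finA finite_subset by (intro card_Diff_subset) auto
    finally show "card X \<le> card (\<Union>(N ` X))" using card_mono[OF finA(1) X] by linarith
  qed
  then obtain \<pi> where \<pi>: "inj_on \<pi> A" "\<forall>a\<in>A. \<pi> a \<in> N a" by blast
  have "card A = card B" using A B by (simp add: min_net_def le_antisym)
  then have "card (\<pi> ` A) = card B" by (simp add: card_image \<pi>(1))
  moreover have "\<pi> ` A \<subseteq> B" using \<pi>(2) by (auto simp: N_def)
  ultimately have "\<pi> ` A = B" using finB(1) card_subset_eq by blast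
  then have "bij_betw \<pi> A B" using \<pi>(1) by (simp add: bij_betw_def)
  then show ?thesis using that \<pi>(2) by (auto simp: N_def)
qed

section \<open>Averages over minimal nets\<close>

definition modulus :: "('g \<Rightarrow> 'b::real_normed_vector) \<Rightarrow> real \<Rightarrow> real \<Rightarrow> bool" where
  "modulus f \<delta> w \<longleftrightarrow> (\<forall>x\<in>G. \<forall>y\<in>G. d x y < \<delta> \<longrightarrow> norm (f x - f y) \<le> w)"

definition uc :: "('g \<Rightarrow> 'b::real_normed_vector) \<Rightarrow> bool" where
  "uc f \<longleftrightarrow> (\<forall>w>0. \<exists>\<delta>>0. modulus f \<delta> w)"

lemma average_nets:
  assumes A: "min_net \<epsilon> A" and B: "min_net \<epsilon> B" and f: "modulus f (2 * \<epsilon>) w"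
  shows "norm (average f A - average f B) \<le> w"
proof -
  obtain \<pi> where \<pi>: "bij_betw \<pi> A B" "\<And>a. a \<in> A \<Longrightarrow> d a (\<pi> a) < 2 * \<epsilon>"
    using min_net_matching[OF A B] by blast
  have "average f B = average (\<lambda>a. f (\<pi> a)) A"
    unfolding average_def using sum.reindex_bij_betw[OF \<pi>(1), of f] bij_betw_same_card[OF \<pi>(1)] by simp
  moreover have "norm (average f A - average (\<lambda>a. f (\<pi> a)) A) \<le> w"
  proof (rule average_diff_le)
    show "norm (f a - f (\<pi> a)) \<le> w" if "a \<in> A" for a
      using f \<pi> that min_net_D(2)[OF A] min_net_D(2)[OF B] bij_betwE[OF \<pi>(1)]
      unfolding modulus_def by blast
  qed (use min_net_D[OF A] in auto)
  ultimately show ?thesis by simp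
qed

lemma average_left:
  assumes s: "s \<in> G" and A: "min_net \<epsilon> A" and f: "modulus f (2 * \<epsilon>) w"
  shows "norm (average (\<lambda>x. f (s \<cdot> x)) A - average f A) \<le> w"
proof -
  have "average f ((\<lambda>x. s \<cdot> x) ` A) = average (\<lambda>x. f (s \<cdot> x)) A"
    using left_inj[OF s] min_net_D(2)[OF A]
    by (simp add: average_def sum.reindex card_image inj_on_subset)
  then show ?thesis using average_nets[OF min_net_left[OF s A] A f] by simp
qed

lemma average_right:
  assumes s: "s \<in> G" and A: "min_net \<epsilon> A" and f: "modulus f (2 * \<epsilon>) w"
  shows "norm (average (\<lambda>x. f (x \<cdot> s)) A - average f A) \<le> w"
proof -
  have "average f ((\<lambda>x. x \<cdot> s) ` A) = average (\<lambda>x. f (x \<cdot> s)) A"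
    using right_inj[OF s] min_net_D(2)[OF A]
    by (simp add: average_def sum.reindex card_image inj_on_subset)
  then show ?thesis using average_nets[OF min_net_right[OF s A] A f] by simp
qed

text \<open>Nets of different mesh are compared through the double average of \<open>f (x \<cdot> y)\<close>.\<close>

lemma average_nets_different:
  assumes A: "min_net \<epsilon> A" and f: "modulus f (2 * \<epsilon>) w"
    and B: "min_net \<delta> B" and f': "modulus f (2 * \<delta>) w'"
  shows "norm (average f A - average f B) \<le> w + w'"
proof -
  note AD = min_net_D[OF A] and BD = min_net_D[OF B]
  define P where "P = average (\<lambda>x. average (\<lambda>y. f (x \<cdot> y)) B) A"
  have "norm (P - average (\<lambda>_. average f B) A) \<le> w'"
    unfolding P_def using AD by (intro average_diff_le average_left[OF _ B f']) auto
  moreover have "P = average (\<lambda>y. average (\<lambda>x. f (x \<cdot> y)) A) B" unfolding P_def by (rule average_swap)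
  then have "norm (P - average (\<lambda>_. average f A) B) \<le> w"
    using BD by (simp only:) (intro average_diff_le average_right[OF _ A f]; auto)
  ultimately have "norm (P - average f B) \<le> w'" "norm (P - average f A) \<le> w"
    using AD BD by (simp_all add: average_const)
  then show ?thesis using norm_triangle_ineq4[of "P - average f B" "P - average f A"] by simp
qed

section \<open>The mean as a limit of averages\<close>

definition Net :: "nat \<Rightarrow> 'g set" where
  "Net n = (SOME A. min_net (1 / real (Suc n)) A)"

lemma Net: "min_net (1 / real (Suc n)) (Net n)"
  unfolding Net_def using min_net_exists by (rule someI_ex) simp

lemmas Net_D = min_net_D[OF Net]

definition mean :: "('g \<Rightarrow> 'b::real_normed_vector) \<Rightarrow> 'b" where
  "mean f = lim (\<lambda>n. average f (Net n))"

lemma modulus_mono: "modulus f \<delta> w \<Longrightarrow> \<delta>' \<le> \<delta> \<Longrightarrow> modulus f \<delta>' w"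
  unfolding modulus_def by force

lemma uc_net_modulus:
  assumes "uc f" "w > 0"
  obtains n where "\<And>m. m \<ge> n \<Longrightarrow> modulus f (2 * (1 / real (Suc m))) w"
proof -
  obtain \<delta> where \<delta>: "\<delta> > 0" "modulus f \<delta> w" using assms by (auto simp: uc_def)
  obtain n where n: "2 / \<delta> < real n" using reals_Archimedean2 by blast
  have "2 * (1 / real (Suc m)) \<le> \<delta>" if "m \<ge> n" for m
  proof -
    have "2 / \<delta> \<le> real (Suc m)" using n that by linarith
    then show ?thesis using \<delta>(1) by (simp add: field_simps)
  qed
  then show ?thesis using that modulus_mono[OF \<delta>(2)] by blast
qed

lemma mean_LIMSEQ:
  fixes f :: "'g \<Rightarrow> 'b::banach"
  assumes f: "uc f"
  shows "(\<lambda>n. average f (Net n)) \<longlonglongrightarrow> mean f"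
proof -
  have "Cauchy (\<lambda>n. average f (Net n))"
  proof (rule metric_CauchyI)
    fix e :: real assume "e > 0"
    then have "e / 3 > 0" by simp
    then obtain n where n: "\<And>m. m \<ge> n \<Longrightarrow> modulus f (2 * (1 / real (Suc m))) (e / 3)"
      using uc_net_modulus[OF f] by blast
    have "dist (average f (Net k)) (average f (Net m)) < e" if "k \<ge> n" "m \<ge> n" for k m
      using average_nets_different[OF Net n[OF that(1)] Net n[OF that(2)]] \<open>e > 0\<close>
      by (simp add: dist_norm)
    then show "\<exists>M. \<forall>m\<ge>M. \<forall>n\<ge>M. dist (average f (Net m)) (average f (Net n)) < e" by blast
  qed
  then show ?thesis unfolding mean_def
    by (simp add: Cauchy_convergent_iff convergent_LIMSEQ_iff)
qed

lemma mean_error: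
  fixes f :: "'g \<Rightarrow> 'b::banach"
  assumes f: "uc f" and A: "min_net \<epsilon> A" and w: "modulus f (2 * \<epsilon>) w"
  shows "norm (average f A - mean f) \<le> w"
proof (rule field_le_epsilon)
  fix e :: real assume e: "e > 0"
  obtain n where n: "\<And>m. m \<ge> n \<Longrightarrow> modulus f (2 * (1 / real (Suc m))) e"
    using uc_net_modulus[OF f e] by blast
  have "(\<lambda>m. norm (average f A - average f (Net m))) \<longlonglongrightarrow> norm (average f A - mean f)"
    by (intro tendsto_intros mean_LIMSEQ f)
  moreover have "\<forall>m\<ge>n. norm (average f A - average f (Net m)) \<le> w + e"
    using average_nets_different[OF A w Net n] by blast
  ultimately show "norm (average f A - mean f) \<le> w + e" by (meson LIMSEQ_le_const2)
qed

section \<open>Closure properties of uniform continuity\<close>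

lemma uc_modulusI:
  assumes "\<And>w. w > 0 \<Longrightarrow> \<exists>\<delta>>0. \<forall>x\<in>G. \<forall>y\<in>G. d x y < \<delta> \<longrightarrow> norm (f x - f y) \<le> w"
  shows "uc f"
  using assms by (simp add: uc_def modulus_def)

lemma uc_lipschitz:
  assumes "\<And>x y. x \<in> G \<Longrightarrow> y \<in> G \<Longrightarrow> norm (f x - f y) \<le> L * d x y"
  shows "uc f"
proof (rule uc_modulusI)
  fix w :: real assume w: "w > 0"
  have "norm (f x - f y) \<le> w" if "x \<in> G" "y \<in> G" "d x y < w / (\<bar>L\<bar> + 1)" for x y
  proof -
    have "norm (f x - f y) \<le> (\<bar>L\<bar> + 1) * d x y"
      using assms[OF that(1,2)] mult_right_mono[OF _ d_nonneg[OF that(1,2)], of L "\<bar>L\<bar> + 1"] by linarith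
    also have "\<dots> \<le> (\<bar>L\<bar> + 1) * (w / (\<bar>L\<bar> + 1))" using that(3) by (intro mult_left_mono) auto
    finally show ?thesis by simp
  qed
  moreover have "w / (\<bar>L\<bar> + 1) > 0" using w by simp
  ultimately show "\<exists>\<delta>>0. \<forall>x\<in>G. \<forall>y\<in>G. d x y < \<delta> \<longrightarrow> norm (f x - f y) \<le> w" by blast
qed

lemma uc_const: "uc (\<lambda>_. c)"
  by (rule uc_lipschitz[where L = 0]) simp

lemma uc_bounded:
  assumes "uc f"
  obtains C where "C > 0" "\<And>x. x \<in> G \<Longrightarrow> norm (f x) \<le> C"
proof -
  obtain \<delta> where \<delta>: "\<delta> > 0" "modulus f \<delta> 1" using assms by (metis uc_def zero_less_one)
  obtain A where A: "finite A" "A \<subseteq> G" "\<And>g. g \<in> G \<Longrightarrow> \<exists>a\<in>A. d g a < \<delta>" using d_precompact[OF \<delta>(1)] by blast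
  have "norm (f x) \<le> (\<Sum>a\<in>A. norm (f a)) + 1" if x: "x \<in> G" for x
  proof -
    obtain a where a: "a \<in> A" "d x a < \<delta>" using A(3)[OF x] by blast
    have "norm (f x - f a) \<le> 1" using \<delta>(2) a x A(2) by (auto simp: modulus_def)
    moreover have "norm (f a) \<le> (\<Sum>a\<in>A. norm (f a))" using A(1) a by (intro member_le_sum) auto
    ultimately show ?thesis using norm_triangle_ineq2[of "f x" "f a"] by linarith
  qed
  moreover have "(\<Sum>a\<in>A. norm (f a)) + 1 > 0" by (simp add: sum_nonneg add_nonneg_pos)
  ultimately show ?thesis using that by blast
qed

lemma uc_add:
  assumes "uc f" "uc g"
  shows "uc (\<lambda>x. f x + g x)"
proof (rule uc_modulusI)
  fix w :: real assume "w > 0"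
  then have "w / 2 > 0" by simp
  then obtain \<delta> \<delta>' where "\<delta> > 0" "modulus f \<delta> (w / 2)" "\<delta>' > 0" "modulus g \<delta>' (w / 2)"
    using assms unfolding uc_def by meson
  then show "\<exists>\<delta>>0. \<forall>x\<in>G. \<forall>y\<in>G. d x y < \<delta> \<longrightarrow> norm (f x + g x - (f y + g y)) \<le> w"
    by (intro exI[of _ "min \<delta> \<delta>'"])
      (auto simp: modulus_def add_diff_add intro: norm_triangle_le[OF order_trans[OF add_mono[of _ "w/2" _ "w/2"]]])
qed

lemma uc_bilinear:
  assumes p: "bounded_bilinear p" and f: "uc f" and g: "uc g"
  shows "uc (\<lambda>x. p (f x) (g x))"
proof (rule uc_modulusI)
  fix w :: real assume w: "w > 0"
  obtain K where K: "K > 0" "\<And>a b. norm (p a b) \<le> norm a * norm b * K"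
    using bounded_bilinear.pos_bounded[OF p] by blast
  obtain C where C: "C > 0" "\<And>x. x \<in> G \<Longrightarrow> norm (f x) \<le> C" using uc_bounded[OF f] by blast
  obtain D where D: "D > 0" "\<And>x. x \<in> G \<Longrightarrow> norm (g x) \<le> D" using uc_bounded[OF g] by blast
  have "w / (2 * D * K) > 0" "w / (2 * C * K) > 0" using w K C D by simp_all
  then obtain \<delta> \<delta>' where \<delta>: "\<delta> > 0" "modulus f \<delta> (w / (2 * D * K))" "\<delta>' > 0" "modulus g \<delta>' (w / (2 * C * K))"
    using f g unfolding uc_def by meson
  have "norm (p (f x) (g x) - p (f y) (g y)) \<le> w" if xy: "x \<in> G" "y \<in> G" "d x y < min \<delta> \<delta>'" for x y
  proof -
    have fw: "norm (f x - f y) \<le> w / (2 * D * K)" and gw: "norm (g x - g y) \<le> w / (2 * C * K)"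
      using \<delta> xy by (auto simp: modulus_def)
    have "p (f x) (g x) - p (f y) (g y) = p (f x - f y) (g x) + p (f y) (g x - g y)"
      by (simp add: bounded_bilinear.diff_left[OF p] bounded_bilinear.diff_right[OF p])
    also have "norm \<dots> \<le> norm (f x - f y) * norm (g x) * K + norm (f y) * norm (g x - g y) * K"
      by (intro norm_triangle_le add_mono K(2))
    also have "\<dots> \<le> w / (2 * D * K) * D * K + C * (w / (2 * C * K)) * K"
      using fw gw C D K(1) xy w by (intro add_mono mult_right_mono mult_mono) auto
    also have "\<dots> = w" using C D K by simp
    finally show ?thesis .
  qed
  then show "\<exists>\<delta>>0. \<forall>x\<in>G. \<forall>y\<in>G. d x y < \<delta> \<longrightarrow> norm (p (f x) (g x) - p (f y) (g y)) \<le> w"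
    using \<delta> by (intro exI[of _ "min \<delta> \<delta>'"]) auto
qed

lemma uc_mult: "uc f \<Longrightarrow> uc g \<Longrightarrow> uc (\<lambda>x. f x * g x :: 'b::real_normed_algebra)"
  by (rule uc_bilinear[OF bounded_bilinear_mult])

lemma uc_scaleR: "uc f \<Longrightarrow> uc g \<Longrightarrow> uc (\<lambda>x. f x *\<^sub>R g x)"
  by (rule uc_bilinear[OF bounded_bilinear_scaleR])

lemma uc_linear:
  assumes T: "bounded_linear T" and f: "uc f"
  shows "uc (\<lambda>x. T (f x))"
proof -
  have "bounded_bilinear (\<lambda>r v. r *\<^sub>R T v)"
    by (rule bounded_bilinear.comp[OF bounded_bilinear_scaleR bounded_linear_ident T])
  from uc_bilinear[OF this uc_const[of 1] f] show ?thesis by simp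
qed

lemma uc_norm: "uc f \<Longrightarrow> uc (\<lambda>x. norm (f x))"
  unfolding uc_def modulus_def real_norm_def by (meson norm_triangle_ineq3 order_trans)

lemma uc_sum: "(\<And>i. i \<in> I \<Longrightarrow> uc (f i)) \<Longrightarrow> uc (\<lambda>x. \<Sum>i\<in>I. f i x)"
  by (induction I rule: infinite_finite_induct) (auto simp: uc_const uc_add)

lemma uc_minus: "uc f \<Longrightarrow> uc (\<lambda>x. - f x)"
  using uc_linear[OF bounded_linear_minus[OF bounded_linear_ident]] by blast

lemma uc_diff: "uc f \<Longrightarrow> uc g \<Longrightarrow> uc (\<lambda>x. f x - g x)"
  using uc_add[OF _ uc_minus] by fastforce

lemma uc_left: "uc f \<Longrightarrow> s \<in> G \<Longrightarrow> uc (\<lambda>x. f (s \<cdot> x))"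
  unfolding uc_def modulus_def by (metis d_left mul_closed)

lemma uc_right: "uc f \<Longrightarrow> s \<in> G \<Longrightarrow> uc (\<lambda>x. f (x \<cdot> s))"
  unfolding uc_def modulus_def by (metis d_right mul_closed)

lemma uc_cong: "(\<And>x. x \<in> G \<Longrightarrow> f x = g x) \<Longrightarrow> uc f \<longleftrightarrow> uc g"
  unfolding uc_def modulus_def by simp

section \<open>Linearity, positivity and invariance of the mean\<close>

lemma mean_cong:
  assumes "\<And>x. x \<in> G \<Longrightarrow> f x = g x"
  shows "mean f = mean g"
proof -
  have "average f (Net n) = average g (Net n)" for n
    using assms Net_D(2)[of n] by (intro average_cong) auto
  then show ?thesis by (simp add: mean_def)
qed

lemma mean_const: "mean (\<lambda>_. c :: 'b::real_normed_vector) = c"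
  by (simp add: mean_def average_const Net_D)

lemma mean_add:
  fixes f g :: "'g \<Rightarrow> 'b::banach"
  assumes "uc f" "uc g"
  shows "mean (\<lambda>x. f x + g x) = mean f + mean g"
proof -
  have "(\<lambda>n. average (\<lambda>x. f x + g x) (Net n)) \<longlonglongrightarrow> mean f + mean g"
    unfolding average_add by (intro tendsto_add mean_LIMSEQ assms)
  then show ?thesis using LIMSEQ_unique[OF mean_LIMSEQ[OF uc_add[OF assms]]] by blast
qed

lemma mean_linear:
  fixes f :: "'g \<Rightarrow> 'b::banach" and T :: "'b \<Rightarrow> 'c::banach"
  assumes T: "bounded_linear T" and f: "uc f"
  shows "mean (\<lambda>x. T (f x)) = T (mean f)"
proof -
  have "(\<lambda>n. average (\<lambda>x. T (f x)) (Net n)) \<longlonglongrightarrow> T (mean f)"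
    unfolding average_linear[OF bounded_linear.linear[OF T]]
    by (rule bounded_linear.tendsto[OF T mean_LIMSEQ[OF f]])
  then show ?thesis using LIMSEQ_unique[OF mean_LIMSEQ[OF uc_linear[OF T f]]] by blast
qed

lemma mean_minus: "uc f \<Longrightarrow> mean (\<lambda>x. - f x :: 'b::banach) = - mean f"
  using mean_linear[OF bounded_linear_minus[OF bounded_linear_ident]] by blast

lemma mean_diff: "uc f \<Longrightarrow> uc g \<Longrightarrow> mean (\<lambda>x. f x - g x :: 'b::banach) = mean f - mean g"
  using mean_add[OF _ uc_minus] mean_minus by fastforce

lemma mean_mult: "uc f \<Longrightarrow> mean (\<lambda>x. c * f x :: 'b::{real_normed_algebra,banach}) = c * mean f"
  using mean_linear[OF bounded_linear_mult_right] by blast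

lemma mean_sum:
  fixes f :: "'i \<Rightarrow> 'g \<Rightarrow> 'b::banach"
  assumes "\<And>i. i \<in> I \<Longrightarrow> uc (f i)"
  shows "mean (\<lambda>x. \<Sum>i\<in>I. f i x) = (\<Sum>i\<in>I. mean (f i))"
  using assms
  by (induction I rule: infinite_finite_induct) (simp_all add: mean_const mean_add uc_sum)

lemma mean_mono:
  fixes f g :: "'g \<Rightarrow> real"
  assumes "uc f" "uc g" "\<And>x. x \<in> G \<Longrightarrow> f x \<le> g x"
  shows "mean f \<le> mean g"
proof (rule LIMSEQ_le[OF mean_LIMSEQ[OF assms(1)] mean_LIMSEQ[OF assms(2)]])
  have "average f (Net n) \<le> average g (Net n)" for n
    using assms(3) Net_D(2)[of n] by (intro average_mono) auto
  then show "\<exists>N. \<forall>n\<ge>N. average f (Net n) \<le> average g (Net n)" by blast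
qed

lemma mean_nonneg: "uc f \<Longrightarrow> (\<And>x. x \<in> G \<Longrightarrow> 0 \<le> f x) \<Longrightarrow> 0 \<le> (mean f :: real)"
  using mean_mono[OF uc_const, of f 0] by (simp add: mean_const)

lemma mean_norm:
  fixes f :: "'g \<Rightarrow> 'b::banach"
  assumes f: "uc f"
  shows "norm (mean f) \<le> mean (\<lambda>x. norm (f x))"
  by (rule LIMSEQ_le[OF tendsto_norm[OF mean_LIMSEQ[OF f]] mean_LIMSEQ[OF uc_norm[OF f]]])
    (auto simp: average_norm)

lemma mean_norm_le:
  fixes f :: "'g \<Rightarrow> 'b::banach"
  assumes f: "uc f" and le: "\<And>x. x \<in> G \<Longrightarrow> norm (f x) \<le> c"
  shows "norm (mean f) \<le> c"
  using mean_norm[OF f] mean_mono[OF uc_norm[OF f] uc_const le] by (simp add: mean_const)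

lemma mean_left:
  fixes f :: "'g \<Rightarrow> 'b::banach"
  assumes f: "uc f" and s: "s \<in> G"
  shows "mean (\<lambda>x. f (s \<cdot> x)) = mean f"
proof -
  have "norm (mean (\<lambda>x. f (s \<cdot> x)) - mean f) \<le> w" if "w > 0" for w
  proof -
    obtain n where n: "\<And>m. m \<ge> n \<Longrightarrow> modulus f (2 * (1 / real (Suc m))) w"
      using uc_net_modulus[OF f \<open>w > 0\<close>] by blast
    have "(\<lambda>m. norm (average (\<lambda>x. f (s \<cdot> x)) (Net m) - average f (Net m)))
        \<longlonglongrightarrow> norm (mean (\<lambda>x. f (s \<cdot> x)) - mean f)"
      by (intro tendsto_intros mean_LIMSEQ f uc_left s)
    moreover have "\<forall>m\<ge>n. norm (average (\<lambda>x. f (s \<cdot> x)) (Net m) - average f (Net m)) \<le> w"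
      using average_left[OF s Net n] by blast
    ultimately show ?thesis by (meson LIMSEQ_le_const2)
  qed
  then show ?thesis by (metis dense_ge norm_le_zero_iff right_minus_eq)
qed

lemma mean_right:
  fixes f :: "'g \<Rightarrow> 'b::banach"
  assumes f: "uc f" and s: "s \<in> G"
  shows "mean (\<lambda>x. f (x \<cdot> s)) = mean f"
proof -
  have "norm (mean (\<lambda>x. f (x \<cdot> s)) - mean f) \<le> w" if "w > 0" for w
  proof -
    obtain n where n: "\<And>m. m \<ge> n \<Longrightarrow> modulus f (2 * (1 / real (Suc m))) w"
      using uc_net_modulus[OF f \<open>w > 0\<close>] by blast
    have "(\<lambda>m. norm (average (\<lambda>x. f (x \<cdot> s)) (Net m) - average f (Net m)))
        \<longlonglongrightarrow> norm (mean (\<lambda>x. f (x \<cdot> s)) - mean f)"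
      by (intro tendsto_intros mean_LIMSEQ f uc_right s)
    moreover have "\<forall>m\<ge>n. norm (average (\<lambda>x. f (x \<cdot> s)) (Net m) - average f (Net m)) \<le> w"
      using average_right[OF s Net n] by blast
    ultimately show ?thesis by (meson LIMSEQ_le_const2)
  qed
  then show ?thesis by (metis dense_ge norm_le_zero_iff right_minus_eq)
qed

text \<open>Near \<open>g\<close> the function exceeds half of \<open>f g\<close>, and finitely many
  right translates carry this to all of \<open>G\<close>. Their sum is at least
  \<open>f g / 2\<close>, while its mean is the number of translates times the mean of
  \<open>f\<close>. This makes the inner product below definite.\<close>

lemma mean_pos:
  fixes f :: "'g \<Rightarrow> real"
  assumes f: "uc f" and nonneg: "\<And>x. x \<in> G \<Longrightarrow> 0 \<le> f x" and g: "g \<in> G" "f g > 0"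
  shows "mean f > 0"
proof -
  have "f g / 2 > 0" using g by simp
  then obtain \<delta> where \<delta>: "\<delta> > 0" "modulus f \<delta> (f g / 2)" using f by (meson uc_def)
  obtain A where A: "finite A" "A \<subseteq> G" "\<And>g. g \<in> G \<Longrightarrow> \<exists>a\<in>A. d g a < \<delta>" using d_precompact[OF \<delta>(1)] by blast
  have "\<exists>b\<in>G. a \<cdot> b = g" if "a \<in> A" for a using left_surj[of a g] that A(2) g(1) by blast
  then obtain b where b: "\<And>a. a \<in> A \<Longrightarrow> b a \<in> G" "\<And>a. a \<in> A \<Longrightarrow> a \<cdot> b a = g" by metis
  have uct: "uc (\<lambda>x. f (x \<cdot> b a))" if "a \<in> A" for a by (rule uc_right[OF f b(1)[OF that]])
  have "f g / 2 \<le> (\<Sum>a\<in>A. f (x \<cdot> b a))" if x: "x \<in> G" for x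
  proof -
    obtain a where a: "a \<in> A" "d x a < \<delta>" using A(3)[OF x] by blast
    have "d (x \<cdot> b a) g < \<delta>" using d_right[OF b(1)[OF a(1)] x, of a] a A(2) b(2)[OF a(1)] by auto
    then have "norm (f (x \<cdot> b a) - f g) \<le> f g / 2"
      using \<delta>(2) mul_closed[OF x b(1)[OF a(1)]] g(1) by (auto simp: modulus_def)
    then have "f g / 2 \<le> f (x \<cdot> b a)" unfolding real_norm_def by linarith
    also have "\<dots> \<le> (\<Sum>a\<in>A. f (x \<cdot> b a))"
      using A(1) a(1) nonneg mul_closed[OF x b(1)] by (intro member_le_sum) auto
    finally show ?thesis .
  qed
  moreover have "uc (\<lambda>x. \<Sum>a\<in>A. f (x \<cdot> b a))" by (rule uc_sum) (rule uct)
  ultimately have "f g / 2 \<le> mean (\<lambda>x. \<Sum>a\<in>A. f (x \<cdot> b a))"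
    using mean_mono[OF uc_const[of "f g / 2"]] by (simp only: mean_const)
  also have "\<dots> = (\<Sum>a\<in>A. mean f)"
    by (simp add: mean_sum uct mean_right[OF f b(1)])
  finally have "f g / 2 \<le> real (card A) * mean f" by simp
  then show ?thesis using g(2) mean_nonneg[OF f nonneg]
    by (metis less_eq_real_def half_gt_zero mult_zero_right not_less)
qed

text \<open>A Fubini theorem: joint uniform continuity lets one fine net replace the inner mean
  uniformly in the other variable, and a finite average commutes with a mean by linearity.\<close>

lemma mean_swap:
  fixes F :: "'g \<Rightarrow> 'g \<Rightarrow> 'b::banach"
  assumes F: "\<And>w. w > 0 \<Longrightarrow> \<exists>\<delta>>0. \<forall>x\<in>G. \<forall>x'\<in>G. \<forall>y\<in>G. \<forall>y'\<in>G.
    d x x' < \<delta> \<longrightarrow> d y y' < \<delta> \<longrightarrow> norm (F x y - F x' y') \<le> w"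
  shows "mean (\<lambda>x. mean (\<lambda>y. F x y)) = mean (\<lambda>y. mean (\<lambda>x. F x y))"
proof -
  have ucy: "uc (\<lambda>y. F x y)" if "x \<in> G" for x
    unfolding uc_def modulus_def using F that d_refl by metis
  have ucx: "uc (\<lambda>x. F x y)" if "y \<in> G" for y
    unfolding uc_def modulus_def using F that d_refl by metis
  have mod_mean: "modulus (\<lambda>x. mean (\<lambda>y. F x y)) \<delta> w" "modulus (\<lambda>y. mean (\<lambda>x. F x y)) \<delta> w"
    if "\<delta> > 0" and \<delta>: "\<forall>x\<in>G. \<forall>x'\<in>G. \<forall>y\<in>G. \<forall>y'\<in>G. d x x' < \<delta> \<longrightarrow> d y y' < \<delta> \<longrightarrow> norm (F x y - F x' y') \<le> w"
    for \<delta> w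
  proof -
    show "modulus (\<lambda>x. mean (\<lambda>y. F x y)) \<delta> w"
      unfolding modulus_def
    proof (intro ballI impI)
      fix x x' assume xx: "x \<in> G" "x' \<in> G" "d x x' < \<delta>"
      have "norm (mean (\<lambda>y. F x y - F x' y)) \<le> w"
        using \<delta> xx d_refl \<open>\<delta> > 0\<close> by (intro mean_norm_le uc_diff ucy) auto
      then show "norm (mean (F x) - mean (F x')) \<le> w" using mean_diff[OF ucy ucy] xx by simp
    qed
    show "modulus (\<lambda>y. mean (\<lambda>x. F x y)) \<delta> w"
      unfolding modulus_def
    proof (intro ballI impI)
      fix y y' assume yy: "y \<in> G" "y' \<in> G" "d y y' < \<delta>"
      have "norm (mean (\<lambda>x. F x y - F x y')) \<le> w"
        using \<delta> yy d_refl \<open>\<delta> > 0\<close> by (intro mean_norm_le uc_diff ucx) auto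
      then show "norm (mean (\<lambda>x. F x y) - mean (\<lambda>x. F x y')) \<le> w" using mean_diff[OF ucx ucx] yy by simp
    qed
  qed
  have uc1: "uc (\<lambda>x. mean (\<lambda>y. F x y))" and uc2: "uc (\<lambda>y. mean (\<lambda>x. F x y))"
    unfolding uc_def using F mod_mean by meson+
  have bound: "norm (mean (\<lambda>x. mean (\<lambda>y. F x y)) - mean (\<lambda>y. mean (\<lambda>x. F x y))) \<le> 2 * w" if w: "w > 0" for w
  proof -
    obtain \<delta> where \<delta>: "\<delta> > 0" "\<forall>x\<in>G. \<forall>x'\<in>G. \<forall>y\<in>G. \<forall>y'\<in>G. d x x' < \<delta> \<longrightarrow> d y y' < \<delta> \<longrightarrow> norm (F x y - F x' y') \<le> w"
      using F[OF w] by blast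
    \<comment> \<open>Half of \<delta>, because a net of mesh \<epsilon> requires a modulus at
      \<open>2 * \<epsilon>\<close>: matched points of two nets are only that close.\<close>
    obtain A where A: "min_net (\<delta> / 2) A" using min_net_exists[of "\<delta> / 2"] \<delta>(1) by auto
    note AD = min_net_D[OF A]
    have "norm (average (\<lambda>y. F x y) A - mean (\<lambda>y. F x y)) \<le> w" if x: "x \<in> G" for x
    proof (rule mean_error[OF ucy[OF x] A])
      show "modulus (F x) (2 * (\<delta> / 2)) w" unfolding modulus_def using \<delta> x d_refl by auto
    qed
    moreover have uca: "uc (\<lambda>x. average (\<lambda>y. F x y) A)"
      unfolding average_def using AD ucx by (intro uc_scaleR uc_const uc_sum) auto
    ultimately have "norm (mean (\<lambda>x. average (\<lambda>y. F x y) A - mean (\<lambda>y. F x y))) \<le> w"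
      by (intro mean_norm_le uc_diff uc1)
    then have 1: "norm (mean (\<lambda>x. average (\<lambda>y. F x y) A) - mean (\<lambda>x. mean (\<lambda>y. F x y))) \<le> w"
      by (simp add: mean_diff uca uc1)
    have ucs: "uc (\<lambda>x. \<Sum>y\<in>A. F x y)" using AD ucx by (intro uc_sum) auto
    have "mean (\<lambda>x. average (\<lambda>y. F x y) A) = (1 / real (card A)) *\<^sub>R mean (\<lambda>x. \<Sum>y\<in>A. F x y)"
      unfolding average_def by (rule mean_linear[OF bounded_linear_scaleR_right ucs])
    also have "mean (\<lambda>x. \<Sum>y\<in>A. F x y) = (\<Sum>y\<in>A. mean (\<lambda>x. F x y))"
      using AD ucx by (intro mean_sum) auto
    finally have 2: "mean (\<lambda>x. average (\<lambda>y. F x y) A) = average (\<lambda>y. mean (\<lambda>x. F x y)) A"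
      by (simp add: average_def)
    have "norm (average (\<lambda>y. mean (\<lambda>x. F x y)) A - mean (\<lambda>y. mean (\<lambda>x. F x y))) \<le> w"
      using mod_mean(2)[OF \<delta>] by (intro mean_error[OF uc2 A]) simp
    then show ?thesis using 1 2
      norm_triangle_ineq4[of "average (\<lambda>y. mean (\<lambda>x. F x y)) A - mean (\<lambda>y. mean (\<lambda>x. F x y))"
        "average (\<lambda>y. mean (\<lambda>x. F x y)) A - mean (\<lambda>x. mean (\<lambda>y. F x y))"]
      by simp
  qed
  have "norm (mean (\<lambda>x. mean (\<lambda>y. F x y)) - mean (\<lambda>y. mean (\<lambda>x. F x y))) \<le> 0 + e" if "e > 0" for e
    using bound[of "e / 2"] that by simp
  then have "norm (mean (\<lambda>x. mean (\<lambda>y. F x y)) - mean (\<lambda>y. mean (\<lambda>x. F x y))) \<le> 0"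
    by (rule field_le_epsilon)
  then show ?thesis by simp
qed

end

section \<open>Translation-invariant eigenspaces\<close>

context precompact_group
begin

text \<open>The real inner product of mean-square theory. Real functions are enough because the
  kernel used below is real and symmetric.\<close>

definition ip :: "('g \<Rightarrow> real) \<Rightarrow> ('g \<Rightarrow> real) \<Rightarrow> real" where
  "ip f g = mean (\<lambda>x. f x * g x)"

lemma ip_sym: "ip f g = ip g f"
  by (simp add: ip_def mult.commute)

lemma ip_cong: "(\<And>x. x \<in> G \<Longrightarrow> f x = f' x) \<Longrightarrow> (\<And>x. x \<in> G \<Longrightarrow> g x = g' x) \<Longrightarrow> ip f g = ip f' g'"
  unfolding ip_def by (rule mean_cong) simp

lemma ip_add_left: "uc f \<Longrightarrow> uc g \<Longrightarrow> uc h \<Longrightarrow> ip (\<lambda>x. f x + g x) h = ip f h + ip g h"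
  unfolding ip_def distrib_right by (intro mean_add uc_mult)

lemma ip_diff_left: "uc f \<Longrightarrow> uc g \<Longrightarrow> uc h \<Longrightarrow> ip (\<lambda>x. f x - g x) h = ip f h - ip g h"
  unfolding ip_def left_diff_distrib by (intro mean_diff uc_mult)

lemma ip_scale_left: "uc f \<Longrightarrow> uc h \<Longrightarrow> ip (\<lambda>x. c * f x) h = c * ip f h"
  unfolding ip_def mult.assoc by (intro mean_mult uc_mult)

lemma uc_scale: "uc f \<Longrightarrow> uc (\<lambda>x. c * f x :: real)"
  by (intro uc_mult uc_const)

lemma ip_sum_left:
  assumes "\<And>i. i \<in> I \<Longrightarrow> uc (f i)" "uc h"
  shows "ip (\<lambda>x. \<Sum>i\<in>I. c i * f i x) h = (\<Sum>i\<in>I. c i * ip (f i) h)"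
proof -
  have "ip (\<lambda>x. \<Sum>i\<in>I. c i * f i x) h = mean (\<lambda>x. \<Sum>i\<in>I. c i * (f i x * h x))"
    by (simp add: ip_def sum_distrib_right mult.assoc)
  also have "\<dots> = (\<Sum>i\<in>I. mean (\<lambda>x. c i * (f i x * h x)))"
    using assms by (intro mean_sum uc_scale uc_mult) auto
  also have "\<dots> = (\<Sum>i\<in>I. c i * ip (f i) h)"
    using assms by (intro sum.cong) (auto simp: ip_def mean_mult uc_mult)
  finally show ?thesis .
qed

lemma ip_nonneg: "uc f \<Longrightarrow> 0 \<le> ip f f"
  unfolding ip_def by (intro mean_nonneg uc_mult) auto

lemma ip_le:
  assumes f: "uc f" and le: "\<And>x. x \<in> G \<Longrightarrow> \<bar>f x\<bar> \<le> c"
  shows "ip f f \<le> c\<^sup>2"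
proof -
  have "f x * f x \<le> c\<^sup>2" if "x \<in> G" for x
    using power_mono[OF le[OF that], of 2] by (simp add: power2_eq_square)
  then show ?thesis
    using mean_mono[OF uc_mult[OF f f] uc_const, of "c\<^sup>2"] by (simp add: ip_def mean_const)
qed

lemma ip_eq_0D:
  assumes f: "uc f" and "ip f f = 0" and "x \<in> G"
  shows "f x = 0"
proof (rule ccontr)
  assume "f x \<noteq> 0"
  then have "f x * f x > 0" by (metis not_real_square_gt_zero)
  then have "ip f f > 0"
    unfolding ip_def using \<open>x \<in> G\<close> by (intro mean_pos[OF uc_mult[OF f f]]) auto
  then show False using assms(2) by simp
qed

lemma ip_add_self:
  assumes "uc f" "uc g"
  shows "ip (\<lambda>x. f x + g x) (\<lambda>x. f x + g x) = ip f f + 2 * ip f g + ip g g"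
  using assms ip_sym[of f "\<lambda>x. f x + g x"] ip_sym[of g "\<lambda>x. f x + g x"] ip_sym[of f g]
  by (simp add: ip_add_left uc_add)

lemma ip_diff_self:
  assumes "uc f" "uc g"
  shows "ip (\<lambda>x. f x - g x) (\<lambda>x. f x - g x) = ip f f - 2 * ip f g + ip g g"
  using assms ip_sym[of f "\<lambda>x. f x - g x"] ip_sym[of g "\<lambda>x. f x - g x"] ip_sym[of f g]
  by (simp add: ip_diff_left uc_diff)

lemma ip_scale_self: "uc f \<Longrightarrow> ip (\<lambda>x. c * f x) (\<lambda>x. c * f x) = c\<^sup>2 * ip f f"
  using ip_sym[of f "\<lambda>x. c * f x"] by (simp add: ip_scale_left uc_scale power2_eq_square)

lemma ip_add_self_le:
  assumes "uc f" "uc g"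
  shows "ip (\<lambda>x. f x + g x) (\<lambda>x. f x + g x) \<le> 2 * ip f f + 2 * ip g g"
  using ip_nonneg[OF uc_diff[OF assms]] ip_diff_self[OF assms] ip_add_self[OF assms] by linarith

lemma Cauchy_Schwarz:
  assumes f: "uc f" and g: "uc g"
  shows "(ip f g)\<^sup>2 \<le> ip f f * ip g g"
proof (cases "ip g g = 0")
  case True
  then have "ip f g = ip f (\<lambda>_. 0)" using ip_eq_0D[OF g True] by (intro ip_cong) auto
  then show ?thesis using True by (simp add: ip_def mean_const)
next
  case False
  then have pos: "ip g g > 0" using ip_nonneg[OF g] by simp
  define c where "c = ip f g / ip g g"
  have "0 \<le> ip (\<lambda>x. f x - c * g x) (\<lambda>x. f x - c * g x)" by (intro ip_nonneg uc_diff uc_scale f g)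
  also have "\<dots> = ip f f - 2 * ip f (\<lambda>x. c * g x) + c\<^sup>2 * ip g g"
    by (simp only: ip_diff_self[OF f uc_scale[OF g]] ip_scale_self[OF g])
  also have "ip f (\<lambda>x. c * g x) = c * ip f g"
    using ip_scale_left[OF g f, of c] ip_sym[of f "\<lambda>x. c * g x"] ip_sym[of f g] by simp
  also have "ip f f - 2 * (c * ip f g) + c\<^sup>2 * ip g g = ip f f - (ip f g)\<^sup>2 / ip g g"
    using pos by (simp add: c_def power2_eq_square field_simps)
  finally show ?thesis using pos by (simp add: pos_divide_le_eq)
qed

text \<open>A tent of height and radius \<open>r\<close>. It is 1-Lipschitz whatever
  \<open>r\<close> is, and as it depends only on \<open>d x y\<close> it inherits symmetry and both
  invariances.\<close>

definition ker :: "real \<Rightarrow> 'g \<Rightarrow> 'g \<Rightarrow> real" where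
  "ker r x y = max 0 (r - d x y)"

text \<open>By left invariance the kernel depends only on the quotient of its arguments, so this
  integral operator is a convolution with the tent centred at \<open>one\<close>.\<close>

definition conv :: "real \<Rightarrow> ('g \<Rightarrow> real) \<Rightarrow> 'g \<Rightarrow> real" where
  "conv r f x = ip (ker r x) f"

lemma ker_sym: "x \<in> G \<Longrightarrow> y \<in> G \<Longrightarrow> ker r x y = ker r y x"
  by (simp add: ker_def d_sym)

lemma ker_bounds: "x \<in> G \<Longrightarrow> y \<in> G \<Longrightarrow> 0 \<le> r \<Longrightarrow> \<bar>ker r x y\<bar> \<le> r"
  using d_nonneg[of x y] by (simp add: ker_def)

lemma ker_lipschitz:
  assumes "x \<in> G" "x' \<in> G" "y \<in> G"
  shows "\<bar>ker r x y - ker r x' y\<bar> \<le> d x x'"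
  using d_triangle[OF assms] d_triangle[of x' x y] d_sym[of x x'] assms d_nonneg[OF assms(1,2)]
  unfolding ker_def by (auto simp: max_def abs_le_iff)

lemma uc_ker: "x \<in> G \<Longrightarrow> uc (ker r x)"
  by (rule uc_lipschitz[where L = 1]) (metis ker_lipschitz ker_sym mult_1 real_norm_def)

lemma ip_ker_le:
  assumes "x \<in> G" "0 \<le> r"
  shows "ip (ker r x) (ker r x) \<le> r\<^sup>2"
  by (rule ip_le[OF uc_ker]) (use assms ker_bounds in auto)

lemma ip_ker_diff_le:
  assumes "x \<in> G" "x' \<in> G"
  shows "ip (\<lambda>y. ker r x y - ker r x' y) (\<lambda>y. ker r x y - ker r x' y) \<le> (d x x')\<^sup>2"
  by (rule ip_le[OF uc_diff[OF uc_ker uc_ker]]) (use assms ker_lipschitz in auto)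

lemma conv_cong: "(\<And>y. y \<in> G \<Longrightarrow> f y = g y) \<Longrightarrow> conv r f x = conv r g x"
  unfolding conv_def by (rule ip_cong) simp_all

lemma conv_square_le:
  assumes f: "uc f" and x: "x \<in> G" and r: "r \<ge> 0"
  shows "(conv r f x)\<^sup>2 \<le> r\<^sup>2 * ip f f"
proof -
  have "(conv r f x)\<^sup>2 \<le> ip (ker r x) (ker r x) * ip f f"
    unfolding conv_def by (rule Cauchy_Schwarz[OF uc_ker[OF x] f])
  also have "\<dots> \<le> r\<^sup>2 * ip f f"
    by (rule mult_right_mono[OF ip_ker_le[OF x r] ip_nonneg[OF f]])
  finally show ?thesis .
qed

text \<open>Together with \<open>conv_square_le\<close> this is the source of compactness:
  mean-square bounded functions are sent to uniformly bounded functions with a common Lipschitz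
  constant.\<close>

lemma conv_lipschitz_square:
  assumes f: "uc f" and x: "x \<in> G" "x' \<in> G"
  shows "(conv r f x - conv r f x')\<^sup>2 \<le> (d x x')\<^sup>2 * ip f f"
proof -
  have eq: "conv r f x - conv r f x' = ip (\<lambda>y. ker r x y - ker r x' y) f"
    unfolding conv_def by (rule ip_diff_left[OF uc_ker uc_ker f, symmetric]) (rule x)+
  have "(conv r f x - conv r f x')\<^sup>2
      \<le> ip (\<lambda>y. ker r x y - ker r x' y) (\<lambda>y. ker r x y - ker r x' y) * ip f f"
    unfolding eq by (rule Cauchy_Schwarz[OF uc_diff[OF uc_ker uc_ker] f]) (rule x)+
  also have "\<dots> \<le> (d x x')\<^sup>2 * ip f f"
    by (rule mult_right_mono[OF ip_ker_diff_le[OF x] ip_nonneg[OF f]])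
  finally show ?thesis .
qed

lemma uc_conv:
  assumes f: "uc f"
  shows "uc (conv r f)"
proof (rule uc_lipschitz)
  fix x y assume xy: "x \<in> G" "y \<in> G"
  have "(conv r f x - conv r f y)\<^sup>2 \<le> (sqrt (ip f f) * d x y)\<^sup>2"
    using conv_lipschitz_square[OF f xy] by (simp add: power_mult_distrib ip_nonneg f mult.commute)
  moreover have "0 \<le> sqrt (ip f f) * d x y" by (intro mult_nonneg_nonneg d_nonneg xy) (simp add: ip_nonneg f)
  ultimately show "norm (conv r f x - conv r f y) \<le> sqrt (ip f f) * d x y"
    using abs_le_square_iff[of "conv r f x - conv r f y" "sqrt (ip f f) * d x y"] by simp
qed

lemma conv_diff: "uc f \<Longrightarrow> uc g \<Longrightarrow> x \<in> G \<Longrightarrow> conv r (\<lambda>y. f y - g y) x = conv r f x - conv r g x"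
  unfolding conv_def using ip_sym ip_diff_left uc_ker by metis

lemma conv_scale: "uc f \<Longrightarrow> x \<in> G \<Longrightarrow> conv r (\<lambda>y. c * f y) x = c * conv r f x"
  unfolding conv_def using ip_sym ip_scale_left uc_ker by metis

lemma conv_sum:
  assumes "\<And>i. i \<in> I \<Longrightarrow> uc (f i)" "x \<in> G"
  shows "conv r (\<lambda>y. \<Sum>i\<in>I. c i * f i y) x = (\<Sum>i\<in>I. c i * conv r (f i) x)"
  unfolding conv_def using ip_sum_left[of I f "ker r x" c] assms
  by (simp add: ip_sym[of "ker r x"] uc_ker)

text \<open>Left invariance of \<open>d\<close> lets the translation pass through the kernel, and
  invariance of the mean removes it. Eigenspaces are therefore stable under left
  translation.\<close>

lemma conv_left:
  assumes f: "uc f" and t: "t \<in> G" and x: "x \<in> G"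
  shows "conv r (\<lambda>y. f (t \<cdot> y)) x = conv r f (t \<cdot> x)"
proof -
  have "conv r (\<lambda>y. f (t \<cdot> y)) x = mean (\<lambda>y. ker r (t \<cdot> x) (t \<cdot> y) * f (t \<cdot> y))"
    unfolding conv_def ip_def by (rule mean_cong) (simp add: ker_def d_left t x)
  also have "\<dots> = conv r f (t \<cdot> x)"
    unfolding conv_def ip_def
    by (rule mean_left[of "\<lambda>y. ker r (t \<cdot> x) y * f y"]) (intro uc_mult uc_ker f mul_closed t x)+
  finally show ?thesis .
qed

text \<open>Fubini and the symmetry of the kernel; the labour is the joint uniform continuity of the
  integrand.\<close>

lemma conv_selfadjoint:
  assumes f: "uc f" and g: "uc g" and r: "r > 0"
  shows "ip (conv r f) g = ip f (conv r g)"
proof -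
  obtain C where C: "C > 0" "\<And>x. x \<in> G \<Longrightarrow> norm (f x) \<le> C" using uc_bounded[OF f] by blast
  obtain D where D: "D > 0" "\<And>x. x \<in> G \<Longrightarrow> norm (g x) \<le> D" using uc_bounded[OF g] by blast
  define F where "F = (\<lambda>x y. ker r x y * f y * g x)"
  have "mean (\<lambda>x. mean (\<lambda>y. F x y)) = mean (\<lambda>y. mean (\<lambda>x. F x y))"
  proof (rule mean_swap)
    fix w :: real assume w: "w > 0"
    have "w / (4 * C * D) > 0" "w / (4 * r * D) > 0" "w / (4 * r * C) > 0" using w C(1) D(1) r by simp_all
    then obtain \<delta>1 \<delta>2 where \<delta>: "\<delta>1 > 0" "modulus f \<delta>1 (w / (4 * r * D))" "\<delta>2 > 0" "modulus g \<delta>2 (w / (4 * r * C))"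
      using f g unfolding uc_def by meson
    \<comment> \<open>The kernel varies by at most \<open>d x x' + d y y'\<close>, which accounts
      for \<open>w / 2\<close> of the error; the variations of \<open>f\<close> and \<open>g\<close>
      account for \<open>w / 4\<close> each.\<close>
    define \<delta> where "\<delta> = min (w / (4 * C * D)) (min \<delta>1 \<delta>2)"
    have "norm (F x y - F x' y') \<le> w"
      if G4: "x \<in> G" "x' \<in> G" "y \<in> G" "y' \<in> G" and dd: "d x x' < \<delta>" "d y y' < \<delta>" for x x' y y'
    proof -
      have k: "\<bar>ker r x y - ker r x' y'\<bar> \<le> 2 * (w / (4 * C * D))"
      proof -
        have "\<bar>ker r x y - ker r x' y\<bar> \<le> d x x'" by (rule ker_lipschitz[OF G4(1,2,3)])
        moreover have "\<bar>ker r x' y - ker r x' y'\<bar> \<le> d y y'"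
          using ker_lipschitz[OF G4(3,4,2), of r] ker_sym G4 by simp
        moreover have "d x x' < w / (4 * C * D)" "d y y' < w / (4 * C * D)" using dd by (simp_all add: \<delta>_def)
        ultimately show ?thesis by linarith
      qed
      have fd: "\<bar>f y - f y'\<bar> \<le> w / (4 * r * D)" using \<delta>(2) G4 dd by (auto simp: modulus_def \<delta>_def)
      have gd: "\<bar>g x - g x'\<bar> \<le> w / (4 * r * C)" using \<delta>(4) G4 dd by (auto simp: modulus_def \<delta>_def)
      have "F x y - F x' y' = (ker r x y - ker r x' y') * f y * g x
          + ker r x' y' * (f y - f y') * g x + ker r x' y' * f y' * (g x - g x')"
        by (simp add: F_def algebra_simps)
      also have "norm \<dots> \<le> \<bar>ker r x y - ker r x' y'\<bar> * \<bar>f y\<bar> * \<bar>g x\<bar>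
          + \<bar>ker r x' y'\<bar> * \<bar>f y - f y'\<bar> * \<bar>g x\<bar> + \<bar>ker r x' y'\<bar> * \<bar>f y'\<bar> * \<bar>g x - g x'\<bar>"
        unfolding real_norm_def
        by (rule order_trans[OF abs_triangle_ineq add_mono[OF order_trans[OF abs_triangle_ineq]]])
          (simp_all add: abs_mult)
      also have "\<dots> \<le> (2 * (w / (4 * C * D))) * C * D + r * (w / (4 * r * D)) * D + r * C * (w / (4 * r * C))"
        using k fd gd C D r w G4 ker_bounds[of x' y' r]
        by (intro add_mono mult_mono) (auto simp: zero_le_mult_iff)
      also have "\<dots> = w" using C(1) D(1) r by (simp add: field_simps)
      finally show ?thesis .
    qed
    moreover have "\<delta> > 0" using \<delta> w C(1) D(1) by (simp add: \<delta>_def)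
    ultimately show "\<exists>\<delta>>0. \<forall>x\<in>G. \<forall>x'\<in>G. \<forall>y\<in>G. \<forall>y'\<in>G.
        d x x' < \<delta> \<longrightarrow> d y y' < \<delta> \<longrightarrow> norm (F x y - F x' y') \<le> w" by blast
  qed
  moreover have "mean (\<lambda>x. mean (\<lambda>y. F x y)) = ip (conv r f) g"
    unfolding ip_def conv_def F_def
    by (intro mean_cong) (simp add: mean_mult[symmetric] uc_mult uc_ker f mult.commute mult.left_commute)
  moreover have "mean (\<lambda>y. mean (\<lambda>x. F x y)) = ip f (conv r g)"
    unfolding ip_def conv_def
  proof (rule mean_cong)
    fix y assume y: "y \<in> G"
    have "mean (\<lambda>x. F x y) = mean (\<lambda>x. f y * (ker r y x * g x))"
      by (rule mean_cong) (simp add: F_def ker_sym y mult.commute mult.left_commute)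
    then show "mean (\<lambda>x. F x y) = f y * mean (\<lambda>x. ker r y x * g x)"
      by (simp add: mean_mult uc_mult uc_ker y g)
  qed
  ultimately show ?thesis by simp
qed

text \<open>The Arzela-Ascoli argument: a diagonal subsequence converges on the countable dense
  union of the nets, and the common Lipschitz bound spreads this uniformly over
  \<open>G\<close>.\<close>

lemma equicontinuous_subsequence:
  fixes h :: "nat \<Rightarrow> 'g \<Rightarrow> real"
  assumes bdd: "\<And>k x. x \<in> G \<Longrightarrow> \<bar>h k x\<bar> \<le> C"
    and lip: "\<And>k x y. x \<in> G \<Longrightarrow> y \<in> G \<Longrightarrow> \<bar>h k x - h k y\<bar> \<le> d x y"
  obtains s g where "strict_mono (s :: nat \<Rightarrow> nat)" "\<And>x y. x \<in> G \<Longrightarrow> y \<in> G \<Longrightarrow> \<bar>g x - g y\<bar> \<le> d x y"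
    "\<And>e. e > 0 \<Longrightarrow> \<exists>N. \<forall>k\<ge>N. \<forall>x\<in>G. \<bar>h (s k) x - g x\<bar> \<le> e"
proof -
  have "countable (\<Union>n. Net n)" using Net_D(1) by (simp add: countable_finite)
  moreover have "norm (h k x) \<le> C" if "x \<in> (\<Union>n. Net n)" for k x using bdd that Net_D(2) by auto
  ultimately obtain s where s: "strict_mono s" "\<And>x. x \<in> (\<Union>n. Net n) \<Longrightarrow> \<exists>l. (\<lambda>n. h (s n) x) \<longlonglongrightarrow> l"
    using function_convergent_subsequence by metis
  have cauchy: "\<exists>N. \<forall>k\<ge>N. \<forall>l\<ge>N. \<forall>x\<in>G. \<bar>h (s k) x - h (s l) x\<bar> < e" if e: "e > 0" for e
  proof -
    obtain n where n: "inverse (real (Suc n)) < e / 3" using reals_Archimedean[of "e / 3"] e by auto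
    have "\<exists>N. \<forall>k\<ge>N. \<forall>l\<ge>N. \<bar>h (s k) a - h (s l) a\<bar> < e / 3" if a: "a \<in> Net n" for a
    proof -
      have "Cauchy (\<lambda>k. h (s k) a)" using s(2) a by (blast intro: convergent_Cauchy convergentI)
      then show ?thesis using e unfolding Cauchy_def dist_real_def by (metis divide_pos_pos zero_less_numeral)
    qed
    then obtain N where N: "\<And>a k l. a \<in> Net n \<Longrightarrow> k \<ge> N a \<Longrightarrow> l \<ge> N a \<Longrightarrow> \<bar>h (s k) a - h (s l) a\<bar> < e / 3"
      by metis
    have "\<bar>h (s k) x - h (s l) x\<bar> < e" if kl: "k \<ge> Max (N ` Net n)" "l \<ge> Max (N ` Net n)" and x: "x \<in> G" for k l x
    proof -
      obtain a where a: "a \<in> Net n" "d x a < 1 / real (Suc n)"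
        using Net[of n] x by (auto simp: min_net_def net_def)
      have aG: "a \<in> G" using a(1) Net_D(2) by blast
      have "N a \<le> Max (N ` Net n)" using Net_D(1) a(1) by simp
      then have "\<bar>h (s k) a - h (s l) a\<bar> < e / 3" using N[OF a(1)] kl by simp
      moreover have "\<bar>h (s k) x - h (s k) a\<bar> < e / 3" "\<bar>h (s l) x - h (s l) a\<bar> < e / 3"
        using lip[OF x aG, of "s k"] lip[OF x aG, of "s l"] a(2) n by (simp_all add: inverse_eq_divide)
      ultimately show ?thesis by linarith
    qed
    then show ?thesis by blast
  qed
  define g where "g = (\<lambda>x. lim (\<lambda>k. h (s k) x))"
  have lim: "(\<lambda>k. h (s k) x) \<longlonglongrightarrow> g x" if x: "x \<in> G" for x
  proof -
    have "Cauchy (\<lambda>k. h (s k) x)" unfolding Cauchy_def dist_real_def using cauchy x by meson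
    then show ?thesis unfolding g_def by (simp add: Cauchy_convergent_iff convergent_LIMSEQ_iff)
  qed
  have g_lip: "\<bar>g x - g y\<bar> \<le> d x y" if "x \<in> G" "y \<in> G" for x y
  proof (rule LIMSEQ_le_const2)
    show "(\<lambda>k. \<bar>h (s k) x - h (s k) y\<bar>) \<longlonglongrightarrow> \<bar>g x - g y\<bar>" by (intro tendsto_intros lim that)
  qed (use lip that in blast)
  have g_lim: "\<exists>N. \<forall>k\<ge>N. \<forall>x\<in>G. \<bar>h (s k) x - g x\<bar> \<le> e" if e: "e > 0" for e
  proof -
    obtain N where N: "\<And>k l x. k \<ge> N \<Longrightarrow> l \<ge> N \<Longrightarrow> x \<in> G \<Longrightarrow> \<bar>h (s k) x - h (s l) x\<bar> < e"
      using cauchy[OF e] by blast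
    have "\<bar>h (s k) x - g x\<bar> \<le> e" if "k \<ge> N" "x \<in> G" for k x
    proof (rule LIMSEQ_le_const2)
      show "(\<lambda>l. \<bar>h (s k) x - h (s l) x\<bar>) \<longlonglongrightarrow> \<bar>h (s k) x - g x\<bar>" by (intro tendsto_intros lim that)
      show "\<exists>M. \<forall>l\<ge>M. \<bar>h (s k) x - h (s l) x\<bar> \<le> e" using N[OF that(1) _ that(2)] less_imp_le by blast
    qed
    then show ?thesis by blast
  qed
  show ?thesis
  proof (rule that[OF s(1)])
    show "\<bar>g x - g y\<bar> \<le> d x y" if "x \<in> G" "y \<in> G" for x y by (rule g_lip[OF that])
    show "\<exists>N. \<forall>k\<ge>N. \<forall>x\<in>G. \<bar>h (s k) x - g x\<bar> \<le> e" if "e > 0" for e by (rule g_lim[OF that])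
  qed
qed

text \<open>Eigenfunctions of the square of the convolution are used because the operator itself may
  have eigenvalues of either sign. The square is positive, and its quadratic form is the squared
  norm of \<open>conv r f\<close>, the quantity maximised later.\<close>

definition eigen_family :: "real \<Rightarrow> real \<Rightarrow> nat \<Rightarrow> (nat \<Rightarrow> 'g \<Rightarrow> real) \<Rightarrow> (nat \<Rightarrow> real) \<Rightarrow> bool" where
  "eigen_family r \<delta> n u lam \<longleftrightarrow>
     (\<forall>i<n. uc (u i) \<and> \<delta> \<le> lam i \<and> (\<forall>x\<in>G. conv r (conv r (u i)) x = lam i * u i x)) \<and>
     (\<forall>i<n. \<forall>j<n. ip (u i) (u j) = (if i = j then 1 else 0))"

lemma ortho_expansion:
  fixes u :: "nat \<Rightarrow> 'g \<Rightarrow> real"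
  assumes "\<forall>i<n. uc (u i)" "\<forall>i<n. \<forall>j<n. ip (u i) (u j) = (if i = j then 1 else 0)"
    and f: "uc f"
  defines "p \<equiv> \<lambda>x. \<Sum>i<n. ip f (u i) * u i x"
  shows "uc p" "\<And>j. j < n \<Longrightarrow> ip p (u j) = ip f (u j)"
    "ip (\<lambda>x. f x - p x) (\<lambda>x. f x - p x) = ip f f - (\<Sum>i<n. (ip f (u i))\<^sup>2)"
proof -
  have u: "\<And>i. i < n \<Longrightarrow> uc (u i)" "\<And>i j. i < n \<Longrightarrow> j < n \<Longrightarrow> ip (u i) (u j) = (if i = j then 1 else 0)"
    using assms(1,2) by auto
  show p: "uc p" unfolding p_def using u(1) by (intro uc_sum uc_scale) auto
  show pu: "ip p (u j) = ip f (u j)" if j: "j < n" for j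
  proof -
    have "ip p (u j) = (\<Sum>i<n. ip f (u i) * ip (u i) (u j))"
      unfolding p_def using u(1) j by (intro ip_sum_left) auto
    also have "\<dots> = (\<Sum>i<n. if i = j then ip f (u i) else 0)"
      using u(2) j by (intro sum.cong) auto
    also have "\<dots> = ip f (u j)" using j sum.delta[of "{..<n}" j "\<lambda>i. ip f (u i)"] by simp
    finally show ?thesis .
  qed
  have pg: "ip p g = (\<Sum>i<n. ip f (u i) * ip (u i) g)" if "uc g" for g
    unfolding p_def using u(1) that by (intro ip_sum_left) auto
  have "ip p f = (\<Sum>i<n. (ip f (u i))\<^sup>2)"
    unfolding pg[OF f] by (rule sum.cong) (simp_all add: power2_eq_square ip_sym[of _ f])
  moreover have "ip p p = (\<Sum>i<n. (ip f (u i))\<^sup>2)"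
    unfolding pg[OF p] using pu by (intro sum.cong) (simp_all add: power2_eq_square ip_sym[of _ p])
  ultimately show "ip (\<lambda>x. f x - p x) (\<lambda>x. f x - p x) = ip f f - (\<Sum>i<n. (ip f (u i))\<^sup>2)"
    unfolding ip_diff_self[OF f p] ip_sym[of f p] by simp
qed

lemma eigen_family_D:
  assumes "eigen_family r \<delta> n u lam"
  shows "\<And>i. i < n \<Longrightarrow> uc (u i)" "\<And>i. i < n \<Longrightarrow> \<delta> \<le> lam i"
    "\<And>i x. i < n \<Longrightarrow> x \<in> G \<Longrightarrow> conv r (conv r (u i)) x = lam i * u i x"
    "\<And>i j. i < n \<Longrightarrow> j < n \<Longrightarrow> ip (u i) (u j) = (if i = j then 1 else 0)"
    "\<forall>i<n. uc (u i)" "\<forall>i<n. \<forall>j<n. ip (u i) (u j) = (if i = j then 1 else 0)"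
  using assms by (simp_all add: eigen_family_def)

text \<open>The Hilbert--Schmidt norm of the convolution operator bounds the number of eigenfunctions.\<close>

lemma eigen_family_card:
  assumes r: "r > 0" and fam: "eigen_family r \<delta> n u lam"
  shows "real n * \<delta> \<le> r\<^sup>2"
proof -
  note u = eigen_family_D[OF fam]
  \<comment> \<open>The coefficient of the kernel section \<open>ker r x\<close> at
    \<open>u i\<close> is \<open>conv r (u i) x\<close>, so this is Bessel's inequality for that
    section; averaging over \<open>x\<close> gives the sum of the eigenvalues.\<close>
  have "(\<Sum>i<n. conv r (u i) x * conv r (u i) x) \<le> r\<^sup>2" if x: "x \<in> G" for x
  proof -
    have "0 \<le> ip (ker r x) (ker r x) - (\<Sum>i<n. (ip (ker r x) (u i))\<^sup>2)"
      unfolding ortho_expansion(3)[OF u(5,6) uc_ker[OF x], symmetric]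
      by (intro ip_nonneg uc_diff uc_ker[OF x] ortho_expansion(1)[OF u(5,6)])
    moreover have "ip (ker r x) (ker r x) \<le> r\<^sup>2" using x r by (intro ip_ker_le) auto
    ultimately show ?thesis by (simp add: conv_def power2_eq_square)
  qed
  then have "mean (\<lambda>x. \<Sum>i<n. conv r (u i) x * conv r (u i) x) \<le> mean (\<lambda>x. r\<^sup>2)"
    using u(1) by (intro mean_mono uc_sum uc_mult uc_conv uc_const) auto
  moreover have "mean (\<lambda>x. \<Sum>i<n. conv r (u i) x * conv r (u i) x) = (\<Sum>i<n. ip (conv r (u i)) (conv r (u i)))"
    unfolding ip_def using u(1) by (intro mean_sum uc_mult uc_conv) auto
  moreover have "ip (conv r (u i)) (conv r (u i)) = lam i" if i: "i < n" for i
  proof -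
    have "ip (conv r (u i)) (conv r (u i)) = ip (u i) (conv r (conv r (u i)))"
      by (rule conv_selfadjoint[OF u(1)[OF i] uc_conv[OF u(1)[OF i]] r])
    also have "\<dots> = ip (u i) (\<lambda>x. lam i * u i x)" using u(3)[OF i] by (intro ip_cong) auto
    also have "\<dots> = lam i"
      using ip_sym[of "u i" "\<lambda>x. lam i * u i x"] by (simp add: ip_scale_left u(1,4) i)
    finally show ?thesis .
  qed
  moreover have "real n * \<delta> \<le> (\<Sum>i<n. lam i)" using sum_bounded_below[of "{..<n}" \<delta> lam] u(2) by simp
  ultimately show ?thesis by (simp add: mean_const)
qed

definition max_eigen_family :: "real \<Rightarrow> real \<Rightarrow> nat \<Rightarrow> (nat \<Rightarrow> 'g \<Rightarrow> real) \<Rightarrow> (nat \<Rightarrow> real) \<Rightarrow> bool" where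
  "max_eigen_family r \<delta> n u lam \<longleftrightarrow> eigen_family r \<delta> n u lam \<and> (\<forall>m v mu. eigen_family r \<delta> m v mu \<longrightarrow> m \<le> n)"

lemma max_eigen_family_exists:
  assumes r: "r > 0" and \<delta>: "\<delta> > 0"
  obtains n u lam where "max_eigen_family r \<delta> n u lam"
proof -
  have "\<exists>n. (\<exists>u lam. eigen_family r \<delta> n u lam) \<and> (\<forall>m. (\<exists>u lam. eigen_family r \<delta> m u lam) \<longrightarrow> m \<le> n)"
  proof (rule Nat.ex_has_greatest_nat)
    show "\<exists>u lam. eigen_family r \<delta> 0 u lam" by (simp add: eigen_family_def)
    show "\<forall>m. (\<exists>u lam. eigen_family r \<delta> m u lam) \<longrightarrow> m \<le> nat \<lceil>r\<^sup>2 / \<delta>\<rceil>"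
    proof (intro allI impI)
      fix m assume "\<exists>u lam. eigen_family r \<delta> m u lam"
      then have "real m * \<delta> \<le> r\<^sup>2" using eigen_family_card[OF r] by blast
      then have "real m \<le> r\<^sup>2 / \<delta>" using \<delta> by (simp add: pos_le_divide_eq)
      then show "m \<le> nat \<lceil>r\<^sup>2 / \<delta>\<rceil>" by linarith
    qed
  qed
  then show ?thesis using that unfolding max_eigen_family_def by blast
qed

text \<open>The part of \<open>v\<close> orthogonal to the family is again an eigenfunction for
  \<mu>; if it were nonzero, its normalisation would enlarge the maximal family. So the span
  contains all eigenfunctions with eigenvalue at least \<delta>.\<close>

lemma eigenfunction_in_span:
  assumes r: "r > 0" and \<delta>: "\<delta> > 0" and fam: "max_eigen_family r \<delta> n u lam"
    and v: "uc v" "\<mu> \<ge> \<delta>" "\<And>x. x \<in> G \<Longrightarrow> conv r (conv r v) x = \<mu> * v x" and x: "x \<in> G"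
  shows "v x = (\<Sum>i<n. ip v (u i) * u i x)"
proof -
  have famE: "eigen_family r \<delta> n u lam" using fam by (simp add: max_eigen_family_def)
  note u = eigen_family_D[OF famE]
  define p where "p = (\<lambda>x. \<Sum>i<n. ip v (u i) * u i x)"
  define w where "w = (\<lambda>x. v x - p x)"
  have p: "uc p" and pu: "\<And>j. j < n \<Longrightarrow> ip p (u j) = ip v (u j)"
    using ortho_expansion(1,2)[OF u(5,6) v(1)] by (simp_all add: p_def)
  have w: "uc w" unfolding w_def by (intro uc_diff v p)
  have wu: "ip w (u j) = 0" if "j < n" for j
    unfolding w_def using ip_diff_left[OF v(1) p u(1)[OF that]] pu[OF that] by simp
  \<comment> \<open>Self-adjointness: the coefficient vanishes unless \<open>lam i = \<mu>\<close>.
    Hence the projection \<open>p\<close> is itself an eigenfunction for \<mu>.\<close>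
  have coeff: "ip v (u i) * lam i = \<mu> * ip v (u i)" if i: "i < n" for i
  proof -
    have "\<mu> * ip v (u i) = ip (\<lambda>x. \<mu> * v x) (u i)" by (simp add: ip_scale_left v(1) u(1) i)
    also have "\<dots> = ip (conv r (conv r v)) (u i)" using v(3) by (intro ip_cong) auto
    also have "\<dots> = ip v (conv r (conv r (u i)))"
      by (simp add: conv_selfadjoint uc_conv v(1) u(1) i r)
    also have "\<dots> = ip v (\<lambda>x. lam i * u i x)" using u(3)[OF i] by (intro ip_cong) auto
    also have "\<dots> = lam i * ip v (u i)"
      using ip_sym[of v "\<lambda>x. lam i * u i x"] ip_sym[of v "u i"] by (simp add: ip_scale_left v(1) u(1) i)
    finally show ?thesis by (metis mult.commute)
  qed
  have Bw: "conv r (conv r w) x = \<mu> * w x" if x: "x \<in> G" for x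
  proof -
    have "conv r (conv r p) x = conv r (\<lambda>y. \<Sum>i<n. ip v (u i) * conv r (u i) y) x"
      using u(1) unfolding p_def by (intro conv_cong conv_sum) auto
    also have "\<dots> = (\<Sum>i<n. ip v (u i) * conv r (conv r (u i)) x)"
      using u(1) uc_conv x by (intro conv_sum) auto
    also have "\<dots> = (\<Sum>i<n. \<mu> * ip v (u i) * u i x)"
      using u(3) x coeff by (intro sum.cong) (auto simp: mult.assoc[symmetric])
    also have "\<dots> = \<mu> * p x" by (simp add: p_def sum_distrib_left mult.assoc)
    finally have Bp: "conv r (conv r p) x = \<mu> * p x" .
    have "conv r (conv r w) x = conv r (\<lambda>y. conv r v y - conv r p y) x"
      unfolding w_def by (intro conv_cong conv_diff v p)
    also have "\<dots> = conv r (conv r v) x - conv r (conv r p) x" by (intro conv_diff uc_conv v p x)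
    finally show ?thesis using Bp v(3)[OF x] by (simp add: w_def right_diff_distrib)
  qed
  have "ip w w = 0"
  proof (rule ccontr)
    assume "ip w w \<noteq> 0"
    then have pos: "ip w w > 0" using ip_nonneg[OF w] by simp
    define c where "c = 1 / sqrt (ip w w)"
    define u' where "u' = u(n := (\<lambda>x. c * w x))"
    have c2: "c\<^sup>2 * ip w w = 1" using pos by (simp add: c_def power_divide)
    have "eigen_family r \<delta> (Suc n) u' (lam(n := \<mu>))"
      unfolding eigen_family_def
    proof (intro conjI allI impI ballI)
      fix i assume i: "i < Suc n"
      show "uc (u' i)" using u(1) uc_scale[OF w] i by (auto simp: u'_def less_Suc_eq)
      show "\<delta> \<le> (lam(n := \<mu>)) i" using u(2) v(2) i by (auto simp: less_Suc_eq)
      fix x assume x: "x \<in> G"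
      show "conv r (conv r (u' i)) x = (lam(n := \<mu>)) i * u' i x"
      proof (cases "i = n")
        case True
        have "conv r (conv r (\<lambda>x. c * w x)) x = conv r (\<lambda>y. c * conv r w y) x"
          by (intro conv_cong conv_scale w)
        also have "\<dots> = c * conv r (conv r w) x" by (intro conv_scale uc_conv w x)
        finally show ?thesis using True Bw[OF x] by (simp add: u'_def)
      next
        case False
        then show ?thesis using u(3) i x by (simp add: u'_def)
      qed
    next
      fix i j assume ij: "i < Suc n" "j < Suc n"
      have cw: "ip (\<lambda>x. c * w x) (u j) = 0" if "j < n" for j
        using ip_scale_left[OF w u(1)[OF that]] wu[OF that] by simp
      show "ip (u' i) (u' j) = (if i = j then 1 else 0)"
      proof (cases "i = n"; cases "j = n")
        assume "i = n" "j = n"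
        then show ?thesis using ip_scale_self[OF w] c2 by (simp add: u'_def)
      next
        assume "i = n" "j \<noteq> n"
        then show ?thesis using cw[of j] ij by (simp add: u'_def)
      next
        assume "i \<noteq> n" "j = n"
        then show ?thesis using cw[of i] ij ip_sym[of "u i"] by (simp add: u'_def)
      next
        assume "i \<noteq> n" "j \<noteq> n"
        then show ?thesis using u(4) ij by (simp add: u'_def)
      qed
    qed
    then have "Suc n \<le> n" using fam unfolding max_eigen_family_def by blast
    then show False by simp
  qed
  then have "w x = 0" by (rule ip_eq_0D[OF w _ x])
  then show ?thesis by (simp add: w_def p_def)
qed

end

section \<open>Convolution on the complement of a maximal family\<close>

context precompact_group
begin

text \<open>The convolution commutes with its square, so \<open>conv r (u j)\<close> is again an
  eigenfunction for \<open>lam j\<close> and stays in the span of the family; self-adjointness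
  transfers this to the complement.\<close>

lemma conv_perp:
  assumes r: "r > 0" and \<delta>: "\<delta> > 0" and fam: "max_eigen_family r \<delta> n u lam"
    and f: "uc f" and perp: "\<And>i. i < n \<Longrightarrow> ip f (u i) = 0" and j: "j < n"
  shows "ip (conv r f) (u j) = 0"
proof -
  have famE: "eigen_family r \<delta> n u lam" using fam by (simp add: max_eigen_family_def)
  note u = eigen_family_D[OF famE]
  define v where "v = conv r (u j)"
  have v: "uc v" unfolding v_def by (rule uc_conv[OF u(1)[OF j]])
  have eig: "conv r (conv r v) x = lam j * v x" if x: "x \<in> G" for x
  proof -
    have "conv r (conv r v) x = conv r (\<lambda>y. lam j * u j y) x"
      unfolding v_def by (rule conv_cong) (rule u(3)[OF j])
    then show ?thesis using conv_scale[OF u(1)[OF j] x] by (simp add: v_def)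
  qed
  have v_eq: "v x = (\<Sum>i<n. ip v (u i) * u i x)" if "x \<in> G" for x
    by (rule eigenfunction_in_span[OF r \<delta> fam v u(2)[OF j] eig that])
  have "ip (conv r f) (u j) = ip f v" unfolding v_def by (rule conv_selfadjoint[OF f u(1)[OF j] r])
  also have "\<dots> = ip (\<lambda>x. \<Sum>i<n. ip v (u i) * u i x) f"
    unfolding ip_sym[of f v] by (rule ip_cong) (simp_all add: v_eq[symmetric])
  also have "\<dots> = (\<Sum>i<n. ip v (u i) * ip (u i) f)" using u(1) f by (intro ip_sum_left) auto
  also have "\<dots> = 0" using perp ip_sym[of _ f] by simp
  finally show ?thesis .
qed

text \<open>On the orthogonal complement of a maximal family the norm of the convolution operator would be
  attained at an eigenfunction, which the maximality rules out if the norm is too large.\<close>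

lemma spectral_gap:
  assumes r: "r > 0" and \<delta>: "\<delta> > 0" and fam: "max_eigen_family r \<delta> n u lam"
    and f: "uc f" and perp: "\<And>i. i < n \<Longrightarrow> ip f (u i) = 0"
  shows "ip (conv r f) (conv r f) \<le> \<delta> * ip f f"
proof (rule ccontr)
  assume "\<not> ip (conv r f) (conv r f) \<le> \<delta> * ip f f"
  then have big: "\<delta> * ip f f < ip (conv r f) (conv r f)" by simp
  have famE: "eigen_family r \<delta> n u lam" using fam by (simp add: max_eigen_family_def)
  note u = eigen_family_D[OF famE]
  define ok where "ok = (\<lambda>g. uc g \<and> (\<forall>i<n. ip g (u i) = 0))"
  have ok_conv: "ok (conv r g)" if "ok g" for g
    using that conv_perp[OF r \<delta> fam] uc_conv by (simp add: ok_def)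
  have ok_scale: "ok (\<lambda>x. c * g x)" if "ok g" for g c
    using that u(1) by (simp add: ok_def uc_scale ip_scale_left)
  have conv_le: "ip (conv r g) (conv r g) \<le> r\<^sup>2 * ip g g" if g: "uc g" for g
  proof -
    have "\<bar>conv r g x\<bar> \<le> r * sqrt (ip g g)" if "x \<in> G" for x
      using conv_square_le[OF g that, of r] r abs_le_square_iff[of "conv r g x" "r * sqrt (ip g g)"]
      by (simp add: power_mult_distrib ip_nonneg g abs_mult)
    then have "ip (conv r g) (conv r g) \<le> (r * sqrt (ip g g))\<^sup>2" by (intro ip_le uc_conv g)
    then show ?thesis by (simp add: power_mult_distrib ip_nonneg g)
  qed
  define V where "V = {ip (conv r g) (conv r g) |g. ok g \<and> ip g g = 1}"
  have normalise: "\<exists>c. c > 0 \<and> ip (\<lambda>x. c * g x) (\<lambda>x. c * g x) = 1 \<and>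
      ip (conv r (\<lambda>x. c * g x)) (conv r (\<lambda>x. c * g x)) * ip g g = ip (conv r g) (conv r g)"
    if g: "uc g" "ip g g \<noteq> 0" for g
  proof -
    have pos: "ip g g > 0" using g ip_nonneg[OF g(1)] by simp
    define c where "c = 1 / sqrt (ip g g)"
    have c2: "c\<^sup>2 * ip g g = 1" using pos by (simp add: c_def power_divide)
    have "ip (conv r (\<lambda>x. c * g x)) (conv r (\<lambda>x. c * g x)) = ip (\<lambda>x. c * conv r g x) (\<lambda>x. c * conv r g x)"
      by (rule ip_cong) (simp_all add: conv_scale g(1))
    also have "\<dots> = c\<^sup>2 * ip (conv r g) (conv r g)" by (rule ip_scale_self[OF uc_conv[OF g(1)]])
    finally have "ip (conv r (\<lambda>x. c * g x)) (conv r (\<lambda>x. c * g x)) * ip g g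
        = (c\<^sup>2 * ip g g) * ip (conv r g) (conv r g)" by simp
    moreover have "c > 0" using pos by (simp add: c_def)
    ultimately show ?thesis using c2 ip_scale_self[OF g(1), of c] by (intro exI[of _ c]) simp
  qed
  have f_ok: "ok f" using f perp by (simp add: ok_def)
  have fnz: "ip f f \<noteq> 0" using conv_le[OF f] big by auto
  have V_bdd: "bdd_above V"
    unfolding V_def bdd_above_def using conv_le by (force simp: ok_def)
  \<comment> \<open>The squared norm of the convolution on the complement. The assumption that the
    claim fails at \<open>f\<close> makes it exceed \<delta>, so an eigenfunction for
    \<open>m\<close> would fall under the maximality.\<close>
  define m where "m = Sup V"
  have m_gt: "m > \<delta>"
  proof -
    obtain c where c: "ip (\<lambda>x. c * f x) (\<lambda>x. c * f x) = 1"
        "ip (conv r (\<lambda>x. c * f x)) (conv r (\<lambda>x. c * f x)) * ip f f = ip (conv r f) (conv r f)"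
      using normalise[OF f fnz] by blast
    have "ip (conv r (\<lambda>x. c * f x)) (conv r (\<lambda>x. c * f x)) \<in> V"
      unfolding V_def using ok_scale[OF f_ok] c(1) by blast
    then have "ip (conv r (\<lambda>x. c * f x)) (conv r (\<lambda>x. c * f x)) \<le> m"
      unfolding m_def using V_bdd by (rule cSup_upper)
    moreover have "\<delta> * ip f f < ip (conv r (\<lambda>x. c * f x)) (conv r (\<lambda>x. c * f x)) * ip f f"
      using big c(2) by simp
    then have "\<delta> < ip (conv r (\<lambda>x. c * f x)) (conv r (\<lambda>x. c * f x))"
      using ip_nonneg[OF f] by (simp add: mult_less_cancel_right)
    ultimately show ?thesis by simp
  qed
  have m0: "m > 0" using m_gt \<delta> by simp
  have hom: "ip (conv r g) (conv r g) \<le> m * ip g g" if g: "ok g" for g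
  proof (cases "ip g g = 0")
    case True
    then show ?thesis using conv_le[of g] g by (simp add: ok_def)
  next
    case False
    have ucg: "uc g" using g by (simp add: ok_def)
    obtain c where c: "ip (\<lambda>x. c * g x) (\<lambda>x. c * g x) = 1"
        "ip (conv r (\<lambda>x. c * g x)) (conv r (\<lambda>x. c * g x)) * ip g g = ip (conv r g) (conv r g)"
      using normalise[OF ucg False] by blast
    have "ip (conv r (\<lambda>x. c * g x)) (conv r (\<lambda>x. c * g x)) \<in> V"
      unfolding V_def using ok_scale[OF g] c(1) by blast
    then have "ip (conv r (\<lambda>x. c * g x)) (conv r (\<lambda>x. c * g x)) \<le> m"
      unfolding m_def using V_bdd by (rule cSup_upper)
    then have "ip (conv r (\<lambda>x. c * g x)) (conv r (\<lambda>x. c * g x)) * ip g g \<le> m * ip g g"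
      using ip_nonneg[OF ucg] by (rule mult_right_mono)
    then show ?thesis using c(2) by simp
  qed
  have "\<exists>g. ok g \<and> ip g g = 1 \<and> m - 1 / real (Suc k) < ip (conv r g) (conv r g)" for k
  proof -
    have "V \<noteq> {}"
    proof -
      obtain c where "ip (\<lambda>x. c * f x) (\<lambda>x. c * f x) = 1" using normalise[OF f fnz] by blast
      then show ?thesis unfolding V_def using ok_scale[OF f_ok] by blast
    qed
    moreover have "m - 1 / real (Suc k) < Sup V" by (simp add: m_def)
    ultimately obtain y where "y \<in> V" "m - 1 / real (Suc k) < y" using less_cSupE by metis
    then show ?thesis by (auto simp: V_def)
  qed
  then obtain F where F_ok: "\<And>k. ok (F k)" and F1: "\<And>k. ip (F k) (F k) = 1"
      and Fm: "\<And>k. m - 1 / real (Suc k) < ip (conv r (F k)) (conv r (F k))" by metis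
  have F: "uc (F k)" for k using F_ok by (simp add: ok_def)
  have bdd: "\<bar>conv r (F k) x\<bar> \<le> r" if "x \<in> G" for k x
    using conv_square_le[OF F that, of r k] r abs_le_square_iff[of "conv r (F k) x" r] by (simp add: F1)
  have lip: "\<bar>conv r (F k) x - conv r (F k) y\<bar> \<le> d x y" if "x \<in> G" "y \<in> G" for k x y
    using conv_lipschitz_square[OF F that, of r k] d_nonneg[OF that]
      abs_le_square_iff[of "conv r (F k) x - conv r (F k) y" "d x y"] by (simp add: F1)
  obtain s g where s: "strict_mono (s :: nat \<Rightarrow> nat)" and g_lip: "\<And>x y. x \<in> G \<Longrightarrow> y \<in> G \<Longrightarrow> \<bar>g x - g y\<bar> \<le> d x y"
      and g_lim: "\<And>e. e > 0 \<Longrightarrow> \<exists>N. \<forall>k\<ge>N. \<forall>x\<in>G. \<bar>conv r (F (s k)) x - g x\<bar> \<le> e"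
    using equicontinuous_subsequence[of "\<lambda>k. conv r (F k)" r] bdd lip by metis
  have g: "uc g" by (rule uc_lipschitz[where L = 1]) (simp add: g_lip)
  \<comment> \<open>The only possible limit of the maximising sequence: \<open>conv r (F k)\<close>
    tends to \<open>g\<close> along the subsequence, while \<open>conv r (conv r (F k))\<close>
    approaches \<open>m\<close> times \<open>F k\<close>.\<close>
  define w where "w = (\<lambda>x. (1 / m) * conv r g x)"
  have w: "uc w" unfolding w_def by (intro uc_scale uc_conv g)
  define \<Delta> where "\<Delta> = (\<lambda>k. ip (\<lambda>x. F (s k) x - w x) (\<lambda>x. F (s k) x - w x))"
  have \<Delta>_small: "\<exists>N. \<forall>k\<ge>N. \<Delta> k \<le> e" if e: "e > 0" for e
  proof -
    \<comment> \<open>Chosen so that applying the convolution, of norm at most \<open>r\<close>, and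
      dividing by \<open>m\<close> leaves \<open>sqrt (e / 4)\<close>. Two squared errors of
      \<open>e / 4\<close>, each doubled by \<open>ip_add_self_le\<close>, add up to
      \<open>e\<close>.\<close>
    define \<eta> where "\<eta> = sqrt (e / 4) * m / r"
    have \<eta>: "\<eta> > 0" using e m0 r by (simp add: \<eta>_def)
    obtain N1 where N1: "\<And>k x. k \<ge> N1 \<Longrightarrow> x \<in> G \<Longrightarrow> \<bar>conv r (F (s k)) x - g x\<bar> \<le> \<eta>"
      using g_lim[OF \<eta>] by blast
    obtain N2 where N2: "1 / real (Suc N2) < e * m / 4"
      using reals_Archimedean[of "e * m / 4"] e m0 by (auto simp: inverse_eq_divide)
    have "\<Delta> k \<le> e" if k: "k \<ge> max N1 N2" for k
    proof -
      let ?F = "F (s k)"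
      let ?B = "conv r (conv r ?F)"
      have B: "uc ?B" by (intro uc_conv F)
      have small1: "ip (\<lambda>x. ?F x - (1 / m) * ?B x) (\<lambda>x. ?F x - (1 / m) * ?B x) \<le> e / 4"
      proof -
        \<comment> \<open>The squared distance expands to
          \<open>1 - 2 a / m + ip ?B ?B / m^2\<close>. Since \<open>hom\<close> gives
          \<open>ip ?B ?B \<le> m a\<close>, at most \<open>(m - a) / m\<close> remains, which is
          small along a maximising sequence.\<close>
        define a where "a = ip (conv r ?F) (conv r ?F)"
        have "ip ?F (\<lambda>x. (1 / m) * ?B x) = (1 / m) * ip ?B ?F"
          using ip_sym[of ?F "\<lambda>x. (1 / m) * ?B x"] by (simp only: ip_scale_left[OF B F])
        also have "ip ?B ?F = a" unfolding a_def by (rule conv_selfadjoint[OF uc_conv[OF F] F r])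
        finally have 1: "ip ?F (\<lambda>x. (1 / m) * ?B x) = (1 / m) * a" .
        have "ip ?B ?B \<le> m * a" unfolding a_def by (rule hom[OF ok_conv[OF F_ok]])
        then have "(1 / m)\<^sup>2 * ip ?B ?B \<le> (1 / m)\<^sup>2 * (m * a)" by (rule mult_left_mono) simp
        also have "\<dots> = (1 / m) * a" using m0 by (simp add: power2_eq_square)
        finally have 2: "(1 / m)\<^sup>2 * ip ?B ?B \<le> (1 / m) * a" .
        have "ip (\<lambda>x. ?F x - (1 / m) * ?B x) (\<lambda>x. ?F x - (1 / m) * ?B x)
            = 1 - 2 * ((1 / m) * a) + (1 / m)\<^sup>2 * ip ?B ?B"
          by (simp only: ip_diff_self[OF F uc_scale[OF B]] ip_scale_self[OF B] 1 F1)
        also have "\<dots> \<le> 1 - (1 / m) * a" using 2 by linarith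
        also have "\<dots> = (1 / m) * (m - a)" using m0 by (simp add: right_diff_distrib)
        also have "\<dots> \<le> (1 / m) * (e * m / 4)"
        proof (rule mult_left_mono)
          have "k \<le> s k" by (rule strict_mono_imp_increasing[OF s])
          then have "1 / real (Suc (s k)) \<le> 1 / real (Suc N2)" using k by (simp add: frac_le)
          then show "m - a \<le> e * m / 4" using Fm[of "s k"] N2 unfolding a_def by linarith
        qed (use m0 in simp)
        also have "\<dots> = e / 4" using m0 by simp
        finally show ?thesis .
      qed
      have small2: "ip (\<lambda>x. (1 / m) * ?B x - w x) (\<lambda>x. (1 / m) * ?B x - w x) \<le> e / 4"
      proof -
        have "\<bar>(1 / m) * ?B x - w x\<bar> \<le> sqrt (e / 4)" if x: "x \<in> G" for x
        proof -
          have "(conv r (\<lambda>y. conv r ?F y - g y) x)\<^sup>2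
              \<le> r\<^sup>2 * ip (\<lambda>y. conv r ?F y - g y) (\<lambda>y. conv r ?F y - g y)"
            using r by (intro conv_square_le uc_diff uc_conv F g x) simp
          also have "\<dots> \<le> r\<^sup>2 * \<eta>\<^sup>2"
            using N1[of k] k by (intro mult_left_mono ip_le uc_diff uc_conv F g) auto
          finally have "(?B x - conv r g x)\<^sup>2 \<le> (r * \<eta>)\<^sup>2"
            by (simp add: conv_diff uc_conv F g x power_mult_distrib)
          then have "\<bar>?B x - conv r g x\<bar> \<le> r * \<eta>"
            using abs_le_square_iff[of "?B x - conv r g x" "r * \<eta>"] r \<eta> by simp
          moreover have "(1 / m) * ?B x - w x = (1 / m) * (?B x - conv r g x)"
            unfolding w_def by (simp add: right_diff_distrib)
          ultimately have "\<bar>(1 / m) * ?B x - w x\<bar> \<le> (1 / m) * (r * \<eta>)"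
            using m0 by (simp add: abs_mult divide_right_mono)
          also have "\<dots> = sqrt (e / 4)" using m0 r by (simp add: \<eta>_def)
          finally show ?thesis .
        qed
        then have "ip (\<lambda>x. (1 / m) * ?B x - w x) (\<lambda>x. (1 / m) * ?B x - w x) \<le> (sqrt (e / 4))\<^sup>2"
          by (intro ip_le uc_diff uc_scale B w)
        then show ?thesis using e by simp
      qed
      have "\<Delta> k \<le> 2 * ip (\<lambda>x. ?F x - (1 / m) * ?B x) (\<lambda>x. ?F x - (1 / m) * ?B x)
          + 2 * ip (\<lambda>x. (1 / m) * ?B x - w x) (\<lambda>x. (1 / m) * ?B x - w x)"
        using ip_add_self_le[OF uc_diff[OF F uc_scale[OF B, of "1 / m"]] uc_diff[OF uc_scale[OF B, of "1 / m"] w], of "s k"]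
        unfolding \<Delta>_def by simp
      then show ?thesis using small1 small2 by linarith
    qed
    then show ?thesis by blast
  qed
  have small_zero: "z = 0" if z: "\<And>k. z\<^sup>2 \<le> c * \<Delta> k" and c: "c \<ge> 0" for z c :: real
  proof (rule ccontr)
    assume "z \<noteq> 0"
    then have z2: "z\<^sup>2 > 0" by simp
    then have "z\<^sup>2 / (c + 1) > 0" using c by simp
    then obtain N where "\<Delta> N \<le> z\<^sup>2 / (c + 1)" using \<Delta>_small by blast
    then have "c * \<Delta> N \<le> c * (z\<^sup>2 / (c + 1))" using c by (rule mult_left_mono)
    also have "\<dots> < z\<^sup>2" using c z2 by (simp add: field_simps)
    finally show False using z[of N] by simp
  qed
  have ucd: "uc (\<lambda>x. F (s k) x - w x)" for k by (intro uc_diff F w)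
  have conv_w: "conv r w x = g x" if x: "x \<in> G" for x
  proof -
    have "(\<lambda>k. conv r (F (s k)) x) \<longlonglongrightarrow> g x"
    proof (rule LIMSEQ_I)
      fix e :: real assume "e > 0"
      then obtain N where "\<forall>k\<ge>N. \<forall>x\<in>G. \<bar>conv r (F (s k)) x - g x\<bar> \<le> e / 2" using g_lim[of "e / 2"] by auto
      then show "\<exists>N. \<forall>k\<ge>N. norm (conv r (F (s k)) x - g x) < e"
        using x \<open>e > 0\<close> by (intro exI[of _ N]) fastforce
    qed
    moreover have "(\<lambda>k. conv r (F (s k)) x) \<longlonglongrightarrow> conv r w x"
    proof (rule LIMSEQ_I)
      fix e :: real assume e: "e > 0"
      have "(e / (2 * r))\<^sup>2 > 0" using e r by simp
      then obtain N where N: "\<And>k. k \<ge> N \<Longrightarrow> \<Delta> k \<le> (e / (2 * r))\<^sup>2" using \<Delta>_small by blast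
      have "norm (conv r (F (s k)) x - conv r w x) < e" if k: "k \<ge> N" for k
      proof -
        have "(conv r (F (s k)) x - conv r w x)\<^sup>2 = (conv r (\<lambda>y. F (s k) y - w y) x)\<^sup>2"
          by (simp add: conv_diff F w x)
        also have "\<dots> \<le> r\<^sup>2 * \<Delta> k" unfolding \<Delta>_def using r by (intro conv_square_le ucd x) simp
        also have "\<dots> \<le> r\<^sup>2 * (e / (2 * r))\<^sup>2" using N[OF k] by (rule mult_left_mono) simp
        also have "\<dots> = (e / 2)\<^sup>2" using r by (simp add: power_divide power_mult_distrib)
        finally show ?thesis
          using abs_le_square_iff[of "conv r (F (s k)) x - conv r w x" "e / 2"] e by simp
      qed
      then show "\<exists>N. \<forall>k\<ge>N. norm (conv r (F (s k)) x - conv r w x) < e" by blast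
    qed
    ultimately show ?thesis using LIMSEQ_unique by blast
  qed
  have Bw: "conv r (conv r w) x = m * w x" if "x \<in> G" for x
  proof -
    have "conv r (conv r w) x = conv r g x" by (rule conv_cong) (rule conv_w)
    then show ?thesis using m0 by (simp add: w_def)
  qed
  have wu: "ip w (u i) = 0" if i: "i < n" for i
  proof (rule small_zero)
    fix k
    have "ip (\<lambda>x. F (s k) x - w x) (u i) = - ip w (u i)"
      using ip_diff_left[OF F w u(1)[OF i]] F_ok i by (simp add: ok_def)
    then show "(ip w (u i))\<^sup>2 \<le> 1 * \<Delta> k"
      using Cauchy_Schwarz[OF ucd[of k] u(1)[OF i]] u(4)[OF i i] unfolding \<Delta>_def by simp
  qed simp
  \<comment> \<open>The eigenvalue \<open>m\<close> exceeds \<delta>, so \<open>w\<close> lies in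
    the span of the family; being orthogonal to it, \<open>w\<close> vanishes. But \<open>w\<close>
    approximates functions of norm 1 in mean square.\<close>
  have "w x = 0" if x: "x \<in> G" for x
    using eigenfunction_in_span[OF r \<delta> fam w less_imp_le[OF m_gt] Bw x] wu by simp
  then have "ip (\<lambda>x. F (s k) x - w x) (\<lambda>x. F (s k) x - w x) = ip (F (s k)) (F (s k))" for k
    by (intro ip_cong) auto
  then have "\<Delta> k = 1" for k by (simp add: \<Delta>_def F1)
  then show False using \<Delta>_small[of "1/2"] by auto
qed

text \<open>The tent minus its projection to the eigenfunctions is only bounded; one more
  convolution makes the remainder small, by the spectral gap. This is why the convolution square of
  the tent is approximated and not the tent.\<close>

lemma finite_dim_approximation:
  assumes r: "r > 0" and \<kappa>: "\<kappa> > 0"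
  shows "\<exists>(n :: nat) (p :: nat \<Rightarrow> 'g \<Rightarrow> real) b. (\<forall>i<n. uc (p i)) \<and>
    (\<forall>i<n. \<forall>t\<in>G. \<exists>c. \<forall>x\<in>G. p i (t \<cdot> x) = (\<Sum>j<n. c j * p j x)) \<and>
    ip (\<lambda>x. conv r (ker r one) x - (\<Sum>i<n. b i * p i x))
       (\<lambda>x. conv r (ker r one) x - (\<Sum>i<n. b i * p i x)) \<le> \<kappa>"
proof -
  \<comment> \<open>The remainder before convolution has squared norm at most \<open>r^2\<close>, so
    a spectral gap \<delta> leaves \<open>\<delta> * r^2 = \<kappa>\<close>.\<close>
  define \<delta> where "\<delta> = \<kappa> / r\<^sup>2"
  have \<delta>: "\<delta> > 0" using r \<kappa> by (simp add: \<delta>_def)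
  obtain n u lam where fam: "max_eigen_family r \<delta> n u lam" using max_eigen_family_exists[OF r \<delta>] by blast
  then have famE: "eigen_family r \<delta> n u lam" by (simp add: max_eigen_family_def)
  note u = eigen_family_D[OF famE]
  define k where "k = ker r one"
  have k: "uc k" unfolding k_def by (rule uc_ker[OF one_closed])
  define q where "q = (\<lambda>x. \<Sum>i<n. ip k (u i) * u i x)"
  note oe = ortho_expansion[OF u(5,6) k, folded q_def]
  have "ip (conv r (\<lambda>x. k x - q x)) (conv r (\<lambda>x. k x - q x)) \<le> \<delta> * ip (\<lambda>x. k x - q x) (\<lambda>x. k x - q x)"
  proof (rule spectral_gap[OF r \<delta> fam uc_diff[OF k oe(1)]])
    show "ip (\<lambda>x. k x - q x) (u i) = 0" if "i < n" for i
      using ip_diff_left[OF k oe(1) u(1)[OF that]] oe(2)[OF that] by simp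
  qed
  also have "\<dots> \<le> \<delta> * r\<^sup>2"
  proof (rule mult_left_mono)
    have "ip (\<lambda>x. k x - q x) (\<lambda>x. k x - q x) = ip k k - (\<Sum>i<n. (ip k (u i))\<^sup>2)"
      using ortho_expansion(3)[OF u(5,6) k] by (simp add: q_def)
    then have "ip (\<lambda>x. k x - q x) (\<lambda>x. k x - q x) \<le> ip k k" by (simp add: sum_nonneg)
    also have "\<dots> \<le> r\<^sup>2" unfolding k_def using r by (intro ip_ker_le one_closed) simp
    finally show "ip (\<lambda>x. k x - q x) (\<lambda>x. k x - q x) \<le> r\<^sup>2" .
  qed (use \<delta> in simp)
  also have "\<dots> = \<kappa>" using r by (simp add: \<delta>_def)
  finally have "ip (conv r (\<lambda>x. k x - q x)) (conv r (\<lambda>x. k x - q x)) \<le> \<kappa>" .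
  moreover have "conv r (\<lambda>x. k x - q x) x = conv r k x - (\<Sum>i<n. ip k (u i) * conv r (u i) x)" if x: "x \<in> G" for x
  proof -
    have "conv r q x = (\<Sum>i<n. ip k (u i) * conv r (u i) x)"
      unfolding q_def using u(1) x by (intro conv_sum) auto
    then show ?thesis using conv_diff[OF k oe(1) x, of r] by simp
  qed
  then have "ip (conv r (\<lambda>x. k x - q x)) (conv r (\<lambda>x. k x - q x))
      = ip (\<lambda>x. conv r k x - (\<Sum>i<n. ip k (u i) * conv r (u i) x))
           (\<lambda>x. conv r k x - (\<Sum>i<n. ip k (u i) * conv r (u i) x))"
    by (intro ip_cong) auto
  ultimately have approx: "ip (\<lambda>x. conv r k x - (\<Sum>i<n. ip k (u i) * conv r (u i) x))
           (\<lambda>x. conv r k x - (\<Sum>i<n. ip k (u i) * conv r (u i) x)) \<le> \<kappa>" by simp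
  \<comment> \<open>A left translate of \<open>u i\<close> is an eigenfunction for the same
    \<open>lam i\<close>, hence in the span of the maximal family; convolving the expansion gives
    the claim.\<close>
  have inv: "\<exists>c. \<forall>x\<in>G. conv r (u i) (t \<cdot> x) = (\<Sum>j<n. c j * conv r (u j) x)"
    if i: "i < n" and t: "t \<in> G" for i t
  proof -
    define v where "v = (\<lambda>x. u i (t \<cdot> x))"
    have v: "uc v" unfolding v_def by (rule uc_left[OF u(1)[OF i] t])
    have cv: "conv r v x = conv r (u i) (t \<cdot> x)" if "x \<in> G" for x
      unfolding v_def by (rule conv_left[OF u(1)[OF i] t that])
    have eig: "conv r (conv r v) x = lam i * v x" if x: "x \<in> G" for x
    proof -
      have "conv r (conv r v) x = conv r (\<lambda>y. conv r (u i) (t \<cdot> y)) x" by (rule conv_cong) (rule cv)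
      also have "\<dots> = conv r (conv r (u i)) (t \<cdot> x)" by (rule conv_left[OF uc_conv[OF u(1)[OF i]] t x])
      also have "\<dots> = lam i * v x" using u(3)[OF i mul_closed[OF t x]] by (simp add: v_def)
      finally show ?thesis .
    qed
    have v_eq: "v x = (\<Sum>j<n. ip v (u j) * u j x)" if "x \<in> G" for x
      by (rule eigenfunction_in_span[OF r \<delta> fam v u(2)[OF i] eig that])
    have "conv r (u i) (t \<cdot> x) = (\<Sum>j<n. ip v (u j) * conv r (u j) x)" if x: "x \<in> G" for x
    proof -
      have "conv r (u i) (t \<cdot> x) = conv r (\<lambda>x. \<Sum>j<n. ip v (u j) * u j x) x"
        unfolding cv[OF x, symmetric] by (rule conv_cong) (rule v_eq)
      also have "\<dots> = (\<Sum>j<n. ip v (u j) * conv r (u j) x)" using u(1) x by (intro conv_sum) auto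
      finally show ?thesis .
    qed
    then show ?thesis by (intro exI[of _ "\<lambda>j. ip v (u j)"]) simp
  qed
  show ?thesis
  proof (rule exI[of _ n], rule exI[of _ "\<lambda>i. conv r (u i)"], rule exI[of _ "\<lambda>i. ip k (u i)"], intro conjI)
    show "\<forall>i<n. uc (conv r (u i))" using uc_conv[OF u(1)] by blast
    show "\<forall>i<n. \<forall>t\<in>G. \<exists>c. \<forall>x\<in>G. conv r (u i) (t \<cdot> x) = (\<Sum>j<n. c j * conv r (u j) x)"
      using inv by blast
    show "ip (\<lambda>x. conv r (ker r one) x - (\<Sum>i<n. ip k (u i) * conv r (u i) x))
        (\<lambda>x. conv r (ker r one) x - (\<Sum>i<n. ip k (u i) * conv r (u i) x)) \<le> \<kappa>"
      using approx by (simp add: k_def)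
  qed
qed

text \<open>Two tents of radius \<open>r\<close> with centres at least \<open>2 * r\<close> apart
  have product zero. At \<open>one\<close> they coincide, which makes the value there, and then the
  mean, strictly positive.\<close>

lemma mollifier:
  assumes r: "r > 0"
  shows "uc (conv r (ker r one))" "\<And>x. x \<in> G \<Longrightarrow> 0 \<le> conv r (ker r one) x"
    "\<And>x. x \<in> G \<Longrightarrow> d x one \<ge> 2 * r \<Longrightarrow> conv r (ker r one) x = 0"
    "mean (conv r (ker r one)) > 0"
proof -
  have uk: "uc (ker r one)" by (rule uc_ker[OF one_closed])
  show u: "uc (conv r (ker r one))" by (rule uc_conv[OF uk])
  show pos: "0 \<le> conv r (ker r one) x" if "x \<in> G" for x
    unfolding conv_def ip_def by (intro mean_nonneg uc_mult uc_ker that one_closed) (simp add: ker_def)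
  show "conv r (ker r one) x = 0" if x: "x \<in> G" "d x one \<ge> 2 * r" for x
  proof -
    have "ker r x y * ker r one y = 0" if y: "y \<in> G" for y
    proof -
      have "r \<le> d x y \<or> r \<le> d one y"
        using d_triangle[OF x(1) y one_closed] d_sym[OF y one_closed] x(2) by linarith
      then show ?thesis by (auto simp: ker_def max_def)
    qed
    then have "conv r (ker r one) x = mean (\<lambda>_. 0)" unfolding conv_def ip_def by (rule mean_cong)
    then show ?thesis by (simp add: mean_const)
  qed
  have "conv r (ker r one) one > 0"
    unfolding conv_def ip_def using r
    by (intro mean_pos[where g = one] uc_mult uk one_closed) (simp_all add: ker_def d_refl one_closed)
  then show "mean (conv r (ker r one)) > 0" using pos by (intro mean_pos[OF u _ one_closed]) auto
qed

end

section \<open>Finite-dimensional invariant subspaces\<close>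

context compact_operator_group
begin

text \<open>Zero is inserted because \<open>Sup {}\<close> is unspecified on the reals, and \<open>B\<close> may be empty.\<close>

definition opdist_set :: "'a set \<Rightarrow> ('a \<Rightarrow> 'a) \<Rightarrow> ('a \<Rightarrow> 'a) \<Rightarrow> real set" where
  "opdist_set B g h = insert 0 {norm (s (g (t b)) - s (h (t b))) |s t b. s \<in> G \<and> t \<in> G \<and> b \<in> B}"

text \<open>The outer \<open>s\<close> forces left invariance although \<open>G\<close> need not act
  isometrically, and the inner \<open>t\<close> forces right invariance by letting \<open>b\<close>
  run through its whole orbit.\<close>

definition opdist :: "'a set \<Rightarrow> ('a \<Rightarrow> 'a) \<Rightarrow> ('a \<Rightarrow> 'a) \<Rightarrow> real" where
  "opdist B g h = Sup (opdist_set B g h)"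

lemma G_diff: "g \<in> G \<Longrightarrow> g (x - y) = g x - g y"
  using G_linear bounded_linear.linear linear_diff by blast

lemma G_add: "g \<in> G \<Longrightarrow> g (x + y) = g x + g y"
  using G_linear bounded_linear.linear linear_add by blast

lemma G_scaleC: "g \<in> G \<Longrightarrow> g (c *\<^sub>C x) = c *\<^sub>C g x"
  using G_ops ops_scaleC by (metis subsetD)

lemma e_apply: "g \<in> G \<Longrightarrow> e (g x) = g x" "g \<in> G \<Longrightarrow> g (e x) = g x"
  using e_left e_right by (metis comp_apply)+

lemma opdist_set_bdd:
  assumes B: "finite B" and g: "g \<in> G" and h: "h \<in> G"
  shows "bdd_above (opdist_set B g h)"
proof -
  obtain C where C: "C > 0" "\<And>g x. g \<in> G \<Longrightarrow> norm (g x) \<le> C * norm x" using G_bounded by blast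
  have bound: "norm (s (g (t b))) \<le> C * (C * (C * (\<Sum>b\<in>B. norm b)))" if "s \<in> G" "g \<in> G" "t \<in> G" "b \<in> B" for s g t b
  proof -
    have "norm (s (g (t b))) \<le> C * norm (g (t b))" by (rule C(2)[OF that(1)])
    also have "\<dots> \<le> C * (C * norm (t b))" using C(1) by (intro mult_left_mono C(2) that) auto
    also have "\<dots> \<le> C * (C * (C * norm b))" using C(1) by (intro mult_left_mono C(2) that) auto
    also have "\<dots> \<le> C * (C * (C * (\<Sum>b\<in>B. norm b)))"
      using C(1) B that(4) by (intro mult_left_mono member_le_sum) auto
    finally show ?thesis .
  qed
  let ?M = "C * (C * (C * (\<Sum>b\<in>B. norm b)))"
  have "z \<le> 2 * ?M" if z: "z \<in> opdist_set B g h" for z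
  proof (cases "z = 0")
    case True
    then show ?thesis using C(1) by (simp add: sum_nonneg)
  next
    case False
    then obtain s t b where "s \<in> G" "t \<in> G" "b \<in> B" "z = norm (s (g (t b)) - s (h (t b)))"
      using z by (auto simp: opdist_set_def)
    then show ?thesis
      using norm_triangle_ineq4[of "s (g (t b))" "s (h (t b))"] bound[of s g t b] bound[of s h t b] g h by linarith
  qed
  then show ?thesis by (auto simp: bdd_above_def)
qed

lemma opdist_upper:
  assumes "finite B" "g \<in> G" "h \<in> G" "s \<in> G" "t \<in> G" "b \<in> B"
  shows "norm (s (g (t b)) - s (h (t b))) \<le> opdist B g h"
  unfolding opdist_def using assms
  by (intro cSup_upper opdist_set_bdd) (auto simp: opdist_set_def)

lemma opdist_nonneg: "finite B \<Longrightarrow> g \<in> G \<Longrightarrow> h \<in> G \<Longrightarrow> 0 \<le> opdist B g h"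
  unfolding opdist_def by (intro cSup_upper opdist_set_bdd) (auto simp: opdist_set_def)

lemma opdist_least:
  assumes "0 \<le> c" "\<And>s t b. s \<in> G \<Longrightarrow> t \<in> G \<Longrightarrow> b \<in> B \<Longrightarrow> norm (s (g (t b)) - s (h (t b))) \<le> c"
  shows "opdist B g h \<le> c"
  unfolding opdist_def opdist_set_def using assms by (intro cSup_least) auto

lemma opdist_ge: "finite B \<Longrightarrow> g \<in> G \<Longrightarrow> h \<in> G \<Longrightarrow> b \<in> B \<Longrightarrow> norm (g b - h b) \<le> opdist B g h"
  using opdist_upper[OF _ _ _ e_G e_G, of B g h b] by (simp add: e_apply)

text \<open>Finitely many representatives approximate the orbits of \<open>B\<close>, giving a
  finite set \<open>Y\<close> of test vectors. The signature of \<open>g\<close> records the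
  representative of \<open>g y\<close> for each \<open>y\<close> in \<open>Y\<close>; there are
  finitely many signatures, and equal ones force a small distance.\<close>

lemma opdist_precompact:
  assumes B: "finite B" and \<epsilon>: "\<epsilon> > 0"
  shows "\<exists>A. finite A \<and> A \<subseteq> G \<and> (\<forall>g\<in>G. \<exists>a\<in>A. opdist B g a < \<epsilon>)"
proof -
  obtain C where C: "C > 0" "\<And>g x. g \<in> G \<Longrightarrow> norm (g x) \<le> C * norm x" using G_bounded by blast
  \<comment> \<open>Replacing \<open>t b\<close> by a test vector costs \<open>C * \<eta>\<close>
    for each of \<open>g\<close> and \<open>a\<close>, equal signatures cost
    \<open>2 * \<eta>\<close>, and the outer operator contributes a factor \<open>C\<close>. The
    total \<open>C * (2 * C + 2) * \<eta>\<close> is strictly below \<epsilon>.\<close>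
  define \<eta> where "\<eta> = \<epsilon> / (2 * (C * (2 * C + 1)))"
  have \<eta>: "\<eta> > 0" using \<epsilon> C(1) by (simp add: \<eta>_def)
  define good where "good = (\<lambda>x T \<phi>. finite T \<and> T \<subseteq> G \<and> (\<forall>t\<in>G. \<phi> t \<in> T \<and> norm (t x - \<phi> t x) \<le> \<eta>)
      \<and> (\<forall>t\<in>G. \<forall>t'\<in>G. \<phi> t = \<phi> t' \<longrightarrow> norm (t x - t' x) \<le> 2 * \<eta>))"
  have "\<exists>T \<phi>. good x T \<phi>" for x
  proof -
    from G_finite_cover[OF \<eta>, of x] obtain \<P> where \<P>: "finite \<P>" "G \<subseteq> \<Union>\<P>"
        "\<forall>P\<in>\<P>. \<forall>g\<in>P \<inter> G. \<forall>h\<in>P \<inter> G. norm (g x - h x) \<le> \<eta>"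
      by (elim exE conjE)
    define rep where "rep = (\<lambda>P. SOME g. g \<in> P \<inter> G)"
    have rep: "rep P \<in> P \<inter> G" if "P \<inter> G \<noteq> {}" for P
      unfolding rep_def using that by (rule some_in_eq[THEN iffD2])
    have "\<forall>t\<in>G. \<exists>P. P \<in> \<P> \<and> t \<in> P" using \<P>(2) by blast
    then obtain pc where "\<forall>t\<in>G. pc t \<in> \<P> \<and> t \<in> pc t" unfolding bchoice_iff by blast
    then have pc: "\<And>t. t \<in> G \<Longrightarrow> pc t \<in> \<P>" "\<And>t. t \<in> G \<Longrightarrow> t \<in> pc t" by auto
    define \<phi> where "\<phi> = (\<lambda>t. rep (pc t))"
    have \<phi>: "\<phi> t \<in> pc t \<inter> G" if "t \<in> G" for t
      unfolding \<phi>_def using pc(2)[OF that] that by (intro rep) auto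
    have near: "norm (t x - \<phi> t x) \<le> \<eta>" if "t \<in> G" for t
      using \<P>(3)[rule_format, OF pc(1)[OF that] _ \<phi>[OF that]] pc(2)[OF that] that by auto
    have "norm (t x - t' x) \<le> 2 * \<eta>" if "t \<in> G" "t' \<in> G" "\<phi> t = \<phi> t'" for t t'
      using norm_triangle_ineq4[of "t x - \<phi> t x" "t' x - \<phi> t' x"] near[OF that(1)] near[OF that(2)] that(3)
      by simp
    moreover have "finite (\<phi> ` G)"
    proof (rule finite_subset)
      show "\<phi> ` G \<subseteq> rep ` \<P>" using pc(1) by (auto simp: \<phi>_def)
    qed (use \<P>(1) in simp)
    moreover have "\<phi> ` G \<subseteq> G" using \<phi> by blast
    ultimately have "good x (\<phi> ` G) \<phi>" using near by (simp add: good_def)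
    then show ?thesis by (intro exI)
  qed
  then have "\<forall>x. \<exists>T \<phi>. good x T \<phi>" by (rule allI)
  then obtain T \<phi> where "\<And>x. good x (T x) (\<phi> x)" unfolding choice_iff by auto
  then have T: "\<And>x. finite (T x)" "\<And>x. T x \<subseteq> G"
      and \<phi>: "\<And>x t. t \<in> G \<Longrightarrow> \<phi> x t \<in> T x" "\<And>x t. t \<in> G \<Longrightarrow> norm (t x - \<phi> x t x) \<le> \<eta>"
        "\<And>x t t'. t \<in> G \<Longrightarrow> t' \<in> G \<Longrightarrow> \<phi> x t = \<phi> x t' \<Longrightarrow> norm (t x - t' x) \<le> 2 * \<eta>"
    unfolding good_def by auto
  define Y where "Y = (\<Union>b\<in>B. (\<lambda>t. t b) ` T b)"
  have Y: "finite Y" unfolding Y_def using B T(1) by blast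
  define sig where "sig = (\<lambda>g. restrict (\<lambda>y. \<phi> y g) Y)"
  have "sig ` G \<subseteq> (\<Pi>\<^sub>E y\<in>Y. T y)" using \<phi>(1) by (auto simp: sig_def)
  then have fin: "finite (sig ` G)" by (rule finite_subset) (intro finite_PiE Y T(1))
  define rep where "rep = (\<lambda>\<sigma>. SOME g. g \<in> G \<and> sig g = \<sigma>)"
  have rep: "rep (sig g) \<in> G" "sig (rep (sig g)) = sig g" if "g \<in> G" for g
    unfolding rep_def using someI[of "\<lambda>h. h \<in> G \<and> sig h = sig g" g] that by auto
  have "opdist B g (rep (sig g)) < \<epsilon>" if g: "g \<in> G" for g
  proof -
    define a where "a = rep (sig g)"
    have a: "a \<in> G" "sig a = sig g" using rep[OF g] by (simp_all add: a_def)
    have "opdist B g a \<le> C * ((2 * C + 2) * \<eta>)"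
    proof (rule opdist_least)
      show "0 \<le> C * ((2 * C + 2) * \<eta>)" using C(1) \<eta> by simp
      fix s t b assume st: "s \<in> G" "t \<in> G" "b \<in> B"
      define y where "y = \<phi> b t b"
      have "y \<in> Y" unfolding y_def Y_def using st \<phi>(1) by blast
      then have "\<phi> y g = \<phi> y a" using a(2) unfolding sig_def by (metis restrict_apply')
      then have 1: "norm (g y - a y) \<le> 2 * \<eta>" by (rule \<phi>(3)[OF g a(1)])
      have ty: "norm (t b - y) \<le> \<eta>" unfolding y_def by (rule \<phi>(2)[OF st(2)])
      have 2: "norm (k (t b) - k y) \<le> C * \<eta>" if "k \<in> G" for k
        using order_trans[OF C(2)[OF that] mult_left_mono[OF ty less_imp_le[OF C(1)]]] G_diff[OF that, of "t b" y]
        by simp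
      have "g (t b) - a (t b) = (g (t b) - g y) + (g y - a y) - (a (t b) - a y)" by simp
      also have "norm \<dots> \<le> norm (g (t b) - g y) + norm (g y - a y) + norm (a (t b) - a y)"
        using norm_triangle_ineq4[of "(g (t b) - g y) + (g y - a y)" "a (t b) - a y"]
          norm_triangle_ineq[of "g (t b) - g y" "g y - a y"] by linarith
      also have "\<dots> \<le> (2 * C + 2) * \<eta>" using 1 2[OF g] 2[OF a(1)] by (simp add: algebra_simps)
      finally have "norm (g (t b) - a (t b)) \<le> (2 * C + 2) * \<eta>" .
      then have "C * norm (g (t b) - a (t b)) \<le> C * ((2 * C + 2) * \<eta>)" using C(1) by simp
      then show "norm (s (g (t b)) - s (a (t b))) \<le> C * ((2 * C + 2) * \<eta>)"
        using C(2)[OF st(1), of "g (t b) - a (t b)"] G_diff[OF st(1)] by simp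
    qed
    also have "\<dots> < C * ((4 * C + 2) * \<eta>)" using C(1) \<eta> by simp
    also have "\<dots> = \<epsilon>"
    proof -
      have "C * (2 * C + 1) \<noteq> 0" using C(1) by simp
      then show ?thesis by (simp add: \<eta>_def field_simps)
    qed
    finally show ?thesis by (simp add: a_def)
  qed
  then show ?thesis
    using fin rep(1) by (intro exI[of _ "rep ` sig ` G"]) auto
qed

text \<open>A translating element is absorbed into the outer or inner operator of the supremum,
  which gives one inequality; the same for its inverse gives equality.\<close>

lemma precompact_group_opdist:
  assumes B: "finite B"
  shows "precompact_group G (\<circ>) e (opdist B)"
proof -
  have left_le: "opdist B (s \<circ> x) (s \<circ> y) \<le> opdist B x y" if "s \<in> G" "x \<in> G" "y \<in> G" for s x y
  proof (rule opdist_least)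
    show "0 \<le> opdist B x y" by (rule opdist_nonneg[OF B that(2,3)])
    show "norm (u ((s \<circ> x) (t b)) - u ((s \<circ> y) (t b))) \<le> opdist B x y" if "u \<in> G" "t \<in> G" "b \<in> B" for u t b
      using opdist_upper[OF B \<open>x \<in> G\<close> \<open>y \<in> G\<close> G_mult[OF that(1) \<open>s \<in> G\<close>] that(2,3)] by simp
  qed
  have right_le: "opdist B (x \<circ> s) (y \<circ> s) \<le> opdist B x y" if "s \<in> G" "x \<in> G" "y \<in> G" for s x y
  proof (rule opdist_least)
    show "0 \<le> opdist B x y" by (rule opdist_nonneg[OF B that(2,3)])
    show "norm (u ((x \<circ> s) (t b)) - u ((y \<circ> s) (t b))) \<le> opdist B x y" if "u \<in> G" "t \<in> G" "b \<in> B" for u t b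
      using opdist_upper[OF B \<open>x \<in> G\<close> \<open>y \<in> G\<close> that(1) G_mult[OF \<open>s \<in> G\<close> that(2)] that(3)] by simp
  qed
  show ?thesis
  proof
    fix x y z s assume x: "x \<in> G"
    show "opdist B x x = 0"
      using opdist_nonneg[OF B x x] opdist_least[of 0 B x x] by force
    assume y: "y \<in> G"
    show "opdist B x y = opdist B y x"
      unfolding opdist_def opdist_set_def by (simp add: norm_minus_commute)
    show "opdist B x z \<le> opdist B x y + opdist B y z" if z: "z \<in> G"
    proof (rule opdist_least)
      show "0 \<le> opdist B x y + opdist B y z" using opdist_nonneg[OF B] x y z by simp
      show "norm (u (x (t b)) - u (z (t b))) \<le> opdist B x y + opdist B y z"
        if "u \<in> G" "t \<in> G" "b \<in> B" for u t b
        using norm_triangle_ineq[of "u (x (t b)) - u (y (t b))" "u (y (t b)) - u (z (t b))"]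
          opdist_upper[OF B x y that] opdist_upper[OF B y z that] by simp
    qed
  next
    fix s x y assume s: "s \<in> G" and x: "x \<in> G" and y: "y \<in> G"
    obtain t where t: "t \<in> G" "t \<circ> s = e" using G_left_inverse[OF s] by blast
    have "opdist B (t \<circ> (s \<circ> x)) (t \<circ> (s \<circ> y)) = opdist B x y"
      by (simp add: o_assoc t(2) e_left x y)
    then show "opdist B (s \<circ> x) (s \<circ> y) = opdist B x y"
      using left_le[OF s x y] left_le[OF t(1) G_mult[OF s x] G_mult[OF s y]] by simp
    obtain t' where t': "t' \<in> G" "t' \<circ> t = e" using G_left_inverse[OF t(1)] by blast
    have "s = t'" using t(2) t'(2) e_left[OF s] e_right[OF t'(1)] by (metis o_assoc)
    then have st: "s \<circ> t = e" using t'(2) by simp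
    have "opdist B ((x \<circ> s) \<circ> t) ((y \<circ> s) \<circ> t) = opdist B x y"
      by (simp add: o_assoc[symmetric] st e_right x y)
    then show "opdist B (x \<circ> s) (y \<circ> s) = opdist B x y"
      using right_le[OF s x y] right_le[OF t(1) G_mult[OF x s] G_mult[OF y s]] by simp
  qed (use G_mult e_G e_left e_right G_left_inverse opdist_precompact[OF B] in \<open>auto simp: o_assoc\<close>)
qed

definition invariant_subspace :: "'a set \<Rightarrow> bool" where
  "invariant_subspace V \<longleftrightarrow> (\<exists>B. finite B \<and> V = cspace.span B) \<and> (\<forall>x\<in>V. e x = x) \<and> (\<forall>g\<in>G. g ` V \<subseteq> V)"

lemma G_span:
  assumes g: "g \<in> G" and W: "cspace.subspace W" and B: "\<And>b. b \<in> B \<Longrightarrow> g b \<in> W" and x: "x \<in> cspace.span B"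
  shows "g x \<in> W"
  using x
proof (induction rule: cspace.span_induct_alt)
  case base
  then show ?case
    using linear_0[OF bounded_linear.linear[OF G_linear[OF g]]] cspace.subspace_0[OF W] by simp
next
  case (step c b y)
  have "g (c *\<^sub>C b + y) = c *\<^sub>C g b + g y"
    by (simp add: G_add[OF g] G_scaleC[OF g])
  then show ?case using step B cspace.subspace_add[OF W] cspace.subspace_scale[OF W] by simp
qed

lemma e_subspace: "cspace.subspace {x. e x = x}"
proof (rule cspace.subspaceI)
  show "0 \<in> {x. e x = x}" using linear_0[OF bounded_linear.linear[OF G_linear[OF e_G]]] by simp
  show "x + y \<in> {x. e x = x}" if "x \<in> {x. e x = x}" "y \<in> {x. e x = x}" for x y
    using that by (simp add: G_add[OF e_G])
  show "c *\<^sub>C x \<in> {x. e x = x}" if "x \<in> {x. e x = x}" for c x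
    using that by (simp add: G_scaleC[OF e_G])
qed

text \<open>The map \<Phi>, the mean of \<open>f g\<close> times \<open>g \<xi>\<close>, intertwines
  left translation of functions with the action of \<open>G\<close>. It therefore sends a
  finite-dimensional translation-invariant function space into an invariant subspace, and a function
  concentrated near \<open>e\<close> almost to a multiple of \<xi>.\<close>

theorem invariant_subspaces_dense:
  assumes \<xi>: "e \<xi> = \<xi>" and \<epsilon>: "\<epsilon> > 0"
  obtains V v where "invariant_subspace V" "v \<in> V" "norm (\<xi> - v) < \<epsilon>"
proof -
  interpret H: precompact_group G "(\<circ>)" e "opdist {\<xi>}" by (rule precompact_group_opdist) simp
  obtain C where C: "C > 0" "\<And>g x. g \<in> G \<Longrightarrow> norm (g x) \<le> C * norm x" using G_bounded by blast
  have orb: "H.uc (\<lambda>g. g \<xi>)"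
    by (rule H.uc_lipschitz[where L = 1]) (simp add: opdist_ge)
  \<comment> \<open>The mollifier lives within distance \<open>2 * r = \<epsilon> / 4\<close>;
    together with a second error of \<open>\<epsilon> / 4\<close> from the approximation of
    \<open>q\<close>, this stays at \<open>\<epsilon> / 2\<close>.\<close>
  define r where "r = \<epsilon> / 8"
  have r: "r > 0" using \<epsilon> by (simp add: r_def)
  define q where "q = H.conv r (H.ker r e)"
  note q = H.mollifier[OF r, folded q_def]
  define mq where "mq = H.mean q"
  have mq: "mq > 0" using q(4) by (simp add: mq_def)
  \<comment> \<open>Prescribed backwards: the square root of \<kappa> bounds the mean of the
    absolute error, and \<Phi> enlarges it by at most \<open>C * norm \<xi>\<close>. The added 1
    covers \<open>\<xi> = 0\<close>.\<close>
  define \<kappa> where "\<kappa> = (\<epsilon> / 4 * mq / (C * (norm \<xi> + 1)))\<^sup>2"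
  have base: "\<epsilon> / 4 * mq / (C * (norm \<xi> + 1)) > 0"
    using \<epsilon> mq C(1) by (intro divide_pos_pos mult_pos_pos add_nonneg_pos) auto
  then have \<kappa>: "\<kappa> > 0" unfolding \<kappa>_def by (rule zero_less_power)
  from H.finite_dim_approximation[OF r \<kappa>, folded q_def]
  obtain n :: nat and p b where "\<forall>i<n. H.uc (p i)"
      and inv0: "\<forall>i<n. \<forall>t\<in>G. \<exists>c. \<forall>x\<in>G. p i (t \<circ> x) = (\<Sum>j<n. c j * p j x)"
      and approx: "H.ip (\<lambda>x. q x - (\<Sum>i<n. b i * p i x)) (\<lambda>x. q x - (\<Sum>i<n. b i * p i x)) \<le> \<kappa>"
    by (elim exE conjE)
  then have p: "\<And>i. i < n \<Longrightarrow> H.uc (p i)" by simp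
  have inv: "\<exists>c. \<forall>x\<in>G. p i (t \<circ> x) = (\<Sum>j<n. c j * p j x)" if "i < n" "t \<in> G" for i t
    using inv0 that by (simp only:)
  define \<Phi> where "\<Phi> = (\<lambda>f :: ('a \<Rightarrow> 'a) \<Rightarrow> real. H.mean (\<lambda>g. f g *\<^sub>R g \<xi>))"
  have \<Phi>_sum: "\<Phi> (\<lambda>x. \<Sum>i<n. c i * p i x) = (\<Sum>i<n. c i *\<^sub>R \<Phi> (p i))" for c
  proof -
    have "\<Phi> (\<lambda>x. \<Sum>i<n. c i * p i x) = H.mean (\<lambda>g. \<Sum>i<n. c i *\<^sub>R (p i g *\<^sub>R g \<xi>))"
      unfolding \<Phi>_def by (simp add: scaleR_left.sum)
    also have "\<dots> = (\<Sum>i<n. H.mean (\<lambda>g. c i *\<^sub>R (p i g *\<^sub>R g \<xi>)))"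
      using p orb by (intro H.mean_sum H.uc_scaleR H.uc_const) auto
    also have "\<dots> = (\<Sum>i<n. c i *\<^sub>R \<Phi> (p i))"
      unfolding \<Phi>_def using p orb
      by (intro sum.cong H.mean_linear[OF bounded_linear_scaleR_right] H.uc_scaleR) auto
    finally show ?thesis .
  qed
  define B where "B = (\<lambda>i. \<Phi> (p i)) ` {..<n}"
  define V where "V = cspace.span B"
  have G\<Phi>: "h (\<Phi> (p i)) \<in> V" if h: "h \<in> G" and i: "i < n" for h i
  proof -
    \<comment> \<open>With \<open>k\<close> inverse to \<open>h\<close>, substituting
      \<open>h \<circ> g\<close> for \<open>g\<close> moves the action of \<open>h\<close> into a
      translation of \<open>p i\<close> by \<open>k\<close>.\<close>
    obtain k where k: "k \<in> G" "k \<circ> h = e" using G_left_inverse[OF h] by blast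
    obtain c where c: "\<forall>x\<in>G. p i (k \<circ> x) = (\<Sum>j<n. c j * p j x)" using inv[OF i k(1)] by blast
    have uF: "H.uc (\<lambda>g. p i (k \<circ> g) *\<^sub>R g \<xi>)" by (intro H.uc_scaleR H.uc_left p i k orb)
    have "h (\<Phi> (p i)) = H.mean (\<lambda>g. h (p i g *\<^sub>R g \<xi>))"
      unfolding \<Phi>_def by (rule H.mean_linear[symmetric, OF G_linear[OF h]]) (intro H.uc_scaleR p i orb)
    also have "\<dots> = H.mean (\<lambda>g. p i (k \<circ> (h \<circ> g)) *\<^sub>R (h \<circ> g) \<xi>)"
    proof (rule H.mean_cong)
      fix g assume g: "g \<in> G"
      have "k \<circ> (h \<circ> g) = g" by (simp add: o_assoc k(2) e_left g)
      then show "h (p i g *\<^sub>R g \<xi>) = p i (k \<circ> (h \<circ> g)) *\<^sub>R (h \<circ> g) \<xi>"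
        by (simp add: linear_scale[OF bounded_linear.linear[OF G_linear[OF h]]])
    qed
    also have "\<dots> = H.mean (\<lambda>g. p i (k \<circ> g) *\<^sub>R g \<xi>)" by (rule H.mean_left[OF uF h])
    also have "\<dots> = \<Phi> (\<lambda>x. \<Sum>j<n. c j * p j x)" unfolding \<Phi>_def using c by (intro H.mean_cong) simp
    also have "\<dots> = (\<Sum>j<n. complex_of_real (c j) *\<^sub>C \<Phi> (p j))" by (simp add: \<Phi>_sum scaleR_scaleC)
    also have "\<dots> \<in> V" unfolding V_def B_def by (intro cspace.span_sum cspace.span_scale cspace.span_base) auto
    finally show ?thesis .
  qed
  have "e x = x" if "x \<in> V" for x
  proof -
    have "e (\<Phi> (p i)) = \<Phi> (p i)" if i: "i < n" for i
    proof -
      have "e (\<Phi> (p i)) = H.mean (\<lambda>g. e (p i g *\<^sub>R g \<xi>))"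
        unfolding \<Phi>_def by (rule H.mean_linear[symmetric, OF G_linear[OF e_G]]) (intro H.uc_scaleR p i orb)
      also have "\<dots> = \<Phi> (p i)"
        unfolding \<Phi>_def
        by (rule H.mean_cong) (simp add: linear_scale[OF bounded_linear.linear[OF G_linear[OF e_G]]] e_apply)
      finally show ?thesis .
    qed
    then have "B \<subseteq> {x. e x = x}" by (auto simp: B_def)
    then show ?thesis using that cspace.span_minimal[OF _ e_subspace] unfolding V_def by blast
  qed
  moreover have "g ` V \<subseteq> V" if g: "g \<in> G" for g
  proof
    fix y assume "y \<in> g ` V"
    then obtain x where x: "x \<in> V" "y = g x" by blast
    show "y \<in> V" unfolding x(2)
      by (rule G_span[OF g, where B = B]) (use G\<Phi>[OF g] x in \<open>auto simp: V_def B_def cspace.subspace_span\<close>)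
  qed
  moreover have "finite B" by (simp add: B_def)
  ultimately have V: "invariant_subspace V" unfolding invariant_subspace_def V_def by blast
  define q' where "q' = (\<lambda>x. \<Sum>i<n. b i * p i x)"
  have q': "H.uc q'" unfolding q'_def using p by (intro H.uc_sum H.uc_scale) auto
  define v where "v = (1 / mq) *\<^sub>R \<Phi> q'"
  have "v \<in> V"
  proof -
    have "v = complex_of_real (1 / mq) *\<^sub>C (\<Sum>i<n. complex_of_real (b i) *\<^sub>C \<Phi> (p i))"
      by (simp add: v_def q'_def \<Phi>_sum scaleR_scaleC)
    also have "\<dots> \<in> V"
      unfolding V_def B_def by (intro cspace.span_sum cspace.span_scale cspace.span_base) auto
    finally show ?thesis .
  qed
  moreover have "norm (\<xi> - v) < \<epsilon>"
  proof -
    have uq: "H.uc (\<lambda>g. q g *\<^sub>R g \<xi>)" and uq': "H.uc (\<lambda>g. q' g *\<^sub>R g \<xi>)" and uc: "H.uc (\<lambda>g. q g *\<^sub>R \<xi>)"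
      by (intro H.uc_scaleR q(1) q' orb H.uc_const)+
    have m\<xi>: "H.mean (\<lambda>g. q g *\<^sub>R \<xi>) = mq *\<^sub>R \<xi>"
      unfolding mq_def by (rule H.mean_linear[OF bounded_linear_scaleR_left q(1)])
    have 1: "norm (mq *\<^sub>R \<xi> - \<Phi> q) \<le> 2 * r * mq"
    proof -
      have "mq *\<^sub>R \<xi> - \<Phi> q = H.mean (\<lambda>g. q g *\<^sub>R \<xi> - q g *\<^sub>R g \<xi>)"
        unfolding \<Phi>_def m\<xi>[symmetric] by (rule H.mean_diff[OF uc uq, symmetric])
      also have "norm \<dots> \<le> H.mean (\<lambda>g. norm (q g *\<^sub>R \<xi> - q g *\<^sub>R g \<xi>))" by (intro H.mean_norm H.uc_diff uc uq)
      \<comment> \<open>Wherever \<open>q\<close> is nonzero, \<open>g\<close> is within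
        \<open>2 * r\<close> of \<open>e\<close>, and the pseudometric dominates the displacement of
        \<xi>.\<close>
      also have "\<dots> \<le> H.mean (\<lambda>g. 2 * r * q g)"
      proof (rule H.mean_mono)
        show "H.uc (\<lambda>g. norm (q g *\<^sub>R \<xi> - q g *\<^sub>R g \<xi>))" by (intro H.uc_norm H.uc_diff uc uq)
        show "H.uc (\<lambda>g. 2 * r * q g)" by (rule H.uc_scale[OF q(1)])
        fix g assume g: "g \<in> G"
        show "norm (q g *\<^sub>R \<xi> - q g *\<^sub>R g \<xi>) \<le> 2 * r * q g"
        proof (cases "opdist {\<xi>} g e \<ge> 2 * r")
          case True
          then show ?thesis using q(3)[OF g] by simp
        next
          case False
          have "norm (\<xi> - g \<xi>) \<le> 2 * r"
            using opdist_ge[of "{\<xi>}" g e \<xi>] g e_G \<xi> False by (simp add: norm_minus_commute)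
          then have "q g * norm (\<xi> - g \<xi>) \<le> q g * (2 * r)" using q(2)[OF g] by (rule mult_left_mono)
          then show ?thesis using q(2)[OF g] by (simp add: scaleR_diff_right[symmetric] mult.commute)
        qed
      qed
      also have "\<dots> = 2 * r * mq" unfolding mq_def by (rule H.mean_mult[OF q(1)])
      finally show ?thesis .
    qed
    have 2: "norm (\<Phi> q - \<Phi> q') \<le> \<epsilon> / 4 * mq"
    proof -
      define D where "D = (\<lambda>g. norm (q g - q' g))"
      have D: "H.uc D" unfolding D_def by (intro H.uc_norm H.uc_diff q(1) q')
      \<comment> \<open>Cauchy-Schwarz against the constant 1 converts the mean-square estimate into
        one for the mean of the absolute value.\<close>
      have "(H.mean D)\<^sup>2 \<le> \<kappa>"
      proof -
        have "H.mean D = H.ip D (\<lambda>_. 1)" by (simp add: H.ip_def)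
        then have "(H.mean D)\<^sup>2 \<le> H.ip D D * H.ip (\<lambda>_. 1) (\<lambda>_. 1)"
          using H.Cauchy_Schwarz[OF D H.uc_const, of 1] by simp
        also have "H.ip D D = H.ip (\<lambda>x. q x - q' x) (\<lambda>x. q x - q' x)" by (simp add: H.ip_def D_def)
        also have "H.ip (\<lambda>_. 1) (\<lambda>_. 1) = 1" by (simp add: H.ip_def H.mean_const)
        finally show ?thesis using approx by (simp add: q'_def)
      qed
      then have mD: "H.mean D \<le> \<epsilon> / 4 * mq / (C * (norm \<xi> + 1))"
        unfolding \<kappa>_def using base power2_le_imp_le by fastforce
      have "\<Phi> q - \<Phi> q' = H.mean (\<lambda>g. q g *\<^sub>R g \<xi> - q' g *\<^sub>R g \<xi>)"
        unfolding \<Phi>_def by (rule H.mean_diff[OF uq uq', symmetric])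
      also have "norm \<dots> \<le> H.mean (\<lambda>g. norm (q g *\<^sub>R g \<xi> - q' g *\<^sub>R g \<xi>))"
        by (intro H.mean_norm H.uc_diff uq uq')
      also have "\<dots> \<le> H.mean (\<lambda>g. (C * norm \<xi>) * D g)"
      proof (rule H.mean_mono)
        show "H.uc (\<lambda>g. norm (q g *\<^sub>R g \<xi> - q' g *\<^sub>R g \<xi>))" by (intro H.uc_norm H.uc_diff uq uq')
        show "H.uc (\<lambda>g. (C * norm \<xi>) * D g)" by (rule H.uc_scale[OF D])
        fix g assume g: "g \<in> G"
        have "norm (q g *\<^sub>R g \<xi> - q' g *\<^sub>R g \<xi>) = D g * norm (g \<xi>)"
          by (simp add: D_def scaleR_diff_left[symmetric])
        also have "\<dots> \<le> D g * (C * norm \<xi>)" by (rule mult_left_mono[OF C(2)[OF g]]) (simp add: D_def)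
        finally show "norm (q g *\<^sub>R g \<xi> - q' g *\<^sub>R g \<xi>) \<le> (C * norm \<xi>) * D g" by (simp add: mult.commute)
      qed
      also have "\<dots> = (C * norm \<xi>) * H.mean D" by (rule H.mean_mult[OF D])
      also have "\<dots> \<le> (C * (norm \<xi> + 1)) * H.mean D"
        using C(1) H.mean_nonneg[OF D] by (intro mult_right_mono) (auto simp: D_def)
      also have "\<dots> \<le> (C * (norm \<xi> + 1)) * (\<epsilon> / 4 * mq / (C * (norm \<xi> + 1)))"
        using C(1) by (intro mult_left_mono mD) auto
      also have "\<dots> = \<epsilon> / 4 * mq"
      proof -
        have "C * (norm \<xi> + 1) > 0" using C(1) by (intro mult_pos_pos add_nonneg_pos) auto
        then have "C * (norm \<xi> + 1) \<noteq> 0" by (rule less_imp_neq[symmetric])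
        then show ?thesis by (simp only: times_divide_eq_right nonzero_mult_div_cancel_left not_False_eq_True)
      qed
      finally show ?thesis .
    qed
    have "norm (mq *\<^sub>R \<xi> - \<Phi> q') \<le> norm (mq *\<^sub>R \<xi> - \<Phi> q) + norm (\<Phi> q - \<Phi> q')"
      using norm_triangle_ineq[of "mq *\<^sub>R \<xi> - \<Phi> q" "\<Phi> q - \<Phi> q'"] by simp
    also have "\<dots> \<le> 2 * r * mq + \<epsilon> / 4 * mq" using 1 2 by linarith
    also have "\<dots> = \<epsilon> / 2 * mq" by (simp add: r_def)
    finally have "norm (mq *\<^sub>R (\<xi> - v)) \<le> \<epsilon> / 2 * mq"
      using mq by (simp add: v_def scaleR_diff_right)
    then have "norm (\<xi> - v) \<le> \<epsilon> / 2" using mq by (simp add: mult.commute)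
    then show ?thesis using \<epsilon> by simp
  qed
  ultimately show ?thesis using that V by blast
qed

end

section \<open>Invariant inner products\<close>

text \<open>The form is assumed to be an inner product only on \<open>W\<close>, since the averaged
  form used later is controlled only on the invariant subspace. Induction over \<open>B\<close>
  copes with dependent vectors: a zero remainder \<open>w\<close> leaves the basis
  unchanged.\<close>

lemma gram_schmidt:
  fixes Q :: "'a::cbanach \<Rightarrow> 'a \<Rightarrow> complex"
  assumes W: "cspace.subspace W"
    and add: "\<And>x y z. x \<in> W \<Longrightarrow> y \<in> W \<Longrightarrow> z \<in> W \<Longrightarrow> Q (x + y) z = Q x z + Q y z"
    and scale: "\<And>c x y. x \<in> W \<Longrightarrow> y \<in> W \<Longrightarrow> Q (c *\<^sub>C x) y = c * Q x y"
    and herm: "\<And>x y. x \<in> W \<Longrightarrow> y \<in> W \<Longrightarrow> Q y x = cnj (Q x y)"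
    and pos: "\<And>x. x \<in> W \<Longrightarrow> x \<noteq> 0 \<Longrightarrow> Re (Q x x) > 0"
    and B: "finite B" "B \<subseteq> W"
  shows "\<exists>(n :: nat) b. (\<forall>i<n. b i \<in> cspace.span B) \<and>
    (\<forall>i<n. \<forall>j<n. Q (b i) (b j) = (if i = j then 1 else 0)) \<and>
    (\<forall>x\<in>cspace.span B. x = (\<Sum>i<n. Q x (b i) *\<^sub>C b i)) \<and>
    (\<forall>x\<in>cspace.span B. Re (Q x x) = (\<Sum>i<n. (cmod (Q x (b i)))\<^sup>2))"
proof -
  have zero: "Q 0 z = 0" if "z \<in> W" for z
    using scale[OF that that, of 0] by simp
  have sum: "Q (\<Sum>i\<in>I. c i *\<^sub>C f i) z = (\<Sum>i\<in>I. c i * Q (f i) z)"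
    if "\<And>i. i \<in> I \<Longrightarrow> f i \<in> W" "z \<in> W" for I :: "nat set" and c f z
    using that
  proof (induction I rule: infinite_finite_induct)
    case (insert j I)
    have "(\<Sum>i\<in>I. c i *\<^sub>C f i) \<in> W"
      using insert.prems by (intro cspace.subspace_sum[OF W] cspace.subspace_scale[OF W]) auto
    then show ?case using insert by (simp add: add scale cspace.subspace_scale[OF W])
  qed (simp_all add: zero)
  have basis: "\<exists>(n :: nat) b. (\<forall>i<n. b i \<in> cspace.span B) \<and>
    (\<forall>i<n. \<forall>j<n. Q (b i) (b j) = (if i = j then 1 else 0)) \<and>
    (\<forall>x\<in>cspace.span B. x = (\<Sum>i<n. Q x (b i) *\<^sub>C b i))"
    using B
  proof (induction B)
    case empty
    then show ?case by (intro exI[of _ 0]) auto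
  next
    case (insert a B)
    have BW: "cspace.span B \<subseteq> W" and aW: "a \<in> W"
      using cspace.span_minimal[OF _ W] insert.prems by auto
    obtain n :: nat and b where b: "\<forall>i<n. b i \<in> cspace.span B"
        and orth: "\<forall>i<n. \<forall>j<n. Q (b i) (b j) = (if i = j then 1 else 0)"
        and expand: "\<forall>x\<in>cspace.span B. x = (\<Sum>i<n. Q x (b i) *\<^sub>C b i)"
      using insert.IH insert.prems by auto
    have bW: "b i \<in> W" if "i < n" for i using b BW that by blast
    define p where "p = (\<Sum>i<n. Q a (b i) *\<^sub>C b i)"
    have pB: "p \<in> cspace.span B" unfolding p_def using b by (intro cspace.span_sum cspace.span_scale) auto
    define w where "w = a - p"
    have wW: "w \<in> W" unfolding w_def using aW pB BW cspace.subspace_diff[OF W] by blast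
    have aw: "a = w + p" by (simp add: w_def)
    have wb: "Q w (b j) = 0" if j: "j < n" for j
    proof -
      have "Q p (b j) = (\<Sum>i<n. Q a (b i) * Q (b i) (b j))"
        unfolding p_def using bW j by (intro sum) auto
      also have "\<dots> = (\<Sum>i<n. if i = j then Q a (b i) else 0)" using orth j by (intro sum.cong) auto
      also have "\<dots> = Q a (b j)" using j by simp
      finally have "Q p (b j) = Q a (b j)" .
      moreover have "Q a (b j) = Q w (b j) + Q p (b j)"
        using add[OF wW _ bW[OF j], of p] pB BW aw by (metis subsetD)
      ultimately show ?thesis by simp
    qed
    show ?case
    proof (cases "w = 0")
      case True
      then have "a \<in> cspace.span B" using pB by (simp add: w_def)
      then have "cspace.span (insert a B) = cspace.span B" by (rule cspace.span_redundant)
      then show ?thesis using b orth expand by (intro exI[of _ n] exI[of _ b]) simp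
    next
      case False
      define \<rho> where "\<rho> = Re (Q w w)"
      have \<rho>: "\<rho> > 0" unfolding \<rho>_def by (rule pos[OF wW False])
      have "Im (Q w w) = 0" using herm[OF wW wW] by (metis complex_cnj_cancel_iff add_cancel_right_right cnj.simps(2) neg_equal_zero)
      then have Qww: "Q w w = complex_of_real \<rho>" by (simp add: complex_eq_iff \<rho>_def)
      define c where "c = complex_of_real (1 / sqrt \<rho>)"
      have c: "c \<noteq> 0" "cnj c = c" "c * c * complex_of_real \<rho> = 1"
        using \<rho> unfolding c_def by (simp_all flip: of_real_mult)
      define u where "u = c *\<^sub>C w"
      have uW: "u \<in> W" unfolding u_def by (rule cspace.subspace_scale[OF W wW])
      have Q_u: "Q x u = c * Q x w" if "x \<in> W" for x
        using herm[OF uW that] herm[OF wW that] scale[OF wW that, of c] c(2) by (simp add: u_def)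
      have uu: "Q u u = 1" using Q_u[OF uW] scale[OF wW wW, of c] c(3) Qww by (simp add: u_def mult.assoc)
      have ub: "Q u (b j) = 0" if "j < n" for j using scale[OF wW bW[OF that], of c] wb[OF that] by (simp add: u_def)
      have bu: "Q (b j) u = 0" if "j < n" for j using herm[OF uW bW[OF that]] ub[OF that] by simp
      define b' where "b' = b(n := u)"
      have b'n: "b' n = u" and b'i: "b' i = b i" if "i < n" for i using that by (auto simp: b'_def)
      have "p \<in> cspace.span (insert a B)" "a \<in> cspace.span (insert a B)"
        using pB cspace.span_mono[of B "insert a B"] cspace.span_base[of a "insert a B"] by auto
      then have "u \<in> cspace.span (insert a B)"
        unfolding u_def w_def by (intro cspace.span_scale cspace.span_diff)
      then have 1: "\<forall>i<Suc n. b' i \<in> cspace.span (insert a B)"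
        using b cspace.span_mono[of B "insert a B"] by (auto simp: b'_def less_Suc_eq)
      have 2: "\<forall>i<Suc n. \<forall>j<Suc n. Q (b' i) (b' j) = (if i = j then 1 else 0)"
        using orth uu ub bu by (auto simp: b'_def less_Suc_eq)
      have 3: "x = (\<Sum>i<Suc n. Q x (b' i) *\<^sub>C b' i)" if x: "x \<in> cspace.span (insert a B)" for x
      proof -
        obtain k where k: "x - k *\<^sub>C a \<in> cspace.span B" using x by (auto simp: cspace.span_insert)
        define y where "y = (x - k *\<^sub>C a) + k *\<^sub>C p"
        have y: "y \<in> cspace.span B" unfolding y_def using k pB by (intro cspace.span_add cspace.span_scale)
        then have yW: "y \<in> W" using BW by blast
        \<comment> \<open>Since \<open>u = c w\<close> and \<open>a = w + p\<close>, the vector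
          \<open>k a\<close> contributes \<open>(k / c) u\<close> along the new direction and
          \<open>k p\<close> to the old span.\<close>
        have xy: "x = (k / c) *\<^sub>C u + y"
          using c(1) by (simp add: y_def u_def aw scaleC_scaleC scaleC_add_right)
        have kuW: "(k / c) *\<^sub>C u \<in> W" by (rule cspace.subspace_scale[OF W uW])
        have "Q y u = (\<Sum>i<n. Q y (b i) * Q (b i) u)"
          using arg_cong[OF bspec[OF expand y], of "\<lambda>z. Q z u"] sum[of "{..<n}" b u "\<lambda>i. Q y (b i)"] bW uW by simp
        then have "Q y u = 0" using bu by simp
        then have "Q x u = k / c" using add[OF kuW yW uW] scale[OF uW uW] uu by (simp add: xy)
        moreover have "Q x (b i) = Q y (b i)" if "i < n" for i
          using add[OF kuW yW bW[OF that]] scale[OF uW bW[OF that]] ub[OF that] by (simp add: xy)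
        ultimately have "(\<Sum>i<Suc n. Q x (b' i) *\<^sub>C b' i) = (\<Sum>i<n. Q y (b i) *\<^sub>C b i) + (k / c) *\<^sub>C u"
          by (simp add: b'_def)
        also have "\<dots> = x" using bspec[OF expand y] xy by (simp add: add.commute)
        finally show ?thesis by simp
      qed
      show ?thesis using 1 2 3 by blast
    qed
  qed
  then obtain n :: nat and b where b: "\<forall>i<n. b i \<in> cspace.span B"
      and orth: "\<forall>i<n. \<forall>j<n. Q (b i) (b j) = (if i = j then 1 else 0)"
      and expand: "\<forall>x\<in>cspace.span B. x = (\<Sum>i<n. Q x (b i) *\<^sub>C b i)" by blast
  have BW: "cspace.span B \<subseteq> W" using cspace.span_minimal[OF B(2) W] .
  have "Re (Q x x) = (\<Sum>i<n. (cmod (Q x (b i)))\<^sup>2)" if x: "x \<in> cspace.span B" for x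
  proof -
    have xW: "x \<in> W" using x BW by blast
    have bW: "b i \<in> W" if "i < n" for i using b BW that by blast
    have "Q x x = (\<Sum>i<n. Q x (b i) * Q (b i) x)"
      using arg_cong[OF bspec[OF expand x], of "\<lambda>z. Q z x"] sum[of "{..<n}" b x "\<lambda>i. Q x (b i)"] bW xW by simp
    also have "\<dots> = (\<Sum>i<n. complex_of_real ((cmod (Q x (b i)))\<^sup>2))"
      using herm[OF xW bW] by (intro sum.cong) (simp_all only: complex_norm_square lessThan_iff)
    finally show ?thesis by simp
  qed
  then show ?thesis using b orth expand by blast
qed

lemma dual_sum:
  assumes "finite I" "\<And>i. i \<in> I \<Longrightarrow> f i \<in> dual UNIV"
  shows "(\<lambda>x. \<Sum>i\<in>I. f i x * a i) \<in> dual UNIV"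
  using assms
proof (induction I)
  case empty
  then show ?case
    by (auto simp: dual_def bounded_clinear_on_def scaleC_complex_def intro: exI[of _ 0])
next
  case (insert j I)
  have g: "(\<lambda>x. \<Sum>i\<in>I. f i x * a i) \<in> dual UNIV" and fj: "f j \<in> dual UNIV" using insert by auto
  obtain K where K: "\<And>x. cmod (f j x) \<le> K * norm x" using dual_bounded[OF fj] by auto
  obtain L where L: "\<And>x. cmod (\<Sum>i\<in>I. f i x * a i) \<le> L * norm x" using dual_bounded[OF g] by auto
  have "(\<lambda>x. f j x * a j + (\<Sum>i\<in>I. f i x * a i)) \<in> dual UNIV"
    unfolding dual_def mem_Collect_eq
  proof (rule bounded_clinear_onI)
    show "f j (x + y) * a j + (\<Sum>i\<in>I. f i (x + y) * a i)
        = (f j x * a j + (\<Sum>i\<in>I. f i x * a i)) + (f j y * a j + (\<Sum>i\<in>I. f i y * a i))" for x y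
      using dual_add[OF fj, of x y] dual_add[OF g, of x y] by (simp add: distrib_right)
    show "f j (c *\<^sub>C x) * a j + (\<Sum>i\<in>I. f i (c *\<^sub>C x) * a i)
        = c *\<^sub>C (f j x * a j + (\<Sum>i\<in>I. f i x * a i))" for c x
      using dual_scaleC[OF fj, of x c] dual_scaleC[OF g, of x c]
      by (simp add: scaleC_complex_def distrib_left mult.assoc)
    show "norm (f j x * a j + (\<Sum>i\<in>I. f i x * a i)) \<le> (K * cmod (a j) + L) * norm x" for x
    proof -
      have "norm (f j x * a j + (\<Sum>i\<in>I. f i x * a i)) \<le> cmod (f j x) * cmod (a j) + L * norm x"
        by (rule norm_triangle_le) (simp add: norm_mult L)
      also have "cmod (f j x) * cmod (a j) \<le> (K * norm x) * cmod (a j)" by (rule mult_right_mono[OF K]) simp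
      finally show ?thesis by (simp add: algebra_simps)
    qed
  qed
  then show ?case using insert.hyps by simp
qed

text \<open>The coordinates \<open>c i\<close> are functionals on the whole space, so
  \<open>c i (T x)\<close> is continuous in \<open>T\<close> for the weak operator topology.
  Unitarity is stated through coordinates and needs no inner product on \<open>V\<close>.\<close>

definition unitary_basis :: "('a::cbanach \<Rightarrow> 'a) set \<Rightarrow> 'a set \<Rightarrow> nat \<Rightarrow> (nat \<Rightarrow> 'a) \<Rightarrow> (nat \<Rightarrow> 'a \<Rightarrow> complex) \<Rightarrow> bool" where
  "unitary_basis G V n b c \<longleftrightarrow>
     (\<forall>i<n. b i \<in> V \<and> c i \<in> dual UNIV) \<and>
     (\<forall>x\<in>V. x = (\<Sum>i<n. c i x *\<^sub>C b i)) \<and>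
     (\<forall>i<n. \<forall>j<n. c i (b j) = (if i = j then 1 else 0)) \<and>
     (\<forall>g\<in>G. \<forall>x\<in>V. (\<Sum>i<n. (cmod (c i (g x)))\<^sup>2) = (\<Sum>i<n. (cmod (c i x))\<^sup>2))"

context compact_operator_group
begin

text \<open>Weyl's averaging trick: the coordinate inner product is averaged over the group. Taking
  the pseudometric of a basis \<open>B\<close> of \<open>V\<close> makes all orbit maps on
  \<open>V\<close> uniformly continuous, and right invariance of the mean makes the group
  isometric.\<close>

lemma unitary_basis_exists:
  assumes V: "invariant_subspace V"
  shows "\<exists>n b c. unitary_basis G V n b c"
proof -
  obtain B0 where B0: "finite B0" "V = cspace.span B0" using V by (auto simp: invariant_subspace_def)
  have eV: "e x = x" if "x \<in> V" for x using V that by (simp add: invariant_subspace_def)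
  have gV: "g x \<in> V" if "g \<in> G" "x \<in> V" for g x using V that unfolding invariant_subspace_def by blast
  obtain B where B: "B \<subseteq> B0" "\<not> cspace.dependent B" "B0 \<subseteq> cspace.span B"
    using cspace.maximal_independent_subset[of B0] by blast
  have finB: "finite B" using B(1) B0(1) finite_subset by blast
  have VB: "V = cspace.span B"
    unfolding B0(2) using B cspace.span_mono cspace.span_minimal[OF B(3) cspace.subspace_span] by blast
  have subV: "cspace.subspace V" unfolding VB by (rule cspace.subspace_span)
  from dual_basis[OF finB B(2)] obtain \<gamma> where \<gamma>: "\<And>\<beta>. \<beta> \<in> B \<Longrightarrow> \<gamma> \<beta> \<in> dual UNIV"
      "\<And>x. x \<in> cspace.span B \<Longrightarrow> x = (\<Sum>\<beta>\<in>B. \<gamma> \<beta> x *\<^sub>C \<beta>)"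
    by metis
  have \<gamma>_expand: "(\<Sum>\<beta>\<in>B. \<gamma> \<beta> x *\<^sub>C \<beta>) = x" if "x \<in> V" for x
    using \<gamma>(2)[OF that[unfolded VB]] by (rule sym)
  interpret H: precompact_group G "(\<circ>)" e "opdist B" by (rule precompact_group_opdist[OF finB])
  have uc_orbit: "H.uc (\<lambda>g. g x)" if x: "x \<in> V" for x
  proof -
    have bl: "bounded_linear (\<lambda>y :: 'a. a *\<^sub>C y)" for a
      by (rule bounded_linear_intro[where K = "cmod a"])
        (simp_all add: scaleC_add_right scaleR_scaleC scaleC_scaleC norm_scaleC mult.commute)
    have eq: "g x = (\<Sum>\<beta>\<in>B. \<gamma> \<beta> x *\<^sub>C g \<beta>)" if g: "g \<in> G" for g
    proof -
      have "g x = g (\<Sum>\<beta>\<in>B. \<gamma> \<beta> x *\<^sub>C \<beta>)" by (simp add: \<gamma>_expand x)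
      also have "\<dots> = (\<Sum>\<beta>\<in>B. g (\<gamma> \<beta> x *\<^sub>C \<beta>))"
        by (rule linear_sum[OF bounded_linear.linear[OF G_linear[OF g]]])
      finally show ?thesis by (simp add: G_scaleC[OF g])
    qed
    have "H.uc (\<lambda>g. \<Sum>\<beta>\<in>B. \<gamma> \<beta> x *\<^sub>C g \<beta>)"
    proof (rule H.uc_sum, rule H.uc_linear[OF bl])
      show "H.uc (\<lambda>g. g \<beta>)" if "\<beta> \<in> B" for \<beta>
        by (rule H.uc_lipschitz[where L = 1]) (simp add: opdist_ge finB that)
    qed
    then show ?thesis by (rule iffD2[OF H.uc_cong, rotated]) (rule eq)
  qed
  define Q where "Q = (\<lambda>x y. H.mean (\<lambda>g. \<Sum>\<beta>\<in>B. \<gamma> \<beta> (g x) * cnj (\<gamma> \<beta> (g y))))"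
  have uc_coord: "H.uc (\<lambda>g. \<gamma> \<beta> (g x))" if "\<beta> \<in> B" "x \<in> V" for \<beta> x
    by (rule H.uc_linear[OF dual_bounded_linear[OF \<gamma>(1)[OF that(1)]] uc_orbit[OF that(2)]])
  have uc_Q: "H.uc (\<lambda>g. \<Sum>\<beta>\<in>B. \<gamma> \<beta> (g x) * cnj (\<gamma> \<beta> (g y)))" if "x \<in> V" "y \<in> V" for x y
    using that by (intro H.uc_sum H.uc_mult H.uc_linear[OF bounded_linear_cnj] uc_coord)
  have \<gamma>_add: "\<gamma> \<beta> (x + y) = \<gamma> \<beta> x + \<gamma> \<beta> y" and \<gamma>_scale: "\<gamma> \<beta> (c *\<^sub>C x) = c * \<gamma> \<beta> x" if "\<beta> \<in> B" for \<beta> x y c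
    using dual_add[OF \<gamma>(1)[OF that]] dual_scaleC[OF \<gamma>(1)[OF that]] by simp_all
  have Q_add: "Q (x + y) z = Q x z + Q y z" if "x \<in> V" "y \<in> V" "z \<in> V" for x y z
  proof -
    have "Q (x + y) z = H.mean (\<lambda>g. (\<Sum>\<beta>\<in>B. \<gamma> \<beta> (g x) * cnj (\<gamma> \<beta> (g z))) + (\<Sum>\<beta>\<in>B. \<gamma> \<beta> (g y) * cnj (\<gamma> \<beta> (g z))))"
      unfolding Q_def by (rule H.mean_cong) (simp add: G_add \<gamma>_add distrib_right sum.distrib)
    also have "\<dots> = Q x z + Q y z" unfolding Q_def by (intro H.mean_add uc_Q that)
    finally show ?thesis .
  qed
  have Q_scale: "Q (c *\<^sub>C x) y = c * Q x y" if "x \<in> V" "y \<in> V" for c x y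
  proof -
    have "Q (c *\<^sub>C x) y = H.mean (\<lambda>g. c * (\<Sum>\<beta>\<in>B. \<gamma> \<beta> (g x) * cnj (\<gamma> \<beta> (g y))))"
      unfolding Q_def by (rule H.mean_cong) (simp add: G_scaleC \<gamma>_scale sum_distrib_left mult.assoc)
    also have "\<dots> = c * Q x y" unfolding Q_def by (intro H.mean_mult uc_Q that)
    finally show ?thesis .
  qed
  have Q_herm: "Q y x = cnj (Q x y)" if "x \<in> V" "y \<in> V" for x y
  proof -
    have "cnj (Q x y) = H.mean (\<lambda>g. cnj (\<Sum>\<beta>\<in>B. \<gamma> \<beta> (g x) * cnj (\<gamma> \<beta> (g y))))"
      unfolding Q_def by (rule H.mean_linear[OF bounded_linear_cnj uc_Q[OF that], symmetric])
    also have "\<dots> = Q y x" unfolding Q_def by (simp add: cnj_sum mult.commute)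
    finally show ?thesis by simp
  qed
  have Q_pos: "Re (Q x x) > 0" if x: "x \<in> V" "x \<noteq> 0" for x
  proof -
    let ?f = "\<lambda>g. Re (\<Sum>\<beta>\<in>B. \<gamma> \<beta> (g x) * cnj (\<gamma> \<beta> (g x)))"
    have f: "?f g = (\<Sum>\<beta>\<in>B. (cmod (\<gamma> \<beta> (g x)))\<^sup>2)" for g
      by (simp only: complex_norm_square[symmetric] Re_sum Re_complex_of_real)
    have "H.uc ?f" by (rule H.uc_linear[OF bounded_linear_Re uc_Q[OF x(1) x(1)]])
    \<comment> \<open>As \<open>e\<close> fixes \<open>V\<close>, the integrand at \<open>e\<close>
      is the sum of the squared coordinates of \<open>x\<close>; positivity at this single point
      suffices by \<open>mean_pos\<close>.\<close>
    moreover have "?f e > 0"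
    proof -
      have "\<exists>\<beta>\<in>B. \<gamma> \<beta> x \<noteq> 0"
      proof (rule ccontr)
        assume "\<not> (\<exists>\<beta>\<in>B. \<gamma> \<beta> x \<noteq> 0)"
        then have "x = 0" using \<gamma>_expand[OF x(1)] by simp
        then show False using x(2) by simp
      qed
      then obtain \<beta> where "\<beta> \<in> B" "\<gamma> \<beta> x \<noteq> 0" by blast
      then have "(\<Sum>\<beta>\<in>B. (cmod (\<gamma> \<beta> (e x)))\<^sup>2) > 0"
        unfolding eV[OF x(1)] by (intro sum_pos2[OF finB]) auto
      then show ?thesis by (simp only: f)
    qed
    ultimately have "H.mean ?f > 0" by (intro H.mean_pos[OF _ _ e_G]) (auto simp only: f intro: sum_nonneg zero_le_power2)
    then show ?thesis unfolding Q_def using H.mean_linear[OF bounded_linear_Re uc_Q[OF x(1) x(1)]] by simp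
  qed
  have Q_inv: "Q (h x) (h x) = Q x x" if h: "h \<in> G" and x: "x \<in> V" for h x
    unfolding Q_def using H.mean_right[OF uc_Q[OF x x] h] by simp
  from gram_schmidt[OF subV Q_add Q_scale Q_herm Q_pos finB, folded VB]
  obtain n :: nat and b where b: "\<forall>i<n. b i \<in> V" and orth: "\<forall>i<n. \<forall>j<n. Q (b i) (b j) = (if i = j then 1 else 0)"
      and expand: "\<forall>x\<in>V. x = (\<Sum>i<n. Q x (b i) *\<^sub>C b i)"
      and parseval: "\<forall>x\<in>V. Re (Q x x) = (\<Sum>i<n. (cmod (Q x (b i)))\<^sup>2)"
    using cspace.span_superset[of B] by (auto simp: VB)
  \<comment> \<open>\<open>Q x (b i)\<close> is meaningful only for \<open>x\<close> in
    \<open>V\<close>. Written through the globally defined coordinates \<gamma> it extends to a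
    bounded functional on the whole space.\<close>
  define c where "c = (\<lambda>i x. \<Sum>\<beta>\<in>B. \<gamma> \<beta> x * Q \<beta> (b i))"
  have c_dual: "c i \<in> dual UNIV" for i unfolding c_def by (rule dual_sum[OF finB \<gamma>(1)])
  have cQ: "c i x = Q x (b i)" if x: "x \<in> V" and i: "i < n" for i x
  proof -
    have "Q (\<Sum>\<beta>\<in>I. a \<beta> *\<^sub>C \<beta>) (b i) = (\<Sum>\<beta>\<in>I. a \<beta> * Q \<beta> (b i)) \<and> (\<Sum>\<beta>\<in>I. a \<beta> *\<^sub>C \<beta>) \<in> V"
      if "finite I" "I \<subseteq> B" for I a
      using that
    proof (induction I)
      case empty
      have "b i \<in> V" using b i by blast
      then show ?case using Q_scale[of "b i" "b i" 0] cspace.subspace_0[OF subV] by simp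
    next
      case (insert \<beta> I)
      have "\<beta> \<in> V" using insert.prems by (auto simp: VB intro: cspace.span_base)
      then show ?case using insert b i Q_add Q_scale cspace.subspace_scale[OF subV] cspace.subspace_add[OF subV] by simp
    qed
    from this[OF finB order_refl, of "\<lambda>\<beta>. \<gamma> \<beta> x"] show ?thesis
      by (simp add: c_def \<gamma>_expand[OF x])
  qed
  have "unitary_basis G V n b c"
    unfolding unitary_basis_def
  proof (intro conjI allI impI ballI)
    show "b i \<in> V" if "i < n" for i using b that by blast
    show "c i \<in> dual UNIV" for i by (rule c_dual)
    show "x = (\<Sum>i<n. c i x *\<^sub>C b i)" if "x \<in> V" for x using bspec[OF expand that] cQ[OF that] by simp
    show "c i (b j) = (if i = j then 1 else 0)" if "i < n" "j < n" for i j
      using cQ[of "b j" i] b orth that by auto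
    show "(\<Sum>i<n. (cmod (c i (g x)))\<^sup>2) = (\<Sum>i<n. (cmod (c i x))\<^sup>2)" if "g \<in> G" "x \<in> V" for g x
      using bspec[OF parseval gV[OF that]] bspec[OF parseval that(2)] cQ[OF gV[OF that]] cQ[OF that(2)] Q_inv[OF that]
      by simp
  qed
  then show ?thesis by blast
qed

end

section \<open>Block-diagonal unitary operators\<close>

lemma continuous_map_uniform_approx:
  fixes f :: "'s \<Rightarrow> complex"
  assumes approx: "\<And>\<epsilon>. \<epsilon> > 0 \<Longrightarrow> \<exists>h. continuous_map X euclidean h \<and> (\<forall>s\<in>topspace X. dist (h s) (f s) \<le> \<epsilon>)"
  shows "continuous_map X euclidean f"
  unfolding continuous_map_def
proof (intro conjI allI impI)
  fix W :: "complex set" assume W: "openin euclidean W"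
  show "openin X {s \<in> topspace X. f s \<in> W}"
  proof (subst openin_subopen, intro ballI)
    fix s0 assume s0: "s0 \<in> {s \<in> topspace X. f s \<in> W}"
    then obtain \<epsilon> where \<epsilon>: "\<epsilon> > 0" "ball (f s0) \<epsilon> \<subseteq> W" using W open_contains_ball by (metis mem_Collect_eq open_openin)
    have "\<epsilon> / 3 > 0" using \<epsilon>(1) by simp
    from approx[OF this] obtain h where h: "continuous_map X euclidean h" "\<forall>s\<in>topspace X. dist (h s) (f s) \<le> \<epsilon> / 3"
      by blast
    have "openin X {s \<in> topspace X. h s \<in> ball (h s0) (\<epsilon> / 3)}"
      by (rule openin_continuous_map_preimage[OF h(1)]) simp
    moreover have "s0 \<in> {s \<in> topspace X. h s \<in> ball (h s0) (\<epsilon> / 3)}" using s0 \<epsilon>(1) by simp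
    moreover have "{s \<in> topspace X. h s \<in> ball (h s0) (\<epsilon> / 3)} \<subseteq> {s \<in> topspace X. f s \<in> W}"
    proof
      fix s assume "s \<in> {s \<in> topspace X. h s \<in> ball (h s0) (\<epsilon> / 3)}"
      then have s: "s \<in> topspace X" "dist (h s0) (h s) < \<epsilon> / 3" by auto
      have "dist (h s) (f s) \<le> \<epsilon> / 3" "dist (h s0) (f s0) \<le> \<epsilon> / 3" using h(2) s(1) s0 by auto
      then have "dist (f s0) (f s) < \<epsilon>"
        using s(2) dist_triangle[of "f s0" "f s" "h s0"] dist_triangle[of "h s0" "f s" "h s"]
        by (simp add: dist_commute)
      then show "s \<in> {s \<in> topspace X. f s \<in> W}" using \<epsilon>(2) s(1) by auto
    qed
    ultimately show "\<exists>T. openin X T \<and> s0 \<in> T \<and> T \<subseteq> {s \<in> topspace X. f s \<in> W}" by blast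
  qed
qed simp

text \<open>Polarisation recovers the real part from norms; the imaginary part is the real part
  after multiplying the first argument by \<open>- \<i>\<close>.\<close>

lemma isometry_preserves_cinner:
  fixes U :: "'h::chilbert_space \<Rightarrow> 'h"
  assumes H: "cspace.subspace H"
    and add: "\<And>x y. x \<in> H \<Longrightarrow> y \<in> H \<Longrightarrow> U (x + y) = U x + U y"
    and scale: "\<And>c x. x \<in> H \<Longrightarrow> U (c *\<^sub>C x) = c *\<^sub>C U x"
    and norm: "\<And>x. x \<in> H \<Longrightarrow> norm (U x) = norm x"
    and x: "x \<in> H" and y: "y \<in> H"
  shows "cinner (U x) (U y) = cinner x y"
proof -
  have sq: "(norm z)\<^sup>2 = Re (cinner z z)" for z :: 'h
    by (metis norm_eq_sqrt_cinner norm_ge_zero real_sqrt_ge_0_iff real_sqrt_pow2)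
  have polar: "2 * Re (cinner z w) = (norm (z + w))\<^sup>2 - (norm z)\<^sup>2 - (norm w)\<^sup>2" for z w :: 'h
  proof -
    have "cinner (z + w) (z + w) = cinner z z + cnj (cinner w z) + (cinner w z + cinner w w)"
      using cinner_commute[of z "z + w"] cinner_commute[of w "z + w"] cinner_commute[of z w]
        cinner_commute[of z z] cinner_commute[of w w]
      by (simp add: cinner_add_left)
    moreover have "Re (cinner w z) = Re (cinner z w)" using cinner_commute[of w z] by simp
    ultimately show ?thesis unfolding sq by simp
  qed
  have re: "Re (cinner (U z) (U y)) = Re (cinner z y)" if z: "z \<in> H" for z
  proof -
    have "norm (U z + U y) = norm (z + y)"
      using norm[OF cspace.subspace_add[OF H z y]] by (simp only: add[OF z y])
    then show ?thesis using polar[of "U z" "U y"] polar[of z y] norm[OF z] norm[OF y] by simp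
  qed
  have im: "Re (cinner ((- \<i>) *\<^sub>C z) w) = Im (cinner z w)" for z w :: 'h
    unfolding cinner_scaleC_left by simp
  have "Im (cinner (U x) (U y)) = Im (cinner x y)"
    using re[OF cspace.subspace_scale[OF H x, of "- \<i>"]] scale[OF x, of "- \<i>"] im[of "U x" "U y"] im[of x y]
    by (simp only:)
  then show ?thesis using re[OF x] by (simp add: complex_eq_iff)
qed

section \<open>Coordinates and coordinate subspaces of the sequence space\<close>

lemma Rep_ell2_summable: "(\<lambda>i. (cmod (Rep_ell2 x i))\<^sup>2) summable_on UNIV"
  using Rep_ell2[of x] by simp

lemma Rep_ell2_sum: "Rep_ell2 (\<Sum>i\<in>I. f i) p = (\<Sum>i\<in>I. Rep_ell2 (f i) p)"
  by (induction I rule: infinite_finite_induct) (simp_all add: zero_ell2.rep_eq plus_ell2.rep_eq)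

lemma cmod_Rep_ell2_le: "cmod (Rep_ell2 x p) \<le> norm x"
  using ell2_cmod_le_norm by (simp add: norm_ell2_def)

lemma bounded_linear_Rep_ell2: "bounded_linear (\<lambda>x. Rep_ell2 x p)"
  by (rule bounded_linear_intro[where K = 1])
    (simp_all add: plus_ell2.rep_eq scaleR_ell2.rep_eq cmod_Rep_ell2_le scaleR_conv_of_real)

definition ell2_unit :: "'i \<Rightarrow> 'i ell2" where
  "ell2_unit p = Abs_ell2 (\<lambda>q. if q = p then 1 else 0)"

lemma Rep_ell2_unit: "Rep_ell2 (ell2_unit p) q = (if q = p then 1 else 0)"
proof -
  have "(\<lambda>q. (cmod (if q = p then 1 else 0))\<^sup>2) summable_on (UNIV :: 'a set)"
    by (rule finite_nonzero_values_imp_summable_on) (auto intro: finite_subset[of _ "{p}"])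
  then show ?thesis by (simp add: ell2_unit_def Abs_ell2_inverse)
qed

definition ell2_on :: "'i set \<Rightarrow> 'i ell2 set" where
  "ell2_on I = {x. \<forall>p. p \<notin> I \<longrightarrow> Rep_ell2 x p = 0}"

lemma ell2_on_subspace: "cspace.subspace (ell2_on I)"
  by (rule cspace.subspaceI)
    (simp_all add: ell2_on_def zero_ell2.rep_eq plus_ell2.rep_eq scaleC_ell2.rep_eq)

lemma ell2_on_closed: "closed (ell2_on I)"
proof -
  have "ell2_on I = (\<Inter>p\<in>-I. {x. Rep_ell2 x p = 0})" by (auto simp: ell2_on_def)
  moreover have "closed {x. Rep_ell2 x p = 0}" for p :: 'a
    using linear_continuous_on[OF bounded_linear_Rep_ell2, of UNIV p] by (intro closed_Collect_eq continuous_intros)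
  ultimately show ?thesis by auto
qed

lemma ell2_unit_on: "p \<in> I \<Longrightarrow> ell2_unit p \<in> ell2_on I"
  by (auto simp: ell2_on_def Rep_ell2_unit)

text \<open>The squared norm of the remainder is a tail of the convergent sum of squares.
  Intersecting with \<open>I\<close> loses nothing, as the coordinates vanish outside.\<close>

lemma ell2_on_approx:
  assumes x: "x \<in> ell2_on I" and \<epsilon>: "\<epsilon> > 0"
  shows "\<exists>F. finite F \<and> F \<subseteq> I \<and> norm (x - (\<Sum>p\<in>F. Rep_ell2 x p *\<^sub>C ell2_unit p)) \<le> \<epsilon>"
proof -
  let ?s = "\<lambda>p. (cmod (Rep_ell2 x p))\<^sup>2"
  obtain F0 where F0: "finite F0" "dist (sum ?s F0) (infsum ?s UNIV) \<le> \<epsilon>\<^sup>2"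
    using infsum_finite_approximation[OF Rep_ell2_summable[of x], of "\<epsilon>\<^sup>2"] \<epsilon> by auto
  define F where "F = F0 \<inter> I"
  have F: "finite F" "F \<subseteq> I" using F0 by (auto simp: F_def)
  have "sum ?s F = sum ?s F0"
    unfolding F_def using F0(1) x by (intro sum.mono_neutral_left) (auto simp: ell2_on_def)
  then have close: "infsum ?s UNIV \<le> sum ?s F + \<epsilon>\<^sup>2" using F0(2) by (simp add: dist_real_def abs_le_iff)
  let ?y = "x - (\<Sum>p\<in>F. Rep_ell2 x p *\<^sub>C ell2_unit p)"
  have y: "Rep_ell2 ?y q = (if q \<in> F then 0 else Rep_ell2 x q)" for q
  proof -
    have "Rep_ell2 (\<Sum>p\<in>F. Rep_ell2 x p *\<^sub>C ell2_unit p) q = (\<Sum>p\<in>F. if p = q then Rep_ell2 x p else 0)"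
      unfolding Rep_ell2_sum by (rule sum.cong) (simp_all add: scaleC_ell2.rep_eq Rep_ell2_unit)
    then show ?thesis using F(1) by (simp add: minus_ell2.rep_eq)
  qed
  have "norm ?y \<le> \<epsilon>"
    unfolding norm_ell2_def
  proof (rule ell2_norm_leI)
    fix A :: "'a set" assume A: "finite A"
    have "(\<Sum>q\<in>A. (cmod (Rep_ell2 ?y q))\<^sup>2) = sum ?s (A - F)"
      using A by (intro sum.mono_neutral_cong_right) (auto simp: y)
    also have "\<dots> + sum ?s F = sum ?s ((A - F) \<union> F)"
      using A F by (intro sum.union_disjoint[symmetric]) auto
    also have "\<dots> \<le> infsum ?s UNIV"
      using A F by (intro finite_sum_le_infsum Rep_ell2_summable) auto
    finally have "(\<Sum>q\<in>A. (cmod (Rep_ell2 ?y q))\<^sup>2) \<le> \<epsilon>\<^sup>2" using close by simp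
    then show "L2_set (\<lambda>q. cmod (Rep_ell2 ?y q)) A \<le> \<epsilon>"
      unfolding L2_set_def using \<epsilon> real_le_lsqrt by (meson less_imp_le sum_nonneg zero_le_power2)
  qed
  then show ?thesis using F by blast
qed

lemma dual_sum_on:
  assumes f: "f \<in> dual F" and F: "cspace.subspace F" and g: "\<And>i. i \<in> I \<Longrightarrow> g i \<in> F"
  shows "f (\<Sum>i\<in>I. c i *\<^sub>C g i) = (\<Sum>i\<in>I. c i * f (g i))"
  using g
proof (induction I rule: infinite_finite_induct)
  case (insert j I)
  have "(\<Sum>i\<in>I. c i *\<^sub>C g i) \<in> F" using insert.prems by (intro cspace.subspace_sum[OF F] cspace.subspace_scale[OF F]) auto
  then show ?case
    using insert dual_add[OF f, of "c j *\<^sub>C g j"] dual_scaleC[OF f, of "g j"] cspace.subspace_scale[OF F] by simp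
qed (simp_all add: dual_zero[OF f cspace.subspace_0[OF F]])

section \<open>Chosen unitary bases and their block matrices\<close>

context compact_operator_group
begin

text \<open>Dimension, basis and coordinates come from one choice of a triple, so that they fit
  together.\<close>

definition basis_data where
  "basis_data V = (SOME t. unitary_basis G V (fst t) (fst (snd t)) (snd (snd t)))"

definition bdim :: "'a set \<Rightarrow> nat" where "bdim V = fst (basis_data V)"

definition bas :: "'a set \<Rightarrow> nat \<Rightarrow> 'a" where "bas V = fst (snd (basis_data V))"

definition coo :: "'a set \<Rightarrow> nat \<Rightarrow> 'a \<Rightarrow> complex" where "coo V = snd (snd (basis_data V))"

lemma unitary_basis_data:
  assumes "invariant_subspace V"
  shows "unitary_basis G V (bdim V) (bas V) (coo V)"
proof -
  obtain n b c where "unitary_basis G V n b c" using unitary_basis_exists[OF assms] by blast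
  then have "unitary_basis G V (fst (n, b, c)) (fst (snd (n, b, c))) (snd (snd (n, b, c)))" by simp
  then show ?thesis unfolding bdim_def bas_def coo_def basis_data_def by (rule someI)
qed

context
  fixes V assumes V: "invariant_subspace V"
begin

lemma V_subspace: "cspace.subspace V"
  using V unfolding invariant_subspace_def by (metis cspace.subspace_span)

lemma V_G: "g \<in> G \<Longrightarrow> x \<in> V \<Longrightarrow> g x \<in> V"
  using V unfolding invariant_subspace_def by blast

lemma V_e: "x \<in> V \<Longrightarrow> e x = x"
  using V by (simp add: invariant_subspace_def)

lemma bas_V: "i < bdim V \<Longrightarrow> bas V i \<in> V"
  and coo_dual: "i < bdim V \<Longrightarrow> coo V i \<in> dual UNIV"
  and coo_expand: "x \<in> V \<Longrightarrow> (\<Sum>i<bdim V. coo V i x *\<^sub>C bas V i) = x"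
  and coo_bas: "i < bdim V \<Longrightarrow> j < bdim V \<Longrightarrow> coo V i (bas V j) = (if i = j then 1 else 0)"
  and coo_isometry: "g \<in> G \<Longrightarrow> x \<in> V \<Longrightarrow> (\<Sum>i<bdim V. (cmod (coo V i (g x)))\<^sup>2) = (\<Sum>i<bdim V. (cmod (coo V i x))\<^sup>2)"
  using unitary_basis_data[OF V] unfolding unitary_basis_def by (blast, blast, metis, blast, blast)

lemma coo_sum:
  assumes i: "i < bdim V"
  shows "coo V i (\<Sum>j<bdim V. c j *\<^sub>C bas V j) = c i"
proof -
  have "coo V i (\<Sum>j<bdim V. c j *\<^sub>C bas V j) = (\<Sum>j<bdim V. c j * coo V i (bas V j))"
    by (rule dual_sum_on[OF coo_dual[OF i] cspace.subspace_UNIV]) simp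
  also have "\<dots> = (\<Sum>j<bdim V. if j = i then c j else 0)" using coo_bas[OF i] by (intro sum.cong) auto
  finally show ?thesis using i by simp
qed

lemma coo_apply:
  assumes i: "i < bdim V" and g: "g \<in> G" and x: "x \<in> V"
  shows "coo V i (g x) = (\<Sum>j<bdim V. coo V i (g (bas V j)) * coo V j x)"
proof -
  have "g x = g (\<Sum>j<bdim V. coo V j x *\<^sub>C bas V j)" by (simp only: coo_expand[OF x])
  also have "\<dots> = (\<Sum>j<bdim V. coo V j x *\<^sub>C g (bas V j))"
    by (simp add: linear_sum[OF bounded_linear.linear[OF G_linear[OF g]]] G_scaleC[OF g])
  finally have "coo V i (g x) = (\<Sum>j<bdim V. coo V j x * coo V i (g (bas V j)))"
    using dual_sum_on[OF coo_dual[OF i] cspace.subspace_UNIV, of "{..<bdim V}" "\<lambda>j. g (bas V j)" "\<lambda>j. coo V j x"] by simp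
  then show ?thesis by (simp add: mult.commute)
qed

end

definition idx :: "'a set set \<Rightarrow> ('a set \<times> nat) set" where
  "idx W = (SIGMA V:W. {..<bdim V})"

definition inv_spaces :: "'a set set" where
  "inv_spaces = Collect invariant_subspace"

text \<open>The block-diagonal matrix of \<open>g\<close> in the chosen bases. It acts on arbitrary
  functions, so that square summability of the result can be proved before it is made a
  vector.\<close>

definition act :: "('a \<Rightarrow> 'a) \<Rightarrow> ('a set \<times> nat \<Rightarrow> complex) \<Rightarrow> 'a set \<times> nat \<Rightarrow> complex" where
  "act g f p = (if p \<in> idx inv_spaces
     then \<Sum>j<bdim (fst p). coo (fst p) (snd p) (g (bas (fst p) j)) * f (fst p, j) else 0)"

text \<open>A block of coordinates is read as a vector of \<open>V\<close>. The group law and the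
  isometry property for matrices then come from those for operators on \<open>V\<close>.\<close>

lemma act_block:
  assumes V: "invariant_subspace V" and i: "i < bdim V" and g: "g \<in> G"
  shows "act g f (V, i) = coo V i (g (\<Sum>j<bdim V. f (V, j) *\<^sub>C bas V j))"
proof -
  have "(\<Sum>j<bdim V. f (V, j) *\<^sub>C bas V j) \<in> V"
    using bas_V[OF V] V_subspace[OF V] by (intro cspace.subspace_sum cspace.subspace_scale) auto
  then show ?thesis
    using V i coo_apply[OF V i g] coo_sum[OF V] by (simp add: act_def idx_def inv_spaces_def)
qed

lemma act_block_isometry:
  assumes V: "invariant_subspace V" and g: "g \<in> G"
  shows "(\<Sum>i<bdim V. (cmod (act g f (V, i)))\<^sup>2) = (\<Sum>i<bdim V. (cmod (f (V, i)))\<^sup>2)"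
proof -
  have x: "(\<Sum>j<bdim V. f (V, j) *\<^sub>C bas V j) \<in> V"
    using bas_V[OF V] V_subspace[OF V] by (intro cspace.subspace_sum cspace.subspace_scale) auto
  show ?thesis
    using coo_isometry[OF V g x] coo_sum[OF V] act_block[OF V _ g] by simp
qed

text \<open>A finite set of coordinates meets only finitely many blocks. Completing these blocks can
  only enlarge the sum, and on complete blocks the squares are preserved.\<close>

lemma act_sum_le:
  assumes g: "g \<in> G" and f: "(\<lambda>p. (cmod (f p))\<^sup>2) summable_on UNIV" and F: "finite F"
  shows "(\<Sum>p\<in>F. (cmod (act g f p))\<^sup>2) \<le> (\<Sum>\<^sub>\<infinity>p. (cmod (f p))\<^sup>2)"
proof -
  define A where "A = fst ` F \<inter> inv_spaces"
  have A: "finite A" using F by (simp add: A_def)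
  have finS: "finite (idx A)" using A by (simp add: idx_def)
  have "(\<Sum>p\<in>F. (cmod (act g f p))\<^sup>2) = (\<Sum>p\<in>F \<inter> idx inv_spaces. (cmod (act g f p))\<^sup>2)"
    using F by (intro sum.mono_neutral_right) (auto simp: act_def)
  also have "\<dots> \<le> (\<Sum>p\<in>idx A. (cmod (act g f p))\<^sup>2)"
    using finS by (intro sum_mono2) (force simp: idx_def A_def)+
  also have "\<dots> = (\<Sum>V\<in>A. \<Sum>i<bdim V. (cmod (act g f (V, i)))\<^sup>2)"
    unfolding idx_def using A by (subst sum.Sigma) (auto simp: case_prod_beta)
  also have "\<dots> = (\<Sum>V\<in>A. \<Sum>i<bdim V. (cmod (f (V, i)))\<^sup>2)"
    by (rule sum.cong[OF refl]) (rule act_block_isometry[OF _ g], simp add: A_def inv_spaces_def)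
  also have "\<dots> = (\<Sum>p\<in>idx A. (cmod (f p))\<^sup>2)"
    unfolding idx_def using A by (subst sum.Sigma) (auto simp: case_prod_beta)
  also have "\<dots> \<le> (\<Sum>\<^sub>\<infinity>p. (cmod (f p))\<^sup>2)"
    by (rule finite_sum_le_infsum[OF f finS]) auto
  finally show ?thesis .
qed

section \<open>The unitary operators and their coefficients\<close>

definition U :: "('a \<Rightarrow> 'a) \<Rightarrow> ('a set \<times> nat) ell2 \<Rightarrow> ('a set \<times> nat) ell2" where
  "U g x = Abs_ell2 (act g (Rep_ell2 x))"

lemma Rep_U:
  assumes g: "g \<in> G"
  shows "Rep_ell2 (U g x) = act g (Rep_ell2 x)"
proof -
  have "(\<lambda>p. (cmod (act g (Rep_ell2 x) p))\<^sup>2) summable_on UNIV"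
    using act_sum_le[OF g Rep_ell2_summable[of x]]
    by (intro nonneg_bdd_above_summable_on bdd_aboveI2) auto
  then show ?thesis by (simp add: U_def Abs_ell2_inverse)
qed

lemma norm_U_le:
  assumes g: "g \<in> G"
  shows "norm (U g x) \<le> norm x"
  unfolding norm_ell2_def
proof (rule ell2_norm_leI)
  fix F :: "('a set \<times> nat) set" assume F: "finite F"
  show "L2_set (\<lambda>p. cmod (Rep_ell2 (U g x) p)) F \<le> ell2_norm x"
    unfolding L2_set_def Rep_U[OF g] ell2_norm.rep_eq
    by (rule real_sqrt_le_mono[OF act_sum_le[OF g Rep_ell2_summable F]])
qed

lemma U_add: "g \<in> G \<Longrightarrow> U g (x + y) = U g x + U g y"
  by (simp add: ell2_eq_iff Rep_U plus_ell2.rep_eq act_def distrib_left sum.distrib)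

lemma U_scaleC: "g \<in> G \<Longrightarrow> U g (c *\<^sub>C x) = c *\<^sub>C U g x"
  by (simp add: ell2_eq_iff Rep_U scaleC_ell2.rep_eq act_def sum_distrib_left mult.left_commute)

lemma U_linear: "g \<in> G \<Longrightarrow> bounded_linear (U g)"
  by (rule bounded_linear_intro[where K = 1])
    (simp_all add: U_add scaleR_scaleC U_scaleC norm_U_le)

lemma U_mult:
  assumes g: "g \<in> G" and h: "h \<in> G"
  shows "U (g \<circ> h) x = U g (U h x)"
proof -
  have "act (g \<circ> h) f (V, i) = act g (act h f) (V, i)"
    if V: "invariant_subspace V" and i: "i < bdim V" for V i and f
  proof -
    let ?x = "\<Sum>j<bdim V. f (V, j) *\<^sub>C bas V j"
    have x: "?x \<in> V" using bas_V[OF V] V_subspace[OF V] by (intro cspace.subspace_sum cspace.subspace_scale) auto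
    have "(\<Sum>j<bdim V. act h f (V, j) *\<^sub>C bas V j) = (\<Sum>j<bdim V. coo V j (h ?x) *\<^sub>C bas V j)"
      using act_block[OF V _ h] by (intro sum.cong) auto
    also have "\<dots> = h ?x" by (rule coo_expand[OF V V_G[OF V h x]])
    finally show ?thesis using act_block[OF V i g] act_block[OF V i G_mult[OF g h]] by simp
  qed
  then have "act (g \<circ> h) f p = act g (act h f) p" for f p
    by (cases p) (auto simp: act_def idx_def inv_spaces_def)
  then show ?thesis by (simp add: ell2_eq_iff Rep_U g h G_mult)
qed

text \<open>The parameter \<open>W\<close> serves twice: all invariant subspaces give the Hilbert
  space of the representation, a singleton gives one finite-dimensional summand.\<close>

definition HW :: "'a set set \<Rightarrow> ('a set \<times> nat) ell2 set" where
  "HW W = ell2_on (idx W)"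

lemma HW_unit: "V \<in> W \<Longrightarrow> i < bdim V \<Longrightarrow> ell2_unit (V, i) \<in> HW W"
  unfolding HW_def by (rule ell2_unit_on) (simp add: idx_def)

lemma U_HW:
  assumes g: "g \<in> G" and x: "x \<in> HW W"
  shows "U g x \<in> HW W"
  unfolding HW_def ell2_on_def mem_Collect_eq
proof (intro allI impI)
  fix p assume p: "p \<notin> idx W"
  obtain V i where Vi: "p = (V, i)" by (cases p)
  show "Rep_ell2 (U g x) p = 0"
  proof (cases "p \<in> idx inv_spaces")
    case True
    then have "V \<notin> W" using p by (auto simp: Vi idx_def)
    then have "Rep_ell2 x (V, j) = 0" for j using x by (simp add: HW_def ell2_on_def idx_def)
    then show ?thesis by (simp add: Rep_U g act_def Vi)
  qed (simp add: Rep_U g act_def)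
qed

lemma U_e:
  assumes x: "x \<in> HW W" and W: "W \<subseteq> inv_spaces"
  shows "U e x = x"
  unfolding ell2_eq_iff
proof
  fix p :: "'a set \<times> nat"
  obtain V i where Vi: "p = (V, i)" by (cases p)
  show "Rep_ell2 (U e x) p = Rep_ell2 x p"
  proof (cases "p \<in> idx inv_spaces")
    case True
    then have V: "invariant_subspace V" and i: "i < bdim V" by (auto simp: Vi idx_def inv_spaces_def)
    have "(\<Sum>j<bdim V. Rep_ell2 x (V, j) *\<^sub>C bas V j) \<in> V"
      using bas_V[OF V] V_subspace[OF V] by (intro cspace.subspace_sum cspace.subspace_scale) auto
    then show ?thesis
      using act_block[OF V i e_G, of "Rep_ell2 x"] V_e[OF V] coo_sum[OF V i] by (simp add: Rep_U e_G Vi)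
  next
    case False
    then have "p \<notin> idx W" using W by (auto simp: idx_def)
    then have "Rep_ell2 x p = 0" using x unfolding HW_def ell2_on_def by blast
    then show ?thesis using False by (simp add: Rep_U e_G act_def)
  qed
qed

text \<open>A contraction with a contractive left inverse is an isometry; on \<open>HW W\<close> the
  inverse works because \<open>U e\<close> is the identity there.\<close>

lemma norm_U:
  assumes g: "g \<in> G" and x: "x \<in> HW W" and W: "W \<subseteq> inv_spaces"
  shows "norm (U g x) = norm x"
proof (rule antisym[OF norm_U_le[OF g]])
  obtain h where h: "h \<in> G" "h \<circ> g = e" using G_left_inverse[OF g] by blast
  have "norm x = norm (U h (U g x))" using U_mult[OF h(1) g, of x] h(2) U_e[OF x W] by simp
  then show "norm x \<le> norm (U g x)" using norm_U_le[OF h(1), of "U g x"] by simp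
qed

lemma U_surj:
  assumes g: "g \<in> G" and W: "W \<subseteq> inv_spaces"
  shows "U g ` HW W = HW W"
proof
  show "U g ` HW W \<subseteq> HW W" using U_HW[OF g] by blast
  show "HW W \<subseteq> U g ` HW W"
  proof
    fix x assume x: "x \<in> HW W"
    obtain h where h: "h \<in> G" "h \<circ> g = e" using G_left_inverse[OF g] by blast
    obtain k where k: "k \<in> G" "k \<circ> h = e" using G_left_inverse[OF h(1)] by blast
    have "k = g" using h(2) k(2) e_left[OF g] e_right[OF k(1)] by (metis o_assoc)
    then have "U g (U h x) = x" using U_mult[OF g h(1), of x] k(2) U_e[OF x W] by simp
    then show "x \<in> U g ` HW W" using U_HW[OF h(1) x] by (metis imageI)
  qed
qed

lemma U_unit:
  assumes V: "invariant_subspace V" and j: "j < bdim V" and g: "g \<in> G"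
  shows "U g (ell2_unit (V, j)) = (\<Sum>i<bdim V. coo V i (g (bas V j)) *\<^sub>C ell2_unit (V, i))"
  unfolding ell2_eq_iff
proof
  fix p :: "'a set \<times> nat"
  obtain V' i where Vi: "p = (V', i)" by (cases p)
  have R: "Rep_ell2 (\<Sum>k<bdim V. coo V k (g (bas V j)) *\<^sub>C ell2_unit (V, k)) p
      = (\<Sum>k<bdim V. if k = i \<and> V' = V then coo V k (g (bas V j)) else 0)"
    unfolding Rep_ell2_sum by (rule sum.cong) (auto simp: scaleC_ell2.rep_eq Rep_ell2_unit Vi)
  show "Rep_ell2 (U g (ell2_unit (V, j))) p
      = Rep_ell2 (\<Sum>k<bdim V. coo V k (g (bas V j)) *\<^sub>C ell2_unit (V, k)) p"
  proof (cases "V' = V \<and> i < bdim V")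
    case True
    then show ?thesis unfolding R using V j
      by (simp add: Rep_U g act_def idx_def inv_spaces_def Vi Rep_ell2_unit if_distrib[of "\<lambda>c. _ * c"] cong: if_cong)
  next
    case False
    then have "V' \<noteq> V \<or> p \<notin> idx inv_spaces" by (auto simp: idx_def Vi)
    then have "Rep_ell2 (U g (ell2_unit (V, j))) p = 0"
      by (elim disjE) (simp_all add: Rep_U g act_def Vi Rep_ell2_unit)
    moreover have "(\<Sum>k<bdim V. if k = i \<and> V' = V then coo V k (g (bas V j)) else 0) = 0"
      using False by (intro sum.neutral) auto
    ultimately show ?thesis unfolding R by simp
  qed
qed

lemma U_ops: "g \<in> G \<Longrightarrow> U g \<in> bounded_ops (HW W)"
  unfolding bounded_ops_def mem_Collect_eq
  by (intro conjI bounded_clinear_onI[where K = 1]) (auto simp: U_HW U_add U_scaleC norm_U_le)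

lemma U_cinner:
  assumes g: "g \<in> G" and W: "W \<subseteq> inv_spaces" and x: "x \<in> HW W" and y: "y \<in> HW W"
  shows "cinner (U g x) (U g y) = cinner x y"
  by (rule isometry_preserves_cinner[of "HW W"])
    (auto simp: HW_def ell2_on_subspace U_add U_scaleC g x[unfolded HW_def] y[unfolded HW_def]
      intro!: norm_U[OF g _ W, unfolded HW_def])

text \<open>Truncating \<open>x\<close> to finitely many coordinates changes a coefficient by at
  most \<epsilon> uniformly in \<open>g\<close>, as all \<open>U g\<close> are contractions; what
  remains are coefficients of \<open>g\<close> itself. Both continuity of \<open>U\<close> and one
  weak containment rest on this.\<close>

lemma U_coefficient_approx:
  assumes W: "W \<subseteq> inv_spaces" and x: "x \<in> HW W" and f: "f \<in> dual (HW W)" and \<epsilon>: "\<epsilon> > 0"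
  shows "\<exists>F. finite F \<and> F \<subseteq> idx W \<and> (\<forall>g\<in>G. cmod (f (U g x) - (\<Sum>p\<in>F. \<Sum>i<bdim (fst p).
    Rep_ell2 x p * f (ell2_unit (fst p, i)) * coo (fst p) i (g (bas (fst p) (snd p))))) \<le> \<epsilon>)"
proof -
  have sub: "cspace.subspace (HW W)" unfolding HW_def by (rule ell2_on_subspace)
  obtain K where K: "K > 0" "\<And>y. y \<in> HW W \<Longrightarrow> cmod (f y) \<le> K * norm y" using dual_bounded[OF f] by blast
  have "\<epsilon> / K > 0" using \<epsilon> K(1) by simp
  from ell2_on_approx[OF x[unfolded HW_def] this] obtain F where F: "finite F" "F \<subseteq> idx W"
      "norm (x - (\<Sum>p\<in>F. Rep_ell2 x p *\<^sub>C ell2_unit p)) \<le> \<epsilon> / K" by blast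
  let ?y = "\<Sum>p\<in>F. Rep_ell2 x p *\<^sub>C ell2_unit p"
  have unit: "ell2_unit p \<in> HW W" if "p \<in> F" for p
    unfolding HW_def using that F(2) by (intro ell2_unit_on) blast
  have yH: "?y \<in> HW W" using unit by (intro cspace.subspace_sum[OF sub] cspace.subspace_scale[OF sub]) auto
  have "cmod (f (U g x) - (\<Sum>p\<in>F. \<Sum>i<bdim (fst p).
    Rep_ell2 x p * f (ell2_unit (fst p, i)) * coo (fst p) i (g (bas (fst p) (snd p))))) \<le> \<epsilon>" if g: "g \<in> G" for g
  proof -
    have "U g ?y = (\<Sum>p\<in>F. Rep_ell2 x p *\<^sub>C U g (ell2_unit p))"
      by (simp add: linear_sum[OF bounded_linear.linear[OF U_linear[OF g]]] U_scaleC[OF g])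
    then have "f (U g ?y) = (\<Sum>p\<in>F. Rep_ell2 x p * f (U g (ell2_unit p)))"
      using dual_sum_on[OF f sub, of F "\<lambda>p. U g (ell2_unit p)" "Rep_ell2 x"] U_HW[OF g unit] by simp
    also have "\<dots> = (\<Sum>p\<in>F. \<Sum>i<bdim (fst p).
      Rep_ell2 x p * f (ell2_unit (fst p, i)) * coo (fst p) i (g (bas (fst p) (snd p))))"
    proof (rule sum.cong[OF refl])
      fix p assume p: "p \<in> F"
      obtain V j where Vj: "p = (V, j)" by (cases p)
      have VW: "V \<in> W" and j: "j < bdim V" using p F(2) by (auto simp: Vj idx_def)
      have V: "invariant_subspace V" using VW W by (auto simp: inv_spaces_def)
      have "f (U g (ell2_unit (V, j))) = (\<Sum>i<bdim V. coo V i (g (bas V j)) * f (ell2_unit (V, i)))"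
        unfolding U_unit[OF V j g] using HW_unit[OF VW] by (intro dual_sum_on[OF f sub]) auto
      then show "Rep_ell2 x p * f (U g (ell2_unit p)) = (\<Sum>i<bdim (fst p).
        Rep_ell2 x p * f (ell2_unit (fst p, i)) * coo (fst p) i (g (bas (fst p) (snd p))))"
        by (simp add: Vj sum_distrib_left mult.assoc mult.left_commute mult.commute)
    qed
    finally have eq: "f (U g ?y) = (\<Sum>p\<in>F. \<Sum>i<bdim (fst p).
      Rep_ell2 x p * f (ell2_unit (fst p, i)) * coo (fst p) i (g (bas (fst p) (snd p))))" .
    have "cmod (f (U g x) - f (U g ?y)) = cmod (f (U g (x - ?y)))"
      using dual_diff[OF f U_HW[OF g x] U_HW[OF g yH] sub] linear_diff[OF bounded_linear.linear[OF U_linear[OF g]], of x ?y]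
      by simp
    also have "\<dots> \<le> K * norm (U g (x - ?y))"
      by (rule K(2)[OF U_HW[OF g cspace.subspace_diff[OF sub x yH]]])
    also have "\<dots> \<le> K * (\<epsilon> / K)"
      using K(1) by (intro mult_left_mono order_trans[OF norm_U_le[OF g] F(3)]) auto
    finally show ?thesis using K(1) by (simp add: eq)
  qed
  then show ?thesis using F(1,2) by blast
qed

end

section \<open>The Jacobs--de Leeuw--Glicksberg decomposition\<close>

text \<open>Any finite index set and a non-strict bound suffice: an enumeration gives natural
  indices, and passing through \<open>\<epsilon> / 2\<close> keeps the supremum strictly below
  \<epsilon>.\<close>

lemma weakly_containedI:
  fixes \<pi>2 :: "'s \<Rightarrow> 'b::cbanach \<Rightarrow> 'b"
  assumes "\<And>\<xi> f \<epsilon>. \<xi> \<in> F1 \<Longrightarrow> f \<in> dual F1 \<Longrightarrow> \<epsilon> > 0 \<Longrightarrow>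
    \<exists>(I :: 'i set) \<eta> h. finite I \<and> (\<forall>i\<in>I. \<eta> i \<in> F2 \<and> h i \<in> dual F2) \<and>
      (\<forall>s\<in>topspace X. cmod (f (\<pi>1 s \<xi>) - (\<Sum>i\<in>I. h i (\<pi>2 s (\<eta> i)))) \<le> \<epsilon>)"
  shows "weakly_contained X F1 \<pi>1 F2 \<pi>2"
  unfolding weakly_contained_def
proof (intro ballI allI impI)
  fix \<xi> f and \<epsilon> :: real assume *: "\<xi> \<in> F1" "f \<in> dual F1" "\<epsilon> > 0"
  then have "\<epsilon> / 2 > 0" by simp
  from assms[OF *(1,2) this] obtain I :: "'i set" and \<eta> h where I: "finite I"
      and \<eta>h: "\<forall>i\<in>I. \<eta> i \<in> F2 \<and> h i \<in> dual F2"
      and le: "\<forall>s\<in>topspace X. cmod (f (\<pi>1 s \<xi>) - (\<Sum>i\<in>I. h i (\<pi>2 s (\<eta> i)))) \<le> \<epsilon> / 2"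
    by blast
  obtain b where b: "bij_betw b {0..<card I} I" using ex_bij_betw_nat_finite[OF I] by blast
  have "(\<Sum>i\<in>I. h i (\<pi>2 s (\<eta> i))) = (\<Sum>j<card I. h (b j) (\<pi>2 s (\<eta> (b j))))" for s
    using sum.reindex_bij_betw[OF b, of "\<lambda>i. h i (\<pi>2 s (\<eta> i))"] by (simp add: atLeast0LessThan)
  then have "(SUP s\<in>topspace X. ereal (cmod (f (\<pi>1 s \<xi>) - (\<Sum>j<card I. h (b j) (\<pi>2 s (\<eta> (b j))))))) \<le> ereal (\<epsilon> / 2)"
    using le by (intro SUP_least) simp
  also have "\<dots> < ereal \<epsilon>" using *(3) by simp
  finally have "(SUP s\<in>topspace X. ereal (cmod (f (\<pi>1 s \<xi>) - (\<Sum>j<card I. h (b j) (\<pi>2 s (\<eta> (b j))))))) < ereal \<epsilon>" .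
  moreover have "\<forall>j<card I. \<eta> (b j) \<in> F2 \<and> h (b j) \<in> dual F2"
    using \<eta>h bij_betwE[OF b] by simp
  ultimately show "\<exists>(k::nat) \<eta> h. (\<forall>j<k. \<eta> j \<in> F2 \<and> h j \<in> dual F2) \<and>
      (SUP s\<in>topspace X. ereal (cmod (f (\<pi>1 s \<xi>) - (\<Sum>j<k. h j (\<pi>2 s (\<eta> j)))))) < ereal \<epsilon>"
    by (intro exI[of _ "card I"] exI[of _ "\<lambda>j. \<eta> (b j)"] exI[of _ "\<lambda>j. h (b j)"]) blast
qed

lemma dual_restrict: "f \<in> dual UNIV \<Longrightarrow> f \<in> dual F"
  unfolding dual_def bounded_clinear_on_def by blast

lemma dual_times:
  assumes "f \<in> dual UNIV"
  shows "(\<lambda>x. a * f x) \<in> dual UNIV"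
  using dual_sum[of "{()}" "\<lambda>_. f" "\<lambda>_. a"] assms by (simp add: mult.commute)

context semigroup_with_minimal_idempotent
begin

lemma K_eS: "T \<in> S \<Longrightarrow> T \<circ> e \<in> K"
  using K_left e_K by blast

text \<open>Multiplication by \<open>e\<close> is a homomorphism from \<open>S\<close> onto the
  group \<open>K\<close>, through which the representation of the group is pulled back to the
  semigroup.\<close>

lemma mult_e: "T \<in> S \<Longrightarrow> T' \<in> S \<Longrightarrow> (T \<circ> T') \<circ> e = (T \<circ> e) \<circ> (T' \<circ> e)"
  using e_absorb_left[of T'] by (simp add: o_assoc[symmetric])

lemma S_reversible: "T \<in> S \<Longrightarrow> e x = x \<Longrightarrow> e (T x) = T x"
  using e_commutes[of T] by (metis comp_apply)

context
  fixes \<T> :: "('a \<Rightarrow> 'a) set"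
  assumes \<T>_S: "\<T> \<subseteq> S"
begin

lemma topspace_\<T>: "topspace (subtopology (wot UNIV) \<T>) = \<T>"
  using \<T>_S S_ops by (auto simp: topspace_wot_UNIV)

lemma coefficient_continuous:
  "f \<in> dual UNIV \<Longrightarrow> continuous_map (subtopology (wot UNIV) \<T>) euclidean (\<lambda>T. f (T x))"
  by (rule continuous_map_from_subtopology[OF continuous_map_wot_eval]) auto

text \<open>An identity of \<T> need not be the identity operator, but its image in the group is an
  idempotent of \<open>K\<close>, hence \<open>e\<close>.\<close>

lemma identity_e:
  assumes \<iota>: "\<iota> \<in> \<T>" "\<forall>s\<in>\<T>. \<iota> \<circ> s = s \<and> s \<circ> \<iota> = s"
  shows "\<iota> \<circ> e = e"
proof (rule e_unique)
  have S: "\<iota> \<in> S" using \<iota>(1) \<T>_S by blast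
  show "\<iota> \<circ> e \<in> K" by (rule K_eS[OF S])
  show "(\<iota> \<circ> e) \<circ> (\<iota> \<circ> e) = \<iota> \<circ> e" using mult_e[OF S S] \<iota> by auto
qed

lemma representation_reversible:
  "representation (subtopology (wot UNIV) \<T>) (\<circ>) {x. e x = x} (\<lambda>T. T)"
  unfolding representation_def topspace_\<T>
proof (intro conjI ballI impI)
  show "cspace.subspace {x. e x = x}" by (rule e_subspace)
  show "closed {x. e x = x}"
    using linear_continuous_on[OF G_linear[OF e_G], of UNIV] by (intro closed_Collect_eq continuous_intros)
  show "continuous_map (subtopology (wot UNIV) \<T>) (wot {x. e x = x}) (\<lambda>T. T)"
  proof (rule continuous_map_into_wot)
    show "{x. e x = x} \<noteq> {}" using cspace.subspace_0[OF e_subspace] by blast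
    fix T assume "T \<in> topspace (subtopology (wot UNIV) \<T>)"
    then have T: "T \<in> S" using topspace_\<T> \<T>_S by blast
    then have "bounded_clinear_on UNIV T" using S_ops by (auto simp: bounded_ops_def)
    then have "bounded_clinear_on {x. e x = x} T" unfolding bounded_clinear_on_def by blast
    then show "T \<in> bounded_ops {x. e x = x}" using S_reversible[OF T] by (auto simp: bounded_ops_def)
  next
    fix f x assume f: "f \<in> dual {x. e x = x}" and x: "x \<in> {x. e x = x}"
    \<comment> \<open>A functional on the range of the projection \<open>e\<close> extends to the
      whole space by composition with \<open>e\<close>; the extension has the same coefficients
      there.\<close>
    have fe: "(\<lambda>y. f (e y)) \<in> dual UNIV"
      unfolding dual_def mem_Collect_eq
      by (rule bounded_clinear_on_compose[of "{x. e x = x}"])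
        (use f e_S S_ops e_idem in \<open>auto simp: dual_def bounded_ops_def dest: fun_cong\<close>)
    have "f (e (T x)) = f (T x)" if "T \<in> \<T>" for T using S_reversible[of T x] that \<T>_S x by auto
    then show "continuous_map (subtopology (wot UNIV) \<T>) euclidean (\<lambda>T. f (T x))"
      using continuous_map_eq[OF coefficient_continuous[OF fe, of x]] topspace_\<T> by simp
  qed
next
  fix \<iota> x assume \<iota>: "\<iota> \<in> \<T>" "\<forall>s\<in>\<T>. \<iota> \<circ> s = s \<and> s \<circ> \<iota> = s" and x: "x \<in> {x. e x = x}"
  have "\<iota> (e x) = e x" using identity_e[OF \<iota>] by (metis comp_apply)
  then show "\<iota> x = x" using x by simp
qed simp

lemma representation_HW:
  assumes W: "W \<subseteq> inv_spaces"
  shows "representation (subtopology (wot UNIV) \<T>) (\<circ>) (HW W) (\<lambda>T. U (T \<circ> e))"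
  unfolding representation_def topspace_\<T>
proof (intro conjI ballI impI)
  have sub: "cspace.subspace (HW W)" unfolding HW_def by (rule ell2_on_subspace)
  show "cspace.subspace (HW W)" by (rule sub)
  show "closed (HW W)" unfolding HW_def by (rule ell2_on_closed)
  show "continuous_map (subtopology (wot UNIV) \<T>) (wot (HW W)) (\<lambda>T. U (T \<circ> e))"
  proof (rule continuous_map_into_wot)
    show "HW W \<noteq> {}" using cspace.subspace_0[OF sub] by blast
    show "U (T \<circ> e) \<in> bounded_ops (HW W)" if "T \<in> topspace (subtopology (wot UNIV) \<T>)" for T
      using that topspace_\<T> \<T>_S by (intro U_ops K_eS) blast
    fix f x assume f: "f \<in> dual (HW W)" and x: "x \<in> HW W"
    show "continuous_map (subtopology (wot UNIV) \<T>) euclidean (\<lambda>T. f (U (T \<circ> e) x))"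
    proof (rule continuous_map_uniform_approx)
      fix \<epsilon> :: real assume \<epsilon>: "\<epsilon> > 0"
      from U_coefficient_approx[OF W x f \<epsilon>] obtain F where F: "finite F" "F \<subseteq> idx W"
        and le: "\<forall>g\<in>K. cmod (f (U g x) - (\<Sum>p\<in>F. \<Sum>i<bdim (fst p).
          Rep_ell2 x p * f (ell2_unit (fst p, i)) * coo (fst p) i (g (bas (fst p) (snd p))))) \<le> \<epsilon>" by blast
      \<comment> \<open>The projection is moved from the operator into the vector, so that each term
        is a coefficient of \<open>T\<close> itself and thus continuous on \<T>.\<close>
      let ?h = "\<lambda>T. \<Sum>p\<in>F. \<Sum>i<bdim (fst p).
          Rep_ell2 x p * f (ell2_unit (fst p, i)) * coo (fst p) i (T (e (bas (fst p) (snd p))))"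
      have "continuous_map (subtopology (wot UNIV) \<T>) euclidean ?h"
      proof (intro continuous_map_sum F(1) finite_lessThan)
        fix p i assume p: "p \<in> F" and i: "i \<in> {..<bdim (fst p)}"
        have "p \<in> idx W" using p F(2) by blast
        then have "invariant_subspace (fst p)" using W by (cases p) (auto simp: idx_def inv_spaces_def)
        then have "coo (fst p) i \<in> dual UNIV" using i by (intro coo_dual) auto
        then have "(\<lambda>y. Rep_ell2 x p * f (ell2_unit (fst p, i)) * coo (fst p) i y) \<in> dual UNIV"
          by (rule dual_times)
        from coefficient_continuous[OF this]
        show "continuous_map (subtopology (wot UNIV) \<T>) euclidean (\<lambda>T. Rep_ell2 x p * f (ell2_unit (fst p, i))
          * coo (fst p) i (T (e (bas (fst p) (snd p)))))" .
      qed
      moreover have "dist (?h T) (f (U (T \<circ> e) x)) \<le> \<epsilon>" if "T \<in> \<T>" for T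
        using bspec[OF le K_eS[of T]] that \<T>_S by (auto simp: dist_norm norm_minus_commute)
      ultimately show "\<exists>h. continuous_map (subtopology (wot UNIV) \<T>) euclidean h \<and>
          (\<forall>s\<in>topspace (subtopology (wot UNIV) \<T>). dist (h s) (f (U (s \<circ> e) x)) \<le> \<epsilon>)"
        unfolding topspace_\<T> by (intro exI[of _ ?h]) blast
    qed
  qed
next
  fix s t x assume st: "s \<in> \<T>" "t \<in> \<T>"
  then have S: "s \<in> S" "t \<in> S" using \<T>_S by auto
  show "U ((s \<circ> t) \<circ> e) x = U (s \<circ> e) (U (t \<circ> e) x)"
    unfolding mult_e[OF S] by (rule U_mult[OF K_eS K_eS]) (rule S)+
next
  fix \<iota> x assume \<iota>: "\<iota> \<in> \<T>" "\<forall>s\<in>\<T>. \<iota> \<circ> s = s \<and> s \<circ> \<iota> = s" and x: "x \<in> HW W"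
  show "U (\<iota> \<circ> e) x = x" unfolding identity_e[OF \<iota>] by (rule U_e[OF x W])
qed

lemma unitary_HW:
  "unitary_representation (subtopology (wot UNIV) \<T>) (\<circ>) (HW inv_spaces) (\<lambda>T. U (T \<circ> e))"
  unfolding unitary_representation_def topspace_\<T>
proof (intro conjI ballI)
  show "representation (subtopology (wot UNIV) \<T>) (\<circ>) (HW inv_spaces) (\<lambda>T. U (T \<circ> e))"
    by (rule representation_HW) simp
  fix T assume "T \<in> \<T>"
  then have T: "T \<circ> e \<in> K" using \<T>_S by (intro K_eS) blast
  show "U (T \<circ> e) ` HW inv_spaces = HW inv_spaces" by (rule U_surj[OF T]) simp
  show "cinner (U (T \<circ> e) x) (U (T \<circ> e) y) = cinner x y" if "x \<in> HW inv_spaces" "y \<in> HW inv_spaces" for x y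
    by (rule U_cinner[OF T _ that]) simp
qed

text \<open>A single coefficient of \<open>U\<close> suffices: \<xi> is replaced by a nearby vector
  \<open>v\<close> of an invariant subspace, whose coefficients occur exactly in the corresponding
  block.\<close>

lemma reversible_in_HW:
  "weakly_contained (subtopology (wot UNIV) \<T>) {x. e x = x} (\<lambda>T. T) (HW inv_spaces) (\<lambda>T. U (T \<circ> e))"
proof (rule weakly_containedI[where 'i = unit])
  fix \<xi> f and \<epsilon> :: real assume \<xi>: "\<xi> \<in> {x. e x = x}" and f: "f \<in> dual {x. e x = x}" and \<epsilon>: "\<epsilon> > 0"
  obtain M where M: "M > 0" "\<And>x. x \<in> {x. e x = x} \<Longrightarrow> cmod (f x) \<le> M * norm x" using dual_bounded[OF f] by blast
  obtain C where C: "C > 0" "\<And>g x. g \<in> K \<Longrightarrow> norm (g x) \<le> C * norm x" using G_bounded by blast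
  have e\<xi>: "e \<xi> = \<xi>" using \<xi> by simp
  \<comment> \<open>The error \<open>\<xi> - v\<close> passes through a group element, bounded by
    \<open>C\<close>, and through \<open>f\<close>, bounded by \<open>M\<close>.\<close>
  have "\<epsilon> / (M * C) > 0" using \<epsilon> M(1) C(1) by simp
  from invariant_subspaces_dense[OF e\<xi> this] obtain V v where V: "invariant_subspace V" and v: "v \<in> V"
    and \<xi>v: "norm (\<xi> - v) < \<epsilon> / (M * C)" by blast
  have VR: "x \<in> {x. e x = x}" if "x \<in> V" for x using V_e[OF V that] by simp
  have sub: "cspace.subspace (HW inv_spaces)" unfolding HW_def by (rule ell2_on_subspace)
  have VI: "V \<in> inv_spaces" using V by (simp add: inv_spaces_def)
  \<comment> \<open>\<eta> is the coordinate vector of \<open>v\<close> in block \<open>V\<close>,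
    and \<open>h\<close> reassembles a vector of \<open>V\<close> from its block before applying
    \<open>f\<close>.\<close>
  define \<eta> where "\<eta> = (\<Sum>j<bdim V. coo V j v *\<^sub>C ell2_unit (V, j))"
  define h where "h = (\<lambda>z. \<Sum>i<bdim V. f (bas V i) * Rep_ell2 z (V, i))"
  have \<eta>H: "\<eta> \<in> HW inv_spaces"
    unfolding \<eta>_def using HW_unit[OF VI] by (intro cspace.subspace_sum[OF sub] cspace.subspace_scale[OF sub]) auto
  have hd: "h \<in> dual (HW inv_spaces)"
    unfolding dual_def mem_Collect_eq
  proof (rule bounded_clinear_onI)
    show "h (x + y) = h x + h y" for x y by (simp add: h_def plus_ell2.rep_eq distrib_left sum.distrib)
    show "h (c *\<^sub>C x) = c *\<^sub>C h x" for c x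
      by (simp add: h_def scaleC_ell2.rep_eq scaleC_complex_def sum_distrib_left mult.left_commute)
    show "norm (h x) \<le> (\<Sum>i<bdim V. cmod (f (bas V i))) * norm x" for x
      unfolding h_def sum_distrib_right
      by (rule order_trans[OF norm_sum sum_mono]) (simp add: norm_mult mult_left_mono cmod_Rep_ell2_le)
  qed
  have "cmod (f (T \<xi>) - h (U (T \<circ> e) \<eta>)) \<le> \<epsilon>" if "T \<in> \<T>" for T
  proof -
    have T: "T \<in> S" using that \<T>_S by blast
    define g where "g = T \<circ> e"
    have g: "g \<in> K" unfolding g_def by (rule K_eS[OF T])
    have g\<xi>: "g \<xi> = T \<xi>" by (simp add: g_def e\<xi>)
    have "Rep_ell2 \<eta> (V, j) = coo V j v" if "j < bdim V" for j
    proof -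
      have "Rep_ell2 \<eta> (V, j) = (\<Sum>k<bdim V. if k = j then coo V k v else 0)"
        unfolding \<eta>_def Rep_ell2_sum by (rule sum.cong) (simp_all add: scaleC_ell2.rep_eq Rep_ell2_unit)
      then show ?thesis using that by simp
    qed
    then have "(\<Sum>j<bdim V. Rep_ell2 \<eta> (V, j) *\<^sub>C bas V j) = v"
      using coo_expand[OF V v] by simp
    then have "h (U g \<eta>) = (\<Sum>i<bdim V. f (bas V i) * coo V i (g v))"
      unfolding h_def Rep_U[OF g] using act_block[OF V _ g] by (intro sum.cong) auto
    also have "\<dots> = f (\<Sum>i<bdim V. coo V i (g v) *\<^sub>C bas V i)"
      using dual_sum_on[OF f e_subspace, of "{..<bdim V}" "bas V" "\<lambda>i. coo V i (g v)"] VR[OF bas_V[OF V]]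
      by (simp add: mult.commute)
    also have "\<dots> = f (g v)" by (simp only: coo_expand[OF V V_G[OF V g v]])
    finally have hU: "h (U g \<eta>) = f (g v)" .
    have gR: "g \<xi> \<in> {x. e x = x}" "g v \<in> {x. e x = x}" using e_apply(1)[OF g] by auto
    have "cmod (f (T \<xi>) - h (U g \<eta>)) = cmod (f (g \<xi> - g v))"
      unfolding hU g\<xi>[symmetric] dual_diff[OF f gR e_subspace] ..
    also have "\<dots> \<le> M * norm (g \<xi> - g v)" by (rule M(2)[OF cspace.subspace_diff[OF e_subspace gR]])
    also have "\<dots> \<le> M * (C * norm (\<xi> - v))"
      using C(2)[OF g, of "\<xi> - v"] M(1) by (simp add: G_diff[OF g])
    also have "\<dots> \<le> M * (C * (\<epsilon> / (M * C)))" using \<xi>v M(1) C(1) by (intro mult_left_mono) auto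
    also have "\<dots> = \<epsilon>" using M(1) C(1) by simp
    finally show ?thesis by (simp add: g_def)
  qed
  then show "\<exists>(I :: unit set) \<eta> h. finite I \<and> (\<forall>i\<in>I. \<eta> i \<in> HW inv_spaces \<and> h i \<in> dual (HW inv_spaces)) \<and>
      (\<forall>s\<in>topspace (subtopology (wot UNIV) \<T>). cmod (f (s \<xi>) - (\<Sum>i\<in>I. h i (U (s \<circ> e) (\<eta> i)))) \<le> \<epsilon>)"
    unfolding topspace_\<T> using \<eta>H hd by (intro exI[of _ "{()}"] exI[of _ "\<lambda>_. \<eta>"] exI[of _ "\<lambda>_. h"]) simp
qed

text \<open>Each term of the approximating double sum is a coefficient on \<open>E_r\<close>: a
  multiple of a coordinate functional evaluated at the image of a basis vector, which
  \<open>e\<close> fixes. The index combines a coordinate with a row of its block.\<close>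

lemma HW_in_reversible:
  "weakly_contained (subtopology (wot UNIV) \<T>) (HW inv_spaces) (\<lambda>T. U (T \<circ> e)) {x. e x = x} (\<lambda>T. T)"
proof (rule weakly_containedI[where 'i = "('a set \<times> nat) \<times> nat"])
  fix \<xi> f and \<epsilon> :: real assume \<xi>: "\<xi> \<in> HW inv_spaces" and f: "f \<in> dual (HW inv_spaces)" and \<epsilon>: "\<epsilon> > 0"
  from U_coefficient_approx[OF order_refl \<xi> f \<epsilon>] obtain F where F: "finite F" "F \<subseteq> idx inv_spaces"
    and le: "\<forall>g\<in>K. cmod (f (U g \<xi>) - (\<Sum>p\<in>F. \<Sum>i<bdim (fst p).
      Rep_ell2 \<xi> p * f (ell2_unit (fst p, i)) * coo (fst p) i (g (bas (fst p) (snd p))))) \<le> \<epsilon>" by blast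
  define I where "I = (SIGMA p:F. {..<bdim (fst p)})"
  define h where "h = (\<lambda>q y. Rep_ell2 \<xi> (fst q) * f (ell2_unit (fst (fst q), snd q)) * coo (fst (fst q)) (snd q) y)"
  define \<eta> where "\<eta> = (\<lambda>q :: ('a set \<times> nat) \<times> nat. bas (fst (fst q)) (snd (fst q)))"
  have inv: "invariant_subspace (fst p)" "snd p < bdim (fst p)" if "p \<in> F" for p
    using subsetD[OF F(2) that] by (cases p; simp add: idx_def inv_spaces_def)+
  have "\<eta> q \<in> {x. e x = x} \<and> h q \<in> dual {x. e x = x}" if "q \<in> I" for q
  proof -
    have q: "fst q \<in> F" "snd q < bdim (fst (fst q))" using that by (auto simp: I_def)
    have "e (\<eta> q) = \<eta> q" unfolding \<eta>_def by (rule V_e[OF inv(1)[OF q(1)] bas_V[OF inv[OF q(1)]]])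
    moreover have "h q \<in> dual UNIV" unfolding h_def by (rule dual_times[OF coo_dual[OF inv(1)[OF q(1)] q(2)]])
    ultimately show ?thesis using dual_restrict by blast
  qed
  moreover have "finite I" using F(1) by (simp add: I_def)
  moreover have "cmod (f (U (T \<circ> e) \<xi>) - (\<Sum>q\<in>I. h q (T (\<eta> q)))) \<le> \<epsilon>" if "T \<in> \<T>" for T
  proof -
    have T: "T \<circ> e \<in> K" using that \<T>_S by (intro K_eS) blast
    have "(\<Sum>p\<in>F. \<Sum>i<bdim (fst p). Rep_ell2 \<xi> p * f (ell2_unit (fst p, i)) * coo (fst p) i ((T \<circ> e) (bas (fst p) (snd p))))
        = (\<Sum>p\<in>F. \<Sum>i<bdim (fst p). h (p, i) (T (\<eta> (p, i))))"
    proof (intro sum.cong refl)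
      fix p i assume p: "p \<in> F"
      have "e (bas (fst p) (snd p)) = bas (fst p) (snd p)"
        by (rule V_e[OF inv(1)[OF p] bas_V[OF inv[OF p]]])
      then show "Rep_ell2 \<xi> p * f (ell2_unit (fst p, i)) * coo (fst p) i ((T \<circ> e) (bas (fst p) (snd p)))
          = h (p, i) (T (\<eta> (p, i)))" by (simp add: h_def \<eta>_def)
    qed
    also have "\<dots> = (\<Sum>q\<in>I. h q (T (\<eta> q)))"
      unfolding I_def using F(1) by (subst sum.Sigma) (auto simp: case_prod_beta)
    finally show ?thesis using bspec[OF le T] by simp
  qed
  ultimately show "\<exists>(I :: (('a set \<times> nat) \<times> nat) set) \<eta> h. finite I \<and> (\<forall>i\<in>I. \<eta> i \<in> {x. e x = x} \<and> h i \<in> dual {x. e x = x}) \<and>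
      (\<forall>s\<in>topspace (subtopology (wot UNIV) \<T>). cmod (f (U (s \<circ> e) \<xi>) - (\<Sum>i\<in>I. h i (s (\<eta> i)))) \<le> \<epsilon>)"
    unfolding topspace_\<T> by (intro exI[of _ I] exI[of _ \<eta>] exI[of _ h]) blast
qed

lemma HW_mono: "W \<subseteq> W' \<Longrightarrow> HW W \<subseteq> HW W'"
proof -
  assume "W \<subseteq> W'"
  then have "idx W \<subseteq> idx W'" unfolding idx_def by (rule Sigma_mono) simp
  then show ?thesis unfolding HW_def ell2_on_def by (intro Collect_mono) blast
qed

text \<open>The summands \<open>HW {V}\<close> occupy disjoint sets of coordinates, which gives
  orthogonality. Finite truncations lie in their span, which gives density.\<close>

lemma sum_of_finite_dim_HW:
  "sum_of_finite_dim (subtopology (wot UNIV) \<T>) (\<circ>) (HW inv_spaces) (\<lambda>T. U (T \<circ> e))"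
  unfolding sum_of_finite_dim_def
proof (intro exI[of _ "(\<lambda>V. HW {V}) ` inv_spaces"] conjI ballI impI)
  fix H assume "H \<in> (\<lambda>V. HW {V}) ` inv_spaces"
  then obtain V where V: "V \<in> inv_spaces" "H = HW {V}" by blast
  show "H \<subseteq> HW inv_spaces" unfolding V(2) by (rule HW_mono) (use V in simp)
  show "representation (subtopology (wot UNIV) \<T>) (\<circ>) H (\<lambda>T. U (T \<circ> e))"
    unfolding V(2) by (rule representation_HW) (use V in simp)
  have "HW {V} = cspace.span ((\<lambda>i. ell2_unit (V, i)) ` {..<bdim V})"
  proof
    show "cspace.span ((\<lambda>i. ell2_unit (V, i)) ` {..<bdim V}) \<subseteq> HW {V}"
      using HW_unit[of V "{V}"] by (intro cspace.span_minimal) (auto simp: HW_def ell2_on_subspace)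
    show "HW {V} \<subseteq> cspace.span ((\<lambda>i. ell2_unit (V, i)) ` {..<bdim V})"
    proof
      fix x assume x: "x \<in> HW {V}"
      have "Rep_ell2 x p = Rep_ell2 (\<Sum>i<bdim V. Rep_ell2 x (V, i) *\<^sub>C ell2_unit (V, i)) p" for p
      proof -
        obtain V' j where p: "p = (V', j)" by (cases p)
        have "Rep_ell2 (\<Sum>i<bdim V. Rep_ell2 x (V, i) *\<^sub>C ell2_unit (V, i)) p
            = (\<Sum>i<bdim V. if i = j then (if V' = V then Rep_ell2 x (V, i) else 0) else 0)"
          unfolding Rep_ell2_sum by (rule sum.cong) (auto simp: scaleC_ell2.rep_eq Rep_ell2_unit p)
        also have "\<dots> = Rep_ell2 x p" using x by (auto simp: p HW_def ell2_on_def idx_def)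
        finally show ?thesis by simp
      qed
      then have "x = (\<Sum>i<bdim V. Rep_ell2 x (V, i) *\<^sub>C ell2_unit (V, i))"
        by (intro ell2_eq_iff[THEN iffD2] allI)
      also have "\<dots> \<in> cspace.span ((\<lambda>i. ell2_unit (V, i)) ` {..<bdim V})"
        by (intro cspace.span_sum cspace.span_scale cspace.span_base) auto
      finally show "x \<in> cspace.span ((\<lambda>i. ell2_unit (V, i)) ` {..<bdim V})" .
    qed
  qed
  then show "\<exists>B. finite B \<and> H = cspace.span B" unfolding V(2) by blast
next
  fix H H' x y assume H: "H \<in> (\<lambda>V. HW {V}) ` inv_spaces" "H' \<in> (\<lambda>V. HW {V}) ` inv_spaces" "H \<noteq> H'"
    and x: "x \<in> H" and y: "y \<in> H'"
  obtain V V' where V: "H = HW {V}" "H' = HW {V'}" "V \<noteq> V'" using H by blast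
  have "Rep_ell2 x p * cnj (Rep_ell2 y p) = 0" for p
  proof -
    have "p \<notin> idx {V} \<or> p \<notin> idx {V'}" using V(3) by (auto simp: idx_def)
    then show ?thesis using x y unfolding V(1,2) HW_def ell2_on_def
      by (elim disjE) (simp_all del: split_paired_All)
  qed
  then show "cinner x y = 0" unfolding cinner_ell2.rep_eq by (rule infsum_0)
next
  let ?S = "cspace.span (\<Union>((\<lambda>V. HW {V}) ` inv_spaces))"
  have sub: "cspace.subspace (HW inv_spaces)" and clo: "closed (HW inv_spaces)"
    unfolding HW_def by (rule ell2_on_subspace, rule ell2_on_closed)
  have "(\<Union>((\<lambda>V. HW {V}) ` inv_spaces)) \<subseteq> HW inv_spaces"
    using HW_mono[of "{_}" inv_spaces] by (intro UN_least) simp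
  then have "?S \<subseteq> HW inv_spaces" using sub by (rule cspace.span_minimal)
  then have 1: "closure ?S \<subseteq> HW inv_spaces" using clo by (rule closure_minimal)
  have 2: "x \<in> closure ?S" if x: "x \<in> HW inv_spaces" for x
    unfolding closure_approachable
  proof (intro allI impI)
    fix \<epsilon> :: real assume \<epsilon>: "\<epsilon> > 0"
    then have "\<epsilon> / 2 > 0" by simp
    from ell2_on_approx[OF x[unfolded HW_def] this] obtain F where F: "F \<subseteq> idx inv_spaces"
        "norm (x - (\<Sum>p\<in>F. Rep_ell2 x p *\<^sub>C ell2_unit p)) \<le> \<epsilon> / 2" by blast
    have "ell2_unit p \<in> \<Union>((\<lambda>V. HW {V}) ` inv_spaces)" if "p \<in> F" for p
      using that F(1) HW_unit[of "fst p" "{fst p}" "snd p"] by (force simp: idx_def)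
    then have "(\<Sum>p\<in>F. Rep_ell2 x p *\<^sub>C ell2_unit p) \<in> ?S"
      by (intro cspace.span_sum cspace.span_scale cspace.span_base)
    then show "\<exists>y\<in>?S. dist y x < \<epsilon>"
      using F(2) \<epsilon> by (intro bexI[of _ "\<Sum>p\<in>F. Rep_ell2 x p *\<^sub>C ell2_unit p"]) (simp_all add: dist_norm norm_minus_commute)
  qed
  show "HW inv_spaces = closure ?S" using 1 2 by blast
qed

end

end

text \<open>With separate continuity the closure is taken one factor at a time: first the left
  factor varies while the right one stays in \<T>, then the right factor varies against a fixed left
  factor of the closure.\<close>

lemma weak_closure_semigroup:
  assumes "operator_semigroup \<T>"
  shows "\<T> \<subseteq> weak_closure \<T>" "weak_closure \<T> \<subseteq> bounded_ops UNIV"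
    "\<And>s t. s \<in> weak_closure \<T> \<Longrightarrow> t \<in> weak_closure \<T> \<Longrightarrow> s \<circ> t \<in> weak_closure \<T>"
proof -
  have ops: "\<T> \<subseteq> bounded_ops UNIV" and mult: "\<And>s t. s \<in> \<T> \<Longrightarrow> t \<in> \<T> \<Longrightarrow> s \<circ> t \<in> \<T>"
    using assms by (auto simp: operator_semigroup_def)
  show sub: "\<T> \<subseteq> weak_closure \<T>"
    unfolding weak_closure_def using ops by (intro closure_of_subset) (simp add: topspace_wot_UNIV)
  show S_ops: "weak_closure \<T> \<subseteq> bounded_ops UNIV"
    unfolding weak_closure_def using closure_of_subset_topspace[of "wot UNIV" \<T>] by (simp add: topspace_wot_UNIV)
  have 1: "s \<circ> t \<in> weak_closure \<T>" if s: "s \<in> weak_closure \<T>" and t: "t \<in> \<T>" for s t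
  proof -
    have "(\<lambda>s. s \<circ> t) ` (wot UNIV closure_of \<T>) \<subseteq> wot UNIV closure_of ((\<lambda>s. s \<circ> t) ` \<T>)"
      using ops t by (intro continuous_map_image_closure_subset continuous_map_wot_right) blast
    also have "\<dots> \<subseteq> weak_closure \<T>"
      unfolding weak_closure_def using mult t by (intro closure_of_mono) blast
    finally show ?thesis using s by (auto simp: weak_closure_def)
  qed
  show "s \<circ> t \<in> weak_closure \<T>" if s: "s \<in> weak_closure \<T>" and t: "t \<in> weak_closure \<T>" for s t
  proof -
    have "(\<lambda>t. s \<circ> t) ` (wot UNIV closure_of \<T>) \<subseteq> wot UNIV closure_of ((\<lambda>t. s \<circ> t) ` \<T>)"
      using S_ops s by (intro continuous_map_image_closure_subset continuous_map_wot_left) blast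
    also have "\<dots> \<subseteq> wot UNIV closure_of (weak_closure \<T>)"
      using 1[OF s] by (intro closure_of_mono) blast
    also have "\<dots> = weak_closure \<T>" by (simp add: weak_closure_def)
    finally show ?thesis using t by (auto simp: weak_closure_def)
  qed
qed

theorem theorem1p5:
  fixes \<T> :: "('a::cbanach \<Rightarrow> 'a) set"
  assumes "JdLG_admissible \<T>"
  defines "\<S> \<equiv> weak_closure \<T>"
  defines "X \<equiv> subtopology (wot UNIV) \<T>"
  shows "representation X (\<circ>) (reversible_part \<S>) (\<lambda>T. T) \<and>
      (\<exists>(H :: ('a set \<times> nat) ell2 set) U.
         unitary_representation X (\<circ>) H U \<and>
         weakly_equivalent X (reversible_part \<S>) (\<lambda>T. T) H U \<and>
         sum_of_finite_dim X (\<circ>) H U) \<and>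
      (\<forall>M. bi_invariant_mean \<S> M \<longrightarrow>
         aws_part \<S> = {\<xi>. \<forall>f\<in>dual UNIV. M (\<lambda>T. complex_of_real (cmod (f (T \<xi>)))) = 0})"
proof -
  have sg: "operator_semigroup \<T>" and comp: "compactin (wot UNIV) \<S>"
    and ex1: "\<exists>!e. minimal_idempotent \<S> e"
    using assms(1) by (auto simp: JdLG_admissible_def \<S>_def)
  obtain e where e: "minimal_idempotent \<S> e" using ex1 by blast
  then obtain K where K: "smallest_ideal \<S> K" "e \<in> K" "e \<circ> e = e" by (auto simp: minimal_idempotent_def)
  have uniq: "p = e" if "p \<in> K" "p \<circ> p = p" for p
  proof -
    have "minimal_idempotent \<S> p" using that K(1) by (auto simp: minimal_idempotent_def)
    then show ?thesis using ex1 e by blast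
  qed
  interpret semigroup_with_minimal_idempotent \<S> K e
  proof
    show "\<S> \<subseteq> bounded_ops UNIV" unfolding \<S>_def by (rule weak_closure_semigroup(2)[OF sg])
    show "s \<circ> t \<in> \<S>" if "s \<in> \<S>" "t \<in> \<S>" for s t
      using weak_closure_semigroup(3)[OF sg] that unfolding \<S>_def .
  qed (rule comp K uniq; assumption?)+
  have sub: "\<T> \<subseteq> \<S>" using weak_closure_semigroup(1)[OF sg] by (simp add: \<S>_def)
  have "weakly_equivalent X (reversible_part \<S>) (\<lambda>T. T) (HW inv_spaces) (\<lambda>T. U (T \<circ> e))"
    unfolding weakly_equivalent_def X_def reversible_part_eq
    using reversible_in_HW[OF sub] HW_in_reversible[OF sub] by blast
  then show ?thesis
    using representation_reversible[OF sub] unitary_HW[OF sub] sum_of_finite_dim_HW[OF sub] bi_invariant_mean_aws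
    unfolding X_def reversible_part_eq by blast
qed

end
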